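(* Let $N\ge2$, let $D_1$ be the open unit ball of $\mathbb{R}^N$, and let $\kappa>0$. For $k\in\mathbb{N}$ set $\nu_k:=k+\frac{N-2}{2}$ and $$F_k(\alpha):=\frac{\kappa}{\alpha}J_{\nu_k}(\alpha)I_{\nu_k}'\Bigl(\frac{\kappa}{\alpha}\Bigr)-\alpha I_{\nu_k}\Bigl(\frac{\kappa}{\alpha}\Bigr)J_{\nu_k}'(\alpha),\qquad\alpha>0.$$ Denote by $(\alpha_{k,\ell})_{\ell\ge1}$ the infinitely many (positive) simple roots of $F_k$ ordered in increasing order. The eigenvalues of $$\Delta^2u-\kappa^2u=-\lambda\Delta u\ \text{ in }D_1,\qquad u=\partial_ru=0\ \text{ on }\partial D_1,$$ are given by $$\lambda_{k,\ell}=\alpha_{k,\ell}^2-\frac{\kappa^2}{\alpha_{k,\ell}^2},\qquad k\in\mathbb{N},\ \ell\in\mathbb{N}^*,$$ and, in spherical coordinates $(r,\theta)$ with $r=|x|$, $\theta=x/|x|\in\mathbb{S}^{N-1}$, the corresponding eigenfunctions are $R_{k,\ell}(r)\,\mathcal{Y}_k(\theta)$, where $$R_{k,\ell}(r)=r^{-(N-2)/2}\Bigl(c\,J_{\nu_k}(\alpha_{k,\ell}\,r)+d\,I_{\nu_k}\Bigl(\frac{\kappa}{\alpha_{k,\ell}}\,r\Bigr)\Bigr)$$ with $(c,d)\ne(0,0)$ chosen to satisfy the boundary conditions $R_{k,\ell}(1)=R_{k,\ell}'(1)=0$, and $\mathcal{Y}_k$ is a spherical harmonic of degree $k$. In addition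 the following holds. (i) The first (smallest) eigenvalue is given by $\lambda_{0,1}$ and the corresponding eigenspace is spanned by $x\mapsto R_{0,1}(|x|)$. Moreover $r\mapsto|R_{0,1}(r)|$ is positive and decreasing on $[0,1[$. (ii) For any $k\in\mathbb{N}$ and $\ell\in\mathbb{N}^*$, the function $R_{k,\ell}$ possesses $\ell-1$ roots in $]0,1[$, all of which are simple.
   Context: $\mathbb{N}=\{0,1,2,\dots\}$, $\mathbb{N}^*=\{1,2,\dots\}$. $J_\mu$ (resp. $I_\mu$) is the Bessel function (resp. modified Bessel function) of the first kind of order $\mu$. An eigenvalue is a $\lambda\in\mathbb{R}$ for which the problem has a nontrivial solution. A spherical harmonic of degree $k$ is the restriction to $\mathbb{S}^{N-1}$ of a (nonzero) harmonic homogeneous polynomial of degree $k$. "The corresponding eigenfunctions are" is understood as: these functions are eigenfunctions for $\lambda_{k,\ell}$, and each eigenspace is spanned by the functions of this form over all pairs $(k,\ell)$ giving the same eigenvalue. The value $R_{k,\ell}(0)$ is defined by continuous extension. That the positive roots of each $F_k$ are simple and infinite in number is part of the assertion. *)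

theory Defs
  imports "HOL-Analysis.Analysis"
begin

section \<open>Bessel functions\<close>

text \<open>Power series definitions, meant for \<open>x > 0\<close> only: since \<open>0 powr 0 = 0\<close> they
  do not give the value \<open>1\<close> at \<open>x = 0\<close> for \<open>\<mu> = 0\<close>.\<close>

definition bessel_J :: "real \<Rightarrow> real \<Rightarrow> real" where
  "bessel_J \<mu> x =
     (\<Sum>m. (-1) ^ m / fact m * rGamma (real m + \<mu> + 1) * (x / 2) powr (2 * real m + \<mu>))"

definition bessel_I :: "real \<Rightarrow> real \<Rightarrow> real" where
  "bessel_I \<mu> x =
     (\<Sum>m. 1 / fact m * rGamma (real m + \<mu> + 1) * (x / 2) powr (2 * real m + \<mu>))"

definition simple_root :: "(real \<Rightarrow> real) \<Rightarrow> real \<Rightarrow> bool" where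
  "simple_root f r \<longleftrightarrow> f r = 0 \<and> (\<exists>D. (f has_real_derivative D) (at r) \<and> D \<noteq> 0)"


section \<open>The boundary value problem\<close>

definition partial_deriv :: "'a::euclidean_space \<Rightarrow> ('a \<Rightarrow> real) \<Rightarrow> 'a \<Rightarrow> real" where
  "partial_deriv i f x = frechet_derivative f (at x) i"

definition laplacian :: "('a::euclidean_space \<Rightarrow> real) \<Rightarrow> 'a \<Rightarrow> real" where
  "laplacian f x = (\<Sum>i\<in>Basis. partial_deriv i (partial_deriv i f) x)"

text \<open>\<open>n\<close> times continuously differentiable on \<open>S\<close>, for open \<open>S\<close>.\<close>

primrec Ck_on :: "nat \<Rightarrow> 'a::euclidean_space set \<Rightarrow> ('a \<Rightarrow> real) \<Rightarrow> bool" where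
  "Ck_on 0 S f \<longleftrightarrow> continuous_on S f"
| "Ck_on (Suc n) S f \<longleftrightarrow>
     (\<forall>x\<in>S. f differentiable (at x)) \<and> (\<forall>i\<in>Basis. Ck_on n S (partial_deriv i f))"

text \<open>\<open>C\<^sup>1\<close> up to the boundary: \<open>f\<close> and its first partial derivatives on the open
  set \<open>S\<close> extend continuously to \<open>closure S\<close>.\<close>

definition C1_closure :: "'a::euclidean_space set \<Rightarrow> ('a \<Rightarrow> real) \<Rightarrow> bool" where
  "C1_closure S f \<longleftrightarrow>
     Ck_on 1 S f \<and> continuous_on (closure S) f \<and>
     (\<forall>i\<in>Basis. \<exists>g. continuous_on (closure S) g \<and> (\<forall>x\<in>S. g x = partial_deriv i f x))"

text \<open>Classical solutions of \<open>\<Delta>\<^sup>2 u - \<kappa>\<^sup>2 u = - \<mu> \<Delta> u\<close> in the unit ball with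
  \<open>u = \<partial>\<^sub>r u = 0\<close> on the unit sphere. Only the values of \<open>u\<close> on the closed ball matter,
  hence the one-sided radial derivative.\<close>

definition bvp_solution :: "real \<Rightarrow> real \<Rightarrow> ('a::euclidean_space \<Rightarrow> real) \<Rightarrow> bool" where
  "bvp_solution \<kappa> \<mu> u \<longleftrightarrow>
     Ck_on 4 (ball 0 1) u \<and> C1_closure (ball 0 1) u \<and>
     (\<forall>x\<in>ball 0 1. laplacian (laplacian u) x - \<kappa>\<^sup>2 * u x = - \<mu> * laplacian u x) \<and>
     (\<forall>\<theta>\<in>sphere 0 1. u \<theta> = 0 \<and>
        ((\<lambda>r. u (r *\<^sub>R \<theta>)) has_real_derivative 0) (at_left 1))"

definition eigenfunction :: "real \<Rightarrow> real \<Rightarrow> ('a::euclidean_space \<Rightarrow> real) \<Rightarrow> bool" where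
  "eigenfunction \<kappa> \<mu> u \<longleftrightarrow> bvp_solution \<kappa> \<mu> u \<and> (\<exists>x\<in>cball 0 1. u x \<noteq> 0)"

text \<open>The linear span of \<open>B\<close>, functions being identified when they agree on \<open>A\<close>.\<close>

definition span_on :: "'a set \<Rightarrow> ('a \<Rightarrow> real) set \<Rightarrow> ('a \<Rightarrow> real) set" where
  "span_on A B =
     {u. \<exists>T a. finite T \<and> T \<subseteq> B \<and> (\<forall>x\<in>A. u x = (\<Sum>v\<in>T. a v * v x))}"


section \<open>Spherical harmonics and separated functions\<close>

definition harmonic_homogeneous_poly ::
    "nat \<Rightarrow> ('a::euclidean_space \<Rightarrow> real) \<Rightarrow> bool" where
  "harmonic_homogeneous_poly k P \<longleftrightarrow>
     real_polynomial_function P \<and>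
     (\<forall>t x. P (t *\<^sub>R x) = t ^ k * P x) \<and>
     (\<forall>x. laplacian P x = 0)"

definition spherical_harmonic :: "nat \<Rightarrow> ('a::euclidean_space \<Rightarrow> real) \<Rightarrow> bool" where
  "spherical_harmonic k Y \<longleftrightarrow>
     (\<exists>P. harmonic_homogeneous_poly k P \<and> (\<exists>x. P x \<noteq> 0) \<and> (\<forall>\<theta>\<in>sphere 0 1. Y \<theta> = P \<theta>))"

text \<open>The function \<open>R(r) Y(\<theta>)\<close>, where \<open>sgn x = x / |x|\<close>; the value at the origin, where
  \<open>\<theta>\<close> is undefined, is the continuous extension.\<close>

definition separated ::
    "(real \<Rightarrow> real) \<Rightarrow> ('a::euclidean_space \<Rightarrow> real) \<Rightarrow> 'a \<Rightarrow> real" where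
  "separated R Y x =
     (if x = 0 then Lim (at 0) (\<lambda>y. R (norm y) * Y (sgn y)) else R (norm x) * Y (sgn x))"


section \<open>The characteristic functions and the radial parts\<close>

definition nu :: "nat \<Rightarrow> nat \<Rightarrow> real" where
  "nu N k = real k + (real N - 2) / 2"

definition F :: "nat \<Rightarrow> real \<Rightarrow> nat \<Rightarrow> real \<Rightarrow> real" where
  "F N \<kappa> k \<alpha> =
     \<kappa> / \<alpha> * bessel_J (nu N k) \<alpha> * deriv (bessel_I (nu N k)) (\<kappa> / \<alpha>)
     - \<alpha> * bessel_I (nu N k) (\<kappa> / \<alpha>) * deriv (bessel_J (nu N k)) \<alpha>"

definition radial_formula ::
    "nat \<Rightarrow> real \<Rightarrow> nat \<Rightarrow> real \<Rightarrow> real \<Rightarrow> real \<Rightarrow> real \<Rightarrow> real" where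
  "radial_formula N \<kappa> k \<alpha> c d r =
     r powr (- (real N - 2) / 2) *
       (c * bessel_J (nu N k) (\<alpha> * r) + d * bessel_I (nu N k) (\<kappa> / \<alpha> * r))"

definition radial ::
    "nat \<Rightarrow> real \<Rightarrow> nat \<Rightarrow> real \<Rightarrow> real \<Rightarrow> real \<Rightarrow> real \<Rightarrow> real" where
  "radial N \<kappa> k \<alpha> c d r =
     (if r = 0 then Lim (at_right 0) (radial_formula N \<kappa> k \<alpha> c d)
      else radial_formula N \<kappa> k \<alpha> c d r)"

definition admissible :: "nat \<Rightarrow> real \<Rightarrow> nat \<Rightarrow> real \<Rightarrow> real \<Rightarrow> real \<Rightarrow> bool" where
  "admissible N \<kappa> k \<alpha> c d \<longleftrightarrow>
     (c, d) \<noteq> (0, 0) \<and>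
     radial N \<kappa> k \<alpha> c d 1 = 0 \<and>
     (radial N \<kappa> k \<alpha> c d has_real_derivative 0) (at 1)"

end

(*
  On a solution with eigenvalue mu = alpha^2 - kappa^2/alpha^2 the operator
  factors as (Delta + alpha^2)(Delta - kappa^2/alpha^2).  Projecting each of the two components
  of a solution onto a spherical harmonic of degree k gives a solution of a Bessel equation that
  is regular at the origin, hence a multiple of J_nu or I_nu, and the boundary conditions force
  F_k(alpha) = 0.  In the variables z = r^2, t = alpha^2/4 all Bessel functions are values of one
  entire function bess, evaluated at positive (J) or negative (I) arguments.

  The derivative of F_k at a root is a positive multiple of an integral of |u'|^2, so all roots
  are simple and exactly one of them lies between two consecutive zeros of J_nu.  The
  radial function has a root wherever J/I takes its value at r = 1; J/I is a damped oscillation,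
  as an energy function shows, and its critical points separate these places.

  For the completeness of the spherical harmonics, polynomials decompose into harmonic ones
  (Fischer) and are dense among the continuous functions (Stone-Weierstrass).  Surface integrals
  are replaced by Lebesgue integrals with a radial weight over a shell, for which the symmetry of
  the spherical Laplacian reduces to the translation invariance of Lebesgue measure.
*)
theory Submission
  imports Defs
begin

section \<open>The entire function underlying the Bessel functions\<close>

text \<open>Integrals over ]0,1[ are used in differential form: if z X' + m X = q, then (z^m X)' =
  z^(m-1) q, so X takes over the sign of q, and for q >= 0 a zero of X at the right end forces q =
  0. With m = \<nu> + 1 this one device yields the simplicity of the zeros of \<open>bess\<close>,
  the slope of the characteristic function at its roots and the monotonicity of the Wronskian. With
  t = \<alpha>^2/4 and c = \<kappa>^2/16 an eigenvalue reads 4 t - 4 c/t. This is an increasing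
  bijection from t > 0 onto the reals, so every real eigenvalue, negative ones included, is covered
  by the factorization, and eigenvalues are ordered like the roots t. Two estimates on the roots are
  needed besides their simplicity. They exceed \<nu>, so only finitely many degrees k can share an
  eigenvalue; and \<open>bess (\<nu> + 1)\<close> is positive up to the first root for \<nu>, so the
  first root increases with \<nu> and degree 0 gives the smallest eigenvalue.\<close>

definition bess :: "real \<Rightarrow> real \<Rightarrow> real" where
  "bess \<nu> t = (\<Sum>m. (-1) ^ m / fact m * rGamma (real m + \<nu> + 1) * t ^ m)"

lemma rGamma_Suc_shift: "rGamma (real (Suc m) + \<nu> + 1) * (real m + \<nu> + 1) = rGamma (real m + \<nu> + 1)"
  using rGamma_plus1[of "real m + \<nu> + 1"] by (simp add: algebra_simps)

lemma rGamma_pos: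
  fixes x :: real
  assumes "x > 0" shows "rGamma x > 0"
  using Gamma_real_pos[OF assms] by (simp add: rGamma_inverse_Gamma)

text \<open>Each induction step divides by m + \<nu> + 1 >= 1. The bound makes the exponential
  series a majorant of \<open>bess\<close> for arguments of either sign.\<close>

lemma rGamma_shift_le:
  assumes "\<nu> \<ge> 0" shows "rGamma (real m + \<nu> + 1) \<le> rGamma (\<nu> + 1)"
proof (induction m)
  case (Suc m)
  have p: "rGamma (real (Suc m) + \<nu> + 1) > 0"
    using assms by (intro rGamma_pos) simp
  have "rGamma (real (Suc m) + \<nu> + 1) * 1 \<le> rGamma (real (Suc m) + \<nu> + 1) * (real m + \<nu> + 1)"
    using p assms by (intro mult_left_mono) auto
  then show ?case
    using Suc rGamma_Suc_shift[of m \<nu>] by linarith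
qed simp

lemma summable_bess:
  assumes "\<nu> \<ge> 0"
  shows "summable (\<lambda>m. (-1) ^ m / fact m * rGamma (real m + \<nu> + 1) * t ^ m)"
proof (rule summable_comparison_test')
  show "summable (\<lambda>m. rGamma (\<nu> + 1) * (inverse (fact m) * \<bar>t\<bar> ^ m))"
    by (intro summable_mult summable_exp)
  fix m :: nat
  have p: "rGamma (real m + \<nu> + 1) > 0"
    using assms by (intro rGamma_pos) simp
  then show "norm ((-1) ^ m / fact m * rGamma (real m + \<nu> + 1) * t ^ m)
      \<le> rGamma (\<nu> + 1) * (inverse (fact m) * \<bar>t\<bar> ^ m)"
    using rGamma_shift_le[OF assms, of m]
    by (simp add: abs_mult power_abs divide_inverse mult.assoc mult_left_mono)
       (simp add: mult.left_commute[of _ "rGamma _"] mult_right_mono)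
qed

text \<open>In the termwise derivative the factor n + 1 cancels against the factorial, and the index
  shift raises \<nu> by one. The family \<open>bess (\<nu> + j)\<close> is therefore closed under
  differentiation.\<close>

lemma has_derivative_bess:
  assumes "\<nu> \<ge> 0"
  shows "(bess \<nu> has_real_derivative - bess (\<nu> + 1) t) (at t)"
proof -
  let ?c = "\<lambda>m. (-1) ^ m / fact m * rGamma (real m + \<nu> + 1)"
  have d: "((\<lambda>x. \<Sum>n. ?c n * x ^ n) has_real_derivative (\<Sum>n. diffs ?c n * t ^ n)) (at t)"
    by (rule termdiffs_strong_converges_everywhere) (rule summable_bess[OF assms])
  have "diffs ?c n * t ^ n = - ((-1) ^ n / fact n * rGamma (real n + (\<nu> + 1) + 1) * t ^ n)" for n
    by (simp add: diffs_def divide_simps add_ac)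
  then have "(\<Sum>n. diffs ?c n * t ^ n) = - bess (\<nu> + 1) t"
    using suminf_minus[OF summable_bess[of "\<nu> + 1" t]] assms by (simp add: bess_def)
  with d show ?thesis
    by (simp add: bess_def[abs_def])
qed

lemma DERIV_bess [derivative_intros]:
  assumes "\<nu> \<ge> 0" "(f has_real_derivative D) (at x within S)"
  shows "((\<lambda>x. bess \<nu> (f x)) has_real_derivative - bess (\<nu> + 1) (f x) * D) (at x within S)"
  by (rule DERIV_chain2[OF has_derivative_bess[OF assms(1)] assms(2)])

lemma continuous_on_bess [continuous_intros]:
  assumes "\<nu> \<ge> 0" "continuous_on S f" shows "continuous_on S (\<lambda>x. bess \<nu> (f x))"
proof -
  have "continuous_on UNIV (bess \<nu>)"
    using has_derivative_bess[OF assms(1)] DERIV_isCont continuous_at_imp_continuous_on by blast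
  then show ?thesis
    using assms(2) by (rule continuous_on_compose2) auto
qed

text \<open>As \<open>bess (\<nu> + 1)\<close> and \<open>bess (\<nu> + 2)\<close> are -g' and g''
  for g = \<open>bess \<nu>\<close>, this is Bessel's equation t g'' + (\<nu> + 1) g' + g = 0 in the
  variable t = x^2/4. Comparing coefficients reduces it to the functional equation of
  \<open>rGamma\<close>.\<close>

lemma bess_recurrence:
  assumes "\<nu> \<ge> 0"
  shows "(\<nu> + 1) * bess (\<nu> + 1) t - t * bess (\<nu> + 2) t = bess \<nu> t"
proof -
  let ?c = "\<lambda>\<nu> m. (-1) ^ m / fact m * rGamma (real m + \<nu> + 1)"
  have s1: "(\<lambda>m. ?c \<mu> m * t ^ m) sums bess \<mu> t" if "\<mu> \<ge> 0" for \<mu>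
    using summable_bess[OF that] by (simp add: bess_def summable_sums)
  have "(\<lambda>m. t * (?c (\<nu> + 2) m * t ^ m)) sums (t * bess (\<nu> + 2) t)"
    by (rule sums_mult) (rule s1, use assms in simp)
  \<comment> \<open>Multiplication by t shifts the series by one place; a zeroth term 0 is added so
    that coefficients of equal powers can be compared.\<close>
  then have "(\<lambda>m. (\<lambda>n. if n = 0 then 0 else ?c (\<nu> + 2) (n - 1) * t ^ n) (Suc m)) sums (t * bess (\<nu> + 2) t)"
    by (simp add: mult_ac)
  then have s2: "(\<lambda>n. if n = 0 then 0 else ?c (\<nu> + 2) (n - 1) * t ^ n) sums (t * bess (\<nu> + 2) t)"
    using sums_Suc_iff[of "\<lambda>n. if n = 0 then 0 else ?c (\<nu> + 2) (n - 1) * t ^ n" "t * bess (\<nu> + 2) t"]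
    by simp
  have s3: "(\<lambda>n. (\<nu> + 1) * (?c (\<nu> + 1) n * t ^ n) - (if n = 0 then 0 else ?c (\<nu> + 2) (n - 1) * t ^ n))
      sums ((\<nu> + 1) * bess (\<nu> + 1) t - t * bess (\<nu> + 2) t)"
    by (intro sums_diff sums_mult s1 s2) (use assms in simp)
  have "(\<nu> + 1) * (?c (\<nu> + 1) n * t ^ n) - (if n = 0 then 0 else ?c (\<nu> + 2) (n - 1) * t ^ n)
      = ?c \<nu> n * t ^ n" for n
  proof (cases n)
    case 0
    then show ?thesis using rGamma_Suc_shift[of 0 \<nu>] by (simp add: mult_ac add_ac)
  next
    case (Suc m)
    let ?r = "rGamma (real (Suc n) + \<nu> + 1)"
    have e: "rGamma (real n + \<nu> + 1) = ?r * (real n + \<nu> + 1)"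
      using rGamma_Suc_shift[of n \<nu>] by simp
    have a1: "real n + (\<nu> + 1) + 1 = real (Suc n) + \<nu> + 1" "real (n - 1) + (\<nu> + 2) + 1 = real (Suc n) + \<nu> + 1"
      using Suc by auto
    show ?thesis
      unfolding a1 e using Suc by (simp add: divide_simps) (simp add: algebra_simps)
  qed
  with s3 have "(\<lambda>n. ?c \<nu> n * t ^ n) sums ((\<nu> + 1) * bess (\<nu> + 1) t - t * bess (\<nu> + 2) t)"
    by (metis (no_types, lifting) sums_cong)
  then show ?thesis
    using s1[OF assms] sums_unique2 by blast
qed

text \<open>At negative arguments the signs (-1)^m cancel, so all terms are nonnegative and the
  zeroth is positive. This makes the I part a legitimate denominator later on.\<close>

lemma bess_pos_neg:
  assumes "\<nu> \<ge> 0" "s \<ge> 0"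
  shows "bess \<nu> (- s) > 0"
proof -
  let ?f = "\<lambda>m. (-1) ^ m / fact m * rGamma (real m + \<nu> + 1) * (- s) ^ m"
  have e: "?f = (\<lambda>m. rGamma (real m + \<nu> + 1) * s ^ m / fact m)"
    by (simp add: power_minus[of s] fun_eq_iff)
  have p: "rGamma (real m + \<nu> + 1) > 0" for m
    using assms by (intro rGamma_pos) simp
  have "0 < ?f 0" using p[of 0] by simp
  also have "?f 0 = sum ?f {0}" by simp
  also have "\<dots> \<le> suminf ?f"
  proof (rule sum_le_suminf[OF summable_bess[OF assms(1)]])
    show "0 \<le> ?f m" for m
      using less_imp_le[OF p, of m] assms unfolding fun_cong[OF e, of m] by simp
  qed simp
  finally show ?thesis by (simp add: bess_def)
qed

lemma bess_pos_0: "\<nu> \<ge> 0 \<Longrightarrow> bess \<nu> 0 > 0"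
  using bess_pos_neg[of \<nu> 0] by simp

text \<open>The sign sequence \<open>e\<close> is left open so that one computation serves J, with
  (-1)^m, and I, with 1. The factor (x/2)^\<nu> collects the only noninteger power.\<close>

lemma bessel_series_eq:
  assumes "\<nu> \<ge> 0" "x > 0"
    and that: "summable (\<lambda>m. e m / fact m * rGamma (real m + \<nu> + 1) * (x\<^sup>2 / 4) ^ m)"
  shows "(\<Sum>m. e m / fact m * rGamma (real m + \<nu> + 1) * (x / 2) powr (2 * real m + \<nu>))
     = (x / 2) powr \<nu> * (\<Sum>m. e m / fact m * rGamma (real m + \<nu> + 1) * (x\<^sup>2 / 4) ^ m)"
proof -
  have "(x / 2) powr (2 * real m + \<nu>) = (x / 2) powr \<nu> * (x\<^sup>2 / 4) ^ m" for m
  proof -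
    have "(x / 2) powr (2 * real m) = (x / 2) ^ (2 * m)"
      using assms powr_realpow[of "x / 2" "2 * m"] by simp
    then show ?thesis
      by (simp add: powr_add power_mult power2_eq_square)
  qed
  then have "(\<lambda>m. e m / fact m * rGamma (real m + \<nu> + 1) * (x / 2) powr (2 * real m + \<nu>))
    = (\<lambda>m. (x / 2) powr \<nu> * (e m / fact m * rGamma (real m + \<nu> + 1) * (x\<^sup>2 / 4) ^ m))"
    by (auto simp: mult_ac)
  then show ?thesis
    by (simp only: suminf_mult[OF that])
qed

lemma bessel_J_eq:
  assumes "\<nu> \<ge> 0" "x > 0"
  shows "bessel_J \<nu> x = (x / 2) powr \<nu> * bess \<nu> (x\<^sup>2 / 4)"
  unfolding bessel_J_def bess_def by (rule bessel_series_eq[OF assms summable_bess[OF assms(1)]])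

lemma bessel_I_eq:
  assumes "\<nu> \<ge> 0" "x > 0"
  shows "bessel_I \<nu> x = (x / 2) powr \<nu> * bess \<nu> (- (x\<^sup>2 / 4))"
proof -
  have e: "(-1) ^ m / fact m * rGamma (real m + \<nu> + 1) * (- (x\<^sup>2 / 4)) ^ m
      = 1 / fact m * rGamma (real m + \<nu> + 1) * (x\<^sup>2 / 4) ^ m" for m
    by (simp add: power_minus[of "x\<^sup>2 / 4"])
  have "summable (\<lambda>m. 1 / fact m * rGamma (real m + \<nu> + 1) * (x\<^sup>2 / 4) ^ m)"
    using summable_bess[OF assms(1), of "- (x\<^sup>2 / 4)"] by (simp only: e)
  from bessel_series_eq[OF assms this] show ?thesis
    unfolding bessel_I_def bess_def e by simp
qed

lemma DERIV_bessel_J: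
  assumes "\<nu> \<ge> 0" "x > 0"
  shows "(bessel_J \<nu> has_real_derivative
      (x / 2) powr \<nu> / x * (\<nu> * bess \<nu> (x\<^sup>2 / 4) - x\<^sup>2 / 2 * bess (\<nu> + 1) (x\<^sup>2 / 4))) (at x)"
proof -
  have "((\<lambda>x. (x / 2) powr \<nu> * bess \<nu> (x\<^sup>2 / 4)) has_real_derivative
      (x / 2) powr \<nu> / x * (\<nu> * bess \<nu> (x\<^sup>2 / 4) - x\<^sup>2 / 2 * bess (\<nu> + 1) (x\<^sup>2 / 4))) (at x)"
    using assms by (auto intro!: derivative_eq_intros simp: field_simps powr_diff power2_eq_square)
  then show ?thesis
    by (rule has_field_derivative_transform_within_open[of _ _ _ "{0<..}"]) (use assms bessel_J_eq in auto)
qed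

lemma DERIV_bessel_I:
  assumes "\<nu> \<ge> 0" "x > 0"
  shows "(bessel_I \<nu> has_real_derivative
      (x / 2) powr \<nu> / x * (\<nu> * bess \<nu> (- (x\<^sup>2 / 4)) + x\<^sup>2 / 2 * bess (\<nu> + 1) (- (x\<^sup>2 / 4)))) (at x)"
proof -
  have "((\<lambda>x. (x / 2) powr \<nu> * bess \<nu> (- (x\<^sup>2 / 4))) has_real_derivative
      (x / 2) powr \<nu> / x * (\<nu> * bess \<nu> (- (x\<^sup>2 / 4)) + x\<^sup>2 / 2 * bess (\<nu> + 1) (- (x\<^sup>2 / 4)))) (at x)"
    using assms by (auto intro!: derivative_eq_intros simp: field_simps powr_diff power2_eq_square)
  then show ?thesis
    by (rule has_field_derivative_transform_within_open[of _ _ _ "{0<..}"]) (use assms bessel_I_eq in auto)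
qed

text \<open>With \<open>t = \<alpha>\<^sup>2/4\<close> the characteristic function \<open>F\<close> is a constant multiple of the
  following function, in which no fractional powers occur; \<open>c = \<kappa>\<^sup>2/16\<close>.\<close>

definition char_fun :: "real \<Rightarrow> real \<Rightarrow> real \<Rightarrow> real" where
  "char_fun \<nu> c t = t * bess \<nu> (- (c / t)) * bess (\<nu> + 1) t + c / t * bess \<nu> t * bess (\<nu> + 1) (- (c / t))"

lemma nu_nonneg: "N \<ge> 2 \<Longrightarrow> nu N k \<ge> 0"
  by (simp add: nu_def)

text \<open>With \<beta> = \<kappa>/\<alpha>, the derivatives of I and of J each contribute a term
  \<nu> J I, and these cancel in \<open>F\<close>. The prefactor (\<alpha>/2)^\<nu>
  (\<beta>/2)^\<nu> = (\<kappa>/4)^\<nu> does not depend on \<alpha>, so roots and their simplicity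
  carry over.\<close>

lemma F_eq_char_fun:
  assumes "N \<ge> 2" "\<kappa> > 0" "\<alpha> > 0"
  shows "F N \<kappa> k \<alpha> = 2 * (\<kappa> / 4) powr nu N k * char_fun (nu N k) (\<kappa>\<^sup>2 / 16) (\<alpha>\<^sup>2 / 4)"
proof -
  define \<nu> where "\<nu> = nu N k"
  define \<beta> where "\<beta> = \<kappa> / \<alpha>"
  have \<nu>: "\<nu> \<ge> 0" using nu_nonneg[OF assms(1)] by (simp add: \<nu>_def)
  have \<beta>: "\<beta> > 0" using assms by (simp add: \<beta>_def)
  have s: "\<kappa>\<^sup>2 / 16 / (\<alpha>\<^sup>2 / 4) = \<beta>\<^sup>2 / 4"
    using assms by (simp add: \<beta>_def field_simps power2_eq_square)
  have p: "(\<kappa> / 4) powr \<nu> = (\<alpha> / 2) powr \<nu> * (\<beta> / 2) powr \<nu>"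
    using assms \<beta> by (subst powr_mult[symmetric]) (auto simp: \<beta>_def)
  have dJ: "deriv (bessel_J \<nu>) \<alpha> = (\<alpha> / 2) powr \<nu> / \<alpha> * (\<nu> * bess \<nu> (\<alpha>\<^sup>2 / 4) - \<alpha>\<^sup>2 / 2 * bess (\<nu> + 1) (\<alpha>\<^sup>2 / 4))"
    by (rule DERIV_imp_deriv[OF DERIV_bessel_J[OF \<nu> assms(3)]])
  have dI: "deriv (bessel_I \<nu>) \<beta> = (\<beta> / 2) powr \<nu> / \<beta> * (\<nu> * bess \<nu> (- (\<beta>\<^sup>2 / 4)) + \<beta>\<^sup>2 / 2 * bess (\<nu> + 1) (- (\<beta>\<^sup>2 / 4)))"
    by (rule DERIV_imp_deriv[OF DERIV_bessel_I[OF \<nu> \<beta>]])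
  show ?thesis
    unfolding F_def \<nu>_def[symmetric] \<beta>_def[symmetric] dJ dI bessel_J_eq[OF \<nu> assms(3)] bessel_I_eq[OF \<nu> \<beta>]
      char_fun_def s p
    using assms \<beta> by (simp add: field_simps)
qed

section \<open>First order inequalities with the weight z^m\<close>

lemma weight_increasing:
  fixes X X' :: "real \<Rightarrow> real"
  assumes "m > 0" "0 \<le> a" "a < b" "continuous_on {a..b} X"
    and d: "\<And>z. a < z \<Longrightarrow> z < b \<Longrightarrow> (X has_real_derivative X' z) (at z)"
    and pos: "\<And>z. a < z \<Longrightarrow> z < b \<Longrightarrow> z * X' z + m * X z > 0"
  shows "a powr m * X a < b powr m * X b"
proof (rule DERIV_pos_imp_increasing_open[OF assms(3)])
  fix z assume z: "a < z" "z < b"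
  then have "((\<lambda>z. z powr m * X z) has_real_derivative z powr (m - 1) * (z * X' z + m * X z)) (at z)"
    using assms by (auto intro!: derivative_eq_intros d simp: powr_diff field_simps)
  then show "\<exists>y. ((\<lambda>z. z powr m * X z) has_real_derivative y) (at z) \<and> 0 < y"
    using pos[OF z] z assms by (intro exI[of _ "z powr (m - 1) * (z * X' z + m * X z)"] conjI) auto
next
  show "continuous_on {a..b} (\<lambda>z. z powr m * X z)"
    by (intro continuous_intros assms continuous_on_powr') (use assms in auto)
qed

lemma weight_pos:
  fixes X X' :: "real \<Rightarrow> real"
  assumes "m > 0" "0 < b" "continuous_on {0..b} X"
    and "\<And>z. 0 < z \<Longrightarrow> z < b \<Longrightarrow> (X has_real_derivative X' z) (at z)"
    and "\<And>z. 0 < z \<Longrightarrow> z < b \<Longrightarrow> z * X' z + m * X z > 0"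
  shows "X b > 0"
  using weight_increasing[of m 0 b X X'] assms by (auto simp: zero_less_mult_iff)

text \<open>The second claim is the equality case: z^m X is nondecreasing and vanishes at both ends,
  so it is constant and its derivative is zero throughout.\<close>

lemma weight_nonneg:
  fixes X X' :: "real \<Rightarrow> real"
  assumes "m > 0" "0 < b" "continuous_on {0..b} X"
    and d: "\<And>z. 0 < z \<Longrightarrow> z < b \<Longrightarrow> (X has_real_derivative X' z) (at z)"
    and nn: "\<And>z. 0 < z \<Longrightarrow> z < b \<Longrightarrow> z * X' z + m * X z \<ge> 0"
  shows "X b \<ge> 0" and "X b = 0 \<Longrightarrow> 0 < z \<Longrightarrow> z < b \<Longrightarrow> z * X' z + m * X z = 0"
proof -
  let ?Y = "\<lambda>z. z powr m * X z"
  have c: "continuous_on {0..b} ?Y"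
    by (intro continuous_intros assms continuous_on_powr') (use assms in auto)
  have dY: "(?Y has_real_derivative z powr (m - 1) * (z * X' z + m * X z)) (at z)" if "0 < z" "z < b" for z
    using assms that by (auto intro!: derivative_eq_intros d simp: powr_diff field_simps)
  have mono: "?Y x \<le> ?Y y" if xy: "0 \<le> x" "x \<le> y" "y \<le> b" for x y
  proof (rule DERIV_nonneg_imp_increasing_open[OF xy(2)])
    fix z assume "x < z" "z < y"
    then show "\<exists>l. (?Y has_real_derivative l) (at z) \<and> 0 \<le> l"
      using dY[of z] nn[of z] xy
      by (intro exI[of _ "z powr (m - 1) * (z * X' z + m * X z)"] conjI) auto
  qed (rule continuous_on_subset[OF c], use xy in auto)
  show "X b \<ge> 0" using mono[of 0 b] assms by (auto simp: zero_le_mult_iff)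
  assume X0: "X b = 0" and z: "0 < z" "z < b"
  have Y0: "?Y x = 0" if "0 \<le> x" "x \<le> b" for x
    using mono[of 0 x] mono[of x b] that X0 assms by auto
  have "(?Y has_real_derivative 0) (at z)"
  proof (rule has_field_derivative_transform_within_open[of "\<lambda>_. 0" _ _ "{0<..<b}"])
    show "0 = ?Y x" if "x \<in> {0<..<b}" for x using Y0[of x] that by simp
  qed (use z in auto)
  from DERIV_unique[OF this dY[OF z]] z show "z * X' z + m * X z = 0" by simp
qed

text \<open>Chosen so that z^(\<nu>+1) \<open>bessQ \<nu> z\<close> is the primitive of z^\<nu>
  (\<open>bess \<nu> z\<close>)^2 that vanishes at 0. In the original variable this is Lommel's
  integral of x J^2.\<close>

definition bessQ :: "real \<Rightarrow> real \<Rightarrow> real" where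
  "bessQ \<nu> t = t * (bess (\<nu> + 1) t)\<^sup>2 - \<nu> * bess \<nu> t * bess (\<nu> + 1) t + (bess \<nu> t)\<^sup>2"

lemma DERIV_bessQ:
  assumes "\<nu> \<ge> 0"
  obtains D where "(bessQ \<nu> has_real_derivative D) (at t)" "t * D + (\<nu> + 1) * bessQ \<nu> t = (bess \<nu> t)\<^sup>2"
proof
  let ?g = "bess \<nu> t" and ?h = "bess (\<nu> + 1) t" and ?k = "bess (\<nu> + 2) t"
  let ?D = "?h\<^sup>2 - 2 * t * ?h * ?k + \<nu> * ?h\<^sup>2 + \<nu> * ?g * ?k - 2 * ?g * ?h"
  show "(bessQ \<nu> has_real_derivative ?D) (at t)"
    unfolding bessQ_def[abs_def] using assms
    by (auto intro!: derivative_eq_intros simp: algebra_simps power2_eq_square)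
  have r: "t * ?k = (\<nu> + 1) * ?h - ?g" using bess_recurrence[OF assms, of t] by simp
  have "t * ?D = t * ?h\<^sup>2 - 2 * t * ?h * (t * ?k) + \<nu> * t * ?h\<^sup>2 + \<nu> * ?g * (t * ?k) - 2 * t * ?g * ?h"
    by algebra
  then show "t * ?D + (\<nu> + 1) * bessQ \<nu> t = ?g\<^sup>2"
    unfolding r bessQ_def by algebra
qed

text \<open>If both functions vanished at t, so would \<open>bessQ \<nu> t\<close>; the integral of
  z^\<nu> g^2 over ]0,t[ would be zero and g = \<open>bess \<nu>\<close> would vanish there, against
  g(0) > 0.\<close>

lemma bess_simple:
  assumes "\<nu> \<ge> 0" "t \<ge> 0" "bess \<nu> t = 0"
  shows "bess (\<nu> + 1) t \<noteq> 0"
proof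
  assume h: "bess (\<nu> + 1) t = 0"
  have "t \<noteq> 0" using assms(1,3) bess_pos_0[of \<nu>] by auto
  with assms have t: "t > 0" by simp
  define D where "D = (\<lambda>t. SOME D. (bessQ \<nu> has_real_derivative D) (at t) \<and> t * D + (\<nu> + 1) * bessQ \<nu> t = (bess \<nu> t)\<^sup>2)"
  have D: "(bessQ \<nu> has_real_derivative D t) (at t) \<and> t * D t + (\<nu> + 1) * bessQ \<nu> t = (bess \<nu> t)\<^sup>2" for t
    unfolding D_def by (rule someI_ex) (meson DERIV_bessQ[OF assms(1)])
  have c: "continuous_on {0..t} (bessQ \<nu>)"
    using D DERIV_isCont continuous_at_imp_continuous_on by blast
  have z: "z * D z + (\<nu> + 1) * bessQ \<nu> z = 0" if "0 < z" "z < t" for z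
    by (rule weight_nonneg(2)[of "\<nu> + 1" t "bessQ \<nu>" D]) (use assms t h D c that in \<open>auto simp: bessQ_def\<close>)
  then have z: "bess \<nu> z = 0" if "0 < z" "z < t" for z using D that by auto
  have "bess \<nu> 0 = 0"
  proof (rule continuous_constant_on_closure[of "{0<..<t}" "bess \<nu>"])
    show "continuous_on (closure {0<..<t}) (bess \<nu>)" by (intro continuous_on_bess assms continuous_on_id)
  qed (use z t in auto)
  then show False using bess_pos_0[OF assms(1)] by simp
qed

section \<open>Zeros of Bessel functions\<close>

text \<open>Here y = - t g'/g with g = \<open>bess \<nu>\<close>; Bessel's equation becomes the
  Riccati equation t y' = t - \<nu> y + y^2.\<close>

lemma DERIV_bess_quotient:
  assumes "\<nu> \<ge> 0" "t > 0" "bess \<nu> t \<noteq> 0"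
  defines "y \<equiv> \<lambda>t. t * bess (\<nu> + 1) t / bess \<nu> t"
  shows "(y has_real_derivative (t - \<nu> * y t + (y t)\<^sup>2) / t) (at t)"
proof -
  let ?g = "bess \<nu> t" and ?h = "bess (\<nu> + 1) t" and ?k = "bess (\<nu> + 2) t"
  have r: "t * ?k = (\<nu> + 1) * ?h - ?g" using bess_recurrence[OF assms(1), of t] by simp
  have "(y has_real_derivative ((?h - t * ?k) * ?g + t * ?h * ?h) / (?g * ?g)) (at t)"
    unfolding y_def using assms(1-3)
    by (auto intro!: derivative_eq_intros simp: algebra_simps)
  moreover have "((?h - t * ?k) * ?g + t * ?h * ?h) / (?g * ?g) = (t - \<nu> * y t + (y t)\<^sup>2) / t"
    unfolding r y_def using assms(2,3) by (simp add: field_simps power2_eq_square)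
  ultimately show ?thesis by simp
qed

text \<open>Without zeros beyond M the Riccati solution y would exist for all large t. Completing
  the square gives t y' >= 1 + (y - \<nu>/2)^2 once t >= \<nu>^2/4 + 1, so arctan (y - \<nu>/2)
  would grow at least like ln t, although it is bounded.\<close>

lemma bess_zeros_unbounded:
  assumes "\<nu> \<ge> 0"
  shows "\<exists>t>M. bess \<nu> t = 0"
proof (rule ccontr)
  assume "\<not> ?thesis"
  then have nz: "bess \<nu> t \<noteq> 0" if "t > M" for t using that by auto
  define T where "T = max \<bar>M\<bar> (\<nu>\<^sup>2 / 4) + 1"
  have T: "T > M" "T > 0" "T \<ge> \<nu>\<^sup>2 / 4 + 1" by (auto simp: T_def)
  define y where "y = (\<lambda>t. t * bess (\<nu> + 1) t / bess \<nu> t)"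
  have dy: "(y has_real_derivative (t - \<nu> * y t + (y t)\<^sup>2) / t) (at t)" if "t \<ge> T" for t
    unfolding y_def by (rule DERIV_bess_quotient) (use that T assms nz in auto)
  let ?f = "\<lambda>t. arctan (y t - \<nu> / 2) - ln t"
  \<comment> \<open>From T to T exp 4 the logarithm gains 4, more than the length pi of the range of
    arctan.\<close>
  have "?f T \<le> ?f (T * exp 4)"
  proof (rule DERIV_nonneg_imp_nondecreasing[where f = ?f])
    show "T \<le> T * exp 4" using T by simp
    fix t assume t: "T \<le> t" "t \<le> T * exp 4"
    let ?q = "1 + (y t - \<nu> / 2)\<^sup>2"
    have q: "?q > 0" by (simp add: add_pos_nonneg)
    have df: "(?f has_real_derivative inverse ?q * ((t - \<nu> * y t + (y t)\<^sup>2) / t) - inverse t) (at t)"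
    proof (rule DERIV_diff)
      have "((\<lambda>t. y t - \<nu> / 2) has_real_derivative (t - \<nu> * y t + (y t)\<^sup>2) / t) (at t)"
        using dy[OF t(1)] by (auto intro!: derivative_eq_intros)
      from DERIV_chain2[OF DERIV_arctan this]
      show "((\<lambda>t. arctan (y t - \<nu> / 2)) has_real_derivative inverse ?q * ((t - \<nu> * y t + (y t)\<^sup>2) / t)) (at t)" .
      show "(ln has_real_derivative inverse t) (at t)" using t T by (intro DERIV_ln) simp
    qed
    have "inverse t * ?q \<le> (t - \<nu> * y t + (y t)\<^sup>2) / t"
      using t T by (simp add: divide_simps) (simp add: power2_eq_square algebra_simps)
    then have "inverse ?q * (inverse t * ?q) \<le> inverse ?q * ((t - \<nu> * y t + (y t)\<^sup>2) / t)"
      using q by (intro mult_left_mono) auto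
    moreover have "inverse ?q * (inverse t * ?q) = inverse t" using q by simp
    ultimately have "inverse ?q * ((t - \<nu> * y t + (y t)\<^sup>2) / t) - inverse t \<ge> 0" by linarith
    with df show "\<exists>d. (?f has_real_derivative d) (at t) \<and> 0 \<le> d" by blast
  qed
  moreover have "ln (T * exp 4) = ln T + 4" using T by (simp add: ln_mult)
  moreover have "arctan (y (T * exp 4) - \<nu> / 2) < pi / 2" "arctan (y T - \<nu> / 2) > - (pi / 2)"
    using arctan_ubound arctan_lbound by auto
  ultimately show False using pi_less_4 by linarith
qed

text \<open>Infinitely many zeros would accumulate at some x of the compact interval. There either f
  is nonzero or the difference quotient has a nonzero limit, and both keep other zeros away from
  x.\<close>

lemma finite_simple_zeros:
  fixes f :: "real \<Rightarrow> real"
  assumes "\<And>x. a \<le> x \<Longrightarrow> x \<le> b \<Longrightarrow> \<exists>D. (f has_real_derivative D) (at x) \<and> (f x = 0 \<longrightarrow> D \<noteq> 0)"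
  shows "finite {x\<in>{a..b}. f x = 0}"
proof (rule ccontr)
  let ?Z = "{x\<in>{a..b}. f x = 0}"
  assume "infinite ?Z"
  then obtain x where x: "x \<in> {a..b}" "x islimpt ?Z"
    using compact_Icc[of a b] unfolding compact_eq_Bolzano_Weierstrass by (metis (no_types, lifting) mem_Collect_eq subsetI)
  then obtain D where D: "(f has_real_derivative D) (at x)" "f x = 0 \<Longrightarrow> D \<noteq> 0"
    using assms[of x] by auto
  have "eventually (\<lambda>y. f y \<noteq> 0) (at x)"
  proof (cases "f x = 0")
    case True
    have "((\<lambda>y. (f y - f x) / (y - x)) \<longlongrightarrow> D) (at x)"
      using D(1) by (simp add: has_field_derivative_iff)
    from tendsto_imp_eventually_ne[OF this D(2)[OF True]] show ?thesis
      by eventually_elim (auto simp: True)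
  next
    case False
    have "(f \<longlongrightarrow> f x) (at x)"
      using DERIV_isCont[OF D(1)] by (simp add: isCont_def)
    from tendsto_imp_eventually_ne[OF this False] show ?thesis .
  qed
  then have "eventually (\<lambda>y. y \<notin> ?Z) (at x)"
    by eventually_elim auto
  with x(2) show False by (simp add: islimpt_iff_eventually)
qed

text \<open>The enumeration iterates the map to the next larger element. An element that it missed
  would bound the infinite range of \<open>e\<close>, contradicting \<open>fin\<close>.\<close>

lemma enumerate_discrete:
  fixes Z :: "real set"
  assumes fin: "\<And>M. finite (Z \<inter> {..M})" and unb: "\<And>M. \<exists>z\<in>Z. z > M"
  shows "\<exists>e :: nat \<Rightarrow> real. strict_mono e \<and> range e = Z"
proof -
  have "\<exists>w\<in>Z. w > x \<and> (\<forall>z\<in>Z. z > x \<longrightarrow> w \<le> z)" for x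
  proof -
    obtain z where z: "z \<in> Z" "z > x" using unb by blast
    let ?S = "Z \<inter> {x<..z}"
    have f: "finite ?S" by (rule finite_subset[OF _ fin[of z]]) auto
    have ne: "?S \<noteq> {}" using z by auto
    have "Min ?S \<in> ?S" using f ne by (rule Min_in)
    moreover have "Min ?S \<le> w" if "w \<in> Z" "w > x" for w
    proof (cases "w \<le> z")
      case True then show ?thesis using f that by (intro Min_le) auto
    next
      case False then show ?thesis using \<open>Min ?S \<in> ?S\<close> by auto
    qed
    ultimately show ?thesis by (intro bexI[of _ "Min ?S"]) auto
  qed
  then obtain nxt where nxt: "\<And>x. nxt x \<in> Z" "\<And>x. nxt x > x" "\<And>x z. z \<in> Z \<Longrightarrow> z > x \<Longrightarrow> nxt x \<le> z"
    by metis
  obtain z0 where z0: "z0 \<in> Z" using unb by blast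
  \<comment> \<open>A point below all of Z, so that the first iterate is the least element.\<close>
  define x0 where "x0 = Min (Z \<inter> {..z0}) - 1"
  have x0: "x0 < z" if "z \<in> Z" for z
  proof -
    have "Min (Z \<inter> {..z0}) \<le> min z z0"
      using that z0 by (intro Min_le fin) (auto simp: min_def)
    then show ?thesis by (simp add: x0_def)
  qed
  define e where "e = (\<lambda>n. (nxt ^^ Suc n) x0)"
  have e0: "e 0 = nxt x0" and eS: "e (Suc n) = nxt (e n)" for n by (simp_all add: e_def)
  have mono: "strict_mono e" unfolding strict_mono_Suc_iff using eS nxt(2) by simp
  have in_Z: "e n \<in> Z" for n using e0 eS nxt(1) by (cases n) auto
  have "z \<in> range e" if z: "z \<in> Z" for z
  proof (rule ccontr)
    assume n: "z \<notin> range e"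
    have "e k \<le> z" for k
    proof (induction k)
      case 0 then show ?case using nxt(3)[OF z x0[OF z]] by (simp add: e0)
    next
      case (Suc k)
      then have "e k < z" using n by (metis order_le_less rangeI)
      then show ?case using nxt(3)[OF z] by (simp add: eS)
    qed
    then have "range e \<subseteq> Z \<inter> {..z}" using in_Z by auto
    then have "finite (range e)" using fin finite_subset by blast
    then show False using mono strict_mono_imp_inj_on range_inj_infinite by blast
  qed
  then show ?thesis using mono in_Z by (intro exI[of _ e]) auto
qed

text \<open>In terms of the usual positive zeros j of the Bessel function of order \<nu> these are
  the numbers j^2/4, counted from index 0.\<close>

definition bess_zero :: "real \<Rightarrow> nat \<Rightarrow> real" where
  "bess_zero \<nu> = (SOME e. strict_mono e \<and> range e = {t. t > 0 \<and> bess \<nu> t = 0})"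

lemma bess_zero:
  assumes "\<nu> \<ge> 0"
  shows "strict_mono (bess_zero \<nu>)" "range (bess_zero \<nu>) = {t. t > 0 \<and> bess \<nu> t = 0}"
proof -
  let ?Z = "{t. t > 0 \<and> bess \<nu> t = 0}"
  have "finite (?Z \<inter> {..M})" for M
  proof (rule finite_subset)
    show "finite {t\<in>{0..M}. bess \<nu> t = 0}"
      using has_derivative_bess[OF assms] bess_simple[OF assms]
      by (intro finite_simple_zeros) (metis neg_equal_0_iff_equal)
  qed auto
  moreover have "\<exists>t\<in>?Z. t > M" for M
    using bess_zeros_unbounded[OF assms, of "max M 0"] by auto
  ultimately have "\<exists>e :: nat \<Rightarrow> real. strict_mono e \<and> range e = ?Z"
    by (rule enumerate_discrete)
  then have "strict_mono (bess_zero \<nu>) \<and> range (bess_zero \<nu>) = ?Z"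
    unfolding bess_zero_def by (rule someI_ex)
  then show "strict_mono (bess_zero \<nu>)" "range (bess_zero \<nu>) = ?Z" by auto
qed

lemma bess_zero_less: "\<nu> \<ge> 0 \<Longrightarrow> bess_zero \<nu> m < bess_zero \<nu> n \<longleftrightarrow> m < n"
  using bess_zero(1) by (simp add: strict_mono_less)

lemma bess_zero_pos: "\<nu> \<ge> 0 \<Longrightarrow> bess_zero \<nu> n > 0"
  and bess_bess_zero: "\<nu> \<ge> 0 \<Longrightarrow> bess \<nu> (bess_zero \<nu> n) = 0"
  using bess_zero(2)[of \<nu>] by blast+

lemma bess_zeroE:
  assumes "\<nu> \<ge> 0" "t > 0" "bess \<nu> t = 0"
  obtains n where "t = bess_zero \<nu> n"
  using bess_zero(2)[OF assms(1)] assms by blast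

lemma bess_nonzero_between:
  assumes "\<nu> \<ge> 0" "bess_zero \<nu> n < t" "t < bess_zero \<nu> (Suc n)"
  shows "bess \<nu> t \<noteq> 0"
proof
  assume "bess \<nu> t = 0"
  moreover have "t > 0" using bess_zero_pos[OF assms(1), of n] assms(2) by simp
  ultimately obtain m where "t = bess_zero \<nu> m" using bess_zeroE[OF assms(1)] by blast
  then show False using assms bess_zero_less by auto
qed

lemma bess_nonzero_before:
  assumes "\<nu> \<ge> 0" "0 \<le> t" "t < bess_zero \<nu> 0"
  shows "bess \<nu> t \<noteq> 0"
proof
  assume z: "bess \<nu> t = 0"
  then have "t \<noteq> 0" using bess_pos_0[OF assms(1)] by auto
  then obtain m where "t = bess_zero \<nu> m" using bess_zeroE[OF assms(1)] z assms by (metis order_le_less)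
  then show False using assms bess_zero_less by auto
qed

lemma bess_zero_intervals:
  assumes "\<nu> \<ge> 0" "t \<ge> bess_zero \<nu> 0"
  obtains n where "bess_zero \<nu> n \<le> t" "t < bess_zero \<nu> (Suc n)"
proof -
  obtain u where "u > t" "bess \<nu> u = 0" using bess_zeros_unbounded[OF assms(1)] by blast
  moreover have "u > 0" using \<open>u > t\<close> assms bess_zero_pos[of \<nu> 0] by linarith
  ultimately have ex: "\<exists>m. t < bess_zero \<nu> m" using bess_zeroE[OF assms(1)] by metis
  define m where "m = (LEAST m. t < bess_zero \<nu> m)"
  have m: "t < bess_zero \<nu> m" unfolding m_def using ex by (rule LeastI_ex)
  then obtain n where n: "m = Suc n" using assms(2) by (cases m) auto
  have "\<not> t < bess_zero \<nu> n" using not_less_Least[of n "\<lambda>m. t < bess_zero \<nu> m"] n m_def by auto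
  then show ?thesis using that m n by force
qed

section \<open>Sign pattern of \<open>bess\<close> and a lower bound for its first zero\<close>

lemma same_sign_no_zero:
  fixes f :: "real \<Rightarrow> real"
  assumes "continuous_on {min x y..max x y} f" "\<And>z. min x y \<le> z \<Longrightarrow> z \<le> max x y \<Longrightarrow> f z \<noteq> 0" "f x > 0"
  shows "f y > 0"
proof (rule ccontr)
  assume "\<not> ?thesis"
  then have le: "f y \<le> 0" by simp
  have "connected (f ` {min x y..max x y})"
    by (rule connected_continuous_image[OF assms(1)]) simp
  moreover have "f x \<in> f ` {min x y..max x y}" "f y \<in> f ` {min x y..max x y}" by auto
  ultimately have "0 \<in> f ` {min x y..max x y}"
    using le assms(3) unfolding connected_iff_interval by (meson less_imp_le)
  then show False using assms(2) by auto
qed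

lemma bess_pos_before:
  assumes "\<nu> \<ge> 0" "0 \<le> t" "t < bess_zero \<nu> 0"
  shows "bess \<nu> t > 0"
  by (rule same_sign_no_zero[of 0])
     (use assms bess_nonzero_before bess_pos_0 in \<open>auto intro!: continuous_intros\<close>)

text \<open>The derivative of \<open>bess \<nu>\<close> at its zero is -
  \<open>bess (\<nu> + 1)\<close>, which is nonzero; being positive before the zero, \<sigma> g must
  fall through it. In the induction over the zeros \<sigma> is a power of -1.\<close>

lemma bess_sign_at_zero_aux:
  assumes \<nu>: "\<nu> \<ge> 0" and a: "a < bess_zero \<nu> n"
    and s: "\<And>t. a < t \<Longrightarrow> t < bess_zero \<nu> n \<Longrightarrow> \<sigma> * bess \<nu> t > 0"
  shows "\<sigma> * bess (\<nu> + 1) (bess_zero \<nu> n) > 0"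
    and "bess_zero \<nu> n < t \<Longrightarrow> t < bess_zero \<nu> (Suc n) \<Longrightarrow> - \<sigma> * bess \<nu> t > 0"
proof -
  let ?z = "bess_zero \<nu> n" and ?f = "\<lambda>t. \<sigma> * bess \<nu> t"
  have "\<sigma> \<noteq> 0" using s[of "(a + ?z) / 2"] a by auto
  have d: "(?f has_real_derivative - (\<sigma> * bess (\<nu> + 1) ?z)) (at ?z)"
    using \<nu> by (auto intro!: derivative_eq_intros)
  have ne: "\<sigma> * bess (\<nu> + 1) ?z \<noteq> 0"
    using bess_simple[OF \<nu> _ bess_bess_zero[OF \<nu>]] bess_zero_pos[OF \<nu>, of n] \<open>\<sigma> \<noteq> 0\<close> by auto
  show pos: "\<sigma> * bess (\<nu> + 1) ?z > 0"
  proof (rule ccontr)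
    assume "\<not> ?thesis"
    then have "- (\<sigma> * bess (\<nu> + 1) ?z) > 0" using ne by linarith
    from DERIV_pos_inc_left[OF d this] obtain e where e: "e > 0" "\<And>h. 0 < h \<Longrightarrow> h < e \<Longrightarrow> ?f (?z - h) < ?f ?z"
      by blast
    let ?h = "min e (?z - a) / 2"
    have "?f (?z - ?h) < ?f ?z" by (rule e(2)) (use e a in auto)
    moreover have "?f (?z - ?h) > 0" by (rule s) (use e a in \<open>auto simp: min_def field_simps\<close>)
    ultimately show False using bess_bess_zero[OF \<nu>, of n] by simp
  qed
  assume t: "?z < t" "t < bess_zero \<nu> (Suc n)"
  have "- (\<sigma> * bess (\<nu> + 1) ?z) < 0" using pos by simp
  from DERIV_neg_dec_right[OF d this] obtain e where e: "e > 0" "\<And>h. 0 < h \<Longrightarrow> h < e \<Longrightarrow> ?f (?z + h) < ?f ?z"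
    by blast
  let ?x = "?z + min e (t - ?z) / 2"
  have "?f ?x < ?f ?z" by (rule e(2)) (use e t in auto)
  then have "- \<sigma> * bess \<nu> ?x > 0" using bess_bess_zero[OF \<nu>, of n] by simp
  moreover have "?z < ?x" "?x < t" using e t by (auto simp: min_def field_simps)
  moreover have "- \<sigma> * bess \<nu> z \<noteq> 0" if "min ?x t \<le> z" "z \<le> max ?x t" for z
    using bess_nonzero_between[OF \<nu>, of n z] \<open>\<sigma> \<noteq> 0\<close> that t \<open>?z < ?x\<close> \<open>?x < t\<close>
    unfolding min_absorb1[OF less_imp_le[OF \<open>?x < t\<close>]] max_absorb2[OF less_imp_le[OF \<open>?x < t\<close>]] by auto
  ultimately show "- \<sigma> * bess \<nu> t > 0"
    by (intro same_sign_no_zero[of ?x t "\<lambda>t. - \<sigma> * bess \<nu> t"]) (auto intro!: continuous_intros \<nu>)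
qed

lemma bess_sign:
  assumes \<nu>: "\<nu> \<ge> 0"
  shows "(- 1) ^ n * bess (\<nu> + 1) (bess_zero \<nu> n) > 0"
    and "bess_zero \<nu> n < t \<Longrightarrow> t < bess_zero \<nu> (Suc n) \<Longrightarrow> (- 1) ^ Suc n * bess \<nu> t > 0"
proof -
  have "(- 1) ^ n * bess (\<nu> + 1) (bess_zero \<nu> n) > 0 \<and>
     (\<forall>t. bess_zero \<nu> n < t \<longrightarrow> t < bess_zero \<nu> (Suc n) \<longrightarrow> (- 1) ^ Suc n * bess \<nu> t > 0)"
  proof (induction n)
    case 0
    have "1 * bess \<nu> t > 0" if "0 < t" "t < bess_zero \<nu> 0" for t
      using bess_pos_before[OF \<nu>, of t] that by simp
    from bess_sign_at_zero_aux[OF \<nu> bess_zero_pos[OF \<nu>] this] show ?case by auto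
  next
    case (Suc n)
    have l: "bess_zero \<nu> n < bess_zero \<nu> (Suc n)" using bess_zero_less[OF \<nu>] by simp
    have "(- 1) ^ Suc n * bess \<nu> t > 0" if "bess_zero \<nu> n < t" "t < bess_zero \<nu> (Suc n)" for t
      using Suc that by blast
    from bess_sign_at_zero_aux[OF \<nu> l this] show ?case by auto
  qed
  then show "(- 1) ^ n * bess (\<nu> + 1) (bess_zero \<nu> n) > 0"
    and "bess_zero \<nu> n < t \<Longrightarrow> t < bess_zero \<nu> (Suc n) \<Longrightarrow> (- 1) ^ Suc n * bess \<nu> t > 0" by blast+
qed

text \<open>Up to the first zero g = \<open>bess \<nu>\<close> decreases, and the weight identity
  makes (\<nu> + 1) h a mean value of g, where h = - g'. So h <= g(0)/(\<nu> + 1), and a function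
  falling from g(0) at no more than this rate needs at least the length \<nu> + 1 to reach
  0.\<close>

lemma bess_zero_ge:
  assumes "\<nu> \<ge> 0"
  shows "\<nu> + 1 \<le> bess_zero \<nu> 0"
proof -
  let ?e = "bess_zero \<nu> 0"
  define X where "X = (\<lambda>t. bess \<nu> 0 / (\<nu> + 1) - bess (\<nu> + 1) t)"
  have e: "?e > 0" using bess_zero_pos[OF assms] .
  have hpos: "bess (\<nu> + 1) t > 0" if "0 < t" "t \<le> ?e" for t
  proof (rule weight_pos[of "\<nu> + 1" t "bess (\<nu> + 1)" "\<lambda>z. - bess (\<nu> + 2) z"])
    fix z assume z: "0 < z" "z < t"
    show "(bess (\<nu> + 1) has_real_derivative - bess (\<nu> + 2) z) (at z)"
      using has_derivative_bess[of "\<nu> + 1" z] assms by (simp add: add.assoc)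
    show "0 < z * - bess (\<nu> + 2) z + (\<nu> + 1) * bess (\<nu> + 1) z"
      using bess_recurrence[OF assms, of z] bess_pos_before[OF assms, of z] z that by simp
  qed (use assms that in \<open>auto intro!: continuous_intros\<close>)
  have dec: "bess \<nu> t \<le> bess \<nu> 0" if "0 \<le> t" "t \<le> ?e" for t
  proof (rule DERIV_nonpos_imp_decreasing_open[OF that(1)])
    show "\<exists>y. (bess \<nu> has_real_derivative y) (at x) \<and> y \<le> 0" if "0 < x" "x < t" for x
      using has_derivative_bess[OF assms, of x] hpos[of x] that \<open>t \<le> ?e\<close> by (intro exI conjI) auto
  qed (intro continuous_intros assms)
  have "X t \<ge> 0" if "0 < t" "t < ?e" for t
  proof (rule weight_nonneg(1)[of "\<nu> + 1" t X "\<lambda>z. bess (\<nu> + 2) z"])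
    fix z assume z: "0 < z" "z < t"
    show "(X has_real_derivative bess (\<nu> + 2) z) (at z)"
      unfolding X_def using assms by (auto intro!: derivative_eq_intros simp: add_ac)
    have "z * bess (\<nu> + 2) z = (\<nu> + 1) * bess (\<nu> + 1) z - bess \<nu> z"
      using bess_recurrence[OF assms, of z] by simp
    then have "z * bess (\<nu> + 2) z + (\<nu> + 1) * X z = bess \<nu> 0 - bess \<nu> z"
      using assms by (simp add: X_def right_diff_distrib)
    then show "0 \<le> z * bess (\<nu> + 2) z + (\<nu> + 1) * X z" using dec[of z] z that by simp
  qed (use assms that in \<open>auto intro!: continuous_intros simp: X_def\<close>)
  note X = this
  let ?f = "\<lambda>t. bess \<nu> t + t * (bess \<nu> 0 / (\<nu> + 1))"
  have "?f 0 \<le> ?f ?e"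
  proof (rule DERIV_nonneg_imp_increasing_open[where f = ?f])
    fix x assume "0 < x" "x < ?e"
    then have "X x \<ge> 0" by (rule X)
    moreover have "(?f has_real_derivative X x) (at x)"
      unfolding X_def using assms by (auto intro!: derivative_eq_intros)
    ultimately show "\<exists>y. (?f has_real_derivative y) (at x) \<and> 0 \<le> y" by blast
  qed (use e assms in \<open>auto intro!: continuous_intros\<close>)
  then have "bess \<nu> 0 * (\<nu> + 1) \<le> bess \<nu> 0 * ?e"
    using assms bess_bess_zero[OF assms, of 0] by (simp add: field_simps)
  then show ?thesis using bess_pos_0[OF assms] by simp
qed

section \<open>Roots of the characteristic function\<close>

text \<open>The quantity below is a positive multiple of the derivative of the characteristic function
  at a root \<open>t\<close>; it equals \<open>\<integral>\<^sub>0\<^sup>1 z\<^sup>\<nu>\<^sup>+\<^sup>1 u'(z)\<^sup>2 dz\<close> for the corresponding radial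
  function \<open>u\<close>, and \<open>X\<close> in the proof is the explicit primitive divided by \<open>z\<^sup>\<nu>\<^sup>+\<^sup>1\<close>.\<close>

lemma root_slope_pos:
  assumes \<nu>: "\<nu> \<ge> 0" and t: "t > 0" and s: "s > 0" and nz: "bess \<nu> t \<noteq> 0"
    and root: "t * bess \<nu> (- s) * bess (\<nu> + 1) t + s * bess \<nu> t * bess (\<nu> + 1) (- s) = 0"
  defines "x \<equiv> s * bess (\<nu> + 1) (- s) / bess \<nu> (- s)"
  shows "t - s + 2 * \<nu> * x + 2 * x\<^sup>2 > 0"
proof -
  define g where "g = bess \<nu> t"
  define k where "k = bess \<nu> (- s)"
  have k: "k > 0" unfolding k_def by (rule bess_pos_neg) (use \<nu> s in auto)
  have g: "g \<noteq> 0" using nz by (simp add: g_def)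
  \<comment> \<open>Both components are normalized to 1 at z = 1, so that u = G - K vanishes there.
    The suffixes 1 and 2 denote derivatives in z.\<close>
  define G where "G = (\<lambda>z. bess \<nu> (t * z) / g)"
  define K where "K = (\<lambda>z. bess \<nu> (- s * z) / k)"
  define G1 where "G1 = (\<lambda>z. - t * bess (\<nu> + 1) (t * z) / g)"
  define K1 where "K1 = (\<lambda>z. s * bess (\<nu> + 1) (- s * z) / k)"
  define G2 where "G2 = (\<lambda>z. t\<^sup>2 * bess (\<nu> + 2) (t * z) / g)"
  define K2 where "K2 = (\<lambda>z. s\<^sup>2 * bess (\<nu> + 2) (- s * z) / k)"
  have d: "(G has_real_derivative G1 z) (at z)" "(K has_real_derivative K1 z) (at z)"
    "(G1 has_real_derivative G2 z) (at z)" "(K1 has_real_derivative K2 z) (at z)" for z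
    unfolding G_def K_def G1_def K1_def G2_def K2_def using \<nu> g k
    by (auto intro!: derivative_eq_intros simp: power2_eq_square add_ac)
  have odeG: "z * G2 z + (\<nu> + 1) * G1 z = - t * G z" for z
    using bess_recurrence[OF \<nu>, of "t * z"] g
    unfolding G_def G1_def G2_def by (simp add: field_simps power2_eq_square)
  have odeK: "z * K2 z + (\<nu> + 1) * K1 z = s * K z" for z
  proof -
    have r: "bess \<nu> (- (s * z)) = (\<nu> + 1) * bess (\<nu> + 1) (- (s * z)) + s * z * bess (\<nu> + 2) (- (s * z))"
      using bess_recurrence[OF \<nu>, of "- (s * z)"] by simp
    show ?thesis
      using k unfolding K_def K1_def K2_def mult_minus_left r by (simp add: field_simps power2_eq_square)
  qed
  have "\<forall>z. \<exists>D. (bessQ \<nu> has_real_derivative D) (at z) \<and> z * D + (\<nu> + 1) * bessQ \<nu> z = (bess \<nu> z)\<^sup>2"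
    by (rule allI, rule DERIV_bessQ[OF \<nu>]) blast
  from choice[OF this] obtain QD where QD: "\<And>z. (bessQ \<nu> has_real_derivative QD z) (at z)"
     "\<And>z. z * QD z + (\<nu> + 1) * bessQ \<nu> z = (bess \<nu> z)\<^sup>2"
    by blast
  \<comment> \<open>By the two Bessel equations, (G - K) (z (G - K)'' + (\<nu> + 1) (G - K)') equals
    - t G^2 + s K^2 + (t - s) G K. The \<open>bessQ\<close> terms with the weights \<open>gi\<close>
    and \<open>ki\<close> cancel the squares, and q times the Wronskian of G and K cancels the mixed
    term; only z (G' - K')^2 remains.\<close>
  define q where "q = (s - t) / (s + t)"
  define gi where "gi = t / g\<^sup>2"
  define ki where "ki = s / k\<^sup>2"
  define X where "X = (\<lambda>z. (G z - K z) * (G1 z - K1 z) + gi * bessQ \<nu> (t * z) - ki * bessQ \<nu> (- s * z)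
      + q * (G z * K1 z - K z * G1 z))"
  define X' where "X' = (\<lambda>z. (G1 z - K1 z)\<^sup>2 + (G z - K z) * (G2 z - K2 z)
      + gi * (t * QD (t * z)) - ki * (- s * QD (- s * z))
      + q * (G z * K2 z - K z * G2 z))"
  have dQ: "((\<lambda>z. bessQ \<nu> (a * z)) has_real_derivative QD (a * z) * a) (at z)" for a z
    using DERIV_chain2[of "bessQ \<nu>" "QD (a * z)" "\<lambda>z. a * z" z a, OF QD(1) DERIV_cmult_Id] .
  have dX: "(X has_real_derivative X' z) (at z)" for z
  proof -
    have 1: "((\<lambda>z. (G z - K z) * (G1 z - K1 z)) has_real_derivative
        (G1 z - K1 z) * (G1 z - K1 z) + (G2 z - K2 z) * (G z - K z)) (at z)"
      by (rule DERIV_mult[OF DERIV_diff[OF d(1) d(2)] DERIV_diff[OF d(3) d(4)]])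
    have 2: "((\<lambda>z. gi * bessQ \<nu> (t * z)) has_real_derivative gi * (QD (t * z) * t)) (at z)"
      by (rule DERIV_cmult[OF dQ])
    have 3: "((\<lambda>z. ki * bessQ \<nu> (- s * z)) has_real_derivative ki * (QD (- s * z) * - s)) (at z)"
      by (rule DERIV_cmult[OF dQ])
    have 4: "((\<lambda>z. q * (G z * K1 z - K z * G1 z)) has_real_derivative
        q * ((G1 z * K1 z + K2 z * G z) - (K1 z * G1 z + G2 z * K z))) (at z)"
      by (rule DERIV_cmult[OF DERIV_diff[OF DERIV_mult[OF d(1) d(4)] DERIV_mult[OF d(2) d(3)]]])
    have e: "(G1 z - K1 z) * (G1 z - K1 z) + (G2 z - K2 z) * (G z - K z) + gi * (QD (t * z) * t)
       - ki * (QD (- s * z) * - s) + q * ((G1 z * K1 z + K2 z * G z) - (K1 z * G1 z + G2 z * K z)) = X' z"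
      by (simp add: X'_def power2_eq_square algebra_simps)
    show ?thesis
      using DERIV_add[OF DERIV_diff[OF DERIV_add[OF 1 2] 3] 4] unfolding e X_def .
  qed
  have X': "z * X' z + (\<nu> + 1) * X z = z * (G1 z - K1 z)\<^sup>2" for z
  proof -
    have q1: "(t * z) * QD (t * z) + (\<nu> + 1) * bessQ \<nu> (t * z) = g\<^sup>2 * (G z)\<^sup>2"
      using QD(2)[of "t * z"] g by (simp add: G_def power2_eq_square)
    have q2: "(- s * z) * QD (- s * z) + (\<nu> + 1) * bessQ \<nu> (- s * z) = k\<^sup>2 * (K z)\<^sup>2"
      using QD(2)[of "- s * z"] k by (simp add: K_def power2_eq_square)
    have gk: "gi * g\<^sup>2 = t" "ki * k\<^sup>2 = s" "q * (s + t) = s - t"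
      using g k s t by (simp_all add: gi_def ki_def q_def)
    have "z * X' z + (\<nu> + 1) * X z = z * (G1 z - K1 z)\<^sup>2
      + (G z - K z) * ((z * G2 z + (\<nu> + 1) * G1 z) - (z * K2 z + (\<nu> + 1) * K1 z))
      + gi * ((t * z) * QD (t * z) + (\<nu> + 1) * bessQ \<nu> (t * z))
      - ki * ((- s * z) * QD (- s * z) + (\<nu> + 1) * bessQ \<nu> (- s * z))
      + q * (G z * (z * K2 z + (\<nu> + 1) * K1 z) - K z * (z * G2 z + (\<nu> + 1) * G1 z))"
      unfolding X_def X'_def by (simp add: algebra_simps)
    also have "\<dots> = z * (G1 z - K1 z)\<^sup>2 + (G z - K z) * (- t * G z - s * K z) + (gi * g\<^sup>2) * (G z)\<^sup>2
       - (ki * k\<^sup>2) * (K z)\<^sup>2 + (q * (s + t)) * (G z * K z)"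
      unfolding odeG odeK q1 q2 by (simp add: algebra_simps)
    also have "\<dots> = z * (G1 z - K1 z)\<^sup>2"
      unfolding gk by (simp add: power2_eq_square algebra_simps)
    finally show ?thesis .
  qed
  have cX: "continuous_on {0..1} X"
    using dX DERIV_isCont continuous_at_imp_continuous_on by blast
  have G_1: "G 1 = 1" "K 1 = 1" using g k by (auto simp: G_def K_def g_def k_def)
  have K1_1: "K1 1 = x" by (simp add: K1_def x_def k_def)
  \<comment> \<open>The root equation says precisely that G' and K' agree at z = 1, with common
    value x.\<close>
  have "t * k * bess (\<nu> + 1) t = - (s * g * bess (\<nu> + 1) (- s))"
    using root by (simp add: g_def k_def)
  then have h: "t * bess (\<nu> + 1) t = - (s * bess (\<nu> + 1) (- s) / k) * g"
    using g k by (simp add: field_simps)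
  then have h': "t * bess (\<nu> + 1) t = - x * g" by (simp add: x_def k_def)
  then have G1_1: "G1 1 = x" using g by (simp add: G1_def)
  have Xval: "X 1 = t - s + 2 * \<nu> * x + 2 * x\<^sup>2"
  proof -
    have "t * bessQ \<nu> t = (t * bess (\<nu> + 1) t)\<^sup>2 - \<nu> * g * (t * bess (\<nu> + 1) t) + t * g\<^sup>2"
      by (simp add: bessQ_def g_def power2_eq_square algebra_simps)
    also have "\<dots> = (x\<^sup>2 + \<nu> * x + t) * g\<^sup>2"
      unfolding h' by (simp add: power2_eq_square algebra_simps)
    finally have a: "t * bessQ \<nu> t / g\<^sup>2 = x\<^sup>2 + \<nu> * x + t" using g by simp
    have xk: "s * bess (\<nu> + 1) (- s) = x * k" using k by (simp add: x_def k_def)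
    have "s * bessQ \<nu> (- s) = - (s * bess (\<nu> + 1) (- s))\<^sup>2 - \<nu> * k * (s * bess (\<nu> + 1) (- s)) + s * k\<^sup>2"
      by (simp add: bessQ_def k_def power2_eq_square algebra_simps)
    also have "\<dots> = (- x\<^sup>2 - \<nu> * x + s) * k\<^sup>2"
      unfolding xk by (simp add: power2_eq_square algebra_simps)
    finally have b: "s * bessQ \<nu> (- s) / k\<^sup>2 = - x\<^sup>2 - \<nu> * x + s" using k by simp
    show ?thesis
      using a b by (simp add: X_def G_1 K1_1 G1_1 gi_def ki_def)
  qed
  have "X 1 \<ge> 0"
    by (rule weight_nonneg(1)[of "\<nu> + 1" 1 X X']) (use \<nu> cX dX X' in auto)
  \<comment> \<open>Equality would give G' = K' on ]0,1[ and hence G'' = K''. Subtracting the two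
    equations leaves t G + s K = 0, which fails at z = 1 because both components equal 1
    there.\<close>
  moreover have "X 1 \<noteq> 0"
  proof
    assume X0: "X 1 = 0"
    have u1: "G1 z = K1 z" if "0 < z" "z < 1" for z
    proof -
      have "z * X' z + (\<nu> + 1) * X z = 0"
        by (rule weight_nonneg(2)[of "\<nu> + 1" 1 X X']) (use \<nu> cX dX X' X0 that in auto)
      then show ?thesis using X'[of z] that by simp
    qed
    have tG: "t * G z + s * K z = 0" if z: "0 < z" "z < 1" for z
    proof -
      have "((\<lambda>z. G1 z - K1 z) has_real_derivative G2 z - K2 z) (at z)"
        by (intro DERIV_diff d)
      moreover have "((\<lambda>z. G1 z - K1 z) has_real_derivative 0) (at z)"
        by (rule has_field_derivative_transform_within_open[of "\<lambda>_. 0" _ _ "{0<..<1}"]) (use z u1 in auto)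
      ultimately have "G2 z = K2 z" using DERIV_unique by fastforce
      then show ?thesis using odeG[of z] odeK[of z] u1[OF z] by simp
    qed
    have "t * G 1 + s * K 1 = 0"
    proof (rule continuous_constant_on_closure[of "{0<..<1}" "\<lambda>z. t * G z + s * K z"])
      show "continuous_on (closure {0<..<1}) (\<lambda>z. t * G z + s * K z)"
        unfolding G_def K_def using \<nu> g k by (auto intro!: continuous_intros)
    qed (use tG in auto)
    then show False using G_1 s t by simp
  qed
  ultimately show ?thesis using Xval by simp
qed

text \<open>At a root, t D is K g times the positive quantity of \<open>root_slope_pos\<close>, with
  g = \<open>bess \<nu> t\<close> and K > 0; g is nonzero, since otherwise
  \<open>bess (\<nu> + 1) t\<close> would vanish as well. Thus the sign of g prescribes the
  direction of every crossing, which gives simplicity and, between zeros of g, uniqueness.\<close>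

lemma DERIV_char_fun:
  assumes \<nu>: "\<nu> \<ge> 0" and c: "c > 0" and t: "t > 0"
  obtains D where "(char_fun \<nu> c has_real_derivative D) (at t)"
    and "char_fun \<nu> c t = 0 \<Longrightarrow> bess \<nu> t * D > 0"
proof -
  define s where "s = c / t"
  have s: "s > 0" using c t by (simp add: s_def)
  define g where "g = bess \<nu> t"
  define h where "h = bess (\<nu> + 1) t"
  define k where "k = bess (\<nu> + 2) t"
  define K where "K = bess \<nu> (- s)"
  define L where "L = bess (\<nu> + 1) (- s)"
  define M where "M = bess (\<nu> + 2) (- s)"
  have K: "K > 0" and L: "L > 0" unfolding K_def L_def by (rule bess_pos_neg; use \<nu> s in simp)+
  have rk: "t * k = (\<nu> + 1) * h - g" using bess_recurrence[OF \<nu>, of t] by (simp add: g_def h_def k_def)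
  have rM: "s * M = K - (\<nu> + 1) * L" using bess_recurrence[OF \<nu>, of "- s"] by (simp add: K_def L_def M_def)
  define D where "D = K * h - s * L * h - t * K * k - s / t * g * L - s * h * L - (s / t) * g * (s * M)"
  have ct: "c / t = s" "c / t\<^sup>2 = s / t" by (simp_all add: s_def power2_eq_square)
  have ds: "((\<lambda>t. c / t) has_real_derivative - (s / t)) (at t)"
    using t by (auto intro!: derivative_eq_intros simp: s_def power2_eq_square)
  have dd: "((\<lambda>t. bess \<mu> (- (c / t))) has_real_derivative - (s / t) * bess (\<mu> + 1) (- s)) (at t)" if "\<mu> \<ge> 0" for \<mu>
    by (rule derivative_eq_intros that ds refl | simp add: ct)+
  have dK: "((\<lambda>t. bess \<nu> (- (c / t))) has_real_derivative - (s / t) * L) (at t)"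
    using dd[OF \<nu>] by (simp add: L_def)
  have dL: "((\<lambda>t. bess (\<nu> + 1) (- (c / t))) has_real_derivative - (s / t) * M) (at t)"
    using dd[of "\<nu> + 1"] \<nu> by (simp add: M_def add.assoc)
  have dg: "(bess \<nu> has_real_derivative - h) (at t)" "(bess (\<nu> + 1) has_real_derivative - k) (at t)"
    using has_derivative_bess[OF \<nu>, of t] has_derivative_bess[of "\<nu> + 1" t] \<nu> by (simp_all add: h_def k_def add.assoc)
  have dW: "(char_fun \<nu> c has_real_derivative D) (at t)"
    unfolding char_fun_def[abs_def]
    by (rule DERIV_cong[OF DERIV_add[OF DERIV_mult[OF DERIV_mult[OF DERIV_ident dK] dg(2)]
            DERIV_mult[OF DERIV_mult[OF ds dg(1)] dL]]])
       (unfold ct g_def[symmetric] h_def[symmetric] K_def[symmetric] L_def[symmetric],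
        use t in \<open>simp add: D_def field_simps\<close>)
  moreover have "bess \<nu> t * D > 0" if W0: "char_fun \<nu> c t = 0"
  proof -
    define x where "x = s * L / K"
    have W: "t * K * h + s * g * L = 0" using W0 by (simp add: char_fun_def ct g_def h_def K_def L_def)
    have g: "g \<noteq> 0"
    proof
      assume g0: "g = 0"
      then have "h = 0" using W t K by simp
      then show False using bess_simple[OF \<nu>, of t] t g0 by (simp add: g_def h_def)
    qed
    have th: "t * h = - x * g" using W K by (simp add: x_def field_simps)
    have sL: "s * L = x * K" using K by (simp add: x_def)
    have "t * D = K * (t * h) - 2 * (s * L) * (t * h) - t * K * (t * k) - g * (s * L) - s * g * (s * M)"
      using t by (simp add: D_def field_simps)
    also have "\<dots> = K * g * (t - s) - 2 * (s * L) * (t * h) - \<nu> * K * (t * h) + \<nu> * g * (s * L)"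
    proof -
      have "t * K * (t * k) = (\<nu> + 1) * K * (t * h) - t * K * g" unfolding rk by algebra
      moreover have "s * g * (s * M) = s * g * K - (\<nu> + 1) * g * (s * L)" unfolding rM by algebra
      ultimately show ?thesis by (simp add: algebra_simps)
    qed
    also have "\<dots> = K * g * (t - s + 2 * \<nu> * x + 2 * x\<^sup>2)"
      unfolding sL th by (simp add: power2_eq_square algebra_simps)
    finally have tD: "t * D = K * g * (t - s + 2 * \<nu> * x + 2 * x\<^sup>2)" .
    have pos: "t - s + 2 * \<nu> * x + 2 * x\<^sup>2 > 0"
      unfolding x_def K_def L_def
      by (rule root_slope_pos) (use \<nu> t s g W in \<open>auto simp: g_def h_def K_def L_def\<close>)
    have "t * (g * D) = g * (t * D)" by simp
    also have "\<dots> = g\<^sup>2 * (K * (t - s + 2 * \<nu> * x + 2 * x\<^sup>2))" unfolding tD by (simp add: power2_eq_square)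
    also have "\<dots> > 0" using g K pos by simp
    finally show ?thesis using t by (simp add: g_def zero_less_mult_iff)
  qed
  ultimately show ?thesis using that by blast
qed

text \<open>Take the next zero m after a. Positive slopes at both make f positive right of a and
  negative left of m, although there is no zero in between.\<close>

lemma at_most_one_upcrossing:
  fixes f :: "real \<Rightarrow> real"
  assumes "a \<le> b" "f a = 0" "f b = 0"
    and d: "\<And>x. a \<le> x \<Longrightarrow> x \<le> b \<Longrightarrow> \<exists>D. (f has_real_derivative D) (at x) \<and> (f x = 0 \<longrightarrow> D > 0)"
  shows "a = b"
proof (rule ccontr)
  assume "a \<noteq> b"
  with assms have ab: "a < b" by simp
  let ?Z = "{x\<in>{a..b}. f x = 0}"
  have fin: "finite ?Z" by (rule finite_simple_zeros) (use d in force)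
  define m where "m = Min (?Z - {a})"
  have "b \<in> ?Z - {a}" using ab assms by auto
  then have m: "m \<in> ?Z - {a}" unfolding m_def by (intro Min_in) (use fin in auto)
  then have am: "a < m" "m \<le> b" "f m = 0" by auto
  have nz: "f x \<noteq> 0" if "a < x" "x < m" for x
  proof
    assume "f x = 0"
    then have "m \<le> x" unfolding m_def using that am fin by (intro Min_le) auto
    then show False using that by simp
  qed
  obtain Da where "(f has_real_derivative Da) (at a)" "Da > 0" using d[of a] assms by auto
  from DERIV_pos_inc_right[OF this] obtain e where e: "e > 0" "\<And>h. 0 < h \<Longrightarrow> h < e \<Longrightarrow> f a < f (a + h)" by blast
  obtain Dm where "(f has_real_derivative Dm) (at m)" "Dm > 0" using d[of m] am by auto
  from DERIV_pos_inc_left[OF this] obtain e' where e': "e' > 0" "\<And>h. 0 < h \<Longrightarrow> h < e' \<Longrightarrow> f (m - h) < f m" by blast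
  let ?x = "a + min e (m - a) / 2" and ?y = "m - min e' (m - a) / 2"
  have x: "f ?x > 0" using e(2)[of "min e (m - a) / 2"] e(1) am assms by simp
  have y: "f ?y < 0" using e'(2)[of "min e' (m - a) / 2"] e'(1) am by simp
  have xm: "a < ?x" "?x < m" "a < ?y" "?y < m" using e(1) e'(1) am by (auto simp: min_def field_simps)
  have "f ?y > 0"
  proof (rule same_sign_no_zero[of ?x ?y f])
    show "continuous_on {min ?x ?y..max ?x ?y} f"
    proof (rule continuous_at_imp_continuous_on, rule ballI)
      fix z assume z: "z \<in> {min ?x ?y..max ?x ?y}"
      have "a \<le> z" "z \<le> b" using z[unfolded atLeastAtMost_iff] xm am by linarith+
      then show "isCont f z" using d[of z] DERIV_isCont by blast
    qed
    fix z assume "min ?x ?y \<le> z" "z \<le> max ?x ?y"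
    then show "f z \<noteq> 0" using xm by (intro nz) linarith+
  qed (rule x)
  with y show False by simp
qed

text \<open>While \<open>bess \<nu>\<close> is positive the weight identity makes
  \<open>bess (\<nu> + 1)\<close> positive too, and then no term of \<open>char_fun\<close> is
  negative.\<close>

lemma char_fun_pos_before:
  assumes "\<nu> \<ge> 0" "c > 0" "0 < t" "t \<le> bess_zero \<nu> 0"
  shows "char_fun \<nu> c t > 0" and "bess (\<nu> + 1) t > 0"
proof -
  show h: "bess (\<nu> + 1) t > 0"
  proof (rule weight_pos[of "\<nu> + 1" t "bess (\<nu> + 1)" "\<lambda>z. - bess (\<nu> + 2) z"])
    fix z assume z: "0 < z" "z < t"
    show "(bess (\<nu> + 1) has_real_derivative - bess (\<nu> + 2) z) (at z)"
      using has_derivative_bess[of "\<nu> + 1" z] assms by (simp add: add.assoc)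
    show "0 < z * - bess (\<nu> + 2) z + (\<nu> + 1) * bess (\<nu> + 1) z"
      using bess_recurrence[OF assms(1), of z] bess_pos_before[OF assms(1), of z] z assms by simp
  qed (use assms in \<open>auto intro!: continuous_intros\<close>)
  have "bess \<nu> t \<ge> 0"
    using bess_pos_before[OF assms(1), of t] bess_bess_zero[OF assms(1), of 0] assms
    by (cases "t = bess_zero \<nu> 0") auto
  moreover have "bess \<nu> (- (c / t)) > 0" "bess (\<nu> + 1) (- (c / t)) > 0"
    using assms by (auto intro!: bess_pos_neg)
  ultimately show "char_fun \<nu> c t > 0"
    unfolding char_fun_def using h assms by (intro add_pos_nonneg mult_pos_pos mult_nonneg_nonneg) auto
qed

text \<open>At a zero of \<open>bess \<nu>\<close> only the first term of \<open>char_fun\<close>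
  survives; it has the sign of \<open>bess (\<nu> + 1)\<close>, which alternates from zero to
  zero.\<close>

lemma char_fun_at_bess_zero:
  assumes "\<nu> \<ge> 0" "c > 0"
  shows "(- 1) ^ n * char_fun \<nu> c (bess_zero \<nu> n) > 0"
proof -
  let ?t = "bess_zero \<nu> n"
  have t: "?t > 0" by (rule bess_zero_pos[OF assms(1)])
  have "bess \<nu> (- (c / ?t)) > 0" using assms t by (intro bess_pos_neg) auto
  then have "?t * bess \<nu> (- (c / ?t)) * ((- 1) ^ n * bess (\<nu> + 1) ?t) > 0"
    using bess_sign(1)[OF assms(1), of n] t by simp
  then show ?thesis by (simp add: char_fun_def bess_bess_zero[OF assms(1)] mult_ac)
qed

lemma isCont_char_fun:
  assumes "\<nu> \<ge> 0" "c > 0" "t > 0" shows "isCont (char_fun \<nu> c) t"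
  by (rule DERIV_char_fun[OF assms]) (rule DERIV_isCont)

text \<open>Existence is a sign change between consecutive zeros of \<open>bess \<nu>\<close>.
  Between them \<open>bess \<nu>\<close> keeps its sign, so all crossings would go the same way and
  there is only one.\<close>

lemma ex1_char_root:
  assumes \<nu>: "\<nu> \<ge> 0" and c: "c > 0"
  shows "\<exists>!t. bess_zero \<nu> n < t \<and> t < bess_zero \<nu> (Suc n) \<and> char_fun \<nu> c t = 0"
proof (rule ex_ex1I)
  let ?a = "bess_zero \<nu> n" and ?b = "bess_zero \<nu> (Suc n)" and ?\<sigma> = "(- 1 :: real) ^ n"
  have a: "0 < ?a" and ab: "?a < ?b" using bess_zero_pos[OF \<nu>] bess_zero_less[OF \<nu>] by auto
  have sa: "?\<sigma> * char_fun \<nu> c ?a > 0" and sb: "?\<sigma> * char_fun \<nu> c ?b < 0"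
    using char_fun_at_bess_zero[OF \<nu> c, of n] char_fun_at_bess_zero[OF \<nu> c, of "Suc n"] by auto
  have "\<exists>t\<ge>?a. t \<le> ?b \<and> ?\<sigma> * char_fun \<nu> c t = 0"
    by (rule IVT2) (use sa sb ab a in \<open>auto intro!: isCont_mult isCont_char_fun \<nu> c\<close>)
  then obtain t where t: "?a \<le> t" "t \<le> ?b" "char_fun \<nu> c t = 0" by auto
  then have "t \<noteq> ?a" "t \<noteq> ?b" using sa sb by auto
  then show "\<exists>t. ?a < t \<and> t < ?b \<and> char_fun \<nu> c t = 0" using t by (intro exI[of _ t]) auto
next
  \<comment> \<open>Now \<sigma> is (-1)^(n+1), the sign of \<open>bess \<nu>\<close> between its
    zeros n and n + 1; existence used the sign (-1)^n of \<open>char_fun\<close> at zero n.\<close>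
  let ?a = "bess_zero \<nu> n" and ?b = "bess_zero \<nu> (Suc n)" and ?\<sigma> = "(- 1 :: real) ^ Suc n"
  have a: "0 < ?a" by (rule bess_zero_pos[OF \<nu>])
  have le: "t = t'" if t: "?a < t" "t' < ?b" "char_fun \<nu> c t = 0" "char_fun \<nu> c t' = 0" "t \<le> t'" for t t'
  proof (rule at_most_one_upcrossing[of t t' "\<lambda>x. ?\<sigma> * char_fun \<nu> c x"])
    fix x assume x: "t \<le> x" "x \<le> t'"
    then have x0: "x > 0" using t a by linarith
    obtain D where D: "(char_fun \<nu> c has_real_derivative D) (at x)" "char_fun \<nu> c x = 0 \<Longrightarrow> bess \<nu> x * D > 0"
      using DERIV_char_fun[OF \<nu> c x0] by blast
    have "?\<sigma> * bess \<nu> x > 0" by (rule bess_sign(2)[OF \<nu>]) (use x t in auto)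
    then have "?\<sigma> * D > 0" if "char_fun \<nu> c x = 0"
      using D(2)[OF that] by (auto simp: zero_less_mult_iff mult_less_0_iff)
    then show "\<exists>D. ((\<lambda>x. ?\<sigma> * char_fun \<nu> c x) has_real_derivative D) (at x) \<and> (?\<sigma> * char_fun \<nu> c x = 0 \<longrightarrow> D > 0)"
      by (intro exI[of _ "?\<sigma> * D"] conjI DERIV_cmult D(1)) auto
  qed (use t in auto)
  fix t t' assume "?a < t \<and> t < ?b \<and> char_fun \<nu> c t = 0" "?a < t' \<and> t' < ?b \<and> char_fun \<nu> c t' = 0"
  then show "t = t'" using le[of t t'] le[of t' t] by (cases "t \<le> t'") auto
qed

section \<open>Enumeration and size of the roots\<close>

definition char_root :: "real \<Rightarrow> real \<Rightarrow> nat \<Rightarrow> real" where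
  "char_root \<nu> c n = (THE t. bess_zero \<nu> n < t \<and> t < bess_zero \<nu> (Suc n) \<and> char_fun \<nu> c t = 0)"

lemma char_root:
  assumes "\<nu> \<ge> 0" "c > 0"
  shows "bess_zero \<nu> n < char_root \<nu> c n" "char_root \<nu> c n < bess_zero \<nu> (Suc n)"
    "char_fun \<nu> c (char_root \<nu> c n) = 0"
  using theI'[OF ex1_char_root[OF assms, of n]] unfolding char_root_def by blast+

lemma char_root_pos: "\<nu> \<ge> 0 \<Longrightarrow> c > 0 \<Longrightarrow> char_root \<nu> c n > 0"
  using char_root(1)[of \<nu> c n] bess_zero_pos[of \<nu> n] by linarith

lemma strict_mono_char_root:
  assumes "\<nu> \<ge> 0" "c > 0" shows "strict_mono (char_root \<nu> c)"
  unfolding strict_mono_Suc_iff using char_root[OF assms] order_less_trans by blast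

lemma range_char_root:
  assumes "\<nu> \<ge> 0" "c > 0"
  shows "range (char_root \<nu> c) = {t. t > 0 \<and> char_fun \<nu> c t = 0}"
proof (intro subset_antisym subsetI)
  fix t assume t: "t \<in> {t. t > 0 \<and> char_fun \<nu> c t = 0}"
  then have "\<not> t \<le> bess_zero \<nu> 0" using char_fun_pos_before[OF assms, of t] by auto
  then obtain n where n: "bess_zero \<nu> n \<le> t" "t < bess_zero \<nu> (Suc n)"
    using bess_zero_intervals[OF assms(1), of t] by auto
  have "t \<noteq> bess_zero \<nu> n" using char_fun_at_bess_zero[OF assms, of n] t by auto
  then have "char_root \<nu> c n = t"
    unfolding char_root_def using n t by (intro the1_equality[OF ex1_char_root[OF assms]]) auto
  then show "t \<in> range (char_root \<nu> c)" by blast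
next
  fix t assume "t \<in> range (char_root \<nu> c)"
  then obtain n where "t = char_root \<nu> c n" by blast
  then show "t \<in> {t. t > 0 \<and> char_fun \<nu> c t = 0}"
    using char_root_pos[OF assms, of n] char_root(3)[OF assms, of n] by simp
qed

text \<open>After its first zero g = \<open>bess \<nu>\<close> is negative up to the first root,
  where the equation \<open>char_fun\<close> = 0 then forces \<open>bess (\<nu> + 1)\<close> to be
  positive. Going back from the root, z^(\<nu>+1) \<open>bess (\<nu> + 1)\<close> can only grow,
  because its derivative is z^\<nu> g.\<close>

lemma bess_Suc_pos_char_root:
  assumes \<nu>: "\<nu> \<ge> 0" and c: "c > 0" and t: "0 < t" "t \<le> char_root \<nu> c 0"
  shows "bess (\<nu> + 1) t > 0"
proof (cases "t \<le> bess_zero \<nu> 0")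
  case True
  then show ?thesis using char_fun_pos_before(2)[OF \<nu> c t(1)] by simp
next
  case False
  let ?r = "char_root \<nu> c 0"
  note r = char_root[OF \<nu> c, of 0]
  have r0: "?r > 0" by (rule char_root_pos[OF \<nu> c])
  have neg: "bess \<nu> z < 0" if "bess_zero \<nu> 0 < z" "z \<le> ?r" for z
    using bess_sign(2)[OF \<nu>, of 0 z] that r by simp
  have "bess \<nu> (- (c / ?r)) > 0" "bess (\<nu> + 1) (- (c / ?r)) > 0"
    using \<nu> c r0 by (auto intro!: bess_pos_neg)
  then have "c / ?r * bess \<nu> ?r * bess (\<nu> + 1) (- (c / ?r)) < 0"
    using neg[OF r(1)] c r0 by (intro mult_neg_pos mult_pos_neg) auto
  then have "?r * bess \<nu> (- (c / ?r)) * bess (\<nu> + 1) ?r > 0" using r(3) by (simp add: char_fun_def)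
  then have hr: "bess (\<nu> + 1) ?r > 0"
    using r0 \<open>bess \<nu> (- (c / ?r)) > 0\<close> by (meson mult_pos_pos zero_less_mult_pos)
  show ?thesis
  proof (cases "t = ?r")
    case False
    have "t powr (\<nu> + 1) * - bess (\<nu> + 1) t < ?r powr (\<nu> + 1) * - bess (\<nu> + 1) ?r"
    proof (rule weight_increasing[of "\<nu> + 1" t ?r "\<lambda>z. - bess (\<nu> + 1) z" "\<lambda>z. bess (\<nu> + 2) z"])
      fix z assume z: "t < z" "z < ?r"
      show "((\<lambda>z. - bess (\<nu> + 1) z) has_real_derivative bess (\<nu> + 2) z) (at z)"
        using \<nu> by (auto intro!: derivative_eq_intros simp: add_ac)
      show "0 < z * bess (\<nu> + 2) z + (\<nu> + 1) * - bess (\<nu> + 1) z"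
        using bess_recurrence[OF \<nu>, of z] neg[of z] z \<open>\<not> t \<le> bess_zero \<nu> 0\<close> by simp
    qed (use \<nu> t False in \<open>auto intro!: continuous_intros\<close>)
    moreover have "?r powr (\<nu> + 1) * bess (\<nu> + 1) ?r > 0" using hr r0 by simp
    ultimately have "t powr (\<nu> + 1) * bess (\<nu> + 1) t > 0" by simp
    then show ?thesis using t by (simp add: zero_less_mult_iff)
  qed (use hr in simp)
qed

text \<open>This zero of \<open>bess (\<nu> + 1)\<close> separates the first roots for \<nu> and for
  \<nu> + 1, which is how degree 0 comes to hold the smallest root.\<close>

lemma char_root_0_less_bess_zero:
  assumes "\<nu> \<ge> 0" "c > 0"
  shows "char_root \<nu> c 0 < bess_zero (\<nu> + 1) 0"
proof (rule ccontr)
  assume "\<not> ?thesis"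
  then have "bess (\<nu> + 1) (bess_zero (\<nu> + 1) 0) > 0"
    using assms by (intro bess_Suc_pos_char_root[of \<nu> c] bess_zero_pos) auto
  then show False using bess_bess_zero[of "\<nu> + 1" 0] assms by simp
qed

lemma char_root_0_mono:
  assumes "\<nu> \<ge> 0" "c > 0"
  shows "char_root \<nu> c 0 < char_root (\<nu> + 1) c 0"
  using char_root_0_less_bess_zero[OF assms] char_root(1)[of "\<nu> + 1" c 0] assms by simp

text \<open>Bounds the degrees k that can have a given number as a root, and so makes eigenspaces
  finite sums.\<close>

lemma char_root_gt:
  assumes "\<nu> \<ge> 0" "c > 0" shows "\<nu> < char_root \<nu> c n"
proof -
  have "bess_zero \<nu> 0 \<le> bess_zero \<nu> n" using bess_zero(1)[OF assms(1)] by (simp add: strict_mono_less_eq)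
  then show ?thesis using bess_zero_ge[OF assms(1)] char_root(1)[OF assms, of n] by linarith
qed

section \<open>Roots of the radial profile\<close>

context
  fixes \<nu> \<tau> s :: real
  assumes \<nu>: "\<nu> \<ge> 0" and \<tau>: "\<tau> > 0" and s: "s > 0"
begin

text \<open>Write G and K for numerator and denominator. A profile c G + d K vanishing at z = 1
  equals c K (\<open>ratio z\<close> - \<open>ratio 1\<close>), so its zeros are the points where
  \<open>ratio\<close> takes its value at 1.\<close>

definition ratio :: "real \<Rightarrow> real" where
  "ratio z = bess \<nu> (\<tau> * z) / bess \<nu> (- s * z)"

text \<open>This is K G' - G K'. For s = c/\<tau> its value at z = 1 is -
  \<open>char_fun \<nu> c \<tau>\<close>: the end point is critical for \<open>ratio\<close> exactly
  when \<tau> is a root.\<close>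

definition wron :: "real \<Rightarrow> real" where
  "wron z = - (\<tau> * bess \<nu> (- s * z) * bess (\<nu> + 1) (\<tau> * z) + s * bess \<nu> (\<tau> * z) * bess (\<nu> + 1) (- s * z))"

lemma bess_neg_pos: "z \<ge> 0 \<Longrightarrow> \<mu> \<ge> 0 \<Longrightarrow> bess \<mu> (- s * z) > 0"
  using bess_pos_neg[of \<mu> "s * z"] s by simp

lemma DERIV_bess_lin:
  assumes "\<mu> \<ge> 0"
  shows "((\<lambda>z. bess \<mu> (a * z)) has_real_derivative - a * bess (\<mu> + 1) (a * z)) (at z)"
  using DERIV_chain2[OF has_derivative_bess[OF assms] DERIV_cmult_Id, of a z] by (simp add: mult.commute)

lemma DERIV_ratio:
  assumes "z \<ge> 0"
  shows "(ratio has_real_derivative wron z / (bess \<nu> (- s * z))\<^sup>2) (at z)"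
  unfolding ratio_def[abs_def]
  by (rule DERIV_cong[OF DERIV_divide[OF DERIV_bess_lin[OF \<nu>] DERIV_bess_lin[OF \<nu>]]])
     (use bess_neg_pos[OF assms \<nu>] in \<open>auto simp: wron_def power2_eq_square algebra_simps\<close>)

text \<open>The second part is Lagrange's identity for the two Bessel equations: only the zeroth
  order terms, - \<tau> and s, fail to cancel. Hence the monotonicity of z^(\<nu>+1)
  \<open>wron\<close> depends on the sign of G alone.\<close>

lemma DERIV_wron:
  shows "(wron has_real_derivative \<tau>\<^sup>2 * bess \<nu> (- s * z) * bess (\<nu> + 2) (\<tau> * z)
      - s\<^sup>2 * bess \<nu> (\<tau> * z) * bess (\<nu> + 2) (- s * z)) (at z)" (is "(_ has_real_derivative ?D) _")
    and "z * (\<tau>\<^sup>2 * bess \<nu> (- s * z) * bess (\<nu> + 2) (\<tau> * z)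
      - s\<^sup>2 * bess \<nu> (\<tau> * z) * bess (\<nu> + 2) (- s * z)) + (\<nu> + 1) * wron z
       = - (s + \<tau>) * (bess \<nu> (\<tau> * z) * bess \<nu> (- s * z))"
proof -
  have \<nu>1: "\<nu> + 1 \<ge> 0" using \<nu> by simp
  have e: "\<nu> + 1 + 1 = \<nu> + 2" by simp
  note d = DERIV_bess_lin[OF \<nu>] DERIV_bess_lin[OF \<nu>1, unfolded e]
  have "((\<lambda>z. - (\<tau> * (bess \<nu> (- s * z) * bess (\<nu> + 1) (\<tau> * z)) + s * (bess \<nu> (\<tau> * z) * bess (\<nu> + 1) (- s * z))))
     has_real_derivative ?D) (at z)"
    by (rule DERIV_cong[OF DERIV_minus[OF DERIV_add[OF DERIV_cmult[OF DERIV_mult[OF d(1) d(2)]]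
       DERIV_cmult[OF DERIV_mult[OF d(1) d(2)]]]]]) (simp add: algebra_simps power2_eq_square)
  then show "(wron has_real_derivative ?D) (at z)"
    unfolding wron_def[abs_def] by (simp add: mult.assoc)
  define g where "g = bess \<nu> (\<tau> * z)"
  define K where "K = bess \<nu> (- s * z)"
  define h where "h = bess (\<nu> + 1) (\<tau> * z)"
  define L where "L = bess (\<nu> + 1) (- s * z)"
  define k where "k = bess (\<nu> + 2) (\<tau> * z)"
  define M where "M = bess (\<nu> + 2) (- s * z)"
  have r1: "\<tau> * z * k = (\<nu> + 1) * h - g" and r2: "s * z * M = K - (\<nu> + 1) * L"
    using bess_recurrence[OF \<nu>, of "\<tau> * z"] bess_recurrence[OF \<nu>, of "- s * z"]
    unfolding g_def K_def h_def L_def k_def M_def by linarith+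
  have "z * (\<tau>\<^sup>2 * K * k - s\<^sup>2 * g * M) + (\<nu> + 1) * - (\<tau> * K * h + s * g * L)
      = \<tau> * K * (\<tau> * z * k) - s * g * (s * z * M) - (\<nu> + 1) * (\<tau> * K * h + s * g * L)"
    by (simp add: power2_eq_square algebra_simps)
  also have "\<dots> = - (s + \<tau>) * (g * K)"
    unfolding r1 r2 by (simp add: algebra_simps)
  finally show "z * ?D + (\<nu> + 1) * wron z = - (s + \<tau>) * (bess \<nu> (\<tau> * z) * bess \<nu> (- s * z))"
    unfolding wron_def g_def K_def h_def L_def k_def M_def .
qed

text \<open>With \<rho> for \<open>ratio\<close>, Lagrange's identity reads z \<rho>'' + (\<nu> + 1
  + 2 z K'/K) \<rho>' + (s + \<tau>) \<rho> = 0, a damped oscillator with mass z. This is its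
  kinetic plus potential energy, up to a factor 1/2.\<close>

definition energy :: "real \<Rightarrow> real" where
  "energy z = z * (wron z / (bess \<nu> (- s * z))\<^sup>2)\<^sup>2 + (s + \<tau>) * (ratio z)\<^sup>2"

text \<open>The summand 1 comes from the explicit factor z in the energy; as \<nu> >= 0, it is
  outweighed by the damping term 2 (\<nu> + 1).\<close>

lemma DERIV_energy:
  assumes "z \<ge> 0"
  defines "r \<equiv> wron z / (bess \<nu> (- s * z))\<^sup>2"
  shows "(energy has_real_derivative r\<^sup>2 * (1 - 2 * (\<nu> + 1) - 4 * z * s * bess (\<nu> + 1) (- s * z) / bess \<nu> (- s * z))) (at z)"
proof -
  define K where "K = bess \<nu> (- s * z)"
  define L where "L = bess (\<nu> + 1) (- s * z)"
  define V where "V = wron z"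
  define G where "G = bess \<nu> (\<tau> * z)"
  define D where "D = \<tau>\<^sup>2 * bess \<nu> (- s * z) * bess (\<nu> + 2) (\<tau> * z)
      - s\<^sup>2 * bess \<nu> (\<tau> * z) * bess (\<nu> + 2) (- s * z)"
  have K: "K > 0" unfolding K_def by (rule bess_neg_pos[OF assms(1) \<nu>])
  have dK: "((\<lambda>z. bess \<nu> (- s * z)) has_real_derivative s * L) (at z)"
    using DERIV_bess_lin[OF \<nu>, of "- s" z] by (simp add: L_def)
  have dV: "(wron has_real_derivative D) (at z)" unfolding D_def by (rule DERIV_wron)
  have dK2: "((\<lambda>z. (bess \<nu> (- s * z))\<^sup>2) has_real_derivative 2 * K * (s * L)) (at z)"
    using DERIV_power[OF dK, of 2] by (simp add: K_def mult_ac)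
  define R where "R = (D * K\<^sup>2 - V * (2 * K * (s * L))) / (K\<^sup>2 * K\<^sup>2)"
  have dr: "((\<lambda>z. wron z / (bess \<nu> (- s * z))\<^sup>2) has_real_derivative R) (at z)"
    using DERIV_divide[OF dV dK2] K by (simp add: K_def V_def R_def)
  have drho: "(ratio has_real_derivative r) (at z)" unfolding r_def by (rule DERIV_ratio[OF assms(1)])
  have "(energy has_real_derivative 1 * r\<^sup>2 + (2 * r * R) * z + (s + \<tau>) * (2 * ratio z * r)) (at z)"
    unfolding energy_def[abs_def]
    using DERIV_add[OF DERIV_mult[OF DERIV_ident DERIV_power[OF dr, of 2]] DERIV_cmult[OF DERIV_power[OF drho, of 2], of "s + \<tau>"]]
    by (simp add: r_def mult_ac)
  moreover have "1 * r\<^sup>2 + (2 * r * R) * z + (s + \<tau>) * (2 * ratio z * r) = r\<^sup>2 * (1 - 2 * (\<nu> + 1) - 4 * z * s * L / K)"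
  proof -
    have zD: "z * D = - (\<nu> + 1) * V - (s + \<tau>) * (G * K)"
      using DERIV_wron(2)[of z] unfolding D_def V_def G_def K_def by linarith
    have V: "V = r * K\<^sup>2" using K by (simp add: r_def V_def K_def)
    have G: "G = ratio z * K" using K by (simp add: ratio_def G_def K_def)
    have "z * R = (z * D * K\<^sup>2 - V * (2 * K * (z * s * L))) / (K\<^sup>2 * K\<^sup>2)"
      by (simp add: R_def algebra_simps)
    also have "\<dots> = - (\<nu> + 1) * r - (s + \<tau>) * ratio z - 2 * r * z * s * L / K"
      unfolding zD V G using K by (simp add: field_simps power2_eq_square)
    finally have zR: "z * R = - (\<nu> + 1) * r - (s + \<tau>) * ratio z - 2 * r * z * s * L / K" .
    have "1 * r\<^sup>2 + (2 * r * R) * z + (s + \<tau>) * (2 * ratio z * r) = r\<^sup>2 + 2 * r * (z * R) + 2 * (s + \<tau>) * ratio z * r"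
      by simp
    also have "\<dots> = r\<^sup>2 * (1 - 2 * (\<nu> + 1) - 4 * z * s * L / K)"
      unfolding zR using K by (simp add: field_simps power2_eq_square)
    finally show ?thesis .
  qed
  ultimately show ?thesis by (simp add: K_def L_def)
qed

text \<open>The derivative is never positive. If the energy were constant on an interval,
  \<open>wron\<close> would vanish there, hence also G by Lagrange's identity, against the
  simplicity of the zeros of \<open>bess \<nu>\<close>.\<close>

lemma energy_strict:
  assumes "0 \<le> z" "z < w"
  shows "energy w < energy z"
proof -
  define f where "f = (\<lambda>z. 1 - 2 * (\<nu> + 1) - 4 * z * s * bess (\<nu> + 1) (- s * z) / bess \<nu> (- s * z))"
  define r where "r = (\<lambda>z. wron z / (bess \<nu> (- s * z))\<^sup>2)"
  have fneg: "f x < 0" if "x \<ge> 0" for x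
  proof -
    have "4 * x * s * bess (\<nu> + 1) (- s * x) / bess \<nu> (- s * x) \<ge> 0"
      using that s \<nu> bess_neg_pos[OF that \<nu>] bess_neg_pos[OF that, of "\<nu> + 1"] by simp
    then show ?thesis using \<nu> unfolding f_def by argo
  qed
  have d: "(energy has_real_derivative (r x)\<^sup>2 * f x) (at x)" if "x \<ge> 0" for x
    using DERIV_energy[OF that] by (simp add: f_def r_def)
  have c: "continuous_on {a..b} energy" if "0 \<le> a" for a b
    using that d[THEN DERIV_isCont] by (intro continuous_at_imp_continuous_on ballI) simp
  have mono: "energy b \<le> energy a" if "0 \<le> a" "a \<le> b" for a b
  proof (rule DERIV_nonpos_imp_decreasing_open[OF that(2)])
    fix x assume "a < x" "x < b"
    then show "\<exists>y. (energy has_real_derivative y) (at x) \<and> y \<le> 0"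
      using d[of x] fneg[of x] that by (intro exI[of _ "(r x)\<^sup>2 * f x"]) (auto simp: mult_le_0_iff)
  qed (rule c[OF that(1)])
  show ?thesis
  proof (rule ccontr)
    assume "\<not> ?thesis"
    then have eq: "energy x = energy z" if "z \<le> x" "x \<le> w" for x
      using mono[of z x] mono[of x w] that assms by linarith
    have V0: "wron x = 0" if x: "z < x" "x < w" for x
    proof -
      have d0: "(energy has_real_derivative 0) (at x)"
      proof (rule has_field_derivative_transform_within_open[of "\<lambda>_. energy z" _ _ "{z<..<w}"])
        show "energy z = energy y" if "y \<in> {z<..<w}" for y using eq[of y] that by simp
      qed (use x in auto)
      have "0 \<le> x" using x assms by simp
      from DERIV_unique[OF d0 d[OF this]] have "(r x)\<^sup>2 * f x = 0" by simp
      then have "r x = 0" using fneg[of x] x assms by auto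
      then show ?thesis using bess_neg_pos[OF _ \<nu>, of x] x assms by (simp add: r_def)
    qed
    have G0: "bess \<nu> (\<tau> * x) = 0" if x: "z < x" "x < w" for x
    proof -
      have "(wron has_real_derivative 0) (at x)"
        by (rule has_field_derivative_transform_within_open[of "\<lambda>_. 0" _ _ "{z<..<w}"]) (use V0 x in auto)
      from DERIV_unique[OF this DERIV_wron(1)] DERIV_wron(2)[of x] V0[OF x]
      have "(s + \<tau>) * (bess \<nu> (\<tau> * x) * bess \<nu> (- s * x)) = 0" using s \<tau> by auto
      then show ?thesis using bess_neg_pos[OF _ \<nu>, of x] x assms s \<tau> by simp
    qed
    let ?x = "(z + w) / 2"
    have x: "z < ?x" "?x < w" "?x > 0" using assms by auto
    have "((\<lambda>x. bess \<nu> (\<tau> * x)) has_real_derivative 0) (at ?x)"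
      by (rule has_field_derivative_transform_within_open[of "\<lambda>_. 0" _ _ "{z<..<w}"]) (use G0 x in auto)
    from DERIV_unique[OF this DERIV_bess_lin[OF \<nu>]] have "bess (\<nu> + 1) (\<tau> * ?x) = 0" using \<tau> by simp
    moreover have "\<tau> * ?x \<ge> 0" using \<tau> x by (intro mult_nonneg_nonneg) auto
    ultimately show False using bess_simple[OF \<nu> _ G0[OF x(1,2)]] by blast
  qed
qed

text \<open>At 0 and at critical points the energy is purely potential, and later on it still bounds
  the potential part from above.\<close>

lemma ratio_square_gt:
  assumes "0 \<le> z" "z < w" "z = 0 \<or> wron z = 0"
  shows "(ratio w)\<^sup>2 < (ratio z)\<^sup>2"
proof -
  have "energy z = (s + \<tau>) * (ratio z)\<^sup>2" using assms(3) by (auto simp: energy_def)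
  moreover have "(s + \<tau>) * (ratio w)\<^sup>2 \<le> energy w" using assms by (simp add: energy_def)
  ultimately have "(s + \<tau>) * (ratio w)\<^sup>2 < (s + \<tau>) * (ratio z)\<^sup>2"
    using energy_strict[OF assms(1,2)] by linarith
  then show ?thesis using s \<tau> by simp
qed

text \<open>Used with w = 1: a point where \<open>ratio\<close> takes its end value is not critical,
  so the corresponding root of the radial function is simple.\<close>

lemma wron_nonzero:
  assumes "0 \<le> z" "z < w" "wron w = 0" "ratio z = ratio w"
  shows "wron z \<noteq> 0"
  using ratio_square_gt[OF assms(1,2)] assms(4) by auto

text \<open>From the value 0 at the origin, z^(\<nu>+1) \<open>wron\<close> decreases as long as G
  is positive.\<close>

lemma wron_neg:
  assumes "0 < z" and pos: "\<And>x. 0 < x \<Longrightarrow> x < z \<Longrightarrow> bess \<nu> (\<tau> * x) > 0"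
  shows "wron z < 0"
proof -
  have "- wron z > 0"
  proof (rule weight_pos[of "\<nu> + 1" z "\<lambda>z. - wron z"])
    show "continuous_on {0..z} (\<lambda>z. - wron z)"
      unfolding wron_def by (intro continuous_intros) (use \<nu> in auto)
    fix x assume x: "0 < x" "x < z"
    show "((\<lambda>z. - wron z) has_real_derivative - (\<tau>\<^sup>2 * bess \<nu> (- s * x) * bess (\<nu> + 2) (\<tau> * x)
        - s\<^sup>2 * bess \<nu> (\<tau> * x) * bess (\<nu> + 2) (- s * x))) (at x)"
      by (rule DERIV_minus[OF DERIV_wron(1)])
    have "(s + \<tau>) * (bess \<nu> (\<tau> * x) * bess \<nu> (- s * x)) > 0"
      using pos[OF x] bess_neg_pos[OF _ \<nu>, of x] x s \<tau> by simp
    then show "0 < x * - (\<tau>\<^sup>2 * bess \<nu> (- s * x) * bess (\<nu> + 2) (\<tau> * x)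
        - s\<^sup>2 * bess \<nu> (\<tau> * x) * bess (\<nu> + 2) (- s * x)) + (\<nu> + 1) * - wron x"
      using DERIV_wron(2)[of x] by linarith
  qed (use \<nu> assms in auto)
  then show ?thesis by simp
qed

lemma continuous_on_ratio: "0 \<le> a \<Longrightarrow> continuous_on {a..b} ratio"
  using DERIV_ratio[THEN DERIV_isCont] by (intro continuous_at_imp_continuous_on ballI) simp

lemma isCont_wron: "isCont wron z"
  using DERIV_isCont[OF DERIV_wron(1)] .

lemma ratio_Rolle:
  assumes "0 \<le> x" "x < y" "ratio x = ratio y"
  shows "\<exists>z. x < z \<and> z < y \<and> wron z = 0"
proof -
  have d: "(ratio has_real_derivative wron z / (bess \<nu> (- s * z))\<^sup>2) (at z)" if "x < z" for z
    using DERIV_ratio[of z] that assms(1) by simp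
  have "\<exists>z. x < z \<and> z < y \<and> (ratio has_real_derivative 0) (at z)"
    by (rule Rolle[OF assms(2,3) continuous_on_ratio[OF assms(1)]]) (use d real_differentiable_def in blast)
  then obtain z where z: "x < z" "z < y" "(ratio has_real_derivative 0) (at z)" by blast
  have "bess \<nu> (- s * z) > 0" using bess_neg_pos[OF _ \<nu>, of z] z assms by simp
  then have "wron z = 0" using DERIV_unique[OF z(3) d[OF z(1)]] by simp
  then show ?thesis using z by blast
qed

lemma wron_at_bess_zero:
  assumes "\<tau> * z = bess_zero \<nu> n"
  shows "(- 1) ^ n * wron z < 0"
proof -
  have z: "z > 0" using assms bess_zero_pos[OF \<nu>, of n] \<tau> by (metis zero_less_mult_pos)
  have "\<tau> * bess \<nu> (- s * z) * ((- 1) ^ n * bess (\<nu> + 1) (\<tau> * z)) > 0"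
    using bess_sign(1)[OF \<nu>, of n] bess_neg_pos[OF _ \<nu>, of z] z \<tau> by (simp add: assms)
  then show ?thesis by (simp add: wron_def assms bess_bess_zero[OF \<nu>] mult_ac)
qed

text \<open>Between consecutive zeros of G the function z^(\<nu>+1) \<open>wron\<close> is strictly
  monotone by Lagrange's identity.\<close>

lemma wron_zero_unique:
  assumes z: "bess_zero \<nu> n < \<tau> * z" "z \<le> w" "\<tau> * w < bess_zero \<nu> (Suc n)" "wron z = 0" "wron w = 0"
  shows "z = w"
proof (rule ccontr)
  let ?\<sigma> = "(- 1 :: real) ^ n"
  assume "z \<noteq> w"
  then have zw: "z < w" using z by simp
  have z0: "z > 0" using z(1) bess_zero_pos[OF \<nu>, of n] \<tau> by (metis order_less_trans zero_less_mult_pos)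
  have "z powr (\<nu> + 1) * (?\<sigma> * wron z) < w powr (\<nu> + 1) * (?\<sigma> * wron w)"
  proof (rule weight_increasing[of "\<nu> + 1" z w "\<lambda>z. ?\<sigma> * wron z"])
    fix x assume x: "z < x" "x < w"
    show "((\<lambda>z. ?\<sigma> * wron z) has_real_derivative ?\<sigma> * (\<tau>\<^sup>2 * bess \<nu> (- s * x) * bess (\<nu> + 2) (\<tau> * x)
        - s\<^sup>2 * bess \<nu> (\<tau> * x) * bess (\<nu> + 2) (- s * x))) (at x)"
      by (rule DERIV_cmult[OF DERIV_wron(1)])
    have "\<tau> * z < \<tau> * x" "\<tau> * x < \<tau> * w" using x \<tau> by auto
    then have "(-1) ^ Suc n * bess \<nu> (\<tau> * x) > 0" using z by (intro bess_sign(2)[OF \<nu>]) auto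
    then have 1: "- ?\<sigma> * bess \<nu> (\<tau> * x) > 0" by (simp only: power_Suc mult_minus1)
    have 2: "bess \<nu> (- s * x) > 0" by (rule bess_neg_pos[OF _ \<nu>]) (use x z0 in simp)
    have 3: "s + \<tau> > 0" using s \<tau> by simp
    have "(s + \<tau>) * ((- ?\<sigma> * bess \<nu> (\<tau> * x)) * bess \<nu> (- s * x)) > 0"
      by (rule mult_pos_pos[OF 3 mult_pos_pos[OF 1 2]])
    moreover have "x * (?\<sigma> * (\<tau>\<^sup>2 * bess \<nu> (- s * x) * bess (\<nu> + 2) (\<tau> * x)
        - s\<^sup>2 * bess \<nu> (\<tau> * x) * bess (\<nu> + 2) (- s * x))) + (\<nu> + 1) * (?\<sigma> * wron x)
       = ?\<sigma> * (- (s + \<tau>) * (bess \<nu> (\<tau> * x) * bess \<nu> (- s * x)))"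
      unfolding DERIV_wron(2)[of x, symmetric] by (simp add: algebra_simps)
    ultimately show "0 < x * (?\<sigma> * (\<tau>\<^sup>2 * bess \<nu> (- s * x) * bess (\<nu> + 2) (\<tau> * x)
        - s\<^sup>2 * bess \<nu> (\<tau> * x) * bess (\<nu> + 2) (- s * x))) + (\<nu> + 1) * (?\<sigma> * wron x)"
      by (simp add: algebra_simps)
  qed (use \<nu> z0 zw isCont_wron in \<open>auto intro!: continuous_at_imp_continuous_on\<close>)
  then show False using z by simp
qed

lemma ex_wron_zero: "\<exists>z. bess_zero \<nu> n < \<tau> * z \<and> \<tau> * z < bess_zero \<nu> (Suc n) \<and> wron z = 0"
proof -
  let ?a = "bess_zero \<nu> n / \<tau>" and ?b = "bess_zero \<nu> (Suc n) / \<tau>" and ?\<sigma> = "(- 1 :: real) ^ n"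
  have ab: "?a \<le> ?b" using bess_zero_less[OF \<nu>, of n "Suc n"] \<tau> by (simp add: divide_right_mono)
  have sa: "?\<sigma> * wron ?a < 0" using wron_at_bess_zero[of ?a n] \<tau> by simp
  have sb: "?\<sigma> * wron ?b > 0" using wron_at_bess_zero[of ?b "Suc n"] \<tau> by simp
  have "\<exists>t\<ge>?a. t \<le> ?b \<and> ?\<sigma> * wron t = 0"
    by (rule IVT) (use sa sb ab in \<open>auto intro!: isCont_mult isCont_wron\<close>)
  then obtain t where t: "?a \<le> t" "t \<le> ?b" "wron t = 0" by auto
  then have "t \<noteq> ?a" "t \<noteq> ?b" using sa sb by auto
  then have "?a < t" "t < ?b" using t by auto
  then show ?thesis using t(3) \<tau> by (intro exI[of _ t]) (auto simp: field_simps)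
qed

text \<open>The critical points \<open>b 0 < \<dots> < b n = 1\<close> of \<open>ratio\<close> cut \<open>]0,1[\<close> into intervals of strict
  monotonicity; by the energy estimate the critical values alternate in sign and decrease in
  modulus, so that the value \<open>ratio 1\<close> is taken once on each interval but the last.\<close>

lemma ratio_root_count:
  assumes n: "bess_zero \<nu> n < \<tau>" "\<tau> < bess_zero \<nu> (Suc n)" and W1: "wron 1 = 0"
  shows "finite {z. 0 < z \<and> z < 1 \<and> ratio z = ratio 1}" "card {z. 0 < z \<and> z < 1 \<and> ratio z = ratio 1} = n"
proof -
  let ?bz = "bess_zero \<nu>"
  obtain b where b: "\<And>j. ?bz j < \<tau> * b j" "\<And>j. \<tau> * b j < ?bz (Suc j)" "\<And>j. wron (b j) = 0"
    using choice[of "\<lambda>n z. bess_zero \<nu> n < \<tau> * z \<and> \<tau> * z < bess_zero \<nu> (Suc n) \<and> wron z = 0"] ex_wron_zero by blast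
  \<comment> \<open>As \<tau> lies in the gap number n, the critical point of that gap is 1.\<close>
  have bn: "b n = 1"
  proof (cases "b n \<le> 1")
    case True then show ?thesis using wron_zero_unique[of n "b n" 1] b n W1 by simp
  next
    case False then show ?thesis using wron_zero_unique[of n 1 "b n"] b n W1 by simp
  qed
  \<comment> \<open>Left end of the interval number j: the origin for j = 0, otherwise the preceding
    critical point.\<close>
  define a where "a = (\<lambda>j. case j of 0 \<Rightarrow> 0 | Suc i \<Rightarrow> b i)"
  have bpos: "b j > 0" for j using b(1)[of j] bess_zero_pos[OF \<nu>, of j] \<tau> by (metis order_less_trans zero_less_mult_pos)
  have a0: "a j \<ge> 0" for j using bpos less_imp_le by (auto simp: a_def split: nat.splits)
  have abz: "\<tau> * a j < ?bz j" for j using b(2) bess_zero_pos[OF \<nu>] by (cases j) (auto simp: a_def)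
  have ab: "a j < b j" for j
  proof -
    have "\<tau> * a j < \<tau> * b j" using abz[of j] b(1)[of j] by linarith
    then show ?thesis using \<tau> by simp
  qed
  have "strict_mono b" unfolding strict_mono_Suc_iff using ab[of "Suc j" for j] by (simp add: a_def)
  then have b_le: "b i \<le> b j \<longleftrightarrow> i \<le> j" and b_lt: "b i < b j \<longleftrightarrow> i < j" for i j
    by (auto simp: strict_mono_less_eq strict_mono_less)
  \<comment> \<open>The interval from \<open>a j\<close> to \<open>b j\<close> straddles zero number
    j of G. A critical point inside it would be a second one in the gap on its side, or lie before
    the first zero, where \<open>wron\<close> is negative, or at the zero itself, where
    \<open>wron\<close> is nonzero.\<close>
  have nocrit: "wron z \<noteq> 0" if z: "a j < z" "z < b j" for j z
  proof
    assume W: "wron z = 0"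
    have z0: "z > 0" using z a0[of j] by linarith
    consider "\<tau> * z = ?bz j" | "?bz j < \<tau> * z" | "\<tau> * z < ?bz j" by linarith
    then show False
    proof cases
      case 1 then show False using wron_at_bess_zero[of z j] W by simp
    next
      case 2 then show False using wron_zero_unique[of j z "b j"] b z W by simp
    next
      case 3
      show False
      proof (cases j)
        case 0
        have "wron z < 0"
        proof (rule wron_neg[OF z0])
          fix x assume x: "0 < x" "x < z"
          then have "\<tau> * x < \<tau> * z" "0 \<le> \<tau> * x" using \<tau> by auto
          then show "bess \<nu> (\<tau> * x) > 0" using 3 0 by (intro bess_pos_before[OF \<nu>]) auto
        qed
        then show False using W by simp
      next
        case (Suc i)
        then show False using wron_zero_unique[of i "b i" z] b 3 z W by (simp add: a_def)
      qed
    qed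
  qed
  have inj: "x = y" if x: "a j \<le> x" "x \<le> b j" "a j \<le> y" "y \<le> b j" "ratio x = ratio y" for x y j
  proof -
    have *: False if lt: "x < y" "a j \<le> x" "y \<le> b j" "ratio x = ratio y" for x y
    proof -
      have "0 \<le> x" using lt a0[of j] by linarith
      from ratio_Rolle[OF this lt(1,4)] obtain z where "x < z" "z < y" "wron z = 0" by blast
      then show False using nocrit[of j z] lt by simp
    qed
    show ?thesis using *[of x y] *[of y x] x by (metis linorder_neqE)
  qed
  have sgn_ratio: "(- 1) ^ j * ratio x > 0" if "0 \<le> x" "(- 1) ^ j * bess \<nu> (\<tau> * x) > 0" for x j
    using that bess_neg_pos[OF that(1) \<nu>] by (simp add: ratio_def)
  have sgn_a: "(- 1) ^ j * ratio (a j) > 0" for j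
  proof (rule sgn_ratio[OF a0])
    show "(- 1) ^ j * bess \<nu> (\<tau> * a j) > 0"
    proof (cases j)
      case 0 then show ?thesis using bess_pos_0[OF \<nu>] by (simp add: a_def)
    next
      case (Suc i) then show ?thesis using bess_sign(2)[OF \<nu> b(1)[of i] b(2)[of i]] by (simp add: a_def)
    qed
  qed
  have big_a: "(ratio 1)\<^sup>2 < (ratio (a j))\<^sup>2" if "j \<le> n" for j
  proof (rule ratio_square_gt[OF a0])
    show "a j < 1" using ab[of j] b_le[of j n] that bn by linarith
    show "a j = 0 \<or> wron (a j) = 0" using b(3) by (auto simp: a_def split: nat.splits)
  qed
  \<comment> \<open>\<open>ratio\<close> has opposite signs at the two ends, and both end values
    exceed \<open>ratio 1\<close> in modulus, so this value is passed in between.\<close>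
  have "\<exists>z. a j < z \<and> z < b j \<and> ratio z = ratio 1" if j: "j < n" for j
  proof -
    let ?\<sigma> = "(- 1 :: real) ^ j"
    let ?f = "\<lambda>z. ?\<sigma> * (ratio z - ratio 1)"
    have sq: "(?\<sigma> * r)\<^sup>2 = r\<^sup>2" for r :: real by (cases "even j") (simp_all add: power_mult_distrib)
    have "(?\<sigma> * ratio 1)\<^sup>2 < (?\<sigma> * ratio (a j))\<^sup>2" unfolding sq by (rule big_a) (use j in simp)
    then have "\<bar>?\<sigma> * ratio 1\<bar> < ?\<sigma> * ratio (a j)"
      using sgn_a[of j] by (metis abs_of_pos power2_less_imp_less abs_ge_zero power2_abs)
    then have fa: "?f (a j) > 0" by (simp add: right_diff_distrib)
    have "(?\<sigma> * ratio 1)\<^sup>2 < (?\<sigma> * ratio (a (Suc j)))\<^sup>2" unfolding sq by (rule big_a) (use j in simp)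
    moreover have "?\<sigma> * ratio (a (Suc j)) < 0" using sgn_a[of "Suc j"] by simp
    ultimately have "\<bar>?\<sigma> * ratio 1\<bar> < - (?\<sigma> * ratio (a (Suc j)))"
      by (metis abs_of_neg power2_less_imp_less abs_ge_zero power2_abs)
    then have fb: "?f (b j) < 0" by (simp add: right_diff_distrib a_def)
    have "\<exists>z\<ge>a j. z \<le> b j \<and> ?f z = 0"
    proof (rule IVT2')
      show "continuous_on {a j..b j} ?f" by (intro continuous_intros continuous_on_ratio a0)
    qed (use fa fb ab[of j] in auto)
    then obtain z where z: "a j \<le> z" "z \<le> b j" "?f z = 0" by blast
    moreover from z have "z \<noteq> a j" "z \<noteq> b j" using fa fb by force+
    ultimately show ?thesis by (intro exI[of _ z]) auto
  qed
  then have "\<forall>j. \<exists>z. j < n \<longrightarrow> a j < z \<and> z < b j \<and> ratio z = ratio 1" by blast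
  from choice[OF this] obtain r where r: "\<And>j. j < n \<Longrightarrow> a j < r j" "\<And>j. j < n \<Longrightarrow> r j < b j" "\<And>j. j < n \<Longrightarrow> ratio (r j) = ratio 1"
    by blast
  have "bij_betw r {..<n} {z. 0 < z \<and> z < 1 \<and> ratio z = ratio 1}"
  proof (rule bij_betw_imageI)
    have lt: "r i < r j" if "i < j" "j < n" for i j
    proof -
      obtain j' where j': "j = Suc j'" using \<open>i < j\<close> by (cases j) auto
      have "b i \<le> a j" using that j' b_le by (simp add: a_def)
      then show ?thesis using r(2)[of i] r(1)[of j] that by linarith
    qed
    show "inj_on r {..<n}"
      by (rule inj_onI) (metis lt lessThan_iff linorder_neqE_nat order_less_irrefl)
    show "r ` {..<n} = {z. 0 < z \<and> z < 1 \<and> ratio z = ratio 1}"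
    proof (intro subset_antisym subsetI)
      fix z assume "z \<in> r ` {..<n}"
      then obtain j where j: "j < n" "z = r j" by blast
      have "r j < 1" using r(2)[OF j(1)] b_le[of j n] j bn by simp
      then show "z \<in> {z. 0 < z \<and> z < 1 \<and> ratio z = ratio 1}"
        using r[OF j(1)] j a0[of j] by simp
    next
      fix z assume "z \<in> {z. 0 < z \<and> z < 1 \<and> ratio z = ratio 1}"
      then have z: "0 < z" "z < 1" "ratio z = ratio 1" by auto
      define j where "j = (LEAST j. z \<le> b j)"
      have zn: "z \<le> b n" using z bn by simp
      have zb: "z \<le> b j" unfolding j_def using zn by (rule LeastI)
      have jn: "j \<le> n" unfolding j_def using zn by (rule Least_le)
      have az: "a j < z"
      proof (cases j)
        case 0 then show ?thesis using z by (simp add: a_def)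
      next
        case (Suc i)
        then have "\<not> z \<le> b i" using not_less_Least[of i "\<lambda>j. z \<le> b j"] j_def by auto
        then show ?thesis using Suc by (simp add: a_def)
      qed
      \<comment> \<open>On the last interval \<open>ratio\<close> is injective and takes the value
        at the right end 1, which is not counted.\<close>
      have "j \<noteq> n"
      proof
        assume "j = n"
        then have "z = 1" using inj[of n z 1] az bn z ab[of n] by simp
        then show False using z by simp
      qed
      then have jn: "j < n" using jn by simp
      have "z = r j" using inj[of j z "r j"] az zb r[OF jn] z by simp
      then show "z \<in> r ` {..<n}" using jn by blast
    qed
  qed
  then show "finite {z. 0 < z \<and> z < 1 \<and> ratio z = ratio 1}" "card {z. 0 < z \<and> z < 1 \<and> ratio z = ratio 1} = n"
    using bij_betw_finite bij_betw_same_card by fastforce+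
qed

end

text \<open>In the variable \<open>z = r\<^sup>2\<close> this is \<open>R(r) / r\<^sup>k\<close>, up to the normalization of
  \<open>c\<close> and \<open>d\<close>; here \<open>\<tau> = \<alpha>\<^sup>2/4\<close> and \<open>s = \<kappa>\<^sup>2/(4\<alpha>\<^sup>2)\<close>.\<close>

definition profile :: "real \<Rightarrow> real \<Rightarrow> real \<Rightarrow> real \<Rightarrow> real \<Rightarrow> real \<Rightarrow> real" where
  "profile \<nu> \<tau> s c d z = c * bess \<nu> (\<tau> * z) + d * bess \<nu> (- s * z)"

definition profile' :: "real \<Rightarrow> real \<Rightarrow> real \<Rightarrow> real \<Rightarrow> real \<Rightarrow> real \<Rightarrow> real" where
  "profile' \<nu> \<tau> s c d z = - \<tau> * c * bess (\<nu> + 1) (\<tau> * z) + s * d * bess (\<nu> + 1) (- s * z)"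

lemma DERIV_profile:
  assumes "\<nu> \<ge> 0"
  shows "(profile \<nu> \<tau> s c d has_real_derivative profile' \<nu> \<tau> s c d z) (at z)"
proof -
  have d: "((\<lambda>z. bess \<nu> (a * z)) has_real_derivative - a * bess (\<nu> + 1) (a * z)) (at z)" for a
    using DERIV_chain2[OF has_derivative_bess[OF assms] DERIV_cmult_Id, of a z] by (simp add: mult.commute)
  show ?thesis
    unfolding profile_def[abs_def]
    by (rule DERIV_cong[OF DERIV_add[OF DERIV_cmult[OF d] DERIV_cmult[OF d]]]) (simp add: profile'_def)
qed

text \<open>Since K(1) > 0, the condition at z = 1 determines d as - c times \<open>ratio\<close> at
  1; in particular c = 0 would entail d = 0.\<close>

lemma profile_eq_ratio:
  assumes "\<nu> \<ge> 0" "\<tau> > 0" "s > 0" "(c, d) \<noteq> (0, 0)" "profile \<nu> \<tau> s c d 1 = 0"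
  shows "c \<noteq> 0" "z \<ge> 0 \<Longrightarrow> profile \<nu> \<tau> s c d z = c * bess \<nu> (- s * z) * (ratio \<nu> \<tau> s z - ratio \<nu> \<tau> s 1)"
proof -
  have p: "bess \<nu> (- s * z) > 0" if "z \<ge> 0" for z
    using bess_neg_pos[OF assms(1-3) that assms(1)] .
  have e: "c * bess \<nu> \<tau> + d * bess \<nu> (- s) = 0" using assms(5) by (simp add: profile_def)
  show "c \<noteq> 0" using e assms(4) p[of 1] by auto
  have d: "d = - c * ratio \<nu> \<tau> s 1"
    using e p[of 1] by (simp add: ratio_def[OF assms(1-3)] field_simps)
  assume "z \<ge> 0"
  then show "profile \<nu> \<tau> s c d z = c * bess \<nu> (- s * z) * (ratio \<nu> \<tau> s z - ratio \<nu> \<tau> s 1)"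
    using p[of z] unfolding d profile_def by (simp add: ratio_def[OF assms(1-3), of z] algebra_simps)
qed

lemma wron_1_eq_char_fun:
  assumes "\<nu> \<ge> 0" "\<tau> > 0" "c > 0"
  shows "wron \<nu> \<tau> (c / \<tau>) 1 = - char_fun \<nu> c \<tau>"
  using assms by (subst wron_def) (auto simp: char_fun_def)

lemma ex_profile:
  assumes "\<nu> \<ge> 0" "\<tau> > 0" "c0 > 0" "char_fun \<nu> c0 \<tau> = 0"
  shows "\<exists>c d. (c, d) \<noteq> (0, 0) \<and> profile \<nu> \<tau> (c0 / \<tau>) c d 1 = 0 \<and> profile' \<nu> \<tau> (c0 / \<tau>) c d 1 = 0"
proof (intro exI conjI)
  have "bess \<nu> (- (c0 / \<tau>)) > 0" using assms by (intro bess_pos_neg) auto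
  then show "(bess \<nu> (- (c0 / \<tau>)), - bess \<nu> \<tau>) \<noteq> (0, 0)" by simp
  show "profile \<nu> \<tau> (c0 / \<tau>) (bess \<nu> (- (c0 / \<tau>))) (- bess \<nu> \<tau>) 1 = 0"
    by (simp add: profile_def)
  show "profile' \<nu> \<tau> (c0 / \<tau>) (bess \<nu> (- (c0 / \<tau>))) (- bess \<nu> \<tau>) 1 = 0"
    using assms by (simp add: profile'_def char_fun_def)
qed

text \<open>The two boundary conditions are a linear system for (c, d) whose determinant is
  \<open>char_fun \<nu> c0 \<tau>\<close>.\<close>

lemma char_fun_eq_0_if_profile:
  assumes "\<nu> \<ge> 0" "\<tau> > 0" "c0 > 0" "(c, d) \<noteq> (0, 0)"
    "profile \<nu> \<tau> (c0 / \<tau>) c d 1 = 0" "profile' \<nu> \<tau> (c0 / \<tau>) c d 1 = 0"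
  shows "char_fun \<nu> c0 \<tau> = 0"
proof -
  let ?s = "c0 / \<tau>"
  have s: "?s > 0" using assms by simp
  have c: "c \<noteq> 0" by (rule profile_eq_ratio(1)[OF assms(1,2) s assms(4,5)])
  have e1: "d * bess \<nu> (- ?s) = - c * bess \<nu> \<tau>" using assms(5) by (simp add: profile_def)
  have e2: "\<tau> * c * bess (\<nu> + 1) \<tau> = ?s * d * bess (\<nu> + 1) (- ?s)" using assms(6) by (simp add: profile'_def)
  have "c * char_fun \<nu> c0 \<tau> = bess \<nu> (- ?s) * (\<tau> * c * bess (\<nu> + 1) \<tau>) + ?s * c * bess \<nu> \<tau> * bess (\<nu> + 1) (- ?s)"
    by (simp add: char_fun_def algebra_simps)
  also have "\<dots> = ?s * bess (\<nu> + 1) (- ?s) * (d * bess \<nu> (- ?s) + c * bess \<nu> \<tau>)"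
    unfolding e2 by (simp add: algebra_simps)
  also have "\<dots> = 0" unfolding e1 by simp
  finally show ?thesis using c by simp
qed

lemma profile_roots:
  assumes \<nu>: "\<nu> \<ge> 0" and c0: "c0 > 0" and \<tau>: "\<tau> = char_root \<nu> c0 n"
    and cd: "(c, d) \<noteq> (0, 0)" "profile \<nu> \<tau> (c0 / \<tau>) c d 1 = 0"
  defines "Z \<equiv> {z. 0 < z \<and> z < 1 \<and> profile \<nu> \<tau> (c0 / \<tau>) c d z = 0}"
  shows "finite Z" "card Z = n" "z \<in> Z \<Longrightarrow> profile' \<nu> \<tau> (c0 / \<tau>) c d z \<noteq> 0"
proof -
  define s where "s = c0 / \<tau>"
  have \<tau>0: "\<tau> > 0" unfolding \<tau> by (rule char_root_pos[OF \<nu> c0])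
  have s: "s > 0" using \<tau>0 c0 by (simp add: s_def)
  note nts = \<nu> \<tau>0 s
  note pr = profile_eq_ratio[OF nts cd(1) cd(2)[folded s_def]]
  have W1: "wron \<nu> \<tau> s 1 = 0"
    unfolding s_def wron_1_eq_char_fun[OF \<nu> \<tau>0 c0] using char_root(3)[OF \<nu> c0, of n] \<tau> by simp
  have Kp: "bess \<nu> (- s * z) > 0" if "z \<ge> 0" for z by (rule bess_neg_pos[OF nts that \<nu>])
  have Z: "Z = {z. 0 < z \<and> z < 1 \<and> ratio \<nu> \<tau> s z = ratio \<nu> \<tau> s 1}"
  proof -
    have "profile \<nu> \<tau> s c d z = 0 \<longleftrightarrow> ratio \<nu> \<tau> s z = ratio \<nu> \<tau> s 1" if "z > 0" for z
      using pr Kp[of z] that by simp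
    then show ?thesis unfolding Z_def s_def[symmetric] by blast
  qed
  show "finite Z" "card Z = n"
    unfolding Z using ratio_root_count[OF nts _ _ W1] char_root(1,2)[OF \<nu> c0, of n] unfolding \<tau> by auto
  assume "z \<in> Z"
  then have z: "0 < z" "z < 1" "ratio \<nu> \<tau> s z = ratio \<nu> \<tau> s 1" by (auto simp: Z)
  have Wz: "wron \<nu> \<tau> s z \<noteq> 0" by (rule wron_nonzero[OF nts _ _ W1 z(3)]) (use z in auto)
  have dK: "((\<lambda>z. c * bess \<nu> (- s * z)) has_real_derivative c * (- (- s) * - bess (\<nu> + 1) (- s * z) * -1)) (at z)"
    using DERIV_cmult[OF DERIV_bess_lin[OF nts \<nu>, of "- s" z], of c] by simp
  have "((\<lambda>z. ratio \<nu> \<tau> s z - ratio \<nu> \<tau> s 1) has_real_derivative wron \<nu> \<tau> s z / (bess \<nu> (- s * z))\<^sup>2) (at z)"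
    using DERIV_diff[OF DERIV_ratio[OF nts, of z] DERIV_const[of "ratio \<nu> \<tau> s 1"]] z by simp
  from DERIV_mult[OF dK this] z(3)
  have "((\<lambda>z. c * bess \<nu> (- s * z) * (ratio \<nu> \<tau> s z - ratio \<nu> \<tau> s 1)) has_real_derivative
      wron \<nu> \<tau> s z / (bess \<nu> (- s * z))\<^sup>2 * (c * bess \<nu> (- s * z))) (at z)" by simp
  then have "(profile \<nu> \<tau> s c d has_real_derivative
      wron \<nu> \<tau> s z / (bess \<nu> (- s * z))\<^sup>2 * (c * bess \<nu> (- s * z))) (at z)"
    by (rule has_field_derivative_transform_within_open[of _ _ _ "{0<..}"]) (use pr(2) z in auto)
  from DERIV_unique[OF DERIV_profile[OF \<nu>] this]
  show "profile' \<nu> \<tau> (c0 / \<tau>) c d z \<noteq> 0"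
    using Wz pr(1) Kp[of z] z unfolding s_def[symmetric] by simp
qed

text \<open>\<open>profile'\<close> has the same shape with order \<nu> + 1, so the condition on it
  at z = 1 makes it - \<tau> c L (\<rho> - \<rho>(1)), with \<rho> the ratio of order \<nu> + 1 and
  L > 0. This \<rho> strictly decreases on [0,1], because \<open>bess (\<nu> + 1)\<close> stays
  positive up to the first root. Hence \<open>profile\<close> divided by c decreases strictly to
  0.\<close>

lemma profile_0_decreasing:
  assumes \<nu>: "\<nu> \<ge> 0" and c0: "c0 > 0" and \<tau>: "\<tau> = char_root \<nu> c0 0"
    and cd: "(c, d) \<noteq> (0, 0)" "profile \<nu> \<tau> (c0 / \<tau>) c d 1 = 0" "profile' \<nu> \<tau> (c0 / \<tau>) c d 1 = 0"
    and x: "0 \<le> x" "x < y" "y \<le> 1"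
  shows "\<bar>profile \<nu> \<tau> (c0 / \<tau>) c d y\<bar> < \<bar>profile \<nu> \<tau> (c0 / \<tau>) c d x\<bar>"
proof -
  define s where "s = c0 / \<tau>"
  have \<tau>0: "\<tau> > 0" unfolding \<tau> by (rule char_root_pos[OF \<nu> c0])
  have s: "s > 0" using \<tau>0 c0 by (simp add: s_def)
  have \<nu>1: "\<nu> + 1 \<ge> 0" using \<nu> by simp
  note nts = \<nu>1 \<tau>0 s
  have c: "c \<noteq> 0" by (rule profile_eq_ratio(1)[OF \<nu> \<tau>0 s cd(1) cd(2)[folded s_def]])
  let ?\<rho> = "ratio (\<nu> + 1) \<tau> s"
  have Lp: "bess (\<nu> + 1) (- s * z) > 0" if "z \<ge> 0" for z by (rule bess_neg_pos[OF nts that \<nu>1])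
  have hp: "bess (\<nu> + 1) (\<tau> * z) > 0" if "0 < z" "z \<le> 1" for z
  proof (rule bess_Suc_pos_char_root[OF \<nu> c0])
    show "\<tau> * z \<le> char_root \<nu> c0 0" using that \<tau>0 unfolding \<tau>[symmetric] by simp
  qed (use that \<tau>0 in simp)
  have dec: "?\<rho> 1 < ?\<rho> z" if z: "0 \<le> z" "z < 1" for z
  proof (rule DERIV_neg_imp_decreasing_open[OF z(2)])
    fix w assume w: "z < w" "w < 1"
    have "wron (\<nu> + 1) \<tau> s w < 0" by (rule wron_neg[OF nts]) (use w z hp in auto)
    then show "\<exists>y. (?\<rho> has_real_derivative y) (at w) \<and> y < 0"
      using DERIV_ratio[OF nts, of w] Lp[of w] w z
      by (intro exI[of _ "wron (\<nu> + 1) \<tau> s w / (bess (\<nu> + 1) (- s * w))\<^sup>2"]) (auto simp: divide_neg_pos)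
  qed (rule continuous_on_ratio[OF nts z(1)])
  have sd: "s * d = \<tau> * c * ?\<rho> 1"
  proof -
    have "s * d * bess (\<nu> + 1) (- s) = \<tau> * c * bess (\<nu> + 1) \<tau>"
      using cd(3) by (simp add: profile'_def s_def[symmetric])
    moreover have "bess (\<nu> + 1) \<tau> = ?\<rho> 1 * bess (\<nu> + 1) (- s)"
      using Lp[of 1] by (simp add: ratio_def[OF nts])
    ultimately have "s * d * bess (\<nu> + 1) (- s) = (\<tau> * c * ?\<rho> 1) * bess (\<nu> + 1) (- s)" by (simp add: mult.assoc)
    then show ?thesis using Lp[of 1] mult_right_cancel by fastforce
  qed
  have p': "profile' \<nu> \<tau> s c d z = - \<tau> * c * bess (\<nu> + 1) (- s * z) * (?\<rho> z - ?\<rho> 1)" if "z \<ge> 0" for z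
  proof -
    have r: "bess (\<nu> + 1) (\<tau> * z) = ?\<rho> z * bess (\<nu> + 1) (- s * z)"
      using Lp[OF that] by (simp add: ratio_def[OF nts])
    show ?thesis unfolding profile'_def sd r by (simp add: algebra_simps)
  qed
  let ?f = "\<lambda>z. profile \<nu> \<tau> s c d z / c"
  have dec': "?f b < ?f a" if ab: "0 \<le> a" "a < b" "b \<le> 1" for a b
  proof (rule DERIV_neg_imp_decreasing_open[OF ab(2)])
    fix w assume w: "a < w" "w < b"
    have "\<tau> * bess (\<nu> + 1) (- s * w) * (?\<rho> w - ?\<rho> 1) > 0"
      using \<tau>0 Lp[of w] dec[of w] w ab by (intro mult_pos_pos) auto
    moreover have "profile' \<nu> \<tau> s c d w / c = - (\<tau> * bess (\<nu> + 1) (- s * w) * (?\<rho> w - ?\<rho> 1))"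
      using p'[of w] c w ab by (simp add: field_simps)
    ultimately have "profile' \<nu> \<tau> s c d w / c < 0" by linarith
    then show "\<exists>y. (?f has_real_derivative y) (at w) \<and> y < 0"
      using DERIV_cdivide[OF DERIV_profile[OF \<nu>]] by blast
  next
    show "continuous_on {a..b} ?f"
      unfolding profile_def by (intro continuous_intros) (use \<nu> c in auto)
  qed
  have f1: "?f 1 = 0" using cd(2) by (simp add: s_def)
  have "?f y \<ge> 0" using dec'[of y 1] f1 x by (cases "y = 1") auto
  moreover have "?f y < ?f x" by (rule dec') (use x in auto)
  ultimately have "\<bar>?f y\<bar> < \<bar>?f x\<bar>" by linarith
  then show ?thesis using c by (simp add: s_def[symmetric] abs_divide divide_less_cancel)
qed

section \<open>Differentiability classes and the Laplacian\<close>

lemma partial_derivI: "(f has_derivative f') (at x) \<Longrightarrow> partial_deriv i f x = f' i"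
  unfolding partial_deriv_def using frechet_derivative_at by metis

text \<open>Locality on open sets: with \<open>Ck_on_cong\<close> and \<open>laplacian_cong\<close>
  it allows pointwise identities valid only in the ball to be differentiated.\<close>

lemma partial_deriv_cong:
  assumes "open S" "x \<in> S" "\<And>y. y \<in> S \<Longrightarrow> f y = g y"
  shows "partial_deriv i f x = partial_deriv i g x"
proof -
  have "(f has_derivative F) (at x) \<longleftrightarrow> (g has_derivative F) (at x)" for F
    using assms by (metis has_derivative_transform_within_open)
  then show ?thesis by (simp add: partial_deriv_def frechet_derivative_def)
qed

lemma differentiable_cong_open:
  assumes "open S" "x \<in> S" "\<And>y. y \<in> S \<Longrightarrow> f y = g y"
  shows "f differentiable (at x) \<longleftrightarrow> g differentiable (at x)"
  unfolding differentiable_def using assms by (metis has_derivative_transform_within_open)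

lemma has_derivative_partial:
  fixes f :: "'a::euclidean_space \<Rightarrow> real"
  assumes "f differentiable (at x)"
  shows "(f has_derivative (\<lambda>h. \<Sum>i\<in>Basis. (h \<bullet> i) * partial_deriv i f x)) (at x)"
proof -
  let ?F = "frechet_derivative f (at x)"
  have d: "(f has_derivative ?F) (at x)" using assms by (simp add: frechet_derivative_works)
  interpret bounded_linear ?F using d by (rule has_derivative_bounded_linear)
  have "?F = (\<lambda>h. \<Sum>i\<in>Basis. (h \<bullet> i) * partial_deriv i f x)"
  proof
    fix h
    have "?F h = ?F (\<Sum>i\<in>Basis. (h \<bullet> i) *\<^sub>R i)" by (simp add: euclidean_representation)
    also have "\<dots> = (\<Sum>i\<in>Basis. (h \<bullet> i) * partial_deriv i f x)"
      by (simp add: sum scaleR partial_deriv_def)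
    finally show "?F h = (\<Sum>i\<in>Basis. (h \<bullet> i) * partial_deriv i f x)" .
  qed
  then show ?thesis using d by simp
qed

lemma Ck_on_cong:
  assumes "open S" "\<And>y. y \<in> S \<Longrightarrow> f y = g y"
  shows "Ck_on n S f \<longleftrightarrow> Ck_on n S g"
  using assms(2)
proof (induction n arbitrary: f g)
  case 0
  then show ?case by (simp cong: continuous_on_cong)
next
  case (Suc n)
  have "f differentiable (at x) \<longleftrightarrow> g differentiable (at x)" if "x \<in> S" for x
    by (rule differentiable_cong_open[OF assms(1) that]) (rule Suc.prems)
  moreover have "Ck_on n S (partial_deriv i f) \<longleftrightarrow> Ck_on n S (partial_deriv i g)" for i
    by (rule Suc.IH) (rule partial_deriv_cong[OF assms(1)], auto intro: Suc.prems)
  ultimately show ?case by auto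
qed

lemma Ck_on_subset: "Ck_on n S f \<Longrightarrow> T \<subseteq> S \<Longrightarrow> Ck_on n T f"
  by (induction n arbitrary: f) (auto intro: continuous_on_subset)

lemma Ck_on_imp_continuous_on:
  assumes "Ck_on n S f" shows "continuous_on S f"
proof (cases n)
  case (Suc m)
  then have "isCont f x" if "x \<in> S" for x
    using assms that by (intro differentiable_imp_continuous_within) simp
  then show ?thesis by (simp add: continuous_at_imp_continuous_on)
qed (use assms in simp)

lemma Ck_on_SucD: "Ck_on (Suc n) S f \<Longrightarrow> Ck_on n S f"
proof (induction n arbitrary: f)
  case 0
  then show ?case using Ck_on_imp_continuous_on[OF 0] by simp
next
  case (Suc n)
  then show ?case by (metis Ck_on.simps(2))
qed

lemma Ck_on_le:
  assumes "Ck_on n S f" "m \<le> n" shows "Ck_on m S f"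
  using assms(2,1) by (induction rule: inc_induct) (auto intro: Ck_on_SucD simp del: Ck_on.simps)

lemma Ck_on_partial: "Ck_on (Suc n) S f \<Longrightarrow> i \<in> Basis \<Longrightarrow> Ck_on n S (partial_deriv i f)"
  by simp

lemma Ck_on_differentiable: "Ck_on n S f \<Longrightarrow> n > 0 \<Longrightarrow> x \<in> S \<Longrightarrow> f differentiable (at x)"
  by (cases n) auto

lemma partial_deriv_const [simp]: "partial_deriv i (\<lambda>_. c) = (\<lambda>_. 0)"
  by (rule ext, rule partial_derivI[where f' = "\<lambda>_. 0"]) simp

lemma Ck_on_const [simp]: "Ck_on n S (\<lambda>_. c)"
  by (induction n arbitrary: c) auto

lemma partial_deriv_add:
  assumes "f differentiable (at x)" "g differentiable (at x)"
  shows "partial_deriv i (\<lambda>x. f x + g x) x = partial_deriv i f x + partial_deriv i g x"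
  using has_derivative_add[OF assms[unfolded frechet_derivative_works]]
  by (subst partial_derivI) (auto simp: partial_deriv_def)

lemma partial_deriv_mult:
  fixes f g :: "'a::euclidean_space \<Rightarrow> real"
  assumes "f differentiable (at x)" "g differentiable (at x)"
  shows "partial_deriv i (\<lambda>x. f x * g x) x = f x * partial_deriv i g x + partial_deriv i f x * g x"
  using has_derivative_mult[OF assms[unfolded frechet_derivative_works]]
  by (subst partial_derivI) (auto simp: partial_deriv_def)

lemma Ck_on_add:
  assumes "open S" "Ck_on n S f" "Ck_on n S g"
  shows "Ck_on n S (\<lambda>x. f x + g x)"
  using assms(2,3)
proof (induction n arbitrary: f g)
  case (Suc n)
  have "Ck_on n S (partial_deriv i (\<lambda>x. f x + g x))" if "i \<in> Basis" for i
  proof (subst Ck_on_cong[OF assms(1)])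
    show "partial_deriv i (\<lambda>x. f x + g x) x = partial_deriv i f x + partial_deriv i g x" if "x \<in> S" for x
      using Suc.prems that by (intro partial_deriv_add) auto
    show "Ck_on n S (\<lambda>x. partial_deriv i f x + partial_deriv i g x)"
      using Suc.prems that by (intro Suc.IH) auto
  qed
  then show ?case using Suc.prems by auto
qed (auto intro: continuous_on_add)

lemma Ck_on_mult:
  assumes "open S" "Ck_on n S f" "Ck_on n S g"
  shows "Ck_on n S (\<lambda>x. f x * g x)"
  using assms(2,3)
proof (induction n arbitrary: f g)
  case (Suc n)
  have "Ck_on n S (partial_deriv i (\<lambda>x. f x * g x))" if "i \<in> Basis" for i
  proof (subst Ck_on_cong[OF assms(1)])
    show "partial_deriv i (\<lambda>x. f x * g x) x = f x * partial_deriv i g x + partial_deriv i f x * g x" if "x \<in> S" for x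
      using Suc.prems that by (intro partial_deriv_mult) auto
    show "Ck_on n S (\<lambda>x. f x * partial_deriv i g x + partial_deriv i f x * g x)"
      using Suc.prems that Ck_on_SucD[OF Suc.prems(1)] Ck_on_SucD[OF Suc.prems(2)]
      by (intro Ck_on_add assms(1) Suc.IH) auto
  qed
  then show ?case using Suc.prems by (auto intro: differentiable_mult)
qed (auto intro: continuous_on_mult)

lemma Ck_on_cmult: "open S \<Longrightarrow> Ck_on n S f \<Longrightarrow> Ck_on n S (\<lambda>x. c * f x)"
  using Ck_on_mult[of S n "\<lambda>_. c" f] by simp

lemma Ck_on_sum:
  assumes "open S" "\<And>i. i \<in> I \<Longrightarrow> Ck_on n S (f i)"
  shows "Ck_on n S (\<lambda>x. \<Sum>i\<in>I. f i x)"
  using assms(2) by (induction I rule: infinite_finite_induct) (auto intro!: Ck_on_add[OF assms(1)] simp del: Ck_on.simps)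

lemma partial_deriv_linear: "bounded_linear f \<Longrightarrow> partial_deriv i f = (\<lambda>_. f i)"
  by (rule ext) (rule partial_derivI, rule bounded_linear_imp_has_derivative)

lemma Ck_on_linear:
  fixes f :: "'a::euclidean_space \<Rightarrow> real"
  assumes "bounded_linear f"
  shows "Ck_on n S f"
proof (cases n)
  case 0
  then show ?thesis using assms by (simp add: linear_continuous_on)
next
  case (Suc m)
  then show ?thesis using assms
    by (auto simp: partial_deriv_linear bounded_linear_imp_differentiable)
qed

lemma Ck_on_inner: "Ck_on n S (\<lambda>x. x \<bullet> (b::'a::euclidean_space))"
  by (rule Ck_on_linear) (rule bounded_linear_inner_left)

lemma partial_deriv_inner [simp]: "partial_deriv i (\<lambda>x. x \<bullet> b) = (\<lambda>_. i \<bullet> b)"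
  by (rule partial_deriv_linear) (rule bounded_linear_inner_left)

lemma Ck_on_real_polynomial_function:
  fixes p :: "'a::euclidean_space \<Rightarrow> real"
  shows "real_polynomial_function p \<Longrightarrow> Ck_on n UNIV p"
  by (induction p rule: real_polynomial_function.induct)
     (auto intro: Ck_on_linear Ck_on_add Ck_on_mult simp del: Ck_on.simps)

section \<open>Functions of the squared norm and their Laplacians\<close>

lemma has_derivative_radial:
  fixes \<phi> :: "real \<Rightarrow> real"
  assumes "(\<phi> has_real_derivative D) (at (x \<bullet> x))"
  shows "((\<lambda>x. \<phi> (x \<bullet> x)) has_derivative (\<lambda>h. 2 * (x \<bullet> h) * D)) (at x)"
proof -
  have "((\<lambda>x. x \<bullet> x) has_derivative (\<lambda>h. x \<bullet> h + h \<bullet> x)) (at x)"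
    by (intro derivative_eq_intros) auto
  from has_derivative_compose[OF this, of \<phi>] assms
  have "((\<lambda>x. \<phi> (x \<bullet> x)) has_derivative (\<lambda>h. D * (x \<bullet> h + h \<bullet> x))) (at x)"
    by (auto simp: has_field_derivative_def)
  then show ?thesis
    by (rule has_derivative_eq_rhs) (auto simp: fun_eq_iff inner_commute algebra_simps)
qed

lemma partial_deriv_radial:
  assumes "(\<phi> has_real_derivative D) (at (x \<bullet> x))"
  shows "partial_deriv i (\<lambda>x. \<phi> (x \<bullet> x)) x = 2 * (x \<bullet> i) * D"
  using partial_derivI[OF has_derivative_radial[OF assms]] .

text \<open>The sequence \<phi> lists successive derivatives. The induction on n has to run for all
  j at once, since a partial derivative of stage j involves stage j + 1.\<close>

lemma Ck_on_radial:
  fixes \<phi> :: "nat \<Rightarrow> real \<Rightarrow> real"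
  assumes d: "\<And>n z. (\<phi> n has_real_derivative \<phi> (Suc n) z) (at z)"
  shows "Ck_on n UNIV (\<lambda>x::'a::euclidean_space. \<phi> j (x \<bullet> x))"
proof (induction n arbitrary: j)
  case 0
  have "isCont (\<phi> j) z" for z using d DERIV_isCont by blast
  then have "continuous_on UNIV (\<phi> j)" by (simp add: continuous_at_imp_continuous_on)
  then show ?case
    by (auto intro!: continuous_on_compose2[of UNIV "\<phi> j"] continuous_intros)
next
  case (Suc n)
  have "partial_deriv i (\<lambda>x::'a. \<phi> j (x \<bullet> x)) = (\<lambda>x. 2 * (x \<bullet> i) * \<phi> (Suc j) (x \<bullet> x))" for i
    by (rule ext) (rule partial_deriv_radial[OF d])
  moreover have "Ck_on n UNIV (\<lambda>x::'a. 2 * (x \<bullet> i) * \<phi> (Suc j) (x \<bullet> x))" for i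
    by (intro Ck_on_mult Ck_on_const Ck_on_inner Suc.IH open_UNIV)
  moreover have "(\<lambda>x::'a. \<phi> j (x \<bullet> x)) differentiable (at x)" for x
    using has_derivative_radial[OF d] by (auto simp: differentiable_def)
  ultimately show ?case by simp
qed

lemma partial_deriv_sum:
  fixes f :: "'b \<Rightarrow> 'a::euclidean_space \<Rightarrow> real"
  assumes "\<And>j. j \<in> I \<Longrightarrow> f j differentiable (at x)"
  shows "partial_deriv i (\<lambda>x. \<Sum>j\<in>I. f j x) x = (\<Sum>j\<in>I. partial_deriv i (f j) x)"
  unfolding partial_deriv_def
  using frechet_derivative_at[OF has_derivative_sum[of I f "\<lambda>j. frechet_derivative (f j) (at x)" "at x"]] assms
  by (simp add: frechet_derivative_works fun_eq_iff)

lemma partial_deriv_cmult: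
  fixes f :: "'a::euclidean_space \<Rightarrow> real"
  assumes "f differentiable (at x)"
  shows "partial_deriv i (\<lambda>x. c * f x) x = c * partial_deriv i f x"
  using partial_deriv_mult[of "\<lambda>_. c" x f i] assms by simp

lemma laplacian_cong:
  assumes "open S" "x \<in> S" "\<And>y. y \<in> S \<Longrightarrow> f y = g y"
  shows "laplacian f x = laplacian g x"
  unfolding laplacian_def
  by (intro sum.cong refl partial_deriv_cong[OF assms(1,2)]) (rule partial_deriv_cong[OF assms(1)], auto intro: assms)

lemma laplacian_lincomb:
  fixes f g :: "'a::euclidean_space \<Rightarrow> real"
  assumes "open S" "x \<in> S" "Ck_on 2 S f" "Ck_on 2 S g"
  shows "laplacian (\<lambda>x. a * f x + b * g x) x = a * laplacian f x + b * laplacian g x"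
proof -
  note C2 = assms(3,4)[unfolded numeral_2_eq_2]
  have *: "f differentiable (at y)" "g differentiable (at y)" "(\<lambda>y. a * f y) differentiable (at y)"
      "(\<lambda>y. b * g y) differentiable (at y)" if "y \<in> S" for y
    using C2 that by (auto intro: differentiable_mult)
  have p: "partial_deriv i (\<lambda>x. a * f x + b * g x) y = a * partial_deriv i f y + b * partial_deriv i g y" if "y \<in> S" for i y
    using *[OF that] by (simp add: partial_deriv_add partial_deriv_cmult)
  have "partial_deriv i (partial_deriv i (\<lambda>x. a * f x + b * g x)) x
     = a * partial_deriv i (partial_deriv i f) x + b * partial_deriv i (partial_deriv i g) x" if "i \<in> Basis" for i
  proof -
    have "partial_deriv i (partial_deriv i (\<lambda>x. a * f x + b * g x)) x
      = partial_deriv i (\<lambda>y. a * partial_deriv i f y + b * partial_deriv i g y) x"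
      by (rule partial_deriv_cong[OF assms(1,2)]) (rule p)
    moreover have "partial_deriv i f differentiable (at x)" "partial_deriv i g differentiable (at x)"
      using C2 assms(2) that by auto
    moreover from this have "(\<lambda>y. a * partial_deriv i f y) differentiable (at x)" "(\<lambda>y. b * partial_deriv i g y) differentiable (at x)"
      by (auto intro: differentiable_mult)
    ultimately show ?thesis by (simp add: partial_deriv_add partial_deriv_cmult)
  qed
  then show ?thesis by (simp add: laplacian_def sum.distrib sum_distrib_left)
qed

lemma Ck_on_laplacian:
  assumes "open S" "Ck_on (Suc (Suc n)) S f" shows "Ck_on n S (laplacian f)"
  unfolding laplacian_def[abs_def] using assms(2) by (intro Ck_on_sum assms(1)) auto

lemma laplacian_mult:
  fixes f g :: "'a::euclidean_space \<Rightarrow> real"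
  assumes "open S" "x \<in> S" "Ck_on 2 S f" "Ck_on 2 S g"
  shows "laplacian (\<lambda>x. f x * g x) x =
    f x * laplacian g x + 2 * (\<Sum>i\<in>Basis. partial_deriv i f x * partial_deriv i g x) + laplacian f x * g x"
proof -
  note C2 = assms(3,4)[unfolded numeral_2_eq_2]
  have *: "f differentiable (at y)" "g differentiable (at y)" if "y \<in> S" for y
    using C2 that by auto
  have p: "partial_deriv i (\<lambda>x. f x * g x) y = f y * partial_deriv i g y + partial_deriv i f y * g y" if "y \<in> S" for i y
    using *[OF that] by (rule partial_deriv_mult)
  have "partial_deriv i (partial_deriv i (\<lambda>x. f x * g x)) x
     = f x * partial_deriv i (partial_deriv i g) x + 2 * (partial_deriv i f x * partial_deriv i g x)
       + partial_deriv i (partial_deriv i f) x * g x" if "i \<in> Basis" for i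
  proof -
    have "partial_deriv i (partial_deriv i (\<lambda>x. f x * g x)) x
      = partial_deriv i (\<lambda>y. f y * partial_deriv i g y + partial_deriv i f y * g y) x"
      by (rule partial_deriv_cong[OF assms(1,2)]) (rule p)
    moreover have "partial_deriv i f differentiable (at x)" "partial_deriv i g differentiable (at x)"
      using C2 assms(2) that by auto
    ultimately show ?thesis using *[OF assms(2)]
      by (simp add: partial_deriv_add partial_deriv_mult differentiable_mult algebra_simps)
  qed
  then show ?thesis by (simp add: laplacian_def sum.distrib sum_distrib_left sum_distrib_right)
qed

lemma laplacian_radial:
  fixes \<phi> \<phi>' \<phi>'' :: "real \<Rightarrow> real"
  assumes "\<And>z. (\<phi> has_real_derivative \<phi>' z) (at z)" "\<And>z. (\<phi>' has_real_derivative \<phi>'' z) (at z)"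
  shows "laplacian (\<lambda>x::'a::euclidean_space. \<phi> (x \<bullet> x)) x = 2 * real DIM('a) * \<phi>' (x \<bullet> x) + 4 * (x \<bullet> x) * \<phi>'' (x \<bullet> x)"
proof -
  have p: "partial_deriv i (\<lambda>x::'a. \<phi> (x \<bullet> x)) = (\<lambda>x. 2 * (x \<bullet> i) * \<phi>' (x \<bullet> x))" for i
    by (rule ext) (rule partial_deriv_radial[OF assms(1)])
  have "partial_deriv i (\<lambda>x::'a. 2 * (x \<bullet> i) * \<phi>' (x \<bullet> x)) x
    = 2 * \<phi>' (x \<bullet> x) + 4 * (x \<bullet> i)\<^sup>2 * \<phi>'' (x \<bullet> x)" if "i \<in> Basis" for i
  proof -
    have d1: "(\<lambda>x::'a. 2 * (x \<bullet> i)) differentiable (at x)"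
      using Ck_on_mult[OF open_UNIV Ck_on_const[of 1 UNIV 2] Ck_on_inner[of 1 UNIV i]] Ck_on_differentiable[of 1 UNIV] by auto
    have d2: "(\<lambda>x::'a. \<phi>' (x \<bullet> x)) differentiable (at x)"
      using has_derivative_radial[OF assms(2)] by (auto simp: differentiable_def)
    have d3: "(\<lambda>x::'a. x \<bullet> i) differentiable (at x)" using Ck_on_differentiable[OF Ck_on_inner[of 1 UNIV i]] by auto
    show ?thesis
      using partial_deriv_mult[OF d1 d2, of i] partial_deriv_cmult[OF d3, of i 2] that
      by (simp add: partial_deriv_radial[OF assms(2)] power2_eq_square)
  qed
  moreover have "(\<Sum>i\<in>Basis. (x \<bullet> i)\<^sup>2) = x \<bullet> x"
    by (subst euclidean_inner) (simp add: power2_eq_square)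
  ultimately show ?thesis
    by (simp add: laplacian_def p sum.distrib flip: sum_distrib_left sum_distrib_right)
qed

text \<open>Differentiate P (t x) = t^k P x with respect to t at t = 1.\<close>

lemma Euler_homogeneous:
  fixes P :: "'a::euclidean_space \<Rightarrow> real"
  assumes "P differentiable (at x)" "\<And>t. P (t *\<^sub>R x) = t ^ k * P x"
  shows "(\<Sum>i\<in>Basis. (x \<bullet> i) * partial_deriv i P x) = real k * P x"
proof -
  have "((\<lambda>t. t *\<^sub>R x) has_derivative (\<lambda>h. h *\<^sub>R x)) (at (1::real))"
    by (rule bounded_linear_imp_has_derivative) (rule bounded_linear_scaleR_left)
  moreover have "(P has_derivative (\<lambda>h. \<Sum>i\<in>Basis. (h \<bullet> i) * partial_deriv i P x)) (at (1 *\<^sub>R x))"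
    using has_derivative_partial[OF assms(1)] by simp
  ultimately have "((\<lambda>t. P (t *\<^sub>R x)) has_derivative (\<lambda>h. \<Sum>i\<in>Basis. ((h *\<^sub>R x) \<bullet> i) * partial_deriv i P x)) (at 1)"
    by (rule has_derivative_compose)
  then have "((\<lambda>t. t ^ k * P x) has_derivative (\<lambda>h. (\<Sum>i\<in>Basis. (x \<bullet> i) * partial_deriv i P x) * h)) (at 1)"
    unfolding assms(2) by (rule has_derivative_eq_rhs) (auto simp: fun_eq_iff sum_distrib_left algebra_simps)
  then have "((\<lambda>t. t ^ k * P x) has_real_derivative (\<Sum>i\<in>Basis. (x \<bullet> i) * partial_deriv i P x)) (at 1)"
    by (simp add: has_field_derivative_def)
  moreover have "((\<lambda>t. t ^ k * P x) has_real_derivative real k * P x) (at 1)"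
    by (auto intro!: derivative_eq_intros)
  ultimately show ?thesis by (rule DERIV_unique)
qed

lemma harmonic_homogeneous_polyD:
  assumes "harmonic_homogeneous_poly k P"
  shows "Ck_on n UNIV P" "P (t *\<^sub>R x) = t ^ k * P x" "laplacian P x = 0"
    "(\<Sum>i\<in>Basis. (x \<bullet> i) * partial_deriv i P x) = real k * P x"
proof -
  have P: "real_polynomial_function P" "\<And>t x. P (t *\<^sub>R x) = t ^ k * P x" "\<And>x. laplacian P x = 0"
    using assms by (auto simp: harmonic_homogeneous_poly_def)
  show "Ck_on n UNIV P" by (rule Ck_on_real_polynomial_function[OF P(1)])
  show "P (t *\<^sub>R x) = t ^ k * P x" "laplacian P x = 0" by fact+
  show "(\<Sum>i\<in>Basis. (x \<bullet> i) * partial_deriv i P x) = real k * P x"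
    using Ck_on_real_polynomial_function[OF P(1), of 1] P(2) by (intro Euler_homogeneous) auto
qed

text \<open>The mixed term of the product rule is 4 \<phi>' times the Euler sum of P, that is 4 k
  \<phi>' P. Together with the radial term 2 N \<phi>', N the dimension, it produces the coefficient
  k + N/2 = \<nu> + 1 of Bessel's equation.\<close>

lemma laplacian_harmonic_radial:
  fixes P :: "'a::euclidean_space \<Rightarrow> real"
  assumes P: "harmonic_homogeneous_poly k P"
    and d: "\<And>z. (\<phi> has_real_derivative \<phi>' z) (at z)" "\<And>z. (\<phi>' has_real_derivative \<phi>'' z) (at z)"
    and C: "Ck_on 2 UNIV (\<lambda>x::'a. \<phi> (x \<bullet> x))"
  shows "laplacian (\<lambda>x. P x * \<phi> (x \<bullet> x)) x =
    P x * (4 * ((x \<bullet> x) * \<phi>'' (x \<bullet> x) + (real k + real DIM('a) / 2) * \<phi>' (x \<bullet> x)))"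
proof -
  note D = harmonic_homogeneous_polyD[OF P]
  have "(\<Sum>i\<in>Basis. partial_deriv i P x * partial_deriv i (\<lambda>x. \<phi> (x \<bullet> x)) x)
    = 2 * \<phi>' (x \<bullet> x) * (\<Sum>i\<in>Basis. (x \<bullet> i) * partial_deriv i P x)"
    by (simp add: partial_deriv_radial[OF d(1)] sum_distrib_left mult_ac)
  also have "\<dots> = 2 * \<phi>' (x \<bullet> x) * (real k * P x)" by (simp add: D(4))
  finally show ?thesis
    unfolding laplacian_mult[OF open_UNIV UNIV_I D(1) C] D(3) laplacian_radial[of \<phi> \<phi>' \<phi>'', OF d]
    by (simp add: algebra_simps)
qed

text \<open>The j-th derivative of \<open>profile\<close> in closed form, indexed so that
  \<open>Ck_on_radial\<close> applies to the whole sequence.\<close>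

definition profile_deriv :: "real \<Rightarrow> real \<Rightarrow> real \<Rightarrow> real \<Rightarrow> real \<Rightarrow> nat \<Rightarrow> real \<Rightarrow> real" where
  "profile_deriv \<nu> \<tau> s c d j z =
     c * (- \<tau>) ^ j * bess (\<nu> + real j) (\<tau> * z) + d * s ^ j * bess (\<nu> + real j) (- s * z)"

lemma profile_deriv_0: "profile_deriv \<nu> \<tau> s c d 0 = profile \<nu> \<tau> s c d"
  by (auto simp: profile_deriv_def profile_def)

lemma DERIV_profile_deriv:
  assumes "\<nu> \<ge> 0"
  shows "(profile_deriv \<nu> \<tau> s c d j has_real_derivative profile_deriv \<nu> \<tau> s c d (Suc j) z) (at z)"
proof -
  have "\<nu> + real j \<ge> 0" using assms by simp
  then have d: "((\<lambda>z. bess (\<nu> + real j) (a * z)) has_real_derivative - a * bess (\<nu> + real j + 1) (a * z)) (at z)" for a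
    using DERIV_chain2[OF has_derivative_bess DERIV_cmult_Id, of "\<nu> + real j" a z] by (simp add: mult.commute)
  show ?thesis
    unfolding profile_deriv_def[abs_def]
    by (rule DERIV_cong[OF DERIV_add[OF DERIV_cmult[OF d] DERIV_cmult[OF d]]]) (simp add: add_ac)
qed

text \<open>The operator z D^2 + (\<nu> + 1) D acts diagonally, by - \<tau> on the J part and by s
  on the I part. Four times it is the Laplacian on a harmonic polynomial times a profile.\<close>

lemma profile_ode:
  assumes "\<nu> \<ge> 0"
  shows "z * profile_deriv \<nu> \<tau> s c d 2 z + (\<nu> + 1) * profile_deriv \<nu> \<tau> s c d 1 z
      = profile \<nu> \<tau> s (- \<tau> * c) (s * d) z"
proof -
  have 1: "bess \<nu> (\<tau> * z) = (\<nu> + 1) * bess (\<nu> + 1) (\<tau> * z) - \<tau> * z * bess (\<nu> + 2) (\<tau> * z)"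
    and 2: "bess \<nu> (- s * z) = (\<nu> + 1) * bess (\<nu> + 1) (- s * z) - (- s * z) * bess (\<nu> + 2) (- s * z)"
    using bess_recurrence[OF assms] by metis+
  show ?thesis
    unfolding profile_def 1 2 by (simp add: profile_deriv_def algebra_simps power2_eq_square)
qed

lemma laplacian_profile:
  fixes P :: "'a::euclidean_space \<Rightarrow> real"
  assumes P: "harmonic_homogeneous_poly k P" and "DIM('a) \<ge> 2"
  shows "laplacian (\<lambda>x. P x * profile (nu DIM('a) k) \<tau> s c d (x \<bullet> x))
    = (\<lambda>x. P x * profile (nu DIM('a) k) \<tau> s (- (4 * \<tau>) * c) (4 * s * d) (x \<bullet> x))"
proof
  fix x :: 'a
  let ?\<nu> = "nu DIM('a) k"
  have \<nu>: "?\<nu> \<ge> 0" by (rule nu_nonneg[OF assms(2)])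
  have e: "real k + real DIM('a) / 2 = ?\<nu> + 1" by (simp add: nu_def field_simps)
  have "laplacian (\<lambda>x. P x * profile ?\<nu> \<tau> s c d (x \<bullet> x)) x =
    P x * (4 * ((x \<bullet> x) * profile_deriv ?\<nu> \<tau> s c d 2 (x \<bullet> x) + (?\<nu> + 1) * profile_deriv ?\<nu> \<tau> s c d 1 (x \<bullet> x)))"
    unfolding profile_deriv_0[symmetric] e[symmetric] numeral_2_eq_2 One_nat_def
    by (rule laplacian_harmonic_radial[OF P DERIV_profile_deriv[OF \<nu>] DERIV_profile_deriv[OF \<nu>]])
       (rule Ck_on_radial[where \<phi> = "profile_deriv ?\<nu> \<tau> s c d", OF DERIV_profile_deriv[OF \<nu>]])
  also have "\<dots> = P x * profile ?\<nu> \<tau> s (- (4 * \<tau>) * c) (4 * s * d) (x \<bullet> x)"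
    unfolding profile_ode[OF \<nu>] by (simp add: profile_def algebra_simps)
  finally show "laplacian (\<lambda>x. P x * profile ?\<nu> \<tau> s c d (x \<bullet> x)) x =
     P x * profile ?\<nu> \<tau> s (- (4 * \<tau>) * c) (4 * s * d) (x \<bullet> x)" .
qed

lemma C1_closureI:
  assumes "Ck_on 1 UNIV f" shows "C1_closure S f"
proof -
  have "continuous_on (closure S) (partial_deriv i f)" if "i \<in> Basis" for i
    using assms that by (auto intro: continuous_on_subset)
  moreover have "continuous_on (closure S) f"
    using Ck_on_imp_continuous_on[OF assms] continuous_on_subset by blast
  ultimately show ?thesis unfolding C1_closure_def using Ck_on_subset[OF assms] by blast
qed

text \<open>The Laplacian acts on the two parts by - 4 \<tau> and 4 s. These are the roots of X^2 +
  \<mu> X - \<kappa>^2 for \<mu> = 4 \<tau> - 4 s, because \<open>st\<close> makes their product -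
  \<kappa>^2.\<close>

lemma bvp_solution_profile:
  fixes P :: "'a::euclidean_space \<Rightarrow> real"
  assumes P: "harmonic_homogeneous_poly k P" and N: "DIM('a) \<ge> 2" and \<tau>: "\<tau> > 0"
    and st: "s * \<tau> = \<kappa>\<^sup>2 / 16"
    and b: "profile (nu DIM('a) k) \<tau> s c d 1 = 0" "profile' (nu DIM('a) k) \<tau> s c d 1 = 0"
  shows "bvp_solution \<kappa> (4 * \<tau> - 4 * s) (\<lambda>x. P x * profile (nu DIM('a) k) \<tau> s c d (x \<bullet> x))"
proof -
  let ?\<nu> = "nu DIM('a) k"
  let ?u = "\<lambda>x. P x * profile ?\<nu> \<tau> s c d (x \<bullet> x)"
  have \<nu>: "?\<nu> \<ge> 0" by (rule nu_nonneg[OF N])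
  note D = harmonic_homogeneous_polyD[OF P]
  have C: "Ck_on n UNIV ?u" for n
    using Ck_on_mult[OF open_UNIV D(1) Ck_on_radial[where \<phi> = "profile_deriv ?\<nu> \<tau> s c d", OF DERIV_profile_deriv[OF \<nu>], of n 0]]
    by (simp add: profile_deriv_0)
  have pde: "laplacian (laplacian ?u) x - \<kappa>\<^sup>2 * ?u x = - (4 * \<tau> - 4 * s) * laplacian ?u x" for x
  proof -
    have \<kappa>: "\<kappa>\<^sup>2 = 16 * (s * \<tau>)" using st by simp
    show ?thesis
      unfolding laplacian_profile[OF P N] \<kappa> by (simp add: profile_def algebra_simps)
  qed
  have "((\<lambda>r. ?u (r *\<^sub>R \<theta>)) has_real_derivative 0) (at_left 1)" if \<theta>: "\<theta> \<in> sphere 0 1" for \<theta>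
  proof -
    have t1: "\<theta> \<bullet> \<theta> = 1" using \<theta> by (simp add: dot_square_norm)
    have eq: "?u (r *\<^sub>R \<theta>) = r ^ k * P \<theta> * profile ?\<nu> \<tau> s c d (r * r)" for r
      by (simp add: D(2) t1)
    have "((\<lambda>r. r * r) has_real_derivative 2) (at 1)" by (auto intro!: derivative_eq_intros)
    from DERIV_chain2[of "profile ?\<nu> \<tau> s c d" _ "\<lambda>r. r * r", OF DERIV_profile[OF \<nu>] this]
    have dp: "((\<lambda>r. profile ?\<nu> \<tau> s c d (r * r)) has_real_derivative 0) (at 1)" by (simp add: b)
    have "((\<lambda>r. r ^ k * P \<theta>) has_real_derivative real k * P \<theta>) (at 1)"
      by (auto intro!: derivative_eq_intros)
    from DERIV_mult[OF this dp] show ?thesis unfolding eq by (simp add: b has_field_derivative_at_within)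
  qed
  moreover have "?u \<theta> = 0" if \<theta>: "\<theta> \<in> sphere 0 1" for \<theta>
    using \<theta> b by (simp add: dot_square_norm)
  ultimately show ?thesis
    unfolding bvp_solution_def using Ck_on_subset[OF C subset_UNIV] C1_closureI[OF C] pde by blast
qed

section \<open>Spans of functions identified on a set\<close>

lemma span_on_zero: "(\<And>x. x \<in> A \<Longrightarrow> u x = 0) \<Longrightarrow> u \<in> span_on A B"
  unfolding span_on_def by (intro CollectI exI[of _ "{}"]) auto

lemma span_on_base:
  assumes "v \<in> B" "\<And>x. x \<in> A \<Longrightarrow> u x = a * v x" shows "u \<in> span_on A B"
  unfolding span_on_def using assms by (intro CollectI exI[of _ "{v}"] exI[of _ "\<lambda>_. a"]) auto

lemma span_on_add:
  assumes "u \<in> span_on A B" "v \<in> span_on A B" "\<And>x. x \<in> A \<Longrightarrow> w x = u x + v x"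
  shows "w \<in> span_on A B"
proof -
  obtain T a where T: "finite T" "T \<subseteq> B" "\<And>x. x \<in> A \<Longrightarrow> u x = (\<Sum>f\<in>T. a f * f x)"
    using assms(1) by (auto simp: span_on_def)
  obtain T' a' where T': "finite T'" "T' \<subseteq> B" "\<And>x. x \<in> A \<Longrightarrow> v x = (\<Sum>f\<in>T'. a' f * f x)"
    using assms(2) by (auto simp: span_on_def)
  let ?b = "\<lambda>f. (if f \<in> T then a f else 0) + (if f \<in> T' then a' f else 0)"
  have "w x = (\<Sum>f\<in>T \<union> T'. ?b f * f x)" if "x \<in> A" for x
  proof -
    have "(\<Sum>f\<in>T. a f * f x) = (\<Sum>f\<in>T \<union> T'. (if f \<in> T then a f else 0) * f x)"
      using T(1) T'(1) by (intro sum.mono_neutral_cong_left) auto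
    moreover have "(\<Sum>f\<in>T'. a' f * f x) = (\<Sum>f\<in>T \<union> T'. (if f \<in> T' then a' f else 0) * f x)"
      using T(1) T'(1) by (intro sum.mono_neutral_cong_left) auto
    ultimately show ?thesis
      using assms(3)[OF that] T(3)[OF that] T'(3)[OF that] by (simp only: sum.distrib[symmetric] distrib_right)
  qed
  then show ?thesis unfolding span_on_def using T T'
    by (intro CollectI exI[of _ "T \<union> T'"] exI[of _ ?b]) auto
qed

lemma span_on_cmult:
  assumes "u \<in> span_on A B" "\<And>x. x \<in> A \<Longrightarrow> w x = c * u x"
  shows "w \<in> span_on A B"
proof -
  obtain T a where T: "finite T" "T \<subseteq> B" "\<And>x. x \<in> A \<Longrightarrow> u x = (\<Sum>f\<in>T. a f * f x)"
    using assms(1) by (auto simp: span_on_def)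
  then show ?thesis unfolding span_on_def using assms(2)
    by (intro CollectI exI[of _ T] exI[of _ "\<lambda>f. c * a f"]) (auto simp: sum_distrib_left mult.assoc)
qed

lemma span_on_sum:
  assumes "finite I" "\<And>i. i \<in> I \<Longrightarrow> u i \<in> span_on A B" "\<And>x. x \<in> A \<Longrightarrow> w x = (\<Sum>i\<in>I. u i x)"
  shows "w \<in> span_on A B"
  using assms
proof (induction I arbitrary: w)
  case empty
  then show ?case by (intro span_on_zero) auto
next
  case (insert i I)
  have "(\<lambda>x. \<Sum>i\<in>I. u i x) \<in> span_on A B"
    by (rule insert.IH) (use insert.prems(1) in auto)
  then show ?case
  proof (rule span_on_add[of "u i" A B "\<lambda>x. \<Sum>i\<in>I. u i x", rotated])
    show "u i \<in> span_on A B" by (rule insert.prems) simp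
    show "w x = u i x + (\<Sum>i\<in>I. u i x)" if "x \<in> A" for x
      using insert.prems(2)[OF that] insert.hyps by simp
  qed
qed

lemma span_on_mono:
  assumes "B \<subseteq> span_on A C" shows "span_on A B \<subseteq> span_on A C"
proof
  fix u assume "u \<in> span_on A B"
  then obtain T a where T: "finite T" "T \<subseteq> B" "\<And>x. x \<in> A \<Longrightarrow> u x = (\<Sum>f\<in>T. a f * f x)"
    by (auto simp: span_on_def)
  show "u \<in> span_on A C"
  proof (rule span_on_sum[OF T(1) _ T(3)])
    fix f assume "f \<in> T"
    then have "f \<in> span_on A C" using T(2) assms by blast
    then show "(\<lambda>x. a f * f x) \<in> span_on A C" by (rule span_on_cmult[where c = "a f"]) simp
  qed
qed

section \<open>A rotation invariant functional on the sphere\<close>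

text \<open>The positive part has a corner at 0, its square does not; this keeps the cutoff
  \<open>eta\<close> continuously differentiable.\<close>

lemma DERIV_max0_square: "((\<lambda>t::real. (max 0 t)\<^sup>2) has_real_derivative 2 * max 0 t) (at t)"
proof -
  consider "t > 0" | "t < 0" | "t = 0" by linarith
  then show ?thesis
  proof cases
    case 1
    have "((\<lambda>t::real. t\<^sup>2) has_real_derivative 2 * max 0 t) (at t)"
      using 1 by (auto intro!: derivative_eq_intros)
    then show ?thesis
      by (rule has_field_derivative_transform_within_open[of _ _ _ "{0<..}"]) (use 1 in auto)
  next
    case 2
    have "((\<lambda>t::real. 0) has_real_derivative 2 * max 0 t) (at t)" using 2 by simp
    then show ?thesis
      by (rule has_field_derivative_transform_within_open[of _ _ _ "{..<0}"]) (use 2 in auto)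
  next
    case 3
    have "((\<lambda>y::real. ((max 0 y)\<^sup>2 - (max 0 0)\<^sup>2) / (y - 0)) \<longlongrightarrow> 0) (at 0)"
    proof (rule Lim_null_comparison)
      show "\<forall>\<^sub>F y in at (0::real). norm (((max 0 y)\<^sup>2 - (max 0 0)\<^sup>2) / (y - 0)) \<le> \<bar>y\<bar>"
        by (rule always_eventually) (auto simp: max_def power2_eq_square)
      show "((\<lambda>y::real. \<bar>y\<bar>) \<longlongrightarrow> 0) (at 0)"
        by (rule tendsto_eq_intros refl | simp)+
    qed
    then show ?thesis using 3 by (simp add: has_field_derivative_iff)
  qed
qed

text \<open>A \<open>C\<^sup>1\<close> radial weight supported in the shell \<open>1 \<le> |x| \<le> 2\<close>. Integrating \<open>f (x / |x|)\<close>
  against it gives a multiple of the surface integral of \<open>f\<close> over the unit sphere. Its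
  infinitesimal rotation invariance only needs the translation invariance of Lebesgue measure,
  because the rotation fields are divergence free.\<close>

definition eta :: "'a::euclidean_space \<Rightarrow> real" where
  "eta x = (max 0 ((x \<bullet> x - 1) * (4 - x \<bullet> x)))\<^sup>2"

text \<open>The scalar by which x is multiplied in the gradient of \<open>eta\<close> at x.\<close>

definition eta' :: "'a::euclidean_space \<Rightarrow> real" where
  "eta' x = 4 * max 0 ((x \<bullet> x - 1) * (4 - x \<bullet> x)) * (5 - 2 * (x \<bullet> x))"

lemma has_derivative_eta: "(eta has_derivative (\<lambda>h. (x \<bullet> h) * eta' x)) (at x)"
proof -
  have "((\<lambda>z::real. (z - 1) * (4 - z)) has_real_derivative 5 - 2 * (x \<bullet> x)) (at (x \<bullet> x))"
    by (auto intro!: derivative_eq_intros)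
  from DERIV_chain2[OF DERIV_max0_square this]
  have "((\<lambda>z::real. (max 0 ((z - 1) * (4 - z)))\<^sup>2) has_real_derivative eta' x / 2) (at (x \<bullet> x))"
    by (simp add: eta'_def mult_ac)
  from has_derivative_radial[OF this] show ?thesis
    by (simp add: eta_def[abs_def])
qed

lemma eta_nonneg: "eta x \<ge> 0"
  by (simp add: eta_def)

lemma eta_eq_0:
  assumes "norm x \<le> 1 \<or> norm x \<ge> 2" shows "eta x = 0" "eta' x = 0"
proof -
  have "x \<bullet> x \<le> 1 \<or> x \<bullet> x \<ge> 4"
    using assms power_mono[of "norm x" 1 2] power_mono[of 2 "norm x" 2] by (auto simp: dot_square_norm)
  then have "(x \<bullet> x - 1) * (4 - x \<bullet> x) \<le> 0"
    by (auto intro: mult_nonpos_nonneg mult_nonneg_nonpos)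
  then have "max 0 ((x \<bullet> x - 1) * (4 - x \<bullet> x)) = 0" by simp
  then show "eta x = 0" "eta' x = 0" by (auto simp: eta_def eta'_def)
qed

lemma eta_pos:
  assumes "1 < norm x" "norm x < 2" shows "eta x > 0"
proof -
  have "1 < (norm x)\<^sup>2" by (rule one_less_power) (use assms in auto)
  moreover have "(norm x)\<^sup>2 < 4" using power_strict_mono[of "norm x" 2 2] assms by simp
  ultimately have "(x \<bullet> x - 1) * (4 - x \<bullet> x) > 0" by (simp add: dot_square_norm)
  then show ?thesis by (auto simp: eta_def)
qed

lemma continuous_on_eta: "continuous_on S eta"
  by (intro continuous_at_imp_continuous_on ballI) (rule has_derivative_continuous[OF has_derivative_eta])

lemma continuous_on_eta': "continuous_on S eta'"
  unfolding eta'_def[abs_def] by (intro continuous_intros)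

lemma continuous_on_sgn_nz: "continuous_on (- {0}) (sgn :: 'a::euclidean_space \<Rightarrow> 'a)"
  by (intro continuous_on_sgn continuous_on_id) auto

lemma sgn_sphere: "x \<noteq> 0 \<Longrightarrow> sgn x \<in> sphere 0 1" for x :: "'a::euclidean_space"
  by (simp add: norm_sgn)

text \<open>Composition with \<open>sgn\<close> breaks continuity at the origin. As the weighted
  integrands vanish on the unit ball, continuity is glued from two open pieces.\<close>

lemma continuous_on_shell:
  fixes F :: "'b::topological_space \<Rightarrow> 'a::euclidean_space \<Rightarrow> real"
  assumes "continuous_on (U \<times> (- {0})) (\<lambda>(r, x). F r x)"
    and "\<And>r x. norm x \<le> 1 \<Longrightarrow> F r x = 0"
  shows "continuous_on (U \<times> UNIV) (\<lambda>(r, x). F r x)"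
proof -
  have U: "U \<times> (UNIV :: 'a set) = U \<times> (- {0}) \<union> U \<times> ball 0 1" by auto
  show ?thesis
    unfolding U
  proof (rule continuous_on_Un_local_open)
    show "openin (top_of_set (U \<times> (- {0}) \<union> U \<times> ball 0 1)) (U \<times> (- {0 :: 'a}))"
      unfolding U[symmetric] by (intro openin_Times) auto
    show "openin (top_of_set (U \<times> (- {0}) \<union> U \<times> ball 0 1)) (U \<times> ball (0 :: 'a) 1)"
      unfolding U[symmetric] by (intro openin_Times) auto
    show "continuous_on (U \<times> ball 0 1) (\<lambda>(r, x). F r x)"
      by (rule continuous_on_eq[of _ "\<lambda>_. 0"]) (auto simp: assms(2))
  qed (rule assms(1))
qed

lemma continuous_on_eta_sgn:
  fixes F :: "'b::topological_space \<Rightarrow> 'a::euclidean_space \<Rightarrow> real"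
  assumes "continuous_on (U \<times> sphere 0 1) (\<lambda>(r, \<omega>). F r \<omega>)"
  shows "continuous_on (U \<times> T) (\<lambda>(r, x). eta x * F r (sgn x))"
proof -
  have "continuous_on (U \<times> (- {0 :: 'a})) (\<lambda>p. (fst p, sgn (snd p)))"
    by (intro continuous_intros continuous_on_compose2[OF continuous_on_sgn_nz]) auto
  then have "continuous_on (U \<times> (- {0})) (\<lambda>p. (\<lambda>(r, \<omega>). F r \<omega>) (fst p, sgn (snd p)))"
    by (rule continuous_on_compose2[OF assms]) (auto simp: norm_sgn)
  then have "continuous_on (U \<times> (- {0})) (\<lambda>(r, x). eta x * F r (sgn x))"
    unfolding split_beta
    by (intro continuous_on_mult continuous_on_compose2[OF continuous_on_eta[of UNIV]] continuous_on_snd continuous_on_id) auto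
  then have "continuous_on (U \<times> UNIV) (\<lambda>(r, x). eta x * F r (sgn x))"
    by (rule continuous_on_shell) (simp add: eta_eq_0)
  then show ?thesis by (rule continuous_on_subset) auto
qed

lemma continuous_on_eta_sgn1:
  fixes f :: "'a::euclidean_space \<Rightarrow> real"
  assumes "continuous_on (sphere 0 1) f"
  shows "continuous_on T (\<lambda>x. eta x * f (sgn x))"
proof -
  have "continuous_on (UNIV \<times> sphere 0 1) (\<lambda>p. f (snd p))"
    by (rule continuous_on_compose2[OF assms]) (auto intro: continuous_intros)
  then have "continuous_on (UNIV \<times> sphere 0 1) (\<lambda>(r::real, \<omega>). f \<omega>)" by (simp add: split_beta)
  from continuous_on_eta_sgn[OF this, of T]
  have "continuous_on (UNIV \<times> T) (\<lambda>(r::real, x). eta x * f (sgn x))" .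
  moreover have "continuous_on T (\<lambda>x. (0::real, x))" by (intro continuous_intros)
  ultimately have "continuous_on T (\<lambda>x. (\<lambda>(r::real, x). eta x * f (sgn x)) (0, x))"
    by (rule continuous_on_compose2) auto
  then show ?thesis by simp
qed

text \<open>Half side 3 leaves room around the support, which lies in the ball of radius 2:
  translates of the box by less than 1 along an axis still contain it.\<close>

definition shell_box :: "'a::euclidean_space set" where
  "shell_box = cbox (- 3 *\<^sub>R One) (3 *\<^sub>R One)"

definition sph :: "('a::euclidean_space \<Rightarrow> real) \<Rightarrow> real" where
  "sph f = integral shell_box (\<lambda>x. eta x * f (sgn x))"

section \<open>Linearity, definiteness and parameter dependence of \<open>sph\<close>\<close>

lemma sph_integrable:
  "continuous_on (sphere 0 1) f \<Longrightarrow> (\<lambda>x. eta x * f (sgn x)) integrable_on shell_box"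
  unfolding shell_box_def by (intro integrable_continuous continuous_on_eta_sgn1)

lemma sph_cong:
  assumes "\<And>\<omega>. \<omega> \<in> sphere 0 1 \<Longrightarrow> f \<omega> = g \<omega>" shows "sph f = sph g"
  unfolding sph_def
proof (rule Henstock_Kurzweil_Integration.integral_cong)
  fix x :: 'a
  show "eta x * f (sgn x) = eta x * g (sgn x)"
    using assms[of "sgn x"] sgn_sphere[of x] by (cases "x = 0") (auto simp: eta_eq_0)
qed

lemma sph_add:
  assumes "continuous_on (sphere 0 1) f" "continuous_on (sphere 0 1) g"
  shows "sph (\<lambda>\<omega>. f \<omega> + g \<omega>) = sph f + sph g"
  unfolding sph_def distrib_left
  by (intro Henstock_Kurzweil_Integration.integral_add sph_integrable assms)

lemma sph_cmult: "sph (\<lambda>\<omega>. c * f \<omega>) = c * sph f"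
  by (simp add: sph_def mult.left_commute[of _ c])

lemma sph_0 [simp]: "sph (\<lambda>_. 0) = 0"
  by (simp add: sph_def)

lemma sph_sum:
  assumes "\<And>i. i \<in> I \<Longrightarrow> continuous_on (sphere 0 1) (f i)"
  shows "sph (\<lambda>\<omega>. \<Sum>i\<in>I. f i \<omega>) = (\<Sum>i\<in>I. sph (f i))"
  using assms
proof (induction I rule: infinite_finite_induct)
  case (insert i I)
  have "sph (\<lambda>\<omega>. f i \<omega> + (\<Sum>i\<in>I. f i \<omega>)) = sph (f i) + sph (\<lambda>\<omega>. \<Sum>i\<in>I. f i \<omega>)"
    using insert.prems by (intro sph_add continuous_on_sum) auto
  then show ?case using insert by simp
qed auto

text \<open>The continuous nonnegative integrand vanishes everywhere on the box; it is evaluated at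
  (3/2) \<omega>, strictly inside the shell, where \<open>eta\<close> is positive.\<close>

lemma sph_definite:
  fixes f :: "'a::euclidean_space \<Rightarrow> real"
  assumes c: "continuous_on (sphere 0 1) f" and nn: "\<And>\<omega>. \<omega> \<in> sphere 0 1 \<Longrightarrow> f \<omega> \<ge> 0"
    and z: "sph f = 0" and \<omega>: "\<omega> \<in> sphere 0 1"
  shows "f \<omega> = 0"
proof -
  let ?x = "(3 / 2) *\<^sub>R \<omega>"
  have n: "norm ?x = 3 / 2" using \<omega> by simp
  have nn': "eta x * f (sgn x) \<ge> 0" for x :: 'a
    using nn[of "sgn x"] sgn_sphere[of x] eta_nonneg[of x] by (cases "x = 0") (auto simp: eta_eq_0)
  have b: "(y \<in> shell_box) \<longleftrightarrow> (\<forall>i\<in>Basis. \<bar>y \<bullet> i\<bar> \<le> 3)" for y :: 'a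
    unfolding shell_box_def by (auto simp: mem_box abs_le_iff minus_le_iff)
  have xb: "?x \<in> shell_box"
    unfolding b using n Basis_le_norm[of _ ?x] by fastforce
  have "eta ?x * f (sgn ?x) = 0"
  proof (rule has_integral_0_cbox_imp_0[where f = "\<lambda>x::'a. eta x * f (sgn x)" and x = ?x])
    show "continuous_on (cbox (- 3 *\<^sub>R One) (3 *\<^sub>R One)) (\<lambda>x::'a. eta x * f (sgn x))"
      by (rule continuous_on_eta_sgn1[OF c])
    show "((\<lambda>x::'a. eta x * f (sgn x)) has_integral 0) (cbox (- 3 *\<^sub>R One) (3 *\<^sub>R One))"
      using integrable_integral[OF sph_integrable[OF c]] z unfolding sph_def shell_box_def by simp
    show "box (- 3 *\<^sub>R One) (3 *\<^sub>R One) \<noteq> ({} :: 'a set)" by (simp add: box_ne_empty)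
    show "?x \<in> cbox (- 3 *\<^sub>R One) (3 *\<^sub>R One)" using xb by (simp add: shell_box_def)
  qed (rule nn')
  moreover have "eta ?x > 0" using n by (intro eta_pos) auto
  moreover have "sgn ?x = \<omega>" using \<omega> by (simp add: sgn_scaleR sgn_div_norm)
  ultimately show ?thesis by simp
qed

lemma continuous_on_sph:
  fixes F :: "real \<Rightarrow> 'a::euclidean_space \<Rightarrow> real"
  assumes "continuous_on (U \<times> sphere 0 1) (\<lambda>(r, \<omega>). F r \<omega>)"
  shows "continuous_on U (\<lambda>r. sph (F r))"
  unfolding sph_def shell_box_def
  by (rule integral_continuous_on_param) (rule continuous_on_eta_sgn[OF assms])

lemma DERIV_sph:
  fixes F F' :: "real \<Rightarrow> 'a::euclidean_space \<Rightarrow> real"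
  assumes U: "open U" "convex U" "r \<in> U"
    and d: "\<And>r \<omega>. r \<in> U \<Longrightarrow> \<omega> \<in> sphere 0 1 \<Longrightarrow> ((\<lambda>r. F r \<omega>) has_real_derivative F' r \<omega>) (at r)"
    and c: "\<And>r. r \<in> U \<Longrightarrow> continuous_on (sphere 0 1) (F r)"
    and c': "continuous_on (U \<times> sphere 0 1) (\<lambda>(r, \<omega>). F' r \<omega>)"
  shows "((\<lambda>r. sph (F r)) has_real_derivative sph (F' r)) (at r)"
proof -
  have "((\<lambda>r. integral (cbox (- 3 *\<^sub>R One) (3 *\<^sub>R One)) (\<lambda>x::'a. eta x * F r (sgn x))) has_field_derivative
     integral (cbox (- 3 *\<^sub>R One) (3 *\<^sub>R One)) (\<lambda>x::'a. eta x * F' r (sgn x))) (at r within U)"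
  proof (rule leibniz_rule_field_derivative[OF _ _ _ U(3,2)])
    fix r and x :: 'a assume r: "r \<in> U"
    show "((\<lambda>r. eta x * F r (sgn x)) has_real_derivative eta x * F' r (sgn x)) (at r within U)"
    proof (cases "x = 0")
      case False
      then show ?thesis
        using has_field_derivative_at_within[OF DERIV_cmult[OF d[OF r sgn_sphere]]] by blast
    qed (simp add: eta_eq_0)
    show "(\<lambda>x::'a. eta x * F r (sgn x)) integrable_on cbox (- 3 *\<^sub>R One) (3 *\<^sub>R One)"
      using sph_integrable[OF c[OF r]] by (simp add: shell_box_def)
  qed (rule continuous_on_eta_sgn[OF c'])
  then show ?thesis
    unfolding sph_def shell_box_def using at_within_open[OF U(3,1)] by simp
qed

text \<open>The integral of \<psi> (x + t j) over the box does not depend on small t, since the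
  translated box still contains the support. Its derivative at t = 0 is the integral of the partial
  derivative.\<close>

lemma integral_partial_eq_0:
  fixes \<psi> :: "'a::euclidean_space \<Rightarrow> real"
  assumes d: "\<And>x. (\<psi> has_derivative \<psi>' x) (at x)" and c: "continuous_on UNIV (\<lambda>x. \<psi>' x j)"
    and j: "j \<in> Basis" and supp: "\<And>x. norm x \<ge> 2 \<Longrightarrow> \<psi> x = 0"
  shows "integral shell_box (\<lambda>x. \<psi>' x j) = 0"
proof -
  let ?a = "- 3 *\<^sub>R One :: 'a" and ?b = "3 *\<^sub>R One :: 'a"
  let ?U = "{-1<..<1} :: real set"
  have c\<psi>: "continuous_on S \<psi>" for S
    by (intro continuous_at_imp_continuous_on ballI) (rule has_derivative_continuous[OF d])
  have "((\<lambda>t. integral (cbox ?a ?b) (\<lambda>x. \<psi> (x + t *\<^sub>R j))) has_field_derivative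
      integral (cbox ?a ?b) (\<lambda>x. \<psi>' (x + 0 *\<^sub>R j) j)) (at 0 within ?U)"
  proof (rule leibniz_rule_field_derivative)
    fix t :: real and x :: 'a
    have "((\<lambda>t. x + t *\<^sub>R j) has_derivative (\<lambda>h. h *\<^sub>R j)) (at t within ?U)"
      by (auto intro!: derivative_eq_intros)
    from has_derivative_compose[OF this d]
    have h: "((\<lambda>t. \<psi> (x + t *\<^sub>R j)) has_derivative (\<lambda>h. \<psi>' (x + t *\<^sub>R j) (h *\<^sub>R j))) (at t within ?U)" .
    interpret L: bounded_linear "\<psi>' (x + t *\<^sub>R j)" using d by (rule has_derivative_bounded_linear)
    show "((\<lambda>t. \<psi> (x + t *\<^sub>R j)) has_field_derivative \<psi>' (x + t *\<^sub>R j) j) (at t within ?U)"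
      using h unfolding has_field_derivative_def by (simp add: L.scaleR mult.commute[of _ "\<psi>' (x + t *\<^sub>R j) j"])
    show "(\<lambda>x. \<psi> (x + t *\<^sub>R j)) integrable_on cbox ?a ?b"
      by (intro integrable_continuous continuous_on_compose2[OF c\<psi>[of UNIV]]) (auto intro!: continuous_intros)
  next
    show "continuous_on (?U \<times> cbox ?a ?b) (\<lambda>(t, x). \<psi>' (x + t *\<^sub>R j) j)"
      unfolding split_beta by (rule continuous_on_compose2[OF c]) (auto intro!: continuous_intros)
  qed auto
  then have d0: "((\<lambda>t. integral (cbox ?a ?b) (\<lambda>x. \<psi> (x + t *\<^sub>R j))) has_real_derivative
      integral shell_box (\<lambda>x. \<psi>' x j)) (at 0)"
    by (subst (asm) at_within_open) (auto simp: shell_box_def)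
  have "integral (cbox ?a ?b) (\<lambda>x. \<psi> (x + t *\<^sub>R j)) = integral UNIV \<psi>" if t: "t \<in> ?U" for t
  proof -
    have "integral (cbox ?a ?b) (\<psi> \<circ> (+) (t *\<^sub>R j)) = integral (cbox (?a + t *\<^sub>R j) (?b + t *\<^sub>R j)) \<psi>"
      by (rule integral_shift_cbox_plus)
    also have "\<dots> = integral UNIV \<psi>"
    proof -
      have "\<psi> x = 0" if "x \<notin> cbox (?a + t *\<^sub>R j) (?b + t *\<^sub>R j)" for x
      proof (rule supp, rule ccontr)
        assume n: "\<not> 2 \<le> norm x"
        have "\<bar>x \<bullet> i\<bar> \<le> 2" if "i \<in> Basis" for i using Basis_le_norm[OF that, of x] n by linarith
        moreover have "\<bar>t * (j \<bullet> i)\<bar> \<le> 1" if "i \<in> Basis" for i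
          using t j that by (auto simp: inner_Basis)
        ultimately have "- 3 + t * (j \<bullet> i) \<le> x \<bullet> i \<and> x \<bullet> i \<le> 3 + t * (j \<bullet> i)" if "i \<in> Basis" for i
          using that by (smt (verit, best))
        then have "x \<in> cbox (?a + t *\<^sub>R j) (?b + t *\<^sub>R j)"
          by (simp add: mem_box inner_add_left inner_diff_left)
        then show False using that by simp
      qed
      then have "(\<lambda>x. if x \<in> cbox (?a + t *\<^sub>R j) (?b + t *\<^sub>R j) then \<psi> x else 0) = \<psi>" by auto
      then show ?thesis using integral_restrict_UNIV[of "cbox (?a + t *\<^sub>R j) (?b + t *\<^sub>R j)" \<psi>] by simp
    qed
    finally show ?thesis by (simp add: o_def add.commute)
  qed
  note const = this
  have "((\<lambda>t. integral (cbox ?a ?b) (\<lambda>x. \<psi> (x + t *\<^sub>R j))) has_real_derivative 0) (at 0)"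
  proof (rule has_field_derivative_transform_within_open[OF DERIV_const open_greaterThanLessThan])
    show "integral UNIV \<psi> = integral (cbox ?a ?b) (\<lambda>x. \<psi> (x + t *\<^sub>R j))" if "t \<in> ?U" for t
      by (rule const[OF that, symmetric])
  qed simp
  from DERIV_unique[OF d0 this] show ?thesis .
qed

text \<open>The integrand is the j-derivative of x_i \<open>eta\<close> \<Phi> minus the
  i-derivative of x_j \<open>eta\<close> \<Phi>. The terms from the gradient of \<open>eta\<close>
  are x_i x_j \<open>eta'\<close> \<Phi> in both and cancel, and i differs from j.\<close>

lemma integral_rotation_eq_0:
  fixes \<Phi> :: "'a::euclidean_space \<Rightarrow> real"
  assumes d: "\<And>x. x \<noteq> 0 \<Longrightarrow> (\<Phi> has_derivative \<Phi>' x) (at x)"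
    and c: "\<And>b. continuous_on (- {0}) (\<lambda>x. \<Phi>' x b)"
    and i: "i \<in> Basis" and j: "j \<in> Basis" and ij: "i \<noteq> j"
  shows "integral shell_box (\<lambda>x. eta x * ((x \<bullet> i) * \<Phi>' x j - (x \<bullet> j) * \<Phi>' x i)) = 0"
proof -
  define D where "D = (\<lambda>a x h. (h \<bullet> a) * (eta x * \<Phi> x) + (x \<bullet> a) * ((x \<bullet> h) * eta' x * \<Phi> x + eta x * \<Phi>' x h))"
  have c\<Phi>: "continuous_on (- {0}) \<Phi>"
    by (intro continuous_at_imp_continuous_on ballI) (rule has_derivative_continuous[OF d], simp)
  \<comment> \<open>Nothing is known about \<Phi> at the origin, but the product vanishes on the
    unit ball, so its derivative there is 0.\<close>
  have dD: "((\<lambda>x. (x \<bullet> a) * (eta x * \<Phi> x)) has_derivative (if x = 0 then (\<lambda>_. 0) else D a x)) (at x)" for a x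
  proof (cases "x = 0")
    case False
    have "((\<lambda>x. (x \<bullet> a) * (eta x * \<Phi> x)) has_derivative
        (\<lambda>h. (x \<bullet> a) * (eta x * \<Phi>' x h + ((x \<bullet> h) * eta' x) * \<Phi> x) + (h \<bullet> a) * (eta x * \<Phi> x))) (at x)"
      by (intro has_derivative_mult has_derivative_inner_left has_derivative_ident has_derivative_eta d False)
    then show ?thesis
      using False by (simp add: D_def add_ac mult_ac distrib_left)
  next
    case True
    have "((\<lambda>_. 0) has_derivative (\<lambda>_. 0)) (at x)" by simp
    then have "((\<lambda>x. (x \<bullet> a) * (eta x * \<Phi> x)) has_derivative (\<lambda>_. 0)) (at x)"
      by (rule has_derivative_transform_within_open[of _ _ _ UNIV "ball 0 1"]) (auto simp: True eta_eq_0)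
    then show ?thesis using True by simp
  qed
  have z: "integral shell_box (\<lambda>x. (if x = 0 then (\<lambda>_. 0) else D a x) b) = 0"
    and cD: "continuous_on UNIV (\<lambda>x. (if x = 0 then (\<lambda>_. 0) else D a x) b)"
    if b: "b \<in> Basis" for a b
  proof -
    have "continuous_on (- {0}) (\<lambda>x. (if x = 0 then (\<lambda>_. 0) else D a x) b) \<longleftrightarrow> continuous_on (- {0}) (\<lambda>x. D a x b)"
      by (rule continuous_on_cong) auto
    moreover have "continuous_on (- {0}) (\<lambda>x. D a x b)"
      unfolding D_def by (intro continuous_intros c\<Phi> c continuous_on_eta continuous_on_eta')
    ultimately have c1: "continuous_on (- {0}) (\<lambda>x. (if x = 0 then (\<lambda>_. 0) else D a x) b)" by simp
    have "continuous_on (ball 0 1) (\<lambda>x. (if x = 0 then (\<lambda>_. 0) else D a x) b) \<longleftrightarrow> continuous_on (ball 0 1) (\<lambda>_::'a. 0::real)"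
      by (rule continuous_on_cong) (auto simp: D_def eta_eq_0)
    then have c2: "continuous_on (ball 0 1) (\<lambda>x. (if x = 0 then (\<lambda>_. 0) else D a x) b)" by simp
    have "continuous_on (- {0} \<union> ball 0 1) (\<lambda>x. (if x = 0 then (\<lambda>_. 0) else D a x) b)"
      by (rule continuous_on_open_Un) (use c1 c2 in auto)
    moreover have "- {0} \<union> ball 0 1 = (UNIV :: 'a set)" by auto
    ultimately show cont: "continuous_on UNIV (\<lambda>x. (if x = 0 then (\<lambda>_. 0) else D a x) b)" by simp
    show "integral shell_box (\<lambda>x. (if x = 0 then (\<lambda>_. 0) else D a x) b) = 0"
      by (rule integral_partial_eq_0[OF dD cont b]) (simp add: eta_eq_0)
  qed
  have "eta x * ((x \<bullet> i) * \<Phi>' x j - (x \<bullet> j) * \<Phi>' x i)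
    = (if x = 0 then (\<lambda>_. 0) else D i x) j - (if x = 0 then (\<lambda>_. 0) else D j x) i" for x
    using i j ij by (auto simp: D_def inner_Basis eta_eq_0 algebra_simps)
  moreover have "integral shell_box (\<lambda>x. (if x = 0 then (\<lambda>_. 0) else D i x) j - (if x = 0 then (\<lambda>_. 0) else D j x) i) = 0"
  proof (subst Henstock_Kurzweil_Integration.integral_diff)
    show "(\<lambda>x. (if x = 0 then (\<lambda>_. 0) else D i x) j) integrable_on shell_box"
      "(\<lambda>x. (if x = 0 then (\<lambda>_. 0) else D j x) i) integrable_on shell_box"
      unfolding shell_box_def
      by (intro integrable_continuous continuous_on_subset[OF cD[OF j]] continuous_on_subset[OF cD[OF i]]; simp)+
    show "integral shell_box (\<lambda>x. (if x = 0 then (\<lambda>_. 0) else D i x) j)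
      - integral shell_box (\<lambda>x. (if x = 0 then (\<lambda>_. 0) else D j x) i) = 0"
      unfolding z[OF i] z[OF j] by simp
  qed
  ultimately show ?thesis by simp
qed

section \<open>The Laplacian in polar form\<close>

text \<open>Generator of the rotations in the plane of the coordinates i and j; \<open>euler\<close>
  below is r times the radial derivative.\<close>

definition rot :: "'a \<Rightarrow> 'a \<Rightarrow> ('a::euclidean_space \<Rightarrow> real) \<Rightarrow> 'a \<Rightarrow> real" where
  "rot i j f x = (x \<bullet> i) * partial_deriv j f x - (x \<bullet> j) * partial_deriv i f x"

definition euler :: "('a::euclidean_space \<Rightarrow> real) \<Rightarrow> 'a \<Rightarrow> real" where
  "euler f x = (\<Sum>i\<in>Basis. (x \<bullet> i) * partial_deriv i f x)"

lemma Ck_on_diff: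
  assumes "open S" "Ck_on n S f" "Ck_on n S g"
  shows "Ck_on n S (\<lambda>x. f x - g x)"
  using Ck_on_add[OF assms(1,2) Ck_on_cmult[OF assms(1,3), of "-1"]] by simp

lemma Ck_on_rot:
  assumes "open S" "Ck_on (Suc n) S f" "i \<in> Basis" "j \<in> Basis"
  shows "Ck_on n S (rot i j f)"
  unfolding rot_def[abs_def]
  by (intro Ck_on_diff Ck_on_mult assms(1) Ck_on_inner Ck_on_partial[OF assms(2)] assms)

lemma Ck_on_euler:
  assumes "open S" "Ck_on (Suc n) S f" shows "Ck_on n S (euler f)"
  unfolding euler_def[abs_def]
  by (intro Ck_on_sum Ck_on_mult assms(1) Ck_on_inner Ck_on_partial[OF assms(2)])

definition dsgn :: "'a::euclidean_space \<Rightarrow> 'a \<Rightarrow> 'a" where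
  "dsgn x h = inverse (norm x) *\<^sub>R h - ((x \<bullet> h) * inverse (norm x) ^ 3) *\<^sub>R x"

lemma has_derivative_sgn:
  fixes x :: "'a::euclidean_space"
  assumes "x \<noteq> 0" shows "(sgn has_derivative dsgn x) (at x)"
proof -
  have p: "x \<bullet> x > 0" "norm x > 0" using assms by auto
  have "((\<lambda>z. inverse (sqrt z)) has_real_derivative - (inverse (norm x) ^ 3 / 2)) (at (x \<bullet> x))"
    using p by (auto intro!: derivative_eq_intros simp: norm_eq_sqrt_inner[symmetric] divide_simps power3_eq_cube
      simp del: inner_gt_zero_iff)
  from has_derivative_radial[OF this]
  have "((\<lambda>x. inverse (norm x)) has_derivative (\<lambda>h. - ((x \<bullet> h) * inverse (norm x) ^ 3))) (at x)"
    by (simp add: norm_eq_sqrt_inner[symmetric])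
  from has_derivative_scaleR[OF this has_derivative_ident] show ?thesis
    unfolding sgn_div_norm[abs_def]
    by (rule has_derivative_eq_rhs) (auto simp: fun_eq_iff dsgn_def)
qed

text \<open>Rotation fields are tangent to spheres about the origin, so the radial terms of
  \<open>dsgn\<close> cancel.\<close>

lemma dsgn_rot: "(x \<bullet> i) *\<^sub>R dsgn x j - (x \<bullet> j) *\<^sub>R dsgn x i = (sgn x \<bullet> i) *\<^sub>R j - (sgn x \<bullet> j) *\<^sub>R i"
  by (simp add: dsgn_def sgn_div_norm scaleR_diff_right mult_ac)

text \<open>The map x to f (r x/|x|) carries the values of f on the sphere of radius r to all of
  space except 0. Rotations commute with this extension, so its rotational derivative is given by
  \<open>rot i j f\<close> on that sphere.\<close>

lemma sgn_comp:
  fixes f :: "'a::euclidean_space \<Rightarrow> real"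
  assumes S: "open S" and f: "Ck_on 1 S f" and r: "\<forall>\<omega>\<in>sphere 0 1. r *\<^sub>R \<omega> \<in> S"
  defines "D \<equiv> \<lambda>x h. \<Sum>b\<in>Basis. (r * (dsgn x h \<bullet> b)) * partial_deriv b f (r *\<^sub>R sgn x)"
  shows "x \<noteq> 0 \<Longrightarrow> ((\<lambda>x. f (r *\<^sub>R sgn x)) has_derivative D x) (at x)"
    and "continuous_on (- {0}) (\<lambda>x. D x h)"
    and "i \<in> Basis \<Longrightarrow> j \<in> Basis \<Longrightarrow> x \<noteq> 0 \<Longrightarrow> (x \<bullet> i) * D x j - (x \<bullet> j) * D x i = rot i j f (r *\<^sub>R sgn x)"
proof -
  have rS: "r *\<^sub>R sgn x \<in> S" if "x \<noteq> 0" for x by (rule bspec[OF r sgn_sphere[OF that]])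
  show "((\<lambda>x. f (r *\<^sub>R sgn x)) has_derivative D x) (at x)" if x: "x \<noteq> 0"
  proof -
    have "((\<lambda>x. r *\<^sub>R sgn x) has_derivative (\<lambda>h. r *\<^sub>R dsgn x h)) (at x)"
      by (intro has_derivative_scaleR_right has_derivative_sgn x)
    moreover have "(f has_derivative (\<lambda>h. \<Sum>b\<in>Basis. (h \<bullet> b) * partial_deriv b f (r *\<^sub>R sgn x))) (at (r *\<^sub>R sgn x))"
      using Ck_on_differentiable[OF f _ rS[OF x]] by (intro has_derivative_partial) simp
    ultimately have "((\<lambda>x. f (r *\<^sub>R sgn x)) has_derivative
        (\<lambda>h. \<Sum>b\<in>Basis. ((r *\<^sub>R dsgn x h) \<bullet> b) * partial_deriv b f (r *\<^sub>R sgn x))) (at x)"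
      by (rule has_derivative_compose)
    then show ?thesis by (simp add: D_def)
  qed
  have c: "continuous_on (- {0}) (\<lambda>x. partial_deriv b f (r *\<^sub>R sgn x))" if "b \<in> Basis" for b
  proof (rule continuous_on_compose2[of S "partial_deriv b f"])
    show "continuous_on S (partial_deriv b f)" using f that by simp
    show "continuous_on (- {0}) (\<lambda>x::'a. r *\<^sub>R sgn x)" by (intro continuous_on_scaleR continuous_on_const continuous_on_sgn_nz)
  qed (use rS in auto)
  have c': "continuous_on (- {0}) (\<lambda>x. dsgn x h)"
    unfolding dsgn_def by (intro continuous_intros) auto
  show "continuous_on (- {0}) (\<lambda>x. D x h)"
    unfolding D_def by (intro continuous_on_sum continuous_on_mult continuous_on_const continuous_on_inner c c')
  assume ij: "i \<in> Basis" "j \<in> Basis" and x: "x \<noteq> 0"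
  have "(x \<bullet> i) * D x j - (x \<bullet> j) * D x i
    = (\<Sum>b\<in>Basis. (r * (((x \<bullet> i) *\<^sub>R dsgn x j - (x \<bullet> j) *\<^sub>R dsgn x i) \<bullet> b)) * partial_deriv b f (r *\<^sub>R sgn x))"
    unfolding D_def sum_distrib_left sum_subtractf[symmetric]
    by (rule sum.cong) (auto simp: inner_diff_left algebra_simps)
  also have "\<dots> = (\<Sum>b\<in>Basis. r * (sgn x \<bullet> i) * ((j \<bullet> b) * partial_deriv b f (r *\<^sub>R sgn x)))
     - (\<Sum>b\<in>Basis. r * (sgn x \<bullet> j) * ((i \<bullet> b) * partial_deriv b f (r *\<^sub>R sgn x)))"
    unfolding dsgn_rot sum_subtractf[symmetric]
    by (rule sum.cong) (auto simp: inner_diff_left algebra_simps)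
  also have "\<dots> = rot i j f (r *\<^sub>R sgn x)"
    using ij by (simp add: rot_def sum_distrib_left[symmetric] inner_Basis if_distrib if_distribR sum.delta' cong: if_cong)
  finally show "(x \<bullet> i) * D x j - (x \<bullet> j) * D x i = rot i j f (r *\<^sub>R sgn x)" .
qed

lemma continuous_on_sphere_scale:
  fixes f :: "'a::real_normed_vector \<Rightarrow> 'b::topological_space"
  assumes "continuous_on S f" "\<forall>\<omega>\<in>sphere 0 1. r *\<^sub>R \<omega> \<in> S"
  shows "continuous_on (sphere 0 1) (\<lambda>\<omega>. f (r *\<^sub>R \<omega>))"
proof (rule continuous_on_compose2[OF assms(1)])
  show "continuous_on (sphere 0 1) (\<lambda>\<omega>::'a. r *\<^sub>R \<omega>)" by (rule continuous_on_scaleR[OF continuous_on_const continuous_on_id])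
qed (use assms(2) in auto)

text \<open>Integration by parts on the sphere: the rotational derivative of the product integrates
  to zero and obeys the product rule, so \<open>rot i j\<close> is skew-symmetric for
  \<open>sph\<close>.\<close>

lemma sph_rot:
  fixes f p :: "'a::euclidean_space \<Rightarrow> real"
  assumes S: "open S" and f: "Ck_on 1 S f" and r: "\<forall>\<omega>\<in>sphere 0 1. r *\<^sub>R \<omega> \<in> S"
    and p: "Ck_on 1 UNIV p" and ij: "i \<in> Basis" "j \<in> Basis"
  shows "sph (\<lambda>\<omega>. rot i j f (r *\<^sub>R \<omega>) * p \<omega>) = - sph (\<lambda>\<omega>. f (r *\<^sub>R \<omega>) * rot i j p \<omega>)"
proof (cases "i = j")
  case True
  then show ?thesis by (simp add: rot_def)
next
  case False
  let ?D = "\<lambda>x h. \<Sum>b\<in>Basis. (r * (dsgn x h \<bullet> b)) * partial_deriv b f (r *\<^sub>R sgn x)"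
  let ?E = "\<lambda>x h. \<Sum>b\<in>Basis. (1 * (dsgn x h \<bullet> b)) * partial_deriv b p (1 *\<^sub>R sgn x)"
  have U: "\<forall>\<omega>\<in>sphere 0 1. 1 *\<^sub>R \<omega> \<in> (UNIV :: 'a set)" by simp
  note A = sgn_comp[OF S f r] and B = sgn_comp[OF open_UNIV p U]
  let ?\<Phi> = "\<lambda>x. f (r *\<^sub>R sgn x) * p (1 *\<^sub>R sgn x)"
  let ?\<Phi>' = "\<lambda>x h. f (r *\<^sub>R sgn x) * ?E x h + ?D x h * p (1 *\<^sub>R sgn x)"
  have d: "(?\<Phi> has_derivative ?\<Phi>' x) (at x)" if "x \<noteq> 0" for x
    by (rule has_derivative_mult[OF A(1)[OF that] B(1)[OF that]])
  have cA: "continuous_on (- {0}) (\<lambda>x. f (r *\<^sub>R sgn x))"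
    by (intro continuous_at_imp_continuous_on ballI) (rule has_derivative_continuous[OF A(1)], simp)
  have cB: "continuous_on (- {0}) (\<lambda>x. p (1 *\<^sub>R sgn x))"
    by (intro continuous_at_imp_continuous_on ballI) (rule has_derivative_continuous[OF B(1)], simp)
  have c: "continuous_on (- {0}) (\<lambda>x. ?\<Phi>' x h)" for h
    by (intro continuous_on_add continuous_on_mult cA cB A(2) B(2))
  have z: "integral shell_box (\<lambda>x. eta x * ((x \<bullet> i) * ?\<Phi>' x j - (x \<bullet> j) * ?\<Phi>' x i)) = 0"
    by (rule integral_rotation_eq_0[of ?\<Phi> ?\<Phi>', OF d c ij False])
  have eq: "eta x * ((x \<bullet> i) * ?\<Phi>' x j - (x \<bullet> j) * ?\<Phi>' x i) =
     eta x * (\<lambda>\<omega>. rot i j f (r *\<^sub>R \<omega>) * p \<omega> + f (r *\<^sub>R \<omega>) * rot i j p \<omega>) (sgn x)" for x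
  proof (cases "x = 0")
    case x: False
    have alg: "a * (F * E1 + D1 * q) - b * (F * E2 + D2 * q) = F * (a * E1 - b * E2) + (a * D1 - b * D2) * q"
      for a b F E1 E2 D1 D2 q :: real by (simp add: algebra_simps)
    have "(x \<bullet> i) * ?\<Phi>' x j - (x \<bullet> j) * ?\<Phi>' x i
      = f (r *\<^sub>R sgn x) * ((x \<bullet> i) * ?E x j - (x \<bullet> j) * ?E x i) + ((x \<bullet> i) * ?D x j - (x \<bullet> j) * ?D x i) * p (1 *\<^sub>R sgn x)"
      by (rule alg)
    also have "\<dots> = f (r *\<^sub>R sgn x) * rot i j p (1 *\<^sub>R sgn x) + rot i j f (r *\<^sub>R sgn x) * p (1 *\<^sub>R sgn x)"
      unfolding A(3)[OF ij x] B(3)[OF ij x] ..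
    finally show ?thesis by simp
  qed (simp add: eta_eq_0)
  have cf: "continuous_on S (rot i j f)" "continuous_on UNIV (rot i j p)"
    using Ck_on_rot[OF S f[unfolded One_nat_def] ij] Ck_on_rot[OF open_UNIV p[unfolded One_nat_def] ij] by simp_all
  have cp: "continuous_on (sphere 0 1) p" "continuous_on (sphere 0 1) (rot i j p)"
    using Ck_on_imp_continuous_on[OF p] cf(2) continuous_on_subset by blast+
  have "sph (\<lambda>\<omega>. rot i j f (r *\<^sub>R \<omega>) * p \<omega> + f (r *\<^sub>R \<omega>) * rot i j p \<omega>) = 0"
    using z unfolding eq sph_def .
  moreover have "sph (\<lambda>\<omega>. rot i j f (r *\<^sub>R \<omega>) * p \<omega> + f (r *\<^sub>R \<omega>) * rot i j p \<omega>)
    = sph (\<lambda>\<omega>. rot i j f (r *\<^sub>R \<omega>) * p \<omega>) + sph (\<lambda>\<omega>. f (r *\<^sub>R \<omega>) * rot i j p \<omega>)"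
    by (intro sph_add continuous_on_mult cp continuous_on_sphere_scale[OF cf(1) r]
        continuous_on_sphere_scale[OF Ck_on_imp_continuous_on[OF f] r])
  ultimately show ?thesis by linarith
qed

lemma rot_rot:
  fixes v :: "'a::euclidean_space \<Rightarrow> real"
  assumes S: "open S" "x \<in> S" and v: "Ck_on 2 S v" and ij: "i \<in> Basis" "j \<in> Basis"
  shows "rot i j (rot i j v) x =
    (x \<bullet> i) * ((i \<bullet> j) * partial_deriv j v x + (x \<bullet> i) * partial_deriv j (partial_deriv j v) x
        - partial_deriv i v x - (x \<bullet> j) * partial_deriv j (partial_deriv i v) x)
    - (x \<bullet> j) * (partial_deriv j v x + (x \<bullet> i) * partial_deriv i (partial_deriv j v) x
        - (i \<bullet> j) * partial_deriv i v x - (x \<bullet> j) * partial_deriv i (partial_deriv i v) x)"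
proof -
  have d: "partial_deriv b v differentiable (at x)" if "b \<in> Basis" for b
    using v S that unfolding numeral_2_eq_2 by auto
  have dx: "(\<lambda>x. x \<bullet> b) differentiable (at x)" for b :: 'a
    using Ck_on_differentiable[OF Ck_on_inner[of 1 UNIV b]] by auto
  have pd: "partial_deriv a (\<lambda>x. (x \<bullet> b) * partial_deriv e v x) x = (a \<bullet> b) * partial_deriv e v x + (x \<bullet> b) * partial_deriv a (partial_deriv e v) x"
    if "e \<in> Basis" for a b e
    using partial_deriv_mult[OF dx d[OF that], of a b] by simp
  have df: "(\<lambda>x. (x \<bullet> b) * partial_deriv e v x) differentiable (at x)" if "e \<in> Basis" for b e
    by (intro differentiable_mult dx d that)
  have m: "partial_deriv a (\<lambda>x. f x - g x) x = partial_deriv a f x - partial_deriv a g x"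
    if "f differentiable (at x)" "g differentiable (at x)" for a and f g :: "'a \<Rightarrow> real"
    using has_derivative_diff[OF that[unfolded frechet_derivative_works]]
    by (subst partial_derivI) (auto simp: partial_deriv_def)
  have pr: "partial_deriv a (rot i j v) x = ((a \<bullet> i) * partial_deriv j v x + (x \<bullet> i) * partial_deriv a (partial_deriv j v) x)
      - ((a \<bullet> j) * partial_deriv i v x + (x \<bullet> j) * partial_deriv a (partial_deriv i v) x)" for a
    unfolding rot_def[abs_def] m[OF df[OF ij(2)] df[OF ij(1)]] pd[OF ij(1)] pd[OF ij(2)] ..
  show ?thesis
    unfolding rot_def[of i j "rot i j v"] pr using ij by (simp add: inner_commute[of j i] algebra_simps)
qed

lemma euler_euler:
  fixes v :: "'a::euclidean_space \<Rightarrow> real"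
  assumes S: "open S" "x \<in> S" and v: "Ck_on 2 S v"
  shows "euler (euler v) x = euler v x + (\<Sum>i\<in>Basis. \<Sum>j\<in>Basis. (x \<bullet> i) * (x \<bullet> j) * partial_deriv i (partial_deriv j v) x)"
proof -
  have d: "partial_deriv b v differentiable (at x)" if "b \<in> Basis" for b
    using v S that unfolding numeral_2_eq_2 by auto
  have dx: "(\<lambda>x. x \<bullet> b) differentiable (at x)" for b :: 'a
    using Ck_on_differentiable[OF Ck_on_inner[of 1 UNIV b]] by auto
  have pd: "partial_deriv a (\<lambda>x. (x \<bullet> b) * partial_deriv b v x) x = (a \<bullet> b) * partial_deriv b v x + (x \<bullet> b) * partial_deriv a (partial_deriv b v) x"
    if "b \<in> Basis" for a b
    using partial_deriv_mult[OF dx d[OF that], of a b] by simp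
  have "partial_deriv i (euler v) x = (\<Sum>j\<in>Basis. (i \<bullet> j) * partial_deriv j v x + (x \<bullet> j) * partial_deriv i (partial_deriv j v) x)" for i
    unfolding euler_def[abs_def] using d dx pd by (subst partial_deriv_sum) (auto intro: differentiable_mult)
  also have "\<dots> i = partial_deriv i v x + (\<Sum>j\<in>Basis. (x \<bullet> j) * partial_deriv i (partial_deriv j v) x)" if "i \<in> Basis" for i
    unfolding sum.distrib using that by (simp add: inner_Basis if_distrib if_distribR sum.delta' cong: if_cong)
  finally have "partial_deriv i (euler v) x = partial_deriv i v x + (\<Sum>j\<in>Basis. (x \<bullet> j) * partial_deriv i (partial_deriv j v) x)"
    if "i \<in> Basis" for i using that by blast
  then show ?thesis
    unfolding euler_def[of "euler v"] by (simp add: distrib_left sum.distrib euler_def sum_distrib_left mult.assoc)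
qed

text \<open>Splits |x|^2 times the Laplacian into a radial part and a part tangent to spheres; the
  division by 2 makes up for counting each pair (i, j) in both orders.\<close>

lemma laplacian_polar:
  fixes v :: "'a::euclidean_space \<Rightarrow> real"
  assumes S: "open S" "x \<in> S" and v: "Ck_on 2 S v"
  shows "euler (euler v) x + (real DIM('a) - 2) * euler v x
     + (\<Sum>i\<in>Basis. \<Sum>j\<in>Basis. rot i j (rot i j v) x) / 2 = (x \<bullet> x) * laplacian v x"
proof -
  let ?H = "\<Sum>i\<in>Basis. \<Sum>j\<in>Basis. (x \<bullet> i) * (x \<bullet> j) * partial_deriv i (partial_deriv j v) x"
  let ?N = "real DIM('a)"
  have xx: "(\<Sum>i\<in>Basis. (x \<bullet> i) * (x \<bullet> i)) = x \<bullet> x" by (rule euclidean_inner[symmetric])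
  have "(\<Sum>i\<in>Basis. \<Sum>j\<in>Basis. rot i j (rot i j v) x) =
    (\<Sum>i\<in>Basis. \<Sum>j\<in>Basis. (x \<bullet> i) * ((i \<bullet> j) * partial_deriv j v x))
    + (\<Sum>i\<in>Basis. \<Sum>j\<in>Basis. (x \<bullet> i) * (x \<bullet> i) * partial_deriv j (partial_deriv j v) x)
    - (\<Sum>i\<in>Basis. \<Sum>j::'a\<in>Basis. (x \<bullet> i) * partial_deriv i v x)
    - (\<Sum>i\<in>Basis. \<Sum>j\<in>Basis. (x \<bullet> j) * (x \<bullet> i) * partial_deriv j (partial_deriv i v) x)
    - (\<Sum>i::'a\<in>Basis. \<Sum>j\<in>Basis. (x \<bullet> j) * partial_deriv j v x)
    - ?H
    + (\<Sum>i\<in>Basis. \<Sum>j\<in>Basis. (x \<bullet> j) * ((i \<bullet> j) * partial_deriv i v x))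
    + (\<Sum>i\<in>Basis. \<Sum>j\<in>Basis. (x \<bullet> j) * (x \<bullet> j) * partial_deriv i (partial_deriv i v) x)"
    unfolding sum.distrib[symmetric] sum_subtractf[symmetric]
    by (intro sum.cong refl) (simp add: rot_rot[OF S v] algebra_simps)
  moreover have "(\<Sum>i\<in>Basis. \<Sum>j\<in>Basis. (x \<bullet> i) * ((i \<bullet> j) * partial_deriv j v x)) = euler v x"
    by (simp add: euler_def sum_distrib_left[symmetric] inner_Basis if_distrib if_distribR sum.delta' cong: if_cong)
  moreover have "(\<Sum>i\<in>Basis. \<Sum>j\<in>Basis. (x \<bullet> j) * ((i \<bullet> j) * partial_deriv i v x)) = euler v x"
    by (simp add: euler_def inner_Basis if_distrib if_distribR sum.delta' cong: if_cong)
  moreover have "(\<Sum>i\<in>Basis. \<Sum>j\<in>Basis. (x \<bullet> i) * (x \<bullet> i) * partial_deriv j (partial_deriv j v) x) = (x \<bullet> x) * laplacian v x"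
    by (simp add: laplacian_def xx sum_distrib_left[symmetric] sum_distrib_right[symmetric])
  moreover have "(\<Sum>i\<in>Basis. \<Sum>j\<in>Basis. (x \<bullet> j) * (x \<bullet> j) * partial_deriv i (partial_deriv i v) x) = (x \<bullet> x) * laplacian v x"
    by (simp add: laplacian_def xx sum_distrib_left[symmetric] sum_distrib_right[symmetric])
  moreover have "(\<Sum>i\<in>Basis. \<Sum>j::'a\<in>Basis. (x \<bullet> i) * partial_deriv i v x) = ?N * euler v x"
    by (simp add: euler_def sum_distrib_left)
  moreover have "(\<Sum>i::'a\<in>Basis. \<Sum>j\<in>Basis. (x \<bullet> j) * partial_deriv j v x) = ?N * euler v x"
    by (simp add: euler_def)
  moreover have "(\<Sum>i\<in>Basis. \<Sum>j\<in>Basis. (x \<bullet> j) * (x \<bullet> i) * partial_deriv j (partial_deriv i v) x) = ?H"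
    by (rule sum.swap)
  ultimately show ?thesis
    unfolding euler_euler[OF S v] by (simp add: field_simps)
qed

text \<open>The sum runs over ordered pairs, so on the unit sphere this is twice the
  Laplace-Beltrami operator.\<close>

definition sphere_laplacian :: "('a::euclidean_space \<Rightarrow> real) \<Rightarrow> 'a \<Rightarrow> real" where
  "sphere_laplacian v x = (\<Sum>i\<in>Basis. \<Sum>j\<in>Basis. rot i j (rot i j v) x)"

text \<open>Each \<open>rot\<close> is moved across by \<open>sph_rot\<close> twice, and the two
  signs cancel.\<close>

lemma sph_sphere_laplacian:
  fixes f p :: "'a::euclidean_space \<Rightarrow> real"
  assumes S: "open S" and f: "Ck_on 2 S f" and r: "\<forall>\<omega>\<in>sphere 0 1. r *\<^sub>R \<omega> \<in> S"
    and p: "Ck_on 2 UNIV p"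
  shows "sph (\<lambda>\<omega>. sphere_laplacian f (r *\<^sub>R \<omega>) * p \<omega>) = sph (\<lambda>\<omega>. f (r *\<^sub>R \<omega>) * sphere_laplacian p \<omega>)"
proof -
  have f1: "Ck_on 1 S f" and p1: "Ck_on 1 UNIV p" by (rule Ck_on_le[OF f], simp) (rule Ck_on_le[OF p], simp)
  have rf: "Ck_on 1 S (rot i j f)" and rp: "Ck_on 1 UNIV (rot i j p)" if "i \<in> Basis" "j \<in> Basis" for i j
    using that f p by (auto intro!: Ck_on_rot S simp: numeral_2_eq_2 simp del: Ck_on.simps)
  have cf: "continuous_on (sphere 0 1) (\<lambda>\<omega>. g (r *\<^sub>R \<omega>))" if "Ck_on n S g" for g n
    by (rule continuous_on_sphere_scale[OF Ck_on_imp_continuous_on[OF that] r])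
  have cp: "continuous_on (sphere 0 1) q" if "Ck_on n UNIV q" for q :: "'a \<Rightarrow> real" and n
    using Ck_on_imp_continuous_on[OF that] continuous_on_subset by blast
  have rrf: "Ck_on 0 S (rot i j (rot i j f))" and rrp: "Ck_on 0 UNIV (rot i j (rot i j p))" if "i \<in> Basis" "j \<in> Basis" for i j
    using rf[OF that] rp[OF that] that by (auto intro!: Ck_on_rot S simp del: Ck_on.simps)
  have c1: "continuous_on (sphere 0 1) (\<lambda>\<omega>. rot i j (rot i j f) (r *\<^sub>R \<omega>) * p \<omega>)" if "i \<in> Basis" "j \<in> Basis" for i j
    by (intro continuous_on_mult cf[OF rrf] cp[OF p] that)
  have c2: "continuous_on (sphere 0 1) (\<lambda>\<omega>. f (r *\<^sub>R \<omega>) * rot i j (rot i j p) \<omega>)" if "i \<in> Basis" "j \<in> Basis" for i j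
    by (intro continuous_on_mult cp[OF rrp] cf[OF f] that)
  have eq: "sph (\<lambda>\<omega>. rot i j (rot i j f) (r *\<^sub>R \<omega>) * p \<omega>) = sph (\<lambda>\<omega>. f (r *\<^sub>R \<omega>) * rot i j (rot i j p) \<omega>)"
    if "i \<in> Basis" "j \<in> Basis" for i j
    using sph_rot[OF S rf r p1, of i j i j] sph_rot[OF S f1 r rp, of i j i j] that by simp
  have "sph (\<lambda>\<omega>. sphere_laplacian f (r *\<^sub>R \<omega>) * p \<omega>)
    = (\<Sum>i\<in>Basis. \<Sum>j\<in>Basis. sph (\<lambda>\<omega>. rot i j (rot i j f) (r *\<^sub>R \<omega>) * p \<omega>))"
    unfolding sphere_laplacian_def sum_distrib_right
    by (subst sph_sum, intro continuous_on_sum c1, assumption+, intro sum.cong refl sph_sum c1)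
  also have "\<dots> = (\<Sum>i\<in>Basis. \<Sum>j\<in>Basis. sph (\<lambda>\<omega>. f (r *\<^sub>R \<omega>) * rot i j (rot i j p) \<omega>))"
    by (intro sum.cong refl eq)
  also have "\<dots> = sph (\<lambda>\<omega>. f (r *\<^sub>R \<omega>) * sphere_laplacian p \<omega>)"
    unfolding sphere_laplacian_def sum_distrib_left
    by (subst sph_sum, intro continuous_on_sum c2, assumption+, intro sum.cong refl sph_sum[symmetric] c2)
  finally show ?thesis .
qed

text \<open>In \<open>laplacian_polar\<close> the Laplacian vanishes and \<open>euler\<close>
  multiplies by k, so k^2 + (N - 2) k plus half the eigenvalue is zero, N being the
  dimension.\<close>

lemma sphere_laplacian_harmonic:
  fixes P :: "'a::euclidean_space \<Rightarrow> real"
  assumes P: "harmonic_homogeneous_poly k P"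
  shows "sphere_laplacian P x = - 2 * (real k * (real k + real DIM('a) - 2)) * P x"
proof -
  note D = harmonic_homogeneous_polyD[OF P]
  have e: "euler P = (\<lambda>x. real k * P x)" by (simp add: euler_def[abs_def] D(4))
  have dP: "P differentiable (at x)" for x using Ck_on_differentiable[OF D(1)[of 1]] by simp
  have "euler (\<lambda>x. real k * P x) x = real k * euler P x"
    by (simp add: euler_def partial_deriv_cmult[OF dP] sum_distrib_left mult.left_commute)
  then have "euler (euler P) x = real k * (real k * P x)" by (simp add: e)
  then show ?thesis
    using laplacian_polar[OF open_UNIV UNIV_I D(1), of x] unfolding e D(3) sphere_laplacian_def
    by (simp add: algebra_simps)
qed

lemma DERIV_sph_scale:
  fixes v P :: "'a::euclidean_space \<Rightarrow> real"
  assumes v: "Ck_on 1 (ball 0 1) v" and P: "continuous_on (sphere 0 1) P" and r: "0 < r" "r < 1"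
  shows "((\<lambda>r. sph (\<lambda>\<omega>. v (r *\<^sub>R \<omega>) * P \<omega>)) has_real_derivative sph (\<lambda>\<omega>. euler v (r *\<^sub>R \<omega>) * P \<omega>) / r) (at r)"
proof -
  let ?F' = "\<lambda>r \<omega>. (\<Sum>i\<in>Basis. (\<omega> \<bullet> i) * partial_deriv i v (r *\<^sub>R \<omega>)) * P \<omega>"
  have in_ball: "r *\<^sub>R \<omega> \<in> ball 0 1" if "r \<in> {0<..<1}" "\<omega> \<in> sphere 0 1" for r and \<omega> :: 'a using that by simp
  have "((\<lambda>r. sph (\<lambda>\<omega>. v (r *\<^sub>R \<omega>) * P \<omega>)) has_real_derivative sph (?F' r)) (at r)"
  proof (rule DERIV_sph[of "{0<..<1}"])
    fix r :: real and \<omega> :: 'a assume r: "r \<in> {0<..<1}" and \<omega>: "\<omega> \<in> sphere 0 1"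
    have "((\<lambda>r. r *\<^sub>R \<omega>) has_derivative (\<lambda>h. h *\<^sub>R \<omega>)) (at r)"
      by (rule bounded_linear_imp_has_derivative) (rule bounded_linear_scaleR_left)
    moreover have "(v has_derivative (\<lambda>h. \<Sum>i\<in>Basis. (h \<bullet> i) * partial_deriv i v (r *\<^sub>R \<omega>))) (at (r *\<^sub>R \<omega>))"
      by (rule has_derivative_partial[OF Ck_on_differentiable[OF v _ in_ball[OF r \<omega>]]]) simp
    ultimately have "((\<lambda>r. v (r *\<^sub>R \<omega>)) has_derivative (\<lambda>h. \<Sum>i\<in>Basis. ((h *\<^sub>R \<omega>) \<bullet> i) * partial_deriv i v (r *\<^sub>R \<omega>))) (at r)"
      by (rule has_derivative_compose)
    then have "((\<lambda>r. v (r *\<^sub>R \<omega>)) has_real_derivative (\<Sum>i\<in>Basis. (\<omega> \<bullet> i) * partial_deriv i v (r *\<^sub>R \<omega>))) (at r)"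
      unfolding has_field_derivative_def
      by (rule has_derivative_eq_rhs) (auto simp: fun_eq_iff sum_distrib_right sum_distrib_left mult_ac)
    then show "((\<lambda>r. v (r *\<^sub>R \<omega>) * P \<omega>) has_real_derivative ?F' r \<omega>) (at r)"
      by (rule DERIV_cmult_right)
  next
    fix r :: real assume r: "r \<in> {0<..<1}"
    show "continuous_on (sphere 0 1) (\<lambda>\<omega>. v (r *\<^sub>R \<omega>) * P \<omega>)"
      by (intro continuous_on_mult P continuous_on_sphere_scale[OF Ck_on_imp_continuous_on[OF v]] ballI in_ball[OF r])
  next
    have c: "continuous_on ({0<..<1} \<times> sphere 0 1) (\<lambda>p. partial_deriv i v (fst p *\<^sub>R snd p))" if "i \<in> Basis" for i
    proof (rule continuous_on_compose2[of "ball 0 1" "partial_deriv i v"])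
      show "continuous_on (ball 0 1) (partial_deriv i v)" using v that by simp
      show "continuous_on ({0<..<1} \<times> sphere 0 1) (\<lambda>p. fst p *\<^sub>R snd p :: 'a)" by (intro continuous_intros)
      show "(\<lambda>p. fst p *\<^sub>R snd p :: 'a) ` ({0<..<1} \<times> sphere 0 1) \<subseteq> ball 0 1" by auto
    qed
    have cP: "continuous_on ({0<..<1} \<times> sphere 0 1) (\<lambda>p. P (snd p))"
      by (rule continuous_on_compose2[OF P]) (auto intro: continuous_intros)
    show "continuous_on ({0<..<1} \<times> sphere 0 1) (\<lambda>(r, \<omega>). ?F' r \<omega>)"
      unfolding split_beta by (intro continuous_on_mult continuous_on_sum cP c continuous_intros)
  qed (use r in auto)
  moreover have "sph (?F' r) = sph (\<lambda>\<omega>. euler v (r *\<^sub>R \<omega>) * P \<omega>) / r"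
  proof -
    have "?F' r = (\<lambda>\<omega>. (1 / r) * (euler v (r *\<^sub>R \<omega>) * P \<omega>))"
    proof
      fix \<omega>
      have "euler v (r *\<^sub>R \<omega>) = r * (\<Sum>i\<in>Basis. (\<omega> \<bullet> i) * partial_deriv i v (r *\<^sub>R \<omega>))"
        by (simp add: euler_def sum_distrib_left mult.assoc)
      then show "?F' r \<omega> = (1 / r) * (euler v (r *\<^sub>R \<omega>) * P \<omega>)" using r by simp
    qed
    then show ?thesis using sph_cmult[of "1 / r"] by simp
  qed
  ultimately show ?thesis by simp
qed

section \<open>Projection onto spherical harmonics\<close>

text \<open>The equation is written as the system r f' = f1, r f1' = A f - m f1. The Wronskian times
  r^m is constant, and zero at the origin because f1 and y1 vanish there; the factor r^m alone does
  not give this in the plane, where m = 0. So the two solutions are proportional.\<close>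

lemma radial_ode_unique:
  fixes f f1 y y1 A :: "real \<Rightarrow> real"
  assumes df: "\<And>r. 0 < r \<Longrightarrow> r < 1 \<Longrightarrow> (f has_real_derivative f1 r / r) (at r)"
    and df1: "\<And>r. 0 < r \<Longrightarrow> r < 1 \<Longrightarrow> (f1 has_real_derivative (A r * f r - real m * f1 r) / r) (at r)"
    and dy: "\<And>r. 0 < r \<Longrightarrow> r < 1 \<Longrightarrow> (y has_real_derivative y1 r / r) (at r)"
    and dy1: "\<And>r. 0 < r \<Longrightarrow> r < 1 \<Longrightarrow> (y1 has_real_derivative (A r * y r - real m * y1 r) / r) (at r)"
    and c: "continuous_on {0..<1} f" "continuous_on {0..<1} f1" "continuous_on {0..<1} y" "continuous_on {0..<1} y1"
    and 0: "f1 0 = 0" "y1 0 = 0"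
    and nz: "\<And>r. 0 < r \<Longrightarrow> r < 1 \<Longrightarrow> y r \<noteq> 0 \<or> y1 r \<noteq> 0"
  shows "\<exists>c. \<forall>r. 0 < r \<longrightarrow> r < 1 \<longrightarrow> f r = c * y r"
proof -
  define W where "W = (\<lambda>r. r ^ m * (f r * y1 r - y r * f1 r))"
  have dW: "(W has_real_derivative 0) (at r)" if r: "0 < r" "r < 1" for r
  proof -
    have "(W has_real_derivative (real m * r ^ (m - 1)) * (f r * y1 r - y r * f1 r)
       + ((f1 r / r * y1 r + (A r * y r - real m * y1 r) / r * f r) - (y1 r / r * f1 r + (A r * f r - real m * f1 r) / r * y r)) * r ^ m) (at r)"
      unfolding W_def
      by (rule DERIV_mult[OF _ DERIV_diff[OF DERIV_mult[OF df[OF r] dy1[OF r]] DERIV_mult[OF dy[OF r] df1[OF r]]]])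
         (use DERIV_pow[of m r] in simp)
    moreover have "(real m * r ^ (m - 1)) * (f r * y1 r - y r * f1 r)
       + ((f1 r / r * y1 r + (A r * y r - real m * y1 r) / r * f r) - (y1 r / r * f1 r + (A r * f r - real m * f1 r) / r * y r)) * r ^ m = 0"
      using r by (cases m) (auto simp: field_simps)
    ultimately show ?thesis by simp
  qed
  have W0: "f r * y1 r = y r * f1 r" if r: "0 < r" "r < 1" for r
  proof -
    have "continuous_on {0..r} W"
      unfolding W_def by (intro continuous_intros; rule continuous_on_subset[OF c(1)] continuous_on_subset[OF c(2)]
        continuous_on_subset[OF c(3)] continuous_on_subset[OF c(4)]) (use r in auto)
    then have "W r = W 0"
      by (rule DERIV_isconst_end[OF r(1)]) (use r dW in auto)
    then show ?thesis using r 0 by (simp add: W_def)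
  qed
  define d where "d = (\<lambda>r. (y r)\<^sup>2 + (y1 r)\<^sup>2)"
  \<comment> \<open>The factor of proportionality is found by projecting (f, f1) onto (y, y1), which
    never vanishes, whereas y alone may have zeros. Its derivative then turns out to be
    zero.\<close>
  define C where "C = (\<lambda>r. (f r * y r + f1 r * y1 r) / d r)"
  have dpos: "d r > 0" if "0 < r" "r < 1" for r
    using nz[OF that] by (auto simp: d_def intro: add_pos_nonneg add_nonneg_pos)
  have Cf: "f r = C r * y r" "f1 r = C r * y1 r" if r: "0 < r" "r < 1" for r
  proof -
    have "f r * d r = (f r * y r + f1 r * y1 r) * y r" "f1 r * d r = (f r * y r + f1 r * y1 r) * y1 r"
      using W0[OF r] unfolding d_def by algebra+
    then show "f r = C r * y r" "f1 r = C r * y1 r" using dpos[OF r] by (simp_all add: C_def field_simps)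
  qed
  have dC: "(C has_real_derivative 0) (at r)" if r: "0 < r" "r < 1" for r
  proof -
    let ?z = "(A r * y r - real m * y1 r) / r"
    have z: "(A r * f r - real m * f1 r) / r = C r * ?z"
      unfolding Cf(1)[OF r] Cf(2)[OF r] by (simp add: field_simps)
    have dn: "((\<lambda>r. f r * y r + f1 r * y1 r) has_real_derivative
       (f1 r / r * y r + y1 r / r * f r) + ((A r * f r - real m * f1 r) / r * y1 r + ?z * f1 r)) (at r)"
      by (rule DERIV_add[OF DERIV_mult[OF df[OF r] dy[OF r]] DERIV_mult[OF df1[OF r] dy1[OF r]]])
    have dd: "(d has_real_derivative (y1 r / r * y r + y1 r / r * y r) + (?z * y1 r + ?z * y1 r)) (at r)"
      unfolding d_def power2_eq_square
      by (rule DERIV_add[OF DERIV_mult[OF dy[OF r] dy[OF r]] DERIV_mult[OF dy1[OF r] dy1[OF r]]])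
    have n: "f r * y r + f1 r * y1 r = C r * d r" using dpos[OF r] by (simp add: C_def)
    show ?thesis
      unfolding C_def
    proof (rule DERIV_cong[OF DERIV_divide[OF dn dd]])
      show "d r \<noteq> 0" using dpos[OF r] by simp
      have "(f1 r / r * y r + y1 r / r * f r) + ((A r * f r - real m * f1 r) / r * y1 r + ?z * f1 r)
        = C r * ((y1 r / r * y r + y1 r / r * y r) + (?z * y1 r + ?z * y1 r))"
        unfolding z unfolding Cf(1)[OF r] Cf(2)[OF r] by (simp add: distrib_left mult_ac)
      then show "(((f1 r / r * y r + y1 r / r * f r) + ((A r * f r - real m * f1 r) / r * y1 r + ?z * f1 r)) * d r
          - (f r * y r + f1 r * y1 r) * ((y1 r / r * y r + y1 r / r * y r) + (?z * y1 r + ?z * y1 r))) / (d r * d r) = 0"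
        unfolding n by simp
    qed
  qed
  have "C r = C (1 / 2)" if "0 < r" "r < 1" for r
    by (rule DERIV_isconst3[of 0 1]) (use dC that in auto)
  then show ?thesis using Cf(1) by (intro exI[of _ "C (1 / 2)"]) metis
qed

lemma continuous_on_sph_scale:
  fixes v P :: "'a::euclidean_space \<Rightarrow> real"
  assumes v: "continuous_on S v" and P: "continuous_on (sphere 0 1) P"
    and r: "\<And>r \<omega>. r \<in> U \<Longrightarrow> \<omega> \<in> sphere 0 1 \<Longrightarrow> r *\<^sub>R \<omega> \<in> S"
  shows "continuous_on U (\<lambda>r. sph (\<lambda>\<omega>. v (r *\<^sub>R \<omega>) * P \<omega>))"
proof (rule continuous_on_sph)
  have "continuous_on (U \<times> sphere 0 1) (\<lambda>p. v (fst p *\<^sub>R snd p))"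
  proof (rule continuous_on_compose2[OF v])
    show "continuous_on (U \<times> sphere 0 1) (\<lambda>p. fst p *\<^sub>R snd p :: 'a)" by (intro continuous_intros)
  qed (use r in auto)
  moreover have "continuous_on (U \<times> sphere 0 1) (\<lambda>p. P (snd p))"
    by (rule continuous_on_compose2[OF P]) (auto intro: continuous_intros)
  ultimately show "continuous_on (U \<times> sphere 0 1) (\<lambda>(r, \<omega>). v (r *\<^sub>R \<omega>) * P \<omega>)"
    unfolding split_beta by (intro continuous_on_mult)
qed

text \<open>Projecting an eigenfunction of the Laplacian onto a spherical harmonic leaves, by
  symmetry of the spherical Laplacian, a solution of the radial equation; it is regular at the
  origin, hence a multiple of the Bessel solution.\<close>

lemma sph_eigenfunction:
  fixes v P :: "'a::euclidean_space \<Rightarrow> real"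
  assumes v: "Ck_on 2 (ball 0 1) v" and eig: "\<And>x. x \<in> ball 0 1 \<Longrightarrow> laplacian v x = - (4 * a) * v x"
    and a: "a \<noteq> 0" and P: "harmonic_homogeneous_poly k P" and N: "DIM('a) \<ge> 2"
  shows "\<exists>c. \<forall>r. 0 < r \<longrightarrow> r < 1 \<longrightarrow>
     sph (\<lambda>\<omega>. v (r *\<^sub>R \<omega>) * P \<omega>) = c * (r ^ k * bess (nu DIM('a) k) (a * r\<^sup>2))"
proof -
  define \<nu> where "\<nu> = nu DIM('a) k"
  have \<nu>: "\<nu> \<ge> 0" unfolding \<nu>_def by (rule nu_nonneg[OF N])
  have \<nu>k: "2 * \<nu> + 2 = 2 * real k + real DIM('a)" by (simp add: \<nu>_def nu_def field_simps)
  have Nm: "real (DIM('a) - 2) = real DIM('a) - 2" using N by simp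
  note D = harmonic_homogeneous_polyD[OF P]
  have cP: "continuous_on (sphere 0 1) P"
    using Ck_on_imp_continuous_on[OF D(1)] continuous_on_subset by blast
  have v1: "Ck_on 1 (ball 0 1) v" by (rule Ck_on_le[OF v]) simp
  have ev1: "Ck_on 1 (ball 0 1) (euler v)"
    by (rule Ck_on_euler) (use v in \<open>simp_all add: numeral_2_eq_2 del: Ck_on.simps\<close>)
  have in_ball: "r *\<^sub>R \<omega> \<in> ball 0 1" if "0 \<le> r" "r < 1" "\<omega> \<in> sphere 0 1" for r and \<omega> :: 'a
    using that by simp
  define g h k2 where "g = (\<lambda>r. bess \<nu> (a * r\<^sup>2))" and "h = (\<lambda>r. bess (\<nu> + 1) (a * r\<^sup>2))"
    and "k2 = (\<lambda>r. bess (\<nu> + 2) (a * r\<^sup>2))"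
  have dar: "((\<lambda>r. a * r\<^sup>2) has_real_derivative a * (2 * r)) (at r)" for r
    by (auto intro!: derivative_eq_intros)
  have dg: "(g has_real_derivative - h r * (a * (2 * r))) (at r)" for r
    unfolding g_def h_def by (rule DERIV_chain2[OF has_derivative_bess[OF \<nu>] dar])
  have dh: "(h has_real_derivative - k2 r * (a * (2 * r))) (at r)" for r
    using DERIV_chain2[OF has_derivative_bess[of "\<nu> + 1"] dar, of r] \<nu> unfolding h_def k2_def by (simp add: add.assoc)
  have rec: "a * r\<^sup>2 * k2 r = (\<nu> + 1) * h r - g r" for r
    using bess_recurrence[OF \<nu>, of "a * r\<^sup>2"] by (simp add: g_def h_def k2_def)
  define f where "f = (\<lambda>r. sph (\<lambda>\<omega>. v (r *\<^sub>R \<omega>) * P \<omega>))"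
  define f1 where "f1 = (\<lambda>r. sph (\<lambda>\<omega>. euler v (r *\<^sub>R \<omega>) * P \<omega>))"
  \<comment> \<open>The Bessel solution; y1 below is r y', just as f1 is r f'.\<close>
  define y where "y = (\<lambda>r. r ^ k * g r)"
  define \<phi> where "\<phi> = (\<lambda>r. real k * g r - 2 * a * r\<^sup>2 * h r)"
  define y1 where "y1 = (\<lambda>r. r ^ k * \<phi> r)"
  \<comment> \<open>From \<open>laplacian_polar\<close> with both eigenvalues inserted: k (k + N -
    2) comes from the sphere, - 4 a r^2 from the equation for v.\<close>
  define A where "A = (\<lambda>r. real k * (real k + real DIM('a) - 2) - 4 * a * r\<^sup>2)"
  have rk: "((\<lambda>r. r ^ k) has_real_derivative real k * r ^ k / r) (at r)" if "r > 0" for r :: real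
  proof (rule DERIV_cong[OF DERIV_pow])
    show "real k * r ^ (k - Suc 0) = real k * r ^ k / r" using that by (cases k) auto
  qed
  have "\<exists>c. \<forall>r. 0 < r \<longrightarrow> r < 1 \<longrightarrow> f r = c * y r"
  proof (rule radial_ode_unique[of f f1 A "DIM('a) - 2" y y1])
    fix r :: real assume r: "0 < r" "r < 1"
    have r': "\<forall>\<omega>\<in>sphere 0 1. r *\<^sub>R \<omega> \<in> ball (0 :: 'a) 1" using r in_ball by simp
    show "(f has_real_derivative f1 r / r) (at r)"
      unfolding f_def f1_def by (rule DERIV_sph_scale[OF v1 cP r])
    have df1: "(f1 has_real_derivative sph (\<lambda>\<omega>. euler (euler v) (r *\<^sub>R \<omega>) * P \<omega>) / r) (at r)"
      unfolding f1_def by (rule DERIV_sph_scale[OF ev1 cP r])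
    have "sph (\<lambda>\<omega>. euler (euler v) (r *\<^sub>R \<omega>) * P \<omega>) =
      sph (\<lambda>\<omega>. (- 4 * a * r\<^sup>2) * (v (r *\<^sub>R \<omega>) * P \<omega>) + ((- (real DIM('a) - 2)) * (euler v (r *\<^sub>R \<omega>) * P \<omega>)
         + (- 1 / 2) * (sphere_laplacian v (r *\<^sub>R \<omega>) * P \<omega>)))"
    proof (rule sph_cong)
      fix \<omega> :: 'a assume \<omega>: "\<omega> \<in> sphere 0 1"
      have b: "r *\<^sub>R \<omega> \<in> ball 0 1" using r' \<omega> by blast
      have n: "(r *\<^sub>R \<omega>) \<bullet> (r *\<^sub>R \<omega>) = r\<^sup>2" using \<omega> by (simp add: dot_square_norm power2_eq_square)
      have ee: "euler (euler v) (r *\<^sub>R \<omega>) = - 4 * a * r\<^sup>2 * v (r *\<^sub>R \<omega>) - (real DIM('a) - 2) * euler v (r *\<^sub>R \<omega>)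
        - sphere_laplacian v (r *\<^sub>R \<omega>) / 2"
        using laplacian_polar[OF open_ball b v] unfolding n eig[OF b] sphere_laplacian_def by (simp add: algebra_simps)
      show "euler (euler v) (r *\<^sub>R \<omega>) * P \<omega> = (- 4 * a * r\<^sup>2) * (v (r *\<^sub>R \<omega>) * P \<omega>)
         + ((- (real DIM('a) - 2)) * (euler v (r *\<^sub>R \<omega>) * P \<omega>) + (- 1 / 2) * (sphere_laplacian v (r *\<^sub>R \<omega>) * P \<omega>))"
        unfolding ee by (simp add: algebra_simps)
    qed
    also have "\<dots> = (- 4 * a * r\<^sup>2) * f r + ((- (real DIM('a) - 2)) * f1 r
        + (- 1 / 2) * sph (\<lambda>\<omega>. sphere_laplacian v (r *\<^sub>R \<omega>) * P \<omega>))"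
    proof -
      have cs: "continuous_on (ball 0 1) (sphere_laplacian v)"
        unfolding sphere_laplacian_def[abs_def]
      proof (intro continuous_on_sum)
        fix i j :: 'a assume ij: "i \<in> Basis" "j \<in> Basis"
        have "Ck_on 1 (ball 0 1) (rot i j v)"
          by (rule Ck_on_rot) (use v ij in \<open>simp_all add: numeral_2_eq_2 del: Ck_on.simps\<close>)
        then have "Ck_on 0 (ball 0 1) (rot i j (rot i j v))"
          unfolding One_nat_def by (rule Ck_on_rot[OF open_ball _ ij])
        then show "continuous_on (ball 0 1) (rot i j (rot i j v))" by simp
      qed
      have 1: "continuous_on (sphere 0 1) (\<lambda>\<omega>. v (r *\<^sub>R \<omega>) * P \<omega>)"
        "continuous_on (sphere 0 1) (\<lambda>\<omega>. euler v (r *\<^sub>R \<omega>) * P \<omega>)"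
        "continuous_on (sphere 0 1) (\<lambda>\<omega>. sphere_laplacian v (r *\<^sub>R \<omega>) * P \<omega>)"
        by (intro continuous_on_mult cP continuous_on_sphere_scale[OF Ck_on_imp_continuous_on[OF v1] r']
          continuous_on_sphere_scale[OF Ck_on_imp_continuous_on[OF ev1] r'] continuous_on_sphere_scale[OF cs r'])+
      note 2 = continuous_on_mult[OF continuous_on_const 1(1)] continuous_on_mult[OF continuous_on_const 1(2)]
        continuous_on_mult[OF continuous_on_const 1(3)]
      show ?thesis
        unfolding sph_add[OF 2(1) continuous_on_add[OF 2(2) 2(3)]] sph_add[OF 2(2) 2(3)] sph_cmult f_def f1_def ..
    qed
    also have "sph (\<lambda>\<omega>. sphere_laplacian v (r *\<^sub>R \<omega>) * P \<omega>) = sph (\<lambda>\<omega>. v (r *\<^sub>R \<omega>) * sphere_laplacian P \<omega>)"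
      by (rule sph_sphere_laplacian[OF open_ball v r' D(1)])
    also have "\<dots> = - 2 * (real k * (real k + real DIM('a) - 2)) * f r"
      unfolding f_def sph_cmult[symmetric] by (rule sph_cong) (simp add: sphere_laplacian_harmonic[OF P])
    finally have "sph (\<lambda>\<omega>. euler (euler v) (r *\<^sub>R \<omega>) * P \<omega>) = A r * f r - real (DIM('a) - 2) * f1 r"
      unfolding Nm by (simp add: A_def algebra_simps)
    with df1 show "(f1 has_real_derivative (A r * f r - real (DIM('a) - 2) * f1 r) / r) (at r)" by simp
    have "(y has_real_derivative real k * r ^ k / r * g r + - h r * (a * (2 * r)) * r ^ k) (at r)"
      unfolding y_def by (rule DERIV_mult[OF rk[OF r(1)] dg])
    moreover have "real k * r ^ k / r * g r + - h r * (a * (2 * r)) * r ^ k = y1 r / r"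
      using r by (simp add: y1_def \<phi>_def field_simps power2_eq_square)
    ultimately show "(y has_real_derivative y1 r / r) (at r)" by simp
    have d\<phi>: "(\<phi> has_real_derivative real k * (- h r * (a * (2 * r))) - ((2 * a * (2 * r)) * h r + - k2 r * (a * (2 * r)) * (2 * a * r\<^sup>2))) (at r)"
    proof -
      have "((\<lambda>r. 2 * a * r\<^sup>2) has_real_derivative 2 * a * (2 * r)) (at r)" by (auto intro!: derivative_eq_intros)
      from DERIV_diff[OF DERIV_cmult[OF dg, of "real k"] DERIV_mult[OF this dh]] show ?thesis
        unfolding \<phi>_def .
    qed
    have "- k2 r * (a * (2 * r)) * (2 * a * r\<^sup>2) = - (4 * a * r) * (a * r\<^sup>2 * k2 r)" by (simp add: algebra_simps)
    also have "\<dots> = - (4 * a * r) * ((\<nu> + 1) * h r - g r)" unfolding rec ..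
    also have "\<dots> = - (2 * a * r) * ((2 * \<nu> + 2) * h r - 2 * g r)" by (simp add: algebra_simps)
    also have "\<dots> = - (2 * a * r) * ((2 * real k + real DIM('a)) * h r - 2 * g r)" unfolding \<nu>k ..
    finally have e: "- k2 r * (a * (2 * r)) * (2 * a * r\<^sup>2) = - (2 * a * r) * ((2 * real k + real DIM('a)) * h r - 2 * g r)" .
    from DERIV_mult[OF rk[OF r(1)] d\<phi>, unfolded e]
    have "(y1 has_real_derivative real k * r ^ k / r * \<phi> r + (real k * (- h r * (a * (2 * r))) - ((2 * a * (2 * r)) * h r
       + - (2 * a * r) * ((2 * real k + real DIM('a)) * h r - 2 * g r))) * r ^ k) (at r)"
      unfolding y1_def .
    moreover have "real k * r ^ k / r * \<phi> r + (real k * (- h r * (a * (2 * r))) - ((2 * a * (2 * r)) * h r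
       + - (2 * a * r) * ((2 * real k + real DIM('a)) * h r - 2 * g r))) * r ^ k = (A r * y r - real (DIM('a) - 2) * y1 r) / r"
      unfolding Nm using r by (simp add: A_def y_def y1_def \<phi>_def field_simps) (simp add: power2_eq_square algebra_simps)
    ultimately show "(y1 has_real_derivative (A r * y r - real (DIM('a) - 2) * y1 r) / r) (at r)" by simp
    \<comment> \<open>Both could vanish only together with \<open>bess \<nu>\<close> and
      \<open>bess (\<nu> + 1)\<close>. Simplicity of zeros excludes this for positive a, positivity
      of \<open>bess\<close> otherwise.\<close>
    show "y r \<noteq> 0 \<or> y1 r \<noteq> 0"
    proof (rule ccontr)
      assume "\<not> ?thesis"
      then have "g r = 0" "h r = 0" using r a by (auto simp: y_def y1_def \<phi>_def)
      then have gh: "bess \<nu> (a * r\<^sup>2) = 0" "bess (\<nu> + 1) (a * r\<^sup>2) = 0" by (auto simp: g_def h_def)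
      show False
      proof (cases "a > 0")
        case True
        then show False using bess_simple[OF \<nu> _ gh(1)] gh(2) by simp
      next
        case False
        then have "- a * r\<^sup>2 \<ge> 0" by (intro mult_nonneg_nonneg) auto
        from bess_pos_neg[OF \<nu> this] gh(1) show False by simp
      qed
    qed
  next
    have c: "continuous_on {0..<1} (\<lambda>r. sph (\<lambda>\<omega>. w (r *\<^sub>R \<omega>) * P \<omega>))" if "Ck_on 1 (ball 0 1) w" for w
      by (rule continuous_on_sph_scale[OF Ck_on_imp_continuous_on[OF that] cP]) (use in_ball in auto)
    show "continuous_on {0..<1} f" "continuous_on {0..<1} f1" unfolding f_def f1_def by (intro c v1 ev1)+
    have cg: "continuous_on S g" "continuous_on S h" for S
      using DERIV_isCont[OF dg] DERIV_isCont[OF dh] by (auto intro: continuous_at_imp_continuous_on)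
    show "continuous_on {0..<1} y" "continuous_on {0..<1} y1"
      unfolding y_def y1_def \<phi>_def by (intro continuous_intros cg)+
    \<comment> \<open>Here regularity at the origin enters: \<open>euler\<close> carries the factor
      x, which vanishes at 0.\<close>
    show "f1 0 = 0" by (simp add: f1_def euler_def)
    show "y1 0 = 0" by (cases k) (auto simp: y1_def \<phi>_def)
  qed
  then show ?thesis by (simp add: f_def y_def g_def \<nu>_def)
qed

section \<open>Boundary values of the projections\<close>

lemma DERIV_left_unique:
  fixes h :: "real \<Rightarrow> real"
  assumes "(h has_real_derivative D) (at_left a)" "(h has_real_derivative E) (at_left a)"
  shows "D = E"
  using assms tendsto_unique[OF trivial_limit_at_left_real] unfolding has_field_derivative_iff by blast

text \<open>By the fundamental theorem h is a primitive of G up to the end point. This ties the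
  one-sided derivative in the boundary condition to the limit of interior derivatives.\<close>

lemma DERIV_at_left_limit:
  fixes h G :: "real \<Rightarrow> real"
  assumes c: "continuous_on {0..1} h" "continuous_on {0..1} G"
    and d: "\<And>r. 0 < r \<Longrightarrow> r < 1 \<Longrightarrow> (h has_real_derivative G r) (at r)"
  shows "(h has_real_derivative G 1) (at_left 1)"
proof -
  let ?H = "\<lambda>x. integral {0..x} G"
  have dH: "(?H has_real_derivative G t) (at t within {0..1})" if "t \<in> {0..1}" for t
    by (rule integral_has_real_derivative[OF c(2) that])
  have cH: "continuous_on {0..1} ?H" using dH by (rule DERIV_continuous_on)
  have eq: "h r = ?H r + h 0" if r: "r \<in> {0..1}" for r
  proof (cases "r = 0")
    case False
    then have r0: "0 < r" "r \<le> 1" using r by auto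
    have "(\<lambda>x. h x - ?H x) r = (\<lambda>x. h x - ?H x) 0"
    proof (rule DERIV_isconst_end[OF r0(1)])
      show "continuous_on {0..r} (\<lambda>x. h x - ?H x)"
        by (rule continuous_on_subset[OF continuous_on_diff[OF c(1) cH]]) (use r0 in auto)
      fix x assume x: "0 < x" "x < r"
      have "at x within {0..1} = at x" by (rule at_within_interior) (use x r0 in auto)
      then have "(?H has_real_derivative G x) (at x)" using dH[of x] x r0 by simp
      from DERIV_diff[OF d this] show "((\<lambda>x. h x - ?H x) has_real_derivative 0) (at x)" using x r0 by simp
    qed
    then show ?thesis by simp
  qed simp
  have "((\<lambda>r. ?H r + h 0) has_real_derivative G 1) (at 1 within {0..1})"
    using DERIV_add[OF dH[of 1] DERIV_const[of "h 0"]] by simp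
  then have "(h has_real_derivative G 1) (at 1 within {0..1})"
  proof (rule has_field_derivative_transform_within[where d = 1])
    show "?H r + h 0 = h r" if "r \<in> {0..1}" for r using eq[OF that] by simp
  qed auto
  then show ?thesis by (simp add: at_within_Icc_at_left)
qed

lemma eq_at_closure_point:
  fixes f g :: "real \<Rightarrow> real"
  assumes "continuous_on {0<..1} f" "continuous_on {0<..1} g" "\<And>r. 0 < r \<Longrightarrow> r < 1 \<Longrightarrow> f r = g r"
  shows "f 1 = g 1"
proof -
  have "(\<lambda>r. f r - g r) 1 = 0"
  proof (rule continuous_constant_on_closure[where S = "{1/2<..<1}" and f = "\<lambda>r. f r - g r" and x = 1])
    show "continuous_on (closure {1/2<..<1}) (\<lambda>r. f r - g r)"
      by (rule continuous_on_subset[OF continuous_on_diff[OF assms(1,2)]]) auto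
  qed (use assms(3) in auto)
  then show ?thesis by simp
qed

text \<open>The functions \<Delta> u - 4 s u and \<Delta> u + 4 \<tau> u are eigenfunctions of the
  Laplacian for - 4 \<tau> and 4 s, so \<open>sph_eigenfunction\<close> gives both projections, and
  their difference is a multiple of that of u. Continuity of u and of its gradient up to the sphere
  then transports the boundary conditions to the profile.\<close>

lemma bvp_projection:
  fixes u P :: "'a::euclidean_space \<Rightarrow> real"
  assumes u: "bvp_solution \<kappa> (4 * \<tau> - 4 * s) u" and \<tau>: "\<tau> > 0" and s: "s > 0" and st: "s * \<tau> = \<kappa>\<^sup>2 / 16"
    and P: "harmonic_homogeneous_poly k P" and N: "DIM('a) \<ge> 2"
  defines "\<nu> \<equiv> nu DIM('a) k"
  shows "\<exists>c d. (\<forall>r. 0 < r \<longrightarrow> r < 1 \<longrightarrow> sph (\<lambda>\<omega>. u (r *\<^sub>R \<omega>) * P \<omega>) = r ^ k * profile \<nu> \<tau> s c d (r\<^sup>2))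
    \<and> profile \<nu> \<tau> s c d 1 = 0 \<and> profile' \<nu> \<tau> s c d 1 = 0"
proof -
  let ?B = "ball 0 1 :: 'a set"
  have \<nu>: "\<nu> \<ge> 0" unfolding \<nu>_def by (rule nu_nonneg[OF N])
  have u4: "Ck_on 4 ?B u" and u1: "C1_closure ?B u"
    and pde: "\<And>x. x \<in> ?B \<Longrightarrow> laplacian (laplacian u) x - \<kappa>\<^sup>2 * u x = - (4 * \<tau> - 4 * s) * laplacian u x"
    and bc: "\<And>\<theta>. \<theta> \<in> sphere 0 1 \<Longrightarrow> u \<theta> = 0"
      "\<And>\<theta>. \<theta> \<in> sphere 0 1 \<Longrightarrow> ((\<lambda>r. u (r *\<^sub>R \<theta>)) has_real_derivative 0) (at_left 1)"
    using u unfolding bvp_solution_def by blast+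
  have \<kappa>: "\<kappa>\<^sup>2 = 16 * (s * \<tau>)" using st by simp
  have e4: "(4 :: nat) = Suc (Suc 2)" by simp
  have L2: "Ck_on 2 ?B (laplacian u)" by (rule Ck_on_laplacian[OF open_ball u4[unfolded e4]])
  have u2: "Ck_on 2 ?B u" by (rule Ck_on_le[OF u4]) simp
  have cu: "continuous_on (cball 0 1) u" using u1 by (simp add: C1_closure_def)
  note DP = harmonic_homogeneous_polyD[OF P]
  have cP: "continuous_on (sphere 0 1) P"
    using Ck_on_imp_continuous_on[OF DP(1)] continuous_on_subset by blast
  have part: "\<exists>c. \<forall>r. 0 < r \<longrightarrow> r < 1 \<longrightarrow>
     sph (\<lambda>\<omega>. (1 * laplacian u (r *\<^sub>R \<omega>) + b * u (r *\<^sub>R \<omega>)) * P \<omega>) = c * (r ^ k * bess \<nu> (a * r\<^sup>2))"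
    if ab: "(a = \<tau> \<and> b = - 4 * s) \<or> (a = - s \<and> b = 4 * \<tau>)" for a b
    unfolding \<nu>_def
  proof (rule sph_eigenfunction[of "\<lambda>x. 1 * laplacian u x + b * u x", OF _ _ _ P N])
    show "Ck_on 2 ?B (\<lambda>x. 1 * laplacian u x + b * u x)"
      by (intro Ck_on_add open_ball Ck_on_cmult L2 u2)
    show "a \<noteq> 0" using ab \<tau> s by auto
    fix x :: 'a assume x: "x \<in> ?B"
    have LL: "laplacian (laplacian u) x = 16 * (s * \<tau>) * u x - (4 * \<tau> - 4 * s) * laplacian u x"
      using pde[OF x] unfolding \<kappa> by (simp add: algebra_simps)
    show "laplacian (\<lambda>x. 1 * laplacian u x + b * u x) x = - (4 * a) * (1 * laplacian u x + b * u x)"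
      unfolding laplacian_lincomb[OF open_ball x L2 u2] LL using ab by (auto simp: algebra_simps)
  qed
  obtain c1 where c1: "\<And>r. 0 < r \<Longrightarrow> r < 1 \<Longrightarrow>
     sph (\<lambda>\<omega>. (1 * laplacian u (r *\<^sub>R \<omega>) + (- 4 * s) * u (r *\<^sub>R \<omega>)) * P \<omega>) = c1 * (r ^ k * bess \<nu> (\<tau> * r\<^sup>2))"
    using part[of \<tau> "- 4 * s"] by auto
  obtain d1 where d1: "\<And>r. 0 < r \<Longrightarrow> r < 1 \<Longrightarrow>
     sph (\<lambda>\<omega>. (1 * laplacian u (r *\<^sub>R \<omega>) + (4 * \<tau>) * u (r *\<^sub>R \<omega>)) * P \<omega>) = d1 * (r ^ k * bess \<nu> (- s * r\<^sup>2))"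
    using part[of "- s" "4 * \<tau>"] by auto
  \<comment> \<open>The two combinations differ by q u; dividing by q yields the coefficients of the
    J and I parts of u.\<close>
  define q where "q = 4 * (s + \<tau>)"
  have q: "q > 0" using s \<tau> by (simp add: q_def)
  define c d where "c = - c1 / q" and "d = d1 / q"
  define f where "f = (\<lambda>r. sph (\<lambda>\<omega>. u (r *\<^sub>R \<omega>) * P \<omega>))"
  have f: "f r = r ^ k * profile \<nu> \<tau> s c d (r\<^sup>2)" if r: "0 < r" "r < 1" for r
  proof -
    have rb: "\<forall>\<omega>\<in>sphere 0 1. r *\<^sub>R \<omega> \<in> ?B" using r by simp
    have cont: "continuous_on (sphere 0 1) (\<lambda>\<omega>. (1 * laplacian u (r *\<^sub>R \<omega>) + b * u (r *\<^sub>R \<omega>)) * P \<omega>)" for b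
      by (intro continuous_on_mult continuous_on_add continuous_on_const cP
        continuous_on_sphere_scale[OF Ck_on_imp_continuous_on[OF L2] rb] continuous_on_sphere_scale[OF Ck_on_imp_continuous_on[OF u2] rb])
    have "f r = sph (\<lambda>\<omega>. (1 / q) * ((1 * laplacian u (r *\<^sub>R \<omega>) + (4 * \<tau>) * u (r *\<^sub>R \<omega>)) * P \<omega>)
       + (- 1 / q) * ((1 * laplacian u (r *\<^sub>R \<omega>) + (- 4 * s) * u (r *\<^sub>R \<omega>)) * P \<omega>))"
      unfolding f_def
    proof (rule sph_cong)
      fix \<omega> :: 'a
      let ?L = "laplacian u (r *\<^sub>R \<omega>)" and ?u = "u (r *\<^sub>R \<omega>)"
      have "(1 / q) * ((1 * ?L + (4 * \<tau>) * ?u) * P \<omega>) + (- 1 / q) * ((1 * ?L + (- 4 * s) * ?u) * P \<omega>)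
        = (((1 * ?L + (4 * \<tau>) * ?u) * P \<omega>) - ((1 * ?L + (- 4 * s) * ?u) * P \<omega>)) / q"
        by (simp add: diff_divide_distrib)
      also have "((1 * ?L + (4 * \<tau>) * ?u) * P \<omega>) - ((1 * ?L + (- 4 * s) * ?u) * P \<omega>) = q * ?u * P \<omega>"
        by (simp add: q_def algebra_simps)
      finally have "(1 / q) * ((1 * ?L + (4 * \<tau>) * ?u) * P \<omega>) + (- 1 / q) * ((1 * ?L + (- 4 * s) * ?u) * P \<omega>)
        = (q * ?u * P \<omega>) / q" .
      then show "?u * P \<omega> = (1 / q) * ((1 * ?L + (4 * \<tau>) * ?u) * P \<omega>) + (- 1 / q) * ((1 * ?L + (- 4 * s) * ?u) * P \<omega>)"
        using q by simp
    qed
    also have "\<dots> = (1 / q) * (d1 * (r ^ k * bess \<nu> (- s * r\<^sup>2))) + (- 1 / q) * (c1 * (r ^ k * bess \<nu> (\<tau> * r\<^sup>2)))"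
      unfolding sph_add[OF continuous_on_mult[OF continuous_on_const cont] continuous_on_mult[OF continuous_on_const cont]]
        sph_cmult c1[OF r] d1[OF r] ..
    also have "\<dots> = r ^ k * profile \<nu> \<tau> s c d (r\<^sup>2)"
      by (simp add: profile_def c_def d_def algebra_simps)
    finally show ?thesis .
  qed
  have cprof: "continuous_on S (\<lambda>r. profile \<nu> \<tau> s c d (r\<^sup>2))" "continuous_on S (\<lambda>r. profile' \<nu> \<tau> s c d (r\<^sup>2))" for S
    unfolding profile_def profile'_def by (intro continuous_intros; use \<nu> in simp)+
  have cf: "continuous_on {0<..1} f"
    unfolding f_def by (rule continuous_on_sph_scale[OF cu cP]) auto
  have "f 1 = 1 ^ k * profile \<nu> \<tau> s c d (1\<^sup>2)"
    by (rule eq_at_closure_point[OF cf _ f]) (intro continuous_intros cprof)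
  moreover have "f 1 = sph (\<lambda>_::'a. 0)"
    unfolding f_def by (rule sph_cong) (simp add: bc(1))
  ultimately have p1: "profile \<nu> \<tau> s c d 1 = 0" by simp
  from u1 have "\<forall>i. \<exists>g. i \<in> Basis \<longrightarrow> continuous_on (cball 0 1) g \<and> (\<forall>x\<in>?B. g x = partial_deriv i u x)"
    by (auto simp: C1_closure_def)
  from choice[OF this] obtain G where G: "\<And>i. i \<in> Basis \<Longrightarrow> continuous_on (cball 0 1) (G i)"
    "\<And>i x. i \<in> Basis \<Longrightarrow> x \<in> ?B \<Longrightarrow> G i x = partial_deriv i u x" by blast
  \<comment> \<open>The continuous extension of \<open>euler u\<close> to the closed ball, built
    from the extended partial derivatives.\<close>
  define E where "E = (\<lambda>x. \<Sum>i\<in>Basis. (x \<bullet> i) * G i x)"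
  have cE: "continuous_on (cball 0 1) E" unfolding E_def by (intro continuous_intros G)
  have Eeq: "E x = euler u x" if "x \<in> ?B" for x using G(2) that by (simp add: E_def euler_def)
  have du: "((\<lambda>r. u (r *\<^sub>R \<theta>)) has_real_derivative E (r *\<^sub>R \<theta>) / r) (at r)" if \<theta>: "\<theta> \<in> sphere 0 1" and r: "0 < r" "r < 1" for \<theta> r
  proof -
    have b: "r *\<^sub>R \<theta> \<in> ?B" using \<theta> r by simp
    have "((\<lambda>r. r *\<^sub>R \<theta>) has_derivative (\<lambda>h. h *\<^sub>R \<theta>)) (at r)"
      by (rule bounded_linear_imp_has_derivative) (rule bounded_linear_scaleR_left)
    from has_derivative_compose[OF this has_derivative_partial[OF Ck_on_differentiable[OF u4 _ b]]]
    have d: "((\<lambda>r. u (r *\<^sub>R \<theta>)) has_derivative (\<lambda>h. \<Sum>i\<in>Basis. ((h *\<^sub>R \<theta>) \<bullet> i) * partial_deriv i u (r *\<^sub>R \<theta>))) (at r)" by simp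
    have e: "(\<Sum>i\<in>Basis. ((h *\<^sub>R \<theta>) \<bullet> i) * partial_deriv i u (r *\<^sub>R \<theta>)) = E (r *\<^sub>R \<theta>) / r * h" for h
      using r unfolding Eeq[OF b] euler_def by (simp add: sum_distrib_left sum_divide_distrib sum_distrib_right mult_ac)
    show ?thesis using d unfolding e has_field_derivative_def .
  qed
  \<comment> \<open>On the sphere E is the one-sided radial derivative of u, which the boundary
    condition makes zero.\<close>
  have E0: "E \<theta> = 0" if \<theta>: "\<theta> \<in> sphere 0 1" for \<theta>
  proof -
    define J where "J = (\<lambda>r. \<Sum>i\<in>Basis. (\<theta> \<bullet> i) * G i (r *\<^sub>R \<theta>))"
    have JE: "E (r *\<^sub>R \<theta>) / r = J r" if "r > 0" for r
      using that by (simp add: E_def J_def sum_distrib_left sum_divide_distrib mult_ac)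
    have c: "continuous_on {0..1} (\<lambda>r. w (r *\<^sub>R \<theta>))" if "continuous_on (cball 0 1) w" for w :: "'a \<Rightarrow> real"
    proof (rule continuous_on_compose2[OF that])
      show "continuous_on {0..1} (\<lambda>r. r *\<^sub>R \<theta>)" by (intro continuous_intros)
    qed (use \<theta> in auto)
    have "((\<lambda>r. u (r *\<^sub>R \<theta>)) has_real_derivative J 1) (at_left 1)"
    proof (rule DERIV_at_left_limit)
      show "continuous_on {0..1} (\<lambda>r. u (r *\<^sub>R \<theta>))" by (rule c[OF cu])
      show "continuous_on {0..1} J" unfolding J_def by (intro continuous_intros c G)
      show "((\<lambda>r. u (r *\<^sub>R \<theta>)) has_real_derivative J r) (at r)" if "0 < r" "r < 1" for r
        using du[OF \<theta> that] JE[of r] that by simp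
    qed
    from DERIV_left_unique[OF this bc(2)[OF \<theta>]] JE[of 1] show ?thesis by simp
  qed
  define f1 where "f1 = (\<lambda>r. sph (\<lambda>\<omega>. E (r *\<^sub>R \<omega>) * P \<omega>))"
  have cf1: "continuous_on {0<..1} f1"
    unfolding f1_def by (rule continuous_on_sph_scale[OF cE cP]) auto
  have u1': "Ck_on 1 ?B u" by (rule Ck_on_le[OF u4]) simp
  have "f1 r = r ^ k * (real k * profile \<nu> \<tau> s c d (r\<^sup>2) + 2 * r\<^sup>2 * profile' \<nu> \<tau> s c d (r\<^sup>2))" if r: "0 < r" "r < 1" for r
  proof -
    have "f1 r = sph (\<lambda>\<omega>. euler u (r *\<^sub>R \<omega>) * P \<omega>)"
      unfolding f1_def by (rule sph_cong) (use Eeq r in simp)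
    then have df: "(f has_real_derivative f1 r / r) (at r)"
      unfolding f_def using DERIV_sph_scale[OF u1' cP r] by simp
    have "((\<lambda>r. r\<^sup>2) has_real_derivative 2 * r) (at r)" by (auto intro!: derivative_eq_intros)
    from DERIV_mult[OF DERIV_pow[of k r] DERIV_chain2[OF DERIV_profile[OF \<nu>, of \<tau> s c d "r\<^sup>2"] this]]
    have "((\<lambda>r. r ^ k * profile \<nu> \<tau> s c d (r\<^sup>2)) has_real_derivative
       real k * r ^ (k - Suc 0) * profile \<nu> \<tau> s c d (r\<^sup>2) + profile' \<nu> \<tau> s c d (r\<^sup>2) * (2 * r) * r ^ k) (at r)" .
    then have "(f has_real_derivative
       real k * r ^ (k - Suc 0) * profile \<nu> \<tau> s c d (r\<^sup>2) + profile' \<nu> \<tau> s c d (r\<^sup>2) * (2 * r) * r ^ k) (at r)"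
    proof (rule has_field_derivative_transform_within_open[of _ _ _ "{0<..<1}"])
      show "x ^ k * profile \<nu> \<tau> s c d (x\<^sup>2) = f x" if "x \<in> {0<..<1}" for x using f that by simp
    qed (use r in auto)
    from DERIV_unique[OF df this] have "f1 r = (real k * r ^ (k - Suc 0) * profile \<nu> \<tau> s c d (r\<^sup>2) + profile' \<nu> \<tau> s c d (r\<^sup>2) * (2 * r) * r ^ k) * r"
      using r by (simp add: field_simps)
    moreover have "real k * r ^ (k - Suc 0) * r = real k * r ^ k" by (cases k) auto
    ultimately show ?thesis by (auto simp: algebra_simps power2_eq_square)
  qed
  \<comment> \<open>At r = 1 the left side is 0 and the right side is k \<open>profile\<close> + 2
    \<open>profile'\<close>, where \<open>profile\<close> is already known to vanish.\<close>
  from eq_at_closure_point[OF cf1 _ this]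
  have "f1 1 = 1 ^ k * (real k * profile \<nu> \<tau> s c d (1\<^sup>2) + 2 * 1\<^sup>2 * profile' \<nu> \<tau> s c d (1\<^sup>2))"
    by (simp add: continuous_on_add continuous_on_mult continuous_on_power cprof continuous_on_const continuous_on_id)
  moreover have "f1 1 = sph (\<lambda>_::'a. 0)"
    unfolding f1_def by (rule sph_cong) (simp add: E0)
  ultimately have "profile' \<nu> \<tau> s c d 1 = 0" using p1 by simp
  then show ?thesis using p1 f unfolding f_def by blast
qed

section \<open>Fischer decomposition and completeness\<close>

text \<open>Homogeneous polynomials by generation from constants and coordinates, which makes
  induction available; the zero function belongs to every degree.\<close>

inductive homp :: "nat \<Rightarrow> ('a::euclidean_space \<Rightarrow> real) \<Rightarrow> bool" where
  homp_const: "homp 0 (\<lambda>_. c)"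
| homp_zero: "homp k (\<lambda>_. 0)"
| homp_coord: "homp k p \<Longrightarrow> b \<in> Basis \<Longrightarrow> homp (Suc k) (\<lambda>x. (x \<bullet> b) * p x)"
| homp_add: "homp k p \<Longrightarrow> homp k q \<Longrightarrow> homp k (\<lambda>x. p x + q x)"

lemma homp_cmult: "homp k p \<Longrightarrow> homp k (\<lambda>x. c * p x)"
proof (induction rule: homp.induct)
  case (homp_coord k p b)
  from homp.homp_coord[OF homp_coord.IH homp_coord.hyps(2)] show ?case by (simp add: mult.left_commute)
next
  case (homp_add k p q)
  from homp.homp_add[OF homp_add.IH] show ?case by (simp add: distrib_left)
qed (auto intro: homp.intros)

lemma homp_diff: "homp k p \<Longrightarrow> homp k q \<Longrightarrow> homp k (\<lambda>x. p x - q x)"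
  using homp_add[OF _ homp_cmult[of k q "-1"]] by simp

lemma homp_sum:
  assumes "\<And>i. i \<in> I \<Longrightarrow> homp k (f i)" shows "homp k (\<lambda>x. \<Sum>i\<in>I. f i x)"
  using assms by (induction I rule: infinite_finite_induct) (auto intro: homp_zero homp_add)

lemma homp_real_polynomial_function: "homp k p \<Longrightarrow> real_polynomial_function p"
  by (induction rule: homp.induct)
     (auto intro: real_polynomial_function.intros(2,3,4) real_polynomial_function.intros(1)[OF bounded_linear_inner_left])

lemma homp_scale: "homp k p \<Longrightarrow> p (t *\<^sub>R x) = t ^ k * p x"
  by (induction rule: homp.induct) (auto simp: algebra_simps)

lemma homp_Ck_on: "homp k p \<Longrightarrow> Ck_on n UNIV p"
  by (rule Ck_on_real_polynomial_function[OF homp_real_polynomial_function])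

lemma homp_differentiable: "homp k p \<Longrightarrow> p differentiable (at x)"
  using Ck_on_differentiable[OF homp_Ck_on[of k p 1]] by simp

lemma homp_continuous_on: "homp k p \<Longrightarrow> continuous_on S p"
  using Ck_on_imp_continuous_on[OF homp_Ck_on[of k p 0]] continuous_on_subset by blast

text \<open>Subtraction is truncated, so for k = 0 the degree k - 1 does not express the drop; the
  vanishing is therefore stated separately. The same holds for \<open>homp_laplacian\<close> below
  degree 2.\<close>

lemma homp_partial:
  assumes "homp k p"
  shows "homp (k - 1) (partial_deriv i p) \<and> (k = 0 \<longrightarrow> partial_deriv i p = (\<lambda>_. 0))"
  using assms
proof (induction rule: homp.induct)
  case (homp_coord k p b)
  have dx: "(\<lambda>x. x \<bullet> b) differentiable (at x)" for x :: 'a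
    using Ck_on_differentiable[OF Ck_on_inner[of 1 UNIV b]] by auto
  have e: "partial_deriv i (\<lambda>x. (x \<bullet> b) * p x) = (\<lambda>x. (x \<bullet> b) * partial_deriv i p x + (i \<bullet> b) * p x)"
    by (rule ext) (simp add: partial_deriv_mult[OF dx homp_differentiable[OF homp_coord.hyps(1)]])
  have "homp k (\<lambda>x. (x \<bullet> b) * partial_deriv i p x + (i \<bullet> b) * p x)"
  proof (cases k)
    case 0
    then show ?thesis using homp_coord homp_cmult by auto
  next
    case (Suc m)
    have "homp (Suc m) (\<lambda>x. (x \<bullet> b) * partial_deriv i p x)"
      using homp_coord Suc by (intro homp.homp_coord) auto
    then show ?thesis using homp_cmult[OF homp_coord.hyps(1)] Suc by (auto intro: homp_add)
  qed
  then show ?case by (simp add: e)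
next
  case (homp_add k p q)
  have e: "partial_deriv i (\<lambda>x. p x + q x) = (\<lambda>x. partial_deriv i p x + partial_deriv i q x)"
    by (rule ext) (rule partial_deriv_add[OF homp_differentiable[OF homp_add.hyps(1)] homp_differentiable[OF homp_add.hyps(2)]])
  show ?case using homp_add.IH by (auto simp: e intro: homp.homp_add)
qed (auto intro: homp_zero)

lemma homp_laplacian:
  assumes "homp k p" shows "homp (k - 2) (laplacian p)" "k < 2 \<Longrightarrow> laplacian p x = 0"
proof -
  have 1: "homp (k - 1) (partial_deriv i p)" for i using homp_partial[OF assms] by blast
  have "homp (k - 1 - 1) (partial_deriv i (partial_deriv i p))" for i using homp_partial[OF 1] by blast
  moreover have "k - 1 - 1 = k - 2" by simp
  ultimately show "homp (k - 2) (laplacian p)"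
    unfolding laplacian_def[abs_def] by (intro homp_sum) simp
  assume "k < 2"
  then have "partial_deriv i (partial_deriv i p) = (\<lambda>_. 0)" for i using homp_partial[OF 1, of i] by simp
  then show "laplacian p x = 0" by (simp add: laplacian_def)
qed

lemma homp_norm2: "homp k p \<Longrightarrow> homp (k + 2) (\<lambda>x. (x \<bullet> x) * p x)"
proof -
  assume p: "homp k p"
  have "homp (Suc (Suc k)) (\<lambda>x. \<Sum>b\<in>Basis. (x \<bullet> b) * ((x \<bullet> b) * p x))"
    by (intro homp_sum homp_coord p)
  moreover have "(\<Sum>b\<in>Basis. (x \<bullet> b) * ((x \<bullet> b) * p x)) = (x \<bullet> x) * p x" for x :: 'a
    unfolding euclidean_inner[of x x] by (simp add: sum_distrib_right mult.assoc)
  ultimately show ?thesis by simp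
qed

lemma homp_mult: "homp k p \<Longrightarrow> homp m q \<Longrightarrow> homp (k + m) (\<lambda>x. p x * q x)"
proof (induction rule: homp.induct)
  case (homp_coord k p b)
  from homp.homp_coord[OF homp_coord.IH[OF homp_coord.prems] homp_coord.hyps(2)] show ?case by (simp add: mult.assoc)
next
  case (homp_add k p p')
  then have "homp (k + m) (\<lambda>x. p x * q x)" "homp (k + m) (\<lambda>x. p' x * q x)" by auto
  from homp.homp_add[OF this] show ?case by (simp add: distrib_right)
qed (auto intro: homp_cmult homp_zero)

definition hharm :: "nat \<Rightarrow> ('a::euclidean_space \<Rightarrow> real) \<Rightarrow> bool" where
  "hharm k h \<longleftrightarrow> homp k h \<and> (\<forall>x. laplacian h x = 0)"

lemma hharm_harmonic: "hharm k h \<Longrightarrow> harmonic_homogeneous_poly k h"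
  unfolding hharm_def harmonic_homogeneous_poly_def using homp_real_polynomial_function homp_scale by blast

lemma laplacian_cmult:
  fixes f :: "'a::euclidean_space \<Rightarrow> real"
  assumes "Ck_on 2 UNIV f" shows "laplacian (\<lambda>x. c * f x) x = c * laplacian f x"
  using laplacian_lincomb[OF open_UNIV UNIV_I assms assms, of c 0 x] by simp

lemma hharm_cmult: "hharm k h \<Longrightarrow> hharm k (\<lambda>x. c * h x)"
  unfolding hharm_def using homp_cmult[of k h c] laplacian_cmult[OF homp_Ck_on[of k h 2], of c] by simp

text \<open>Sums of terms \<open>|x|\<^sup>2\<^sup>j h(x)\<close> with \<open>h\<close> homogeneous harmonic; by \<open>homp_fis\<close> below these are
  all homogeneous polynomials (Fischer decomposition).\<close>

inductive fis :: "nat \<Rightarrow> ('a::euclidean_space \<Rightarrow> real) \<Rightarrow> bool" where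
  fis_base: "hharm m h \<Longrightarrow> fis (m + 2 * j) (\<lambda>x. (x \<bullet> x) ^ j * h x)"
| fis_add: "fis k p \<Longrightarrow> fis k q \<Longrightarrow> fis k (\<lambda>x. p x + q x)"

lemma fis_homp: "fis k p \<Longrightarrow> homp k p"
proof (induction rule: fis.induct)
  case (fis_base m h j)
  show ?case
  proof (induction j)
    case 0
    then show ?case using fis_base by (simp add: hharm_def)
  next
    case (Suc j)
    from homp_norm2[OF Suc.IH] show ?case by (simp add: mult.assoc add_ac)
  qed
qed (rule homp_add)

lemma fis_norm2: "fis k p \<Longrightarrow> fis (k + 2) (\<lambda>x. (x \<bullet> x) * p x)"
proof (induction rule: fis.induct)
  case (fis_base m h j)
  from fis.fis_base[OF fis_base, of "Suc j"] show ?case by (simp add: mult.assoc add_ac)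
next
  case (fis_add k p q)
  from fis.fis_add[OF fis_add.IH] show ?case by (simp add: distrib_left)
qed

lemma homp_norm_power: "homp (2 * j) (\<lambda>x. (x \<bullet> x) ^ j)"
proof (induction j)
  case 0
  then show ?case using homp_const[of 1] by simp
next
  case (Suc j)
  from homp_norm2[OF this] show ?case by simp
qed

text \<open>The case \<phi> z = z^(j+1) of \<open>laplacian_harmonic_radial\<close>. The constant is
  positive, and this is what \<open>fis_lift\<close> inverts.\<close>

lemma laplacian_hharm_power:
  fixes h :: "'a::euclidean_space \<Rightarrow> real"
  assumes "hharm m h"
  shows "laplacian (\<lambda>x. h x * (x \<bullet> x) ^ Suc j) x
     = (4 * (real j + 1) * (real j + real m + real DIM('a) / 2)) * ((x \<bullet> x) ^ j * h x)"
proof -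
  have d1: "((\<lambda>z. z ^ Suc j) has_real_derivative real (Suc j) * z ^ j) (at z)" for z :: real
    using DERIV_pow[of "Suc j" z] by simp
  have d2: "((\<lambda>z. real (Suc j) * z ^ j) has_real_derivative real (Suc j) * (real j * z ^ (j - Suc 0))) (at z)" for z :: real
    by (rule DERIV_cmult[OF DERIV_pow])
  have z: "z * (real (Suc j) * (real j * z ^ (j - Suc 0))) = real (Suc j) * real j * z ^ j" for z :: real
    by (cases j) auto
  have "laplacian (\<lambda>x. h x * (x \<bullet> x) ^ Suc j) x = h x * (4 * (real (Suc j) * real j * (x \<bullet> x) ^ j
      + (real m + real DIM('a) / 2) * (real (Suc j) * (x \<bullet> x) ^ j)))"
    using laplacian_harmonic_radial[OF hharm_harmonic[OF assms] d1 d2 homp_Ck_on[OF homp_norm_power]] unfolding z .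
  also have "\<dots> = (4 * (real j + 1) * (real j + real m + real DIM('a) / 2)) * ((x \<bullet> x) ^ j * h x)"
    by (simp add: algebra_simps)
  finally show ?thesis .
qed

text \<open>Multiplication by |x|^2 followed by the Laplacian acts on each building block as a
  positive scalar, so a preimage is obtained by rescaling the blocks.\<close>

lemma fis_lift: "fis k q \<Longrightarrow> \<exists>q'. fis k q' \<and> (\<forall>x. laplacian (\<lambda>x. (x \<bullet> x) * q' x) x = q x)"
proof (induction rule: fis.induct)
  case (fis_base m h j)
  define c where "c = 4 * (real j + 1) * (real j + real m + real DIM('a) / 2)"
  have c: "c > 0" using DIM_positive[where 'a = 'a] by (simp add: c_def add_nonneg_pos)
  let ?h = "\<lambda>x. (1 / c) * h x"
  have h: "hharm m ?h" by (rule hharm_cmult[OF fis_base])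
  have "laplacian (\<lambda>x. (x \<bullet> x) * ((x \<bullet> x) ^ j * ?h x)) x = (x \<bullet> x) ^ j * h x" for x
  proof -
    have "(\<lambda>x. (x \<bullet> x) * ((x \<bullet> x) ^ j * ?h x)) = (\<lambda>x. ?h x * (x \<bullet> x) ^ Suc j)" by (simp add: fun_eq_iff)
    then show ?thesis using laplacian_hharm_power[OF h, of j x] c unfolding c_def[symmetric] by simp
  qed
  then show ?case using fis.fis_base[OF h] by blast
next
  case (fis_add k p q)
  then obtain p' q' where p': "fis k p'" "\<And>x. laplacian (\<lambda>x. (x \<bullet> x) * p' x) x = p x"
    and q': "fis k q'" "\<And>x. laplacian (\<lambda>x. (x \<bullet> x) * q' x) x = q x" by blast
  have C: "Ck_on 2 UNIV (\<lambda>x. (x \<bullet> x) * p' x)" "Ck_on 2 UNIV (\<lambda>x. (x \<bullet> x) * q' x)"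
    using homp_Ck_on homp_norm2 fis_homp p'(1) q'(1) by blast+
  have "laplacian (\<lambda>x. (x \<bullet> x) * (p' x + q' x)) x = p x + q x" for x
    using laplacian_lincomb[OF open_UNIV UNIV_I C, of 1 1 x] p'(2) q'(2) by (simp add: distrib_left)
  then show ?case using fis.fis_add[OF p'(1) q'(1)] by blast
qed

text \<open>Choose q such that |x|^2 q has the same Laplacian as p; then h = p - |x|^2 q is
  harmonic. Below degree 2 the polynomial p is harmonic itself.\<close>

lemma fischer_step:
  assumes p: "homp k p" and f: "k \<ge> 2 \<Longrightarrow> fis (k - 2) (laplacian p)"
  shows "\<exists>h q. hharm k h \<and> homp (k - 2) q \<and> (k < 2 \<longrightarrow> q = (\<lambda>_. 0)) \<and> (k \<ge> 2 \<longrightarrow> fis (k - 2) q)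
     \<and> (\<forall>x. p x = h x + (x \<bullet> x) * q x)"
proof (cases "k < 2")
  case True
  then have "hharm k p" using homp_laplacian(2)[OF p] p by (simp add: hharm_def)
  then show ?thesis using True homp_zero by (intro exI[of _ p] exI[of _ "\<lambda>_. 0"]) auto
next
  case False
  then obtain q where q: "fis (k - 2) q" "\<And>x. laplacian (\<lambda>x. (x \<bullet> x) * q x) x = laplacian p x"
    using fis_lift[OF f] by auto
  have kk: "k - 2 + 2 = k" using False by simp
  have hq: "homp k (\<lambda>x. (x \<bullet> x) * q x)" using homp_norm2[OF fis_homp[OF q(1)]] unfolding kk .
  let ?h = "\<lambda>x. p x - (x \<bullet> x) * q x"
  have "laplacian ?h x = 0" for x
    using laplacian_lincomb[OF open_UNIV UNIV_I homp_Ck_on[OF p] homp_Ck_on[OF hq], of 1 "-1" x] q(2) by simp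
  then have "hharm k ?h" using homp_diff[OF p hq] by (simp add: hharm_def)
  then show ?thesis using False q(1) fis_homp[OF q(1)] by (intro exI[of _ ?h] exI[of _ q]) auto
qed

lemma homp_fis: "homp k p \<Longrightarrow> fis k p"
proof (induction k arbitrary: p rule: less_induct)
  case (less k)
  have f: "fis (k - 2) (laplacian p)" if "k \<ge> 2"
    using less.IH[of "k - 2"] homp_laplacian(1)[OF less.prems] that by simp
  from fischer_step[OF less.prems f] obtain h q where hq: "hharm k h" "k < 2 \<longrightarrow> q = (\<lambda>_. 0)" "k \<ge> 2 \<longrightarrow> fis (k - 2) q"
    "\<And>x. p x = h x + (x \<bullet> x) * q x" by blast
  have h: "fis k h" using fis_base[OF hq(1), of 0] by simp
  have p: "p = (\<lambda>x. h x + (x \<bullet> x) * q x)" using hq(4) by blast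
  show ?case
  proof (cases "k < 2")
    case True
    then show ?thesis using h hq(2) p by simp
  next
    case False
    then have kk: "k - 2 + 2 = k" and "fis (k - 2) q" using hq(3) by simp_all
    then have "fis k (\<lambda>x. (x \<bullet> x) * q x)" using fis_norm2[of "k - 2" q] unfolding kk by simp
    then show ?thesis unfolding p by (rule fis_add[OF h])
  qed
qed

lemma span_on_mult:
  assumes "u \<in> span_on A M" shows "(\<lambda>x. f x * u x) \<in> span_on A ((\<lambda>m x. f x * m x) ` M)"
proof -
  obtain T a where T: "finite T" "T \<subseteq> M" "\<And>x. x \<in> A \<Longrightarrow> u x = (\<Sum>m\<in>T. a m * m x)"
    using assms by (auto simp: span_on_def)
  show ?thesis
  proof (rule span_on_sum[OF T(1)])
    fix m assume "m \<in> T"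
    then have "(\<lambda>x. f x * m x) \<in> (\<lambda>m x. f x * m x) ` M" using T(2) by blast
    then show "(\<lambda>x. a m * (f x * m x)) \<in> span_on A ((\<lambda>m x. f x * m x) ` M)"
      by (rule span_on_base[where a = "a m"]) simp
  next
    fix x assume "x \<in> A"
    then show "f x * u x = (\<Sum>m\<in>T. a m * (f x * m x))" by (simp add: T(3) sum_distrib_left mult_ac)
  qed
qed

lemma span_on_subset:
  assumes "u \<in> span_on A B" "B \<subseteq> C" shows "u \<in> span_on A C"
proof -
  obtain T a where "finite T" "T \<subseteq> B" "\<forall>x\<in>A. u x = (\<Sum>v\<in>T. a v * v x)"
    using assms(1) by (auto simp: span_on_def)
  then show ?thesis unfolding span_on_def using assms(2) by (intro CollectI exI[of _ T] exI[of _ a]) auto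
qed

text \<open>Coordinates times a spanning set of degree k span degree k + 1. Finiteness is what later
  permits a Gram projection.\<close>

lemma homp_finite_span:
  "\<exists>M :: ('a::euclidean_space \<Rightarrow> real) set. finite M \<and> (\<forall>m\<in>M. homp k m) \<and> (\<forall>p. homp k p \<longrightarrow> p \<in> span_on UNIV M)"
proof (induction k)
  case 0
  have "p \<in> span_on UNIV {\<lambda>_. 1}" if "homp 0 p" for p :: "'a \<Rightarrow> real"
  proof (rule span_on_base)
    show "p x = p 0 * 1" for x using homp_scale[OF that, of 0 x] by simp
  qed simp
  then show ?case by (intro exI[of _ "{\<lambda>_. 1}"]) (auto intro: homp_const)
next
  case (Suc k)
  then obtain M :: "('a \<Rightarrow> real) set" where M: "finite M" "\<And>m. m \<in> M \<Longrightarrow> homp k m" "\<And>p. homp k p \<Longrightarrow> p \<in> span_on UNIV M" by blast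
  let ?M = "\<Union>b\<in>Basis. (\<lambda>m x. (x \<bullet> b) * m x) ` M"
  have "p \<in> span_on UNIV ?M" if "homp n p" "n = Suc k" for n p
    using that
  proof (induction rule: homp.induct)
    case (homp_coord j p b)
    have "homp k p" using homp_coord.hyps(1) homp_coord.prems by simp
    from span_on_mult[OF M(3)[OF this], of "\<lambda>x. x \<bullet> b"] show ?case
      by (rule span_on_subset) (use homp_coord.hyps(2) in blast)
  next
    case (homp_add j p q)
    show ?case by (rule span_on_add[OF homp_add.IH]) (use homp_add.prems in simp_all)
  next
    case (homp_zero j)
    show ?case by (rule span_on_zero) simp
  qed simp
  note span = this
  show ?case
  proof (intro exI[of _ ?M] conjI ballI allI impI)
    show "finite ?M" using M(1) by simp
    show "homp (Suc k) m" if "m \<in> ?M" for m using that M(2) by (auto intro: homp_coord)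
    show "p \<in> span_on UNIV ?M" if "homp (Suc k) p" for p by (rule span[OF that refl])
  qed
qed

text \<open>B collects the harmonic parts of a finite spanning set. On the unit sphere |x|^2 = 1, so
  modulo the span of B a polynomial of degree k is reduced to degree k - 2.\<close>

lemma harmonic_spanning_set:
  "\<exists>B :: ('a::euclidean_space \<Rightarrow> real) set. finite B \<and> (\<forall>b\<in>B. hharm k b) \<and> (\<forall>p. homp k p \<longrightarrow>
     (\<exists>h q. h \<in> span_on UNIV B \<and> homp (k - 2) q \<and> (k < 2 \<longrightarrow> q = (\<lambda>_. 0)) \<and> (\<forall>x. p x = h x + (x \<bullet> x) * q x)))"
proof -
  obtain M :: "('a \<Rightarrow> real) set" where M: "finite M" "\<And>m. m \<in> M \<Longrightarrow> homp k m"
      "\<And>p. homp k p \<Longrightarrow> p \<in> span_on UNIV M"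
    using homp_finite_span[of k] by blast
  have "\<forall>m. \<exists>hq. m \<in> M \<longrightarrow> hharm k (fst hq) \<and> homp (k - 2) (snd hq) \<and> (k < 2 \<longrightarrow> snd hq = (\<lambda>_. 0))
     \<and> (\<forall>x. m x = fst hq x + (x \<bullet> x) * snd hq x)"
  proof
    fix m
    show "\<exists>hq. m \<in> M \<longrightarrow> hharm k (fst hq) \<and> homp (k - 2) (snd hq) \<and> (k < 2 \<longrightarrow> snd hq = (\<lambda>_. 0))
     \<and> (\<forall>x. m x = fst hq x + (x \<bullet> x) * snd hq x)"
    proof (cases "m \<in> M")
      case True
      from fischer_step[OF M(2)[OF True] homp_fis[OF homp_laplacian(1)[OF M(2)[OF True]]]] show ?thesis by auto
    qed simp
  qed
  from choice[OF this] obtain hq where hq: "\<And>m. m \<in> M \<Longrightarrow> hharm k (fst (hq m))" "\<And>m. m \<in> M \<Longrightarrow> homp (k - 2) (snd (hq m))"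
    "\<And>m. m \<in> M \<Longrightarrow> k < 2 \<Longrightarrow> snd (hq m) = (\<lambda>_. 0)" "\<And>m x. m \<in> M \<Longrightarrow> m x = fst (hq m) x + (x \<bullet> x) * snd (hq m) x"
    by blast
  let ?B = "(\<lambda>m. fst (hq m)) ` M"
  have "\<exists>h q. h \<in> span_on UNIV ?B \<and> homp (k - 2) q \<and> (k < 2 \<longrightarrow> q = (\<lambda>_. 0)) \<and> (\<forall>x. p x = h x + (x \<bullet> x) * q x)"
    if hp: "homp k p" for p
  proof -
    obtain T a where T: "finite T" "T \<subseteq> M" "\<And>x. p x = (\<Sum>m\<in>T. a m * m x)"
      using M(3)[OF hp] by (auto simp: span_on_def)
    let ?h = "\<lambda>x. \<Sum>m\<in>T. a m * fst (hq m) x" and ?q = "\<lambda>x. \<Sum>m\<in>T. a m * snd (hq m) x"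
    have "?h \<in> span_on UNIV ?B"
    proof (rule span_on_sum[OF T(1)])
      fix m assume "m \<in> T"
      then have "fst (hq m) \<in> ?B" using T(2) by blast
      then show "(\<lambda>x. a m * fst (hq m) x) \<in> span_on UNIV ?B" by (rule span_on_base[where a = "a m"]) simp
    qed simp
    moreover have "homp (k - 2) ?q" using T(2) hq(2) by (intro homp_sum homp_cmult) blast
    moreover have "?q = (\<lambda>_. 0)" if "k < 2"
    proof -
      have "snd (hq m) = (\<lambda>_. 0)" if "m \<in> T" for m using hq(3) \<open>k < 2\<close> that T(2) by blast
      then show ?thesis by simp
    qed
    moreover have "p x = ?h x + (x \<bullet> x) * ?q x" for x
    proof -
      have "p x = (\<Sum>m\<in>T. a m * (fst (hq m) x + (x \<bullet> x) * snd (hq m) x))"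
        unfolding T(3) using T(2) hq(4) by (intro sum.cong refl) (metis subsetD)
      then show ?thesis by (simp add: distrib_left sum.distrib sum_distrib_left mult_ac)
    qed
    ultimately show ?thesis by blast
  qed
  note span = this
  show ?thesis
  proof (intro exI[of _ ?B] conjI ballI allI impI)
    show "hharm k b" if "b \<in> ?B" for b using that hq(1) by auto
  qed (use M(1) span in simp_all)
qed

text \<open>Sums of homogeneous polynomials of mixed degrees. They contain every
  \<open>real_polynomial_function\<close>, the class for which the density theorem is
  available.\<close>

inductive polys :: "('a::euclidean_space \<Rightarrow> real) \<Rightarrow> bool" where
  polys_homp: "homp k p \<Longrightarrow> polys p"
| polys_add: "polys p \<Longrightarrow> polys q \<Longrightarrow> polys (\<lambda>x. p x + q x)"

lemma polys_homp_mult: "polys q \<Longrightarrow> homp k p \<Longrightarrow> polys (\<lambda>x. p x * q x)"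
proof (induction rule: polys.induct)
  case (polys_homp m q)
  then show ?case using homp_mult polys.polys_homp by blast
next
  case (polys_add q q')
  from polys.polys_add[OF polys_add.IH(1)[OF polys_add.prems] polys_add.IH(2)[OF polys_add.prems]] show ?case
    by (simp add: distrib_left)
qed

lemma polys_mult: "polys p \<Longrightarrow> polys q \<Longrightarrow> polys (\<lambda>x. p x * q x)"
proof (induction rule: polys.induct)
  case (polys_homp k p)
  then show ?case using polys_homp_mult by blast
next
  case (polys_add p p')
  from polys.polys_add[OF polys_add.IH(1)[OF polys_add.prems] polys_add.IH(2)[OF polys_add.prems]] show ?case
    by (simp add: distrib_right)
qed

lemma real_polynomial_function_polys:
  fixes p :: "'a::euclidean_space \<Rightarrow> real"
  shows "real_polynomial_function p \<Longrightarrow> polys p"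
proof (induction rule: real_polynomial_function.induct)
  case (linear f)
  then interpret bounded_linear f .
  have "f = (\<lambda>x. \<Sum>b\<in>Basis. f b * (x \<bullet> b))"
  proof
    fix x
    have "f x = f (\<Sum>b\<in>Basis. (x \<bullet> b) *\<^sub>R b)" by (simp add: euclidean_representation)
    then show "f x = (\<Sum>b\<in>Basis. f b * (x \<bullet> b))" by (simp add: sum scaleR mult.commute)
  qed
  moreover have "homp (Suc 0) (\<lambda>x::'a. x \<bullet> b)" if "b \<in> Basis" for b
    using homp_coord[OF homp_const[of 1] that] by simp
  then have "homp (Suc 0) (\<lambda>x. \<Sum>b\<in>Basis. f b * (x \<bullet> b))" by (intro homp_sum homp_cmult)
  ultimately show ?case using polys_homp by metis
next
  case (const c)
  then show ?case by (rule polys_homp[OF homp_const])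
qed (auto intro: polys_add polys_mult)

section \<open>Completeness, Gram projection and orthogonality of degrees\<close>

lemma sph_mono:
  assumes "continuous_on (sphere 0 1) f" "continuous_on (sphere 0 1) g" "\<And>\<omega>. \<omega> \<in> sphere 0 1 \<Longrightarrow> f \<omega> \<le> g \<omega>"
  shows "sph f \<le> sph g"
  unfolding sph_def
proof (rule integral_le[OF sph_integrable[OF assms(1)] sph_integrable[OF assms(2)]])
  fix x :: 'a
  show "eta x * f (sgn x) \<le> eta x * g (sgn x)"
    using assms(3)[OF sgn_sphere[of x]] eta_nonneg[of x] by (cases "x = 0") (auto simp: eta_eq_0 mult_left_mono)
qed

lemma sph_eq_0_on_span:
  assumes h: "h \<in> span_on UNIV B" and U: "continuous_on (sphere 0 1) U"
    and B: "\<And>b. b \<in> B \<Longrightarrow> continuous_on (sphere 0 1) b" "\<And>b. b \<in> B \<Longrightarrow> sph (\<lambda>\<omega>. U \<omega> * b \<omega>) = 0"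
  shows "sph (\<lambda>\<omega>. U \<omega> * h \<omega>) = 0"
proof -
  obtain T a where T: "finite T" "T \<subseteq> B" "\<And>x. h x = (\<Sum>b\<in>T. a b * b x)"
    using h by (auto simp: span_on_def)
  have "sph (\<lambda>\<omega>. U \<omega> * h \<omega>) = sph (\<lambda>\<omega>. \<Sum>b\<in>T. a b * (U \<omega> * b \<omega>))"
    by (rule sph_cong) (simp add: T(3) sum_distrib_left mult_ac)
  also have "\<dots> = (\<Sum>b\<in>T. sph (\<lambda>\<omega>. a b * (U \<omega> * b \<omega>)))"
    by (rule sph_sum, intro continuous_on_mult continuous_on_const U B(1)) (use T(2) in blast)
  also have "\<dots> = 0" using B(2) T(2) by (auto simp: sph_cmult intro!: sum.neutral)
  finally show ?thesis .
qed

text \<open>On the sphere p = h + q with q of lower degree, so orthogonality to harmonics spreads to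
  all polynomials by induction on the degree. Density then bounds the integral of U^2 by e times
  that of |U|, for every e > 0.\<close>

lemma orthogonal_harmonics_imp_zero:
  fixes U :: "'a::euclidean_space \<Rightarrow> real"
  assumes U: "continuous_on (sphere 0 1) U"
    and B: "\<And>k b. b \<in> B k \<Longrightarrow> hharm k b" "\<And>k b. b \<in> B k \<Longrightarrow> sph (\<lambda>\<omega>. U \<omega> * b \<omega>) = 0"
    and dec: "\<And>k p. homp k p \<Longrightarrow> \<exists>h q. h \<in> span_on UNIV (B k) \<and> homp (k - 2) q \<and> (k < 2 \<longrightarrow> q = (\<lambda>_. 0))
       \<and> (\<forall>x. p x = h x + (x \<bullet> x) * q x)"
    and \<omega>: "\<omega> \<in> sphere 0 1"
  shows "U \<omega> = 0"
proof -
  have cB: "continuous_on (sphere 0 1) b" if "b \<in> B k" for k b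
    using B(1)[OF that] homp_continuous_on unfolding hharm_def by blast
  have hom: "sph (\<lambda>\<omega>. U \<omega> * p \<omega>) = 0" if "homp k p" for k p
    using that
  proof (induction k arbitrary: p rule: less_induct)
    case (less k)
    obtain h q where hq: "h \<in> span_on UNIV (B k)" "homp (k - 2) q" "k < 2 \<longrightarrow> q = (\<lambda>_. 0)" "\<And>x. p x = h x + (x \<bullet> x) * q x"
      using dec[OF less.prems] by blast
    have h0: "sph (\<lambda>\<omega>. U \<omega> * h \<omega>) = 0" by (rule sph_eq_0_on_span[OF hq(1) U cB B(2)])
    have q0: "sph (\<lambda>\<omega>. U \<omega> * q \<omega>) = 0"
      using less.IH[OF _ hq(2)] hq(3) by (cases "k < 2") auto
    have cq: "continuous_on (sphere 0 1) q" by (rule homp_continuous_on[OF hq(2)])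
    have ph: "h x = p x - (x \<bullet> x) * q x" for x using hq(4)[of x] by simp
    have ch: "continuous_on (sphere 0 1) h"
      unfolding ph[abs_def] by (intro continuous_intros homp_continuous_on[OF less.prems] cq)
    have "sph (\<lambda>\<omega>. U \<omega> * p \<omega>) = sph (\<lambda>\<omega>. U \<omega> * h \<omega> + U \<omega> * q \<omega>)"
      by (rule sph_cong) (simp add: hq(4) dot_square_norm distrib_left)
    also have "\<dots> = 0" by (subst sph_add) (auto intro: continuous_on_mult U ch cq simp: h0 q0)
    finally show ?case .
  qed
  have cpol: "continuous_on (sphere 0 1) p \<and> sph (\<lambda>\<omega>. U \<omega> * p \<omega>) = 0" if "polys p" for p
    using that
  proof (induction rule: polys.induct)
    case (polys_homp k p)
    then show ?case using hom homp_continuous_on by blast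
  next
    case (polys_add p q)
    then show ?case using sph_add[of "\<lambda>\<omega>. U \<omega> * p \<omega>" "\<lambda>\<omega>. U \<omega> * q \<omega>"] U
      by (auto simp: distrib_left intro: continuous_on_mult continuous_on_add)
  qed
  have cUU: "continuous_on (sphere 0 1) (\<lambda>\<omega>. U \<omega> * U \<omega>)" by (intro continuous_on_mult U)
  have le: "sph (\<lambda>\<omega>. U \<omega> * U \<omega>) \<le> e * sph (\<lambda>\<omega>. \<bar>U \<omega>\<bar>)" if e: "e > 0" for e
  proof -
    have "compact (sphere (0 :: 'a) 1)" by simp
    from Stone_Weierstrass_real_polynomial_function[OF this U e] obtain g
      where g: "real_polynomial_function g" "\<And>x. x \<in> sphere 0 1 \<Longrightarrow> \<bar>U x - g x\<bar> < e" by blast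
    have g': "continuous_on (sphere 0 1) g" "sph (\<lambda>\<omega>. U \<omega> * g \<omega>) = 0"
      using cpol[OF real_polynomial_function_polys[OF g(1)]] by auto
    have c1: "continuous_on (sphere 0 1) (\<lambda>\<omega>. U \<omega> * g \<omega>)" "continuous_on (sphere 0 1) (\<lambda>\<omega>. e * \<bar>U \<omega>\<bar>)"
      by (intro continuous_on_mult continuous_on_const continuous_on_rabs U g')+
    have "sph (\<lambda>\<omega>. U \<omega> * U \<omega>) \<le> sph (\<lambda>\<omega>. U \<omega> * g \<omega> + e * \<bar>U \<omega>\<bar>)"
    proof (rule sph_mono[OF cUU continuous_on_add[OF c1]])
      fix \<omega> :: 'a assume "\<omega> \<in> sphere 0 1"
      then have "\<bar>U \<omega> - g \<omega>\<bar> \<le> e" using g(2)[of \<omega>] by simp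
      then have "\<bar>U \<omega>\<bar> * \<bar>U \<omega> - g \<omega>\<bar> \<le> \<bar>U \<omega>\<bar> * e" by (rule mult_left_mono) simp
      then have "U \<omega> * (U \<omega> - g \<omega>) \<le> e * \<bar>U \<omega>\<bar>"
        by (metis abs_ge_self abs_mult mult.commute order_trans)
      then show "U \<omega> * U \<omega> \<le> U \<omega> * g \<omega> + e * \<bar>U \<omega>\<bar>" by (simp add: right_diff_distrib)
    qed
    also have "\<dots> = e * sph (\<lambda>\<omega>. \<bar>U \<omega>\<bar>)" unfolding sph_add[OF c1] g'(2) sph_cmult by simp
    finally show ?thesis .
  qed
  have "sph (\<lambda>\<omega>. U \<omega> * U \<omega>) \<le> 0"
  proof (rule ccontr)
    assume n: "\<not> ?thesis"
    define S where "S = sph (\<lambda>\<omega>. U \<omega> * U \<omega>)"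
    \<comment> \<open>The added 1 keeps C positive, so that e = S/(2 C) may be taken; it leads to S
      <= S/2.\<close>
    define C where "C = \<bar>sph (\<lambda>\<omega>. \<bar>U \<omega>\<bar>)\<bar> + 1"
    have S: "S > 0" using n by (simp add: S_def)
    have C: "C > 0" "sph (\<lambda>\<omega>. \<bar>U \<omega>\<bar>) \<le> C" by (auto simp: C_def)
    have "S \<le> S / (2 * C) * sph (\<lambda>\<omega>. \<bar>U \<omega>\<bar>)" using le[of "S / (2 * C)"] S C by (simp add: S_def)
    also have "\<dots> \<le> S / (2 * C) * C" by (rule mult_left_mono[OF C(2)]) (use S C in simp)
    also have "\<dots> = S / 2" using C by simp
    finally show False using S by simp
  qed
  moreover have "sph (\<lambda>\<omega>. U \<omega> * U \<omega>) \<ge> 0"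
    using sph_mono[OF continuous_on_const cUU, of 0] by simp
  ultimately have "sph (\<lambda>\<omega>. U \<omega> * U \<omega>) = 0" by simp
  from sph_definite[OF cUU _ this \<omega>] show ?thesis by simp
qed

text \<open>Gram-Schmidt by induction on B, which may be linearly dependent: the residual w of the
  new function b0 is the next direction, and if w vanishes on the sphere there is nothing to
  correct.\<close>

lemma Gram_projection:
  fixes U :: "'a::euclidean_space \<Rightarrow> real"
  assumes "finite B" "\<And>b. b \<in> B \<Longrightarrow> continuous_on (sphere 0 1) b" "continuous_on (sphere 0 1) U"
  shows "\<exists>a. \<forall>b'\<in>B. sph (\<lambda>\<omega>. (U \<omega> - (\<Sum>b\<in>B. a b * b \<omega>)) * b' \<omega>) = 0"
  using assms
proof (induction B arbitrary: U)
  case (insert b0 B)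
  have cb0: "continuous_on (sphere 0 1) b0" and cB: "\<And>b. b \<in> B \<Longrightarrow> continuous_on (sphere 0 1) b" and cU: "continuous_on (sphere 0 1) U"
    using insert.prems by auto
  obtain a where a: "\<And>b'. b' \<in> B \<Longrightarrow> sph (\<lambda>\<omega>. (U \<omega> - (\<Sum>b\<in>B. a b * b \<omega>)) * b' \<omega>) = 0"
    using insert.IH[OF cB cU] by blast
  obtain a0 where a0: "\<And>b'. b' \<in> B \<Longrightarrow> sph (\<lambda>\<omega>. (b0 \<omega> - (\<Sum>b\<in>B. a0 b * b \<omega>)) * b' \<omega>) = 0"
    using insert.IH[OF cB cb0] by blast
  define V where "V = (\<lambda>\<omega>. U \<omega> - (\<Sum>b\<in>B. a b * b \<omega>))"
  define w where "w = (\<lambda>\<omega>. b0 \<omega> - (\<Sum>b\<in>B. a0 b * b \<omega>))"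
  have cV: "continuous_on (sphere 0 1) V" and cw: "continuous_on (sphere 0 1) w"
    unfolding V_def w_def by (intro continuous_intros cU cb0 cB; assumption)+
  \<comment> \<open>If the denominator is 0, then w vanishes on the sphere by
    \<open>sph_definite\<close>, and t = 0 by the convention for division.\<close>
  define t where "t = sph (\<lambda>\<omega>. V \<omega> * w \<omega>) / sph (\<lambda>\<omega>. w \<omega> * w \<omega>)"
  define X where "X = (\<lambda>\<omega>. V \<omega> - t * w \<omega>)"
  have cX: "continuous_on (sphere 0 1) X" unfolding X_def by (intro continuous_intros cV cw)
  have X: "sph (\<lambda>\<omega>. X \<omega> * f \<omega>) = sph (\<lambda>\<omega>. V \<omega> * f \<omega>) - t * sph (\<lambda>\<omega>. w \<omega> * f \<omega>)"
    if cf: "continuous_on (sphere 0 1) f" for f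
  proof -
    have "sph (\<lambda>\<omega>. X \<omega> * f \<omega>) = sph (\<lambda>\<omega>. V \<omega> * f \<omega> + (- t) * (w \<omega> * f \<omega>))"
      by (rule sph_cong) (simp add: X_def algebra_simps)
    then show ?thesis
      using sph_add[OF continuous_on_mult[OF cV cf] continuous_on_mult[OF continuous_on_const continuous_on_mult[OF cw cf]], of "- t"]
        sph_cmult[of "- t" "\<lambda>\<omega>. w \<omega> * f \<omega>"] by simp
  qed
  have XB: "sph (\<lambda>\<omega>. X \<omega> * b' \<omega>) = 0" if "b' \<in> B" for b'
    using X[OF cB[OF that]] a[OF that] a0[OF that] by (simp add: V_def w_def)
  have Xw: "sph (\<lambda>\<omega>. X \<omega> * w \<omega>) = 0"
  proof (cases "sph (\<lambda>\<omega>. w \<omega> * w \<omega>) = 0")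
    case True
    have "w \<omega> = 0" if "\<omega> \<in> sphere 0 1" for \<omega>
      using sph_definite[OF continuous_on_mult[OF cw cw] _ True that] by simp
    then have "sph (\<lambda>\<omega>. X \<omega> * w \<omega>) = sph (\<lambda>_::'a. 0)" by (intro sph_cong) simp
    then show ?thesis by simp
  next
    case False
    then show ?thesis using X[OF cw] by (simp add: t_def)
  qed
  have "sph (\<lambda>\<omega>. X \<omega> * b0 \<omega>) = sph (\<lambda>\<omega>. X \<omega> * w \<omega> + (\<Sum>b\<in>B. a0 b * (X \<omega> * b \<omega>)))"
    by (rule sph_cong) (simp add: w_def algebra_simps sum_distrib_left)
  also have "\<dots> = sph (\<lambda>\<omega>. X \<omega> * w \<omega>) + (\<Sum>b\<in>B. sph (\<lambda>\<omega>. a0 b * (X \<omega> * b \<omega>)))"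
    by (subst sph_add, intro continuous_intros cX cw, intro continuous_intros cX cB, assumption, subst sph_sum,
        intro continuous_intros cX cB, assumption, rule refl)
  also have "\<dots> = 0" using XB Xw by (simp add: sph_cmult)
  finally have Xb0: "sph (\<lambda>\<omega>. X \<omega> * b0 \<omega>) = 0" .
  \<comment> \<open>Collects V - t w, where w contains b0 with coefficient 1 and each b of B with
    coefficient - \<open>a0 b\<close>.\<close>
  define c where "c = (\<lambda>b. if b = b0 then t else a b - t * a0 b)"
  have "U \<omega> - (\<Sum>b\<in>insert b0 B. c b * b \<omega>) = X \<omega>" for \<omega>
  proof -
    have "(\<Sum>b\<in>B. c b * b \<omega>) = (\<Sum>b\<in>B. (a b - t * a0 b) * b \<omega>)"
      using insert.hyps by (intro sum.cong refl) (auto simp: c_def)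
    then have "(\<Sum>b\<in>insert b0 B. c b * b \<omega>) = t * b0 \<omega> + (\<Sum>b\<in>B. (a b - t * a0 b) * b \<omega>)"
      using insert.hyps by (simp add: c_def)
    then show ?thesis
      by (simp add: X_def V_def w_def algebra_simps sum_subtractf sum_distrib_left)
  qed
  then show ?case using XB Xb0 by (intro exI[of _ c]) auto
qed simp

text \<open>Eigenfunctions of a symmetric operator for different eigenvalues: k (k + N - 2) and m (m
  + N - 2) differ by (k - m) (k + m + N - 2), where N >= 2 is the dimension and k + m > 0.\<close>

lemma sph_hharm_orthogonal:
  fixes h h' :: "'a::euclidean_space \<Rightarrow> real"
  assumes h: "hharm k h" "hharm m h'" and km: "k \<noteq> m" and N: "DIM('a) \<ge> 2"
  shows "sph (\<lambda>\<omega>. h \<omega> * h' \<omega>) = 0"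
proof -
  let ?e = "\<lambda>k. real k * (real k + real DIM('a) - 2)"
  have C: "Ck_on 2 UNIV h" "Ck_on 2 UNIV h'" using h homp_Ck_on unfolding hharm_def by blast+
  have "sph (\<lambda>\<omega>. sphere_laplacian h (1 *\<^sub>R \<omega>) * h' \<omega>) = sph (\<lambda>\<omega>. h (1 *\<^sub>R \<omega>) * sphere_laplacian h' \<omega>)"
    by (rule sph_sphere_laplacian[OF open_UNIV C(1) _ C(2)]) simp
  moreover have "sph (\<lambda>\<omega>. sphere_laplacian h (1 *\<^sub>R \<omega>) * h' \<omega>) = sph (\<lambda>\<omega>. (- 2 * ?e k) * (h \<omega> * h' \<omega>))"
    by (rule sph_cong) (simp add: sphere_laplacian_harmonic[OF hharm_harmonic[OF h(1)]])
  moreover have "sph (\<lambda>\<omega>. h (1 *\<^sub>R \<omega>) * sphere_laplacian h' \<omega>) = sph (\<lambda>\<omega>. (- 2 * ?e m) * (h \<omega> * h' \<omega>))"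
    by (rule sph_cong) (simp add: sphere_laplacian_harmonic[OF hharm_harmonic[OF h(2)]])
  ultimately have "(?e k - ?e m) * sph (\<lambda>\<omega>. h \<omega> * h' \<omega>) = 0"
    unfolding sph_cmult by (simp add: algebra_simps)
  moreover have "?e k - ?e m = (real k - real m) * (real k + real m + real DIM('a) - 2)"
    by (simp add: algebra_simps)
  moreover have "real k + real m + real DIM('a) - 2 > 0" using km N by linarith
  ultimately show ?thesis using km by simp
qed

text \<open>Ensures that every degree occurs, so that each listed number really has an
  eigenfunction. Two coordinates suffice: powers of the complex variable formed from them have
  harmonic real parts.\<close>

lemma ex_hharm:
  assumes "DIM('a::euclidean_space) \<ge> 2"
  shows "\<exists>h :: 'a \<Rightarrow> real. hharm k h \<and> (\<exists>x. h x \<noteq> 0)"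
proof -
  obtain e1 e2 :: 'a where e: "e1 \<in> Basis" "e2 \<in> Basis" "e1 \<noteq> e2"
  proof -
    have "\<not> DIM('a) \<le> Suc 0" using assms by simp
    then have "\<not> (\<forall>a\<in>Basis :: 'a set. \<forall>b\<in>Basis. a = b)" unfolding card_le_Suc0_iff_eq[OF finite_Basis] .
    then show ?thesis using that by blast
  qed
  text \<open>Real and imaginary part of \<open>(x\<^sub>1 + i x\<^sub>2)\<^sup>k\<close>.\<close>
  define PQ where "PQ = (\<lambda>k. rec_nat ((\<lambda>_. 1), (\<lambda>_. 0)) (\<lambda>_ (P, Q).
     ((\<lambda>x::'a. (x \<bullet> e1) * P x - (x \<bullet> e2) * Q x), (\<lambda>x. (x \<bullet> e1) * Q x + (x \<bullet> e2) * P x))) k)"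
  define P Q where "P = (\<lambda>k. fst (PQ k))" and "Q = (\<lambda>k. snd (PQ k))"
  have P0: "P 0 = (\<lambda>_. 1)" "Q 0 = (\<lambda>_. 0)" by (auto simp: P_def Q_def PQ_def)
  have PS: "P (Suc k) = (\<lambda>x. (x \<bullet> e1) * P k x - (x \<bullet> e2) * Q k x)"
    "Q (Suc k) = (\<lambda>x. (x \<bullet> e1) * Q k x + (x \<bullet> e2) * P k x)" for k
    by (auto simp: P_def Q_def PQ_def split_beta)
  have hom: "homp k (P k) \<and> homp k (Q k)" for k
    by (induction k) (auto simp: P0 PS intro!: homp_const homp_zero homp_diff homp_add homp_coord e)
  have dP: "P k differentiable (at x)" "Q k differentiable (at x)" for k x
    using hom[of k] homp_differentiable by blast+
  have dx: "(\<lambda>x. x \<bullet> b) differentiable (at x)" for b x :: 'a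
    using Ck_on_differentiable[OF Ck_on_inner[of 1 UNIV b]] by auto
  have pdiff: "partial_deriv a (\<lambda>x. f x - g x) x = partial_deriv a f x - partial_deriv a g x"
    if "f differentiable (at x)" "g differentiable (at x)" for a x and f g :: "'a \<Rightarrow> real"
    using has_derivative_diff[OF that[unfolded frechet_derivative_works]]
    by (subst partial_derivI) (auto simp: partial_deriv_def)
  have pP: "partial_deriv i (P (Suc k)) x = (x \<bullet> e1) * partial_deriv i (P k) x + (i \<bullet> e1) * P k x
       - ((x \<bullet> e2) * partial_deriv i (Q k) x + (i \<bullet> e2) * Q k x)"
    "partial_deriv i (Q (Suc k)) x = (x \<bullet> e1) * partial_deriv i (Q k) x + (i \<bullet> e1) * Q k x
       + ((x \<bullet> e2) * partial_deriv i (P k) x + (i \<bullet> e2) * P k x)" for i k x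
    unfolding PS by (simp_all add: pdiff partial_deriv_add partial_deriv_mult differentiable_mult dP dx)
  have ei: "e1 \<bullet> e1 = 1" "e2 \<bullet> e2 = 1" "e1 \<bullet> e2 = 0" "e2 \<bullet> e1 = 0" using e by (auto simp: inner_Basis)
  \<comment> \<open>Cauchy-Riemann equations; the fact \<open>D\<close> after it is the rule that
    the derivative of z^(k+1) is (k + 1) z^k.\<close>
  have cr: "partial_deriv e1 (P k) x = partial_deriv e2 (Q k) x \<and> partial_deriv e2 (P k) x = - partial_deriv e1 (Q k) x" for k x
    by (induction k) (simp_all add: P0 pP ei)
  have D: "(\<forall>x. partial_deriv e1 (P (Suc k)) x = real (Suc k) * P k x) \<and> (\<forall>x. partial_deriv e1 (Q (Suc k)) x = real (Suc k) * Q k x)" for k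
  proof (induction k)
    case 0
    show ?case by (simp add: pP P0 ei)
  next
    case (Suc k)
    then have s: "partial_deriv e1 (P (Suc k)) x = real (Suc k) * P k x" "partial_deriv e1 (Q (Suc k)) x = real (Suc k) * Q k x" for x
      by blast+
    show ?case
      unfolding pP(1)[of e1 "Suc k"] pP(2)[of e1 "Suc k"] s ei by (simp add: PS algebra_simps)
  qed
  have other: "partial_deriv i (P k) x = 0 \<and> partial_deriv i (Q k) x = 0" if "i \<in> Basis" "i \<noteq> e1" "i \<noteq> e2" for i k x
    using that e by (induction k) (simp_all add: P0 pP inner_Basis)
  have lap: "laplacian (P k) x = 0" for k x
  proof (cases k)
    case 0 then show ?thesis by (simp add: P0 laplacian_def)
  next
    case (Suc m)
    have f1: "partial_deriv e1 (P k) = (\<lambda>x. real k * P m x)" and f2: "partial_deriv e2 (P k) = (\<lambda>x. - real k * Q m x)"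
    proof -
      have "partial_deriv e1 (Q k) x = real k * Q m x" for x using D[of m] Suc by blast
      then show "partial_deriv e2 (P k) = (\<lambda>x. - real k * Q m x)" using cr[of k] by (simp add: fun_eq_iff)
      show "partial_deriv e1 (P k) = (\<lambda>x. real k * P m x)" using D[of m] Suc by blast
    qed
    have "laplacian (P k) x = (\<Sum>i\<in>{e1, e2}. partial_deriv i (partial_deriv i (P k)) x)"
      unfolding laplacian_def
    proof (rule sum.mono_neutral_right)
      show "\<forall>i\<in>Basis - {e1, e2}. partial_deriv i (partial_deriv i (P k)) x = 0"
      proof
        fix i assume i: "i \<in> Basis - {e1, e2}"
        then have "partial_deriv i (P k) = (\<lambda>_. 0)" using other by (auto simp: fun_eq_iff)
        then show "partial_deriv i (partial_deriv i (P k)) x = 0" by simp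
      qed
    qed (use e in auto)
    also have "\<dots> = real k * partial_deriv e1 (P m) x + - real k * partial_deriv e2 (Q m) x"
      using e(3) partial_deriv_cmult[OF dP(1), of e1 "real k"] partial_deriv_cmult[OF dP(2), of e2 "- real k"] by (simp add: f1 f2)
    also have "\<dots> = 0" using cr[of m x] by simp
    finally show ?thesis .
  qed
  have "P k e1 = 1 \<and> Q k e1 = 0" for k by (induction k) (simp_all add: P0 PS ei)
  then have "P k e1 \<noteq> 0" by simp
  then show ?thesis using hom lap unfolding hharm_def by blast
qed

section \<open>Solutions of the boundary value problem\<close>

lemma bvp_solution_lincomb:
  fixes u v :: "'a::euclidean_space \<Rightarrow> real"
  assumes u: "bvp_solution \<kappa> \<mu> u" and v: "bvp_solution \<kappa> \<mu> v"
  shows "bvp_solution \<kappa> \<mu> (\<lambda>x. a * u x + b * v x)"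
proof -
  let ?B = "ball 0 1 :: 'a set" and ?w = "\<lambda>x. a * u x + b * v x"
  have u4: "Ck_on 4 ?B u" and v4: "Ck_on 4 ?B v" and u1: "C1_closure ?B u" and v1: "C1_closure ?B v"
    using u v unfolding bvp_solution_def by blast+
  have e4: "(4 :: nat) = Suc (Suc 2)" by simp
  have L: "Ck_on 2 ?B (laplacian u)" "Ck_on 2 ?B (laplacian v)"
    using Ck_on_laplacian[OF open_ball u4[unfolded e4]] Ck_on_laplacian[OF open_ball v4[unfolded e4]] .
  have C2: "Ck_on 2 ?B u" "Ck_on 2 ?B v" by (rule Ck_on_le[OF u4], simp) (rule Ck_on_le[OF v4], simp)
  have w4: "Ck_on 4 ?B ?w" by (intro Ck_on_add Ck_on_cmult open_ball u4 v4)
  have w1: "C1_closure ?B ?w"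
    unfolding C1_closure_def
  proof (intro conjI ballI)
    show "Ck_on 1 ?B ?w" by (rule Ck_on_le[OF w4]) simp
    show "continuous_on (closure ?B) ?w"
      using u1 v1 unfolding C1_closure_def by (intro continuous_intros) auto
    fix i :: 'a assume i: "i \<in> Basis"
    obtain g h where g: "continuous_on (closure ?B) g" "\<forall>x\<in>?B. g x = partial_deriv i u x"
      and h: "continuous_on (closure ?B) h" "\<forall>x\<in>?B. h x = partial_deriv i v x"
      using u1 v1 i unfolding C1_closure_def by blast
    have "a * g x + b * h x = partial_deriv i ?w x" if x: "x \<in> ?B" for x
    proof -
      have d: "u differentiable (at x)" "v differentiable (at x)"
        using Ck_on_differentiable[OF u4 _ x] Ck_on_differentiable[OF v4 _ x] by simp_all
      then have "(\<lambda>x. a * u x) differentiable (at x)" "(\<lambda>x. b * v x) differentiable (at x)"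
        by (auto intro: differentiable_mult)
      then show ?thesis using g h x d by (simp add: partial_deriv_add partial_deriv_cmult)
    qed
    moreover have "continuous_on (closure ?B) (\<lambda>x. a * g x + b * h x)" by (intro continuous_intros g h)
    ultimately show "\<exists>g. continuous_on (closure ?B) g \<and> (\<forall>x\<in>?B. g x = partial_deriv i ?w x)"
      by (intro exI[of _ "\<lambda>x. a * g x + b * h x"]) auto
  qed
  have pde: "laplacian (laplacian ?w) x - \<kappa>\<^sup>2 * ?w x = - \<mu> * laplacian ?w x" if x: "x \<in> ?B" for x
  proof -
    have l: "laplacian ?w y = a * laplacian u y + b * laplacian v y" if "y \<in> ?B" for y
      by (rule laplacian_lincomb[OF open_ball that C2])
    have "laplacian (laplacian ?w) x = laplacian (\<lambda>y. a * laplacian u y + b * laplacian v y) x"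
      by (rule laplacian_cong[OF open_ball x l])
    also have "\<dots> = a * laplacian (laplacian u) x + b * laplacian (laplacian v) x"
      by (rule laplacian_lincomb[OF open_ball x L])
    finally have ll: "laplacian (laplacian ?w) x = a * laplacian (laplacian u) x + b * laplacian (laplacian v) x" .
    have Luv: "laplacian (laplacian u) x = \<kappa>\<^sup>2 * u x - \<mu> * laplacian u x" "laplacian (laplacian v) x = \<kappa>\<^sup>2 * v x - \<mu> * laplacian v x"
      using u v x unfolding bvp_solution_def by (auto simp: algebra_simps)
    show ?thesis unfolding ll l[OF x] Luv by (simp add: algebra_simps)
  qed
  have "?w \<theta> = 0 \<and> ((\<lambda>r. ?w (r *\<^sub>R \<theta>)) has_real_derivative 0) (at_left 1)" if \<theta>: "\<theta> \<in> sphere 0 1" for \<theta>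
  proof -
    have uv: "u \<theta> = 0" "v \<theta> = 0" "((\<lambda>r. u (r *\<^sub>R \<theta>)) has_real_derivative 0) (at_left 1)"
      "((\<lambda>r. v (r *\<^sub>R \<theta>)) has_real_derivative 0) (at_left 1)"
      using u v \<theta> unfolding bvp_solution_def by blast+
    show ?thesis using uv(1,2) DERIV_add[OF DERIV_cmult[OF uv(3), of a] DERIV_cmult[OF uv(4), of b]] by simp
  qed
  then show ?thesis unfolding bvp_solution_def using w4 w1 pde by blast
qed

text \<open>Interior derivatives are local, and on the sphere only one-sided limits along radii
  occur. The lemma is needed because \<open>span_on\<close> fixes functions on the closed ball
  only.\<close>

lemma bvp_solution_cong:
  fixes u v :: "'a::euclidean_space \<Rightarrow> real"
  assumes eq: "\<And>x. x \<in> cball 0 1 \<Longrightarrow> u x = v x" and u: "bvp_solution \<kappa> \<mu> u"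
  shows "bvp_solution \<kappa> \<mu> v"
proof -
  let ?B = "ball 0 1 :: 'a set"
  have eqB: "u x = v x" if "x \<in> ?B" for x using eq that by simp
  have "Ck_on n ?B u \<longleftrightarrow> Ck_on n ?B v" for n by (rule Ck_on_cong[OF open_ball eqB])
  moreover have "partial_deriv i u x = partial_deriv i v x" if "x \<in> ?B" for i x
    by (rule partial_deriv_cong[OF open_ball that eqB])
  moreover have "continuous_on (closure ?B) u \<longleftrightarrow> continuous_on (closure ?B) v"
    by (rule continuous_on_cong) (use eq in auto)
  ultimately have "Ck_on 4 ?B v" "C1_closure ?B v"
    using u unfolding bvp_solution_def C1_closure_def by auto
  moreover have l: "laplacian u x = laplacian v x" if "x \<in> ?B" for x by (rule laplacian_cong[OF open_ball that eqB])
  moreover have "laplacian (laplacian u) x = laplacian (laplacian v) x" if "x \<in> ?B" for x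
    by (rule laplacian_cong[OF open_ball that l])
  moreover have "v \<theta> = 0 \<and> ((\<lambda>r. v (r *\<^sub>R \<theta>)) has_real_derivative 0) (at_left 1)" if \<theta>: "\<theta> \<in> sphere 0 1" for \<theta>
  proof -
    have d: "u \<theta> = 0" "((\<lambda>r. u (r *\<^sub>R \<theta>)) has_real_derivative 0) (at_left 1)"
      using u \<theta> unfolding bvp_solution_def by blast+
    have "eventually (\<lambda>r. u (r *\<^sub>R \<theta>) = v (r *\<^sub>R \<theta>)) (at_left (1 :: real))"
      unfolding eventually_at_left_field
    proof (intro exI[of _ 0] conjI allI impI)
      fix r :: real assume "0 < r" "r < 1"
      then show "u (r *\<^sub>R \<theta>) = v (r *\<^sub>R \<theta>)" using \<theta> by (intro eq) simp
    qed simp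
    then have "eventually (\<lambda>r. (u (r *\<^sub>R \<theta>) - u (1 *\<^sub>R \<theta>)) / (r - 1) = (v (r *\<^sub>R \<theta>) - v (1 *\<^sub>R \<theta>)) / (r - 1)) (at_left (1 :: real))"
      by eventually_elim (use eq[of \<theta>] \<theta> in simp)
    from tendsto_cong[OF this] d(2) have "((\<lambda>r. v (r *\<^sub>R \<theta>)) has_real_derivative 0) (at_left 1)"
      unfolding has_field_derivative_iff by simp
    then show ?thesis using d(1) eq[of \<theta>] \<theta> by simp
  qed
  ultimately show ?thesis
    using u eqB unfolding bvp_solution_def by auto
qed

lemma bvp_solution_zero: "bvp_solution \<kappa> \<mu> (\<lambda>_. 0)"
  unfolding bvp_solution_def
proof (intro conjI ballI)
  have "laplacian (\<lambda>_. 0) = (\<lambda>_ :: 'a. 0)" by (simp add: fun_eq_iff laplacian_def)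
  then show "laplacian (laplacian (\<lambda>_. 0)) x - \<kappa>\<^sup>2 * 0 = - \<mu> * laplacian (\<lambda>_. 0) x" for x :: 'a by simp
qed (auto intro: C1_closureI simp del: Ck_on.simps)

lemma span_on_bvp_solution:
  fixes B :: "('a::euclidean_space \<Rightarrow> real) set"
  assumes B: "\<And>v. v \<in> B \<Longrightarrow> bvp_solution \<kappa> \<mu> v" and u: "u \<in> span_on (cball 0 1) B"
  shows "bvp_solution \<kappa> \<mu> u"
proof -
  obtain T a where T: "finite T" "T \<subseteq> B" "\<forall>x\<in>cball 0 1. u x = (\<Sum>v\<in>T. a v * v x)"
    using u by (auto simp: span_on_def)
  have "bvp_solution \<kappa> \<mu> (\<lambda>x. \<Sum>v\<in>T. a v * v x)"
    using T(1,2)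
  proof (induction T)
    case empty
    then show ?case using bvp_solution_zero by simp
  next
    case (insert w T)
    then have "bvp_solution \<kappa> \<mu> w" "bvp_solution \<kappa> \<mu> (\<lambda>x. \<Sum>v\<in>T. a v * v x)" using B by auto
    from bvp_solution_lincomb[OF this, of "a w" 1] show ?case using insert.hyps by simp
  qed
  then show ?thesis by (rule bvp_solution_cong[rotated]) (use T(3) in auto)
qed

lemma profile_scale: "profile \<nu> \<tau> s (a * c) (a * d) z = a * profile \<nu> \<tau> s c d z"
  by (simp add: profile_def algebra_simps)

text \<open>Since K(1) > 0, the condition at z = 1 fixes (c, d) up to a scalar, so all solutions of
  one degree share their radial part.\<close>

lemma profile_unique:
  assumes \<nu>: "\<nu> \<ge> 0" and \<tau>: "\<tau> > 0" and s: "s > 0"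
    and C: "(C, D) \<noteq> (0, 0)" "profile \<nu> \<tau> s C D 1 = 0" and c: "profile \<nu> \<tau> s c d 1 = 0"
  shows "profile \<nu> \<tau> s c d z = c / C * profile \<nu> \<tau> s C D z"
proof -
  have C0: "C \<noteq> 0" by (rule profile_eq_ratio(1)[OF \<nu> \<tau> s C])
  have K: "bess \<nu> (- s) > 0" using \<nu> s by (intro bess_pos_neg) auto
  have e: "d * bess \<nu> (- s) = - c * bess \<nu> \<tau>" "D * bess \<nu> (- s) = - C * bess \<nu> \<tau>"
    using c C(2) by (auto simp: profile_def)
  have "(C * d) * bess \<nu> (- s) = (c * D) * bess \<nu> (- s)"
    using e by (metis mult.assoc mult.left_commute mult_minus_left)
  then have "C * d = c * D" using K by simp
  then have "d = c / C * D" using C0 by (simp add: field_simps)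
  then show ?thesis using profile_scale[of \<nu> \<tau> s "c / C" C D z] C0 by simp
qed

text \<open>A profile has only finitely many roots in ]0,1[. The radius found here shows
  eigenfunctions to be nontrivial and serves for reading off coefficients.\<close>

lemma ex_profile_nonzero:
  assumes \<nu>: "\<nu> \<ge> 0" and c0: "c0 > 0" and \<tau>: "\<tau> > 0" "char_fun \<nu> c0 \<tau> = 0"
    and cd: "(c, d) \<noteq> (0, 0)" "profile \<nu> \<tau> (c0 / \<tau>) c d 1 = 0"
  shows "\<exists>r. 0 < r \<and> r < 1 \<and> profile \<nu> \<tau> (c0 / \<tau>) c d (r\<^sup>2) \<noteq> 0"
proof -
  obtain n where n: "\<tau> = char_root \<nu> c0 n"
    using range_char_root[OF \<nu> c0] \<tau> by blast
  let ?Z = "{z. 0 < z \<and> z < 1 \<and> profile \<nu> \<tau> (c0 / \<tau>) c d z = 0}"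
  have "finite ?Z" by (rule profile_roots(1)[OF \<nu> c0 n cd])
  moreover have "infinite {0<..<1::real}" by simp
  ultimately have "\<not> {0<..<1} \<subseteq> ?Z" using finite_subset by blast
  then obtain z where z: "0 < z" "z < 1" "profile \<nu> \<tau> (c0 / \<tau>) c d z \<noteq> 0" unfolding subset_iff by auto
  then show ?thesis by (intro exI[of _ "sqrt z"]) auto
qed

text \<open>A solution is determined by its projections onto spherical harmonics. Only finitely many
  degrees contribute, and on each of them the radial part is a multiple of the same profile.\<close>

lemma bvp_solution_in_span:
  fixes u :: "'a::euclidean_space \<Rightarrow> real" and C D :: "nat \<Rightarrow> real"
  assumes N: "DIM('a) \<ge> 2" and \<tau>: "\<tau> > 0" and c0: "c0 > 0" "c0 = \<kappa>\<^sup>2 / 16"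
    and u: "bvp_solution \<kappa> (4 * \<tau> - 4 * (c0 / \<tau>)) u"
    and CD: "\<And>k. char_fun (nu DIM('a) k) c0 \<tau> = 0 \<Longrightarrow> (C k, D k) \<noteq> (0, 0)"
      "\<And>k. char_fun (nu DIM('a) k) c0 \<tau> = 0 \<Longrightarrow> profile (nu DIM('a) k) \<tau> (c0 / \<tau>) (C k) (D k) 1 = 0"
  shows "u \<in> span_on (cball 0 1) {\<lambda>x. P x * profile (nu DIM('a) k) \<tau> (c0 / \<tau>) (C k) (D k) (x \<bullet> x) | k P.
     char_fun (nu DIM('a) k) c0 \<tau> = 0 \<and> harmonic_homogeneous_poly k P \<and> (\<exists>x. P x \<noteq> 0)}" (is "_ \<in> span_on _ ?S")
proof -
  define s where "s = c0 / \<tau>"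
  have s: "s > 0" "s * \<tau> = \<kappa>\<^sup>2 / 16" using c0(1) \<tau> c0(2)[symmetric] by (simp_all add: s_def)
  define \<nu> where "\<nu> = nu DIM('a)"
  have \<nu>: "\<nu> k \<ge> 0" for k unfolding \<nu>_def by (rule nu_nonneg[OF N])
  define K where "K = {k. char_fun (\<nu> k) c0 \<tau> = 0}"
  \<comment> \<open>If \<tau> is a root for degree k, then k <= \<nu> k < \<tau> by
    \<open>char_root_gt\<close>.\<close>
  have "K \<subseteq> {..nat \<lceil>\<tau>\<rceil>}"
  proof
    fix k assume "k \<in> K"
    then obtain n where n: "\<tau> = char_root (\<nu> k) c0 n"
      using range_char_root[OF \<nu> c0(1)] \<tau> unfolding K_def by blast
    then have "\<nu> k < \<tau>" using char_root_gt[OF \<nu> c0(1)] by simp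
    moreover have "real k \<le> \<nu> k" using N by (simp add: \<nu>_def nu_def)
    ultimately have "real k \<le> \<tau>" by simp
    then show "k \<in> {..nat \<lceil>\<tau>\<rceil>}" by (simp add: le_nat_iff) linarith
  qed
  then have finK: "finite K" using finite_subset by blast
  define \<phi> where "\<phi> = (\<lambda>k. profile (\<nu> k) \<tau> s (C k) (D k))"
  have \<phi>1: "\<phi> k 1 = 0" if "k \<in> K" for k
    using CD(2)[of k] that by (simp add: \<phi>_def K_def \<nu>_def s_def)
  define good where "good = (\<lambda>k (B :: ('a \<Rightarrow> real) set). finite B \<and> (\<forall>b\<in>B. hharm k b) \<and> (\<forall>p. homp k p \<longrightarrow>
     (\<exists>h q. h \<in> span_on UNIV B \<and> homp (k - 2) q \<and> (k < 2 \<longrightarrow> q = (\<lambda>_. 0)) \<and> (\<forall>x. p x = h x + (x \<bullet> x) * q x))))"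
  have "\<forall>k. \<exists>B. good k B"
    unfolding good_def using harmonic_spanning_set by (rule allI)
  from choice[OF this] obtain B where "\<forall>k. good k (B k)" ..
  then have gB: "good k (B k)" for k by (rule spec)
  have B1: "finite (B k)" for k using gB[of k] unfolding good_def by (rule conjunct1)
  have B2: "hharm k b" if "b \<in> B k" for k b
    using conjunct1[OF conjunct2[OF gB[of k, unfolded good_def]]] that by (rule bspec)
  have B3: "\<exists>h q. h \<in> span_on UNIV (B k) \<and> homp (k - 2) q \<and> (k < 2 \<longrightarrow> q = (\<lambda>_. 0)) \<and> (\<forall>x. p x = h x + (x \<bullet> x) * q x)"
    if "homp k p" for k p
    using conjunct2[OF conjunct2[OF gB[of k, unfolded good_def]]] that by blast
  note B = B1 B2 B3
  have harm: "harmonic_homogeneous_poly k b" if "b \<in> B k" for k b using hharm_harmonic[OF B(2)[OF that]] .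
  have cb: "continuous_on S b" if "b \<in> B k" for S k b
    using B(2)[OF that] homp_continuous_on unfolding hharm_def by blast
  have cu: "continuous_on (cball 0 1) u" using u unfolding bvp_solution_def C1_closure_def by simp
  have cur: "continuous_on (sphere 0 1) (\<lambda>\<omega>. u (r *\<^sub>R \<omega>))" if "0 \<le> r" "r \<le> 1" for r
    by (rule continuous_on_sphere_scale[OF cu]) (use that in simp)
  \<comment> \<open>For k outside K the boundary conditions leave only c = d = 0; for k in K the
    profile is a multiple of \<phi> k.\<close>
  have proj: "\<exists>\<gamma>. \<forall>r. 0 < r \<longrightarrow> r < 1 \<longrightarrow> sph (\<lambda>\<omega>. u (r *\<^sub>R \<omega>) * b \<omega>) = \<gamma> * (r ^ k * \<phi> k (r\<^sup>2)) \<and> (k \<notin> K \<longrightarrow> \<gamma> = 0)"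
    if b: "b \<in> B k" for k b
  proof -
    have "bvp_solution \<kappa> (4 * \<tau> - 4 * s) u" using u by (simp add: s_def)
    from bvp_projection[OF this \<tau> s harm[OF b] N] obtain c d where
      cd: "\<And>r. 0 < r \<Longrightarrow> r < 1 \<Longrightarrow> sph (\<lambda>\<omega>. u (r *\<^sub>R \<omega>) * b \<omega>) = r ^ k * profile (\<nu> k) \<tau> s c d (r\<^sup>2)"
      and p: "profile (\<nu> k) \<tau> s c d 1 = 0" "profile' (\<nu> k) \<tau> s c d 1 = 0"
      unfolding \<nu>_def by blast
    show ?thesis
    proof (cases "k \<in> K")
      case True
      have "profile (\<nu> k) \<tau> s c d z = c / C k * \<phi> k z" for z
        unfolding \<phi>_def
        by (rule profile_unique[OF \<nu> \<tau> s(1) _ _ p(1)]) (use CD[of k] True in \<open>auto simp: K_def \<nu>_def s_def\<close>)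
      then show ?thesis using cd True by (intro exI[of _ "c / C k"]) auto
    next
      case False
      have "(c, d) = (0, 0)"
      proof (rule ccontr)
        assume "(c, d) \<noteq> (0, 0)"
        from char_fun_eq_0_if_profile[OF \<nu> \<tau> c0(1) this] p have "char_fun (\<nu> k) c0 \<tau> = 0" by (simp add: s_def)
        then show False using False by (simp add: K_def)
      qed
      then have "profile (\<nu> k) \<tau> s c d z = 0" for z by (simp add: profile_def)
      then show ?thesis using cd by (intro exI[of _ 0]) auto
    qed
  qed
  have "\<exists>a. \<forall>b'\<in>B k. \<forall>r. 0 < r \<longrightarrow> r < 1 \<longrightarrow>
      sph (\<lambda>\<omega>. u (r *\<^sub>R \<omega>) * b' \<omega>) = r ^ k * \<phi> k (r\<^sup>2) * (\<Sum>b\<in>B k. a b * sph (\<lambda>\<omega>. b \<omega> * b' \<omega>))" if k: "k \<in> K" for k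
  proof -
    have kK: "char_fun (\<nu> k) c0 \<tau> = 0" using k by (simp add: K_def)
    \<comment> \<open>The coefficients are determined at one radius where \<phi> k is nonzero. They
      are valid at all radii, because every projection of degree k has the same radial
      factor.\<close>
    obtain r0 where r0: "0 < r0" "r0 < 1" "\<phi> k (r0\<^sup>2) \<noteq> 0"
      using ex_profile_nonzero[OF \<nu> c0(1) \<tau> kK, of "C k" "D k"] CD[of k] kK unfolding \<phi>_def \<nu>_def s_def by blast
    define q where "q = r0 ^ k * \<phi> k (r0\<^sup>2)"
    have q: "q \<noteq> 0" using r0 by (simp add: q_def)
    obtain a where a: "\<And>b'. b' \<in> B k \<Longrightarrow> sph (\<lambda>\<omega>. (u (r0 *\<^sub>R \<omega>) - (\<Sum>b\<in>B k. a b * b \<omega>)) * b' \<omega>) = 0"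
      using Gram_projection[OF B(1) cb cur[of r0]] r0 by (meson less_imp_le)
    have "sph (\<lambda>\<omega>. u (r *\<^sub>R \<omega>) * b' \<omega>) = r ^ k * \<phi> k (r\<^sup>2) * (\<Sum>b\<in>B k. a b / q * sph (\<lambda>\<omega>. b \<omega> * b' \<omega>))"
      if b': "b' \<in> B k" and r: "0 < r" "r < 1" for b' r
    proof -
      obtain \<gamma> where \<gamma>: "\<And>r. 0 < r \<Longrightarrow> r < 1 \<Longrightarrow> sph (\<lambda>\<omega>. u (r *\<^sub>R \<omega>) * b' \<omega>) = \<gamma> * (r ^ k * \<phi> k (r\<^sup>2))"
        using proj[OF b'] by blast
      have "sph (\<lambda>\<omega>. u (r0 *\<^sub>R \<omega>) * b' \<omega>) = sph (\<lambda>\<omega>. (u (r0 *\<^sub>R \<omega>) - (\<Sum>b\<in>B k. a b * b \<omega>)) * b' \<omega> + (\<Sum>b\<in>B k. a b * (b \<omega> * b' \<omega>)))"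
        by (rule sph_cong) (simp add: left_diff_distrib sum_distrib_right mult.assoc)
      also have "\<dots> = sph (\<lambda>\<omega>. (u (r0 *\<^sub>R \<omega>) - (\<Sum>b\<in>B k. a b * b \<omega>)) * b' \<omega>) + sph (\<lambda>\<omega>. \<Sum>b\<in>B k. a b * (b \<omega> * b' \<omega>))"
        by (rule sph_add; intro continuous_intros cur cb[OF b'] cb; (assumption | use r0 in simp))
      also have "sph (\<lambda>\<omega>. \<Sum>b\<in>B k. a b * (b \<omega> * b' \<omega>)) = (\<Sum>b\<in>B k. sph (\<lambda>\<omega>. a b * (b \<omega> * b' \<omega>)))"
        by (rule sph_sum; intro continuous_intros cb[OF b'] cb; assumption)
      also have "\<dots> = (\<Sum>b\<in>B k. a b * sph (\<lambda>\<omega>. b \<omega> * b' \<omega>))" by (simp add: sph_cmult)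
      finally have "\<gamma> * q = (\<Sum>b\<in>B k. a b * sph (\<lambda>\<omega>. b \<omega> * b' \<omega>))"
        using \<gamma>[OF r0(1,2)] a[OF b'] by (simp add: q_def)
      then have "\<gamma> = (\<Sum>b\<in>B k. a b * sph (\<lambda>\<omega>. b \<omega> * b' \<omega>)) / q" using q by (simp add: field_simps)
      then show ?thesis using \<gamma>[OF r] by (simp add: sum_divide_distrib mult.commute)
    qed
    then show ?thesis by (intro exI[of _ "\<lambda>b. a b / q"]) blast
  qed
  then have "\<forall>k. \<exists>a. k \<in> K \<longrightarrow> (\<forall>b'\<in>B k. \<forall>r. 0 < r \<longrightarrow> r < 1 \<longrightarrow>
      sph (\<lambda>\<omega>. u (r *\<^sub>R \<omega>) * b' \<omega>) = r ^ k * \<phi> k (r\<^sup>2) * (\<Sum>b\<in>B k. a b * sph (\<lambda>\<omega>. b \<omega> * b' \<omega>)))" by blast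
  from choice[OF this] obtain a where a: "\<And>k b' r. k \<in> K \<Longrightarrow> b' \<in> B k \<Longrightarrow> 0 < r \<Longrightarrow> r < 1 \<Longrightarrow>
      sph (\<lambda>\<omega>. u (r *\<^sub>R \<omega>) * b' \<omega>) = r ^ k * \<phi> k (r\<^sup>2) * (\<Sum>b\<in>B k. a k b * sph (\<lambda>\<omega>. b \<omega> * b' \<omega>))" by blast
  define w where "w = (\<lambda>x. \<Sum>k\<in>K. \<Sum>b\<in>B k. a k b * (b x * \<phi> k (x \<bullet> x)))"
  have w_polar: "w (r *\<^sub>R \<omega>) = (\<Sum>k\<in>K. \<Sum>b\<in>B k. (a k b * (r ^ k * \<phi> k (r\<^sup>2))) * b \<omega>)" if "\<omega> \<in> sphere 0 1" for r \<omega>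
  proof -
    have "(r *\<^sub>R \<omega>) \<bullet> (r *\<^sub>R \<omega>) = r\<^sup>2" using that by (simp add: dot_square_norm power2_eq_square)
    then show ?thesis
      unfolding w_def by (intro sum.cong refl) (simp add: harmonic_homogeneous_polyD(2)[OF harm] mult_ac)
  qed
  \<comment> \<open>On each sphere of radius r < 1 the functions u and w have the same product with
    every b' of degree m: other degrees drop out by orthogonality, degree m agrees by the choice of
    \<open>a\<close>, and for m outside K both products are 0.\<close>
  have zero: "u (r *\<^sub>R \<omega>) - w (r *\<^sub>R \<omega>) = 0" if r: "0 < r" "r < 1" and \<omega>: "\<omega> \<in> sphere 0 1" for r \<omega>
  proof -
    let ?W = "\<lambda>\<omega>. \<Sum>k\<in>K. \<Sum>b\<in>B k. (a k b * (r ^ k * \<phi> k (r\<^sup>2))) * b \<omega>"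
    have cW: "continuous_on (sphere 0 1) ?W" by (intro continuous_intros cb; assumption)
    have cU: "continuous_on (sphere 0 1) (\<lambda>\<omega>. u (r *\<^sub>R \<omega>) - ?W \<omega>)"
      by (intro continuous_on_diff cW cur) (use r in auto)
    have "u (r *\<^sub>R \<omega>) - ?W \<omega> = 0"
    proof (rule orthogonal_harmonics_imp_zero[where B = B and U = "\<lambda>\<omega>. u (r *\<^sub>R \<omega>) - ?W \<omega>", OF cU B(2) _ B(3) \<omega>])
      fix m b' assume b': "b' \<in> B m"
      have cb': "continuous_on (sphere 0 1) b'" by (rule cb[OF b'])
      let ?G = "\<lambda>k. r ^ k * \<phi> k (r\<^sup>2) * (\<Sum>b\<in>B k. a k b * sph (\<lambda>\<omega>. b \<omega> * b' \<omega>))"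
      have "sph (\<lambda>\<omega>. ?W \<omega> * b' \<omega>) = sph (\<lambda>\<omega>. \<Sum>k\<in>K. \<Sum>b\<in>B k. (a k b * (r ^ k * \<phi> k (r\<^sup>2))) * (b \<omega> * b' \<omega>))"
        by (rule sph_cong) (simp add: sum_distrib_right mult.assoc)
      also have "\<dots> = (\<Sum>k\<in>K. sph (\<lambda>\<omega>. \<Sum>b\<in>B k. (a k b * (r ^ k * \<phi> k (r\<^sup>2))) * (b \<omega> * b' \<omega>)))"
        by (rule sph_sum; intro continuous_intros cb' cb; assumption)
      also have "\<dots> = (\<Sum>k\<in>K. \<Sum>b\<in>B k. sph (\<lambda>\<omega>. (a k b * (r ^ k * \<phi> k (r\<^sup>2))) * (b \<omega> * b' \<omega>)))"
        by (intro sum.cong refl sph_sum continuous_intros cb' cb; assumption)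
      also have "\<dots> = (\<Sum>k\<in>K. ?G k)"
        unfolding sph_cmult sum_distrib_left by (intro sum.cong refl) (simp add: mult_ac)
      also have "\<dots> = (\<Sum>k\<in>K. if k = m then ?G k else 0)"
      proof (rule sum.cong[OF refl])
        fix k assume "k \<in> K"
        have "sph (\<lambda>\<omega>. b \<omega> * b' \<omega>) = 0" if "b \<in> B k" "k \<noteq> m" for b
          by (rule sph_hharm_orthogonal[OF B(2)[OF that(1)] B(2)[OF b'] that(2) N])
        then show "?G k = (if k = m then ?G k else 0)" by simp
      qed
      also have "\<dots> = (if m \<in> K then ?G m else 0)" using finK by simp
      also have "\<dots> = sph (\<lambda>\<omega>. u (r *\<^sub>R \<omega>) * b' \<omega>)"
      proof (cases "m \<in> K")
        case True
        then show ?thesis using a[OF True b' r] by simp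
      next
        case False
        then show ?thesis using proj[OF b'] r by auto
      qed
      finally have e: "sph (\<lambda>\<omega>. ?W \<omega> * b' \<omega>) = sph (\<lambda>\<omega>. u (r *\<^sub>R \<omega>) * b' \<omega>)" .
      have "sph (\<lambda>\<omega>. (u (r *\<^sub>R \<omega>) - ?W \<omega>) * b' \<omega>) = sph (\<lambda>\<omega>. u (r *\<^sub>R \<omega>) * b' \<omega> + (- 1) * (?W \<omega> * b' \<omega>))"
        by (rule sph_cong) (simp add: left_diff_distrib)
      also have "\<dots> = sph (\<lambda>\<omega>. u (r *\<^sub>R \<omega>) * b' \<omega>) + sph (\<lambda>\<omega>. (- 1) * (?W \<omega> * b' \<omega>))"
      proof (rule sph_add)
        show "continuous_on (sphere 0 1) (\<lambda>\<omega>. u (r *\<^sub>R \<omega>) * b' \<omega>)"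
          by (intro continuous_on_mult cb' cur) (use r in auto)
      qed (intro continuous_on_mult continuous_on_const cW cb')
      also have "\<dots> = 0" unfolding sph_cmult e by simp
      finally show "sph (\<lambda>\<omega>. (u (r *\<^sub>R \<omega>) - ?W \<omega>) * b' \<omega>) = 0" .
    qed
    then show ?thesis using w_polar[OF \<omega>] by simp
  qed
  have c\<phi>: "continuous_on S (\<lambda>x. \<phi> k (x \<bullet> x))" for S :: "'a set" and k
    unfolding \<phi>_def profile_def by (intro continuous_intros \<nu>)
  have cw: "continuous_on (cball 0 1) w"
    unfolding w_def by (intro continuous_intros cb c\<phi>; assumption)
  \<comment> \<open>Continuity extends the equality from 0 < r < 1 to the origin and the boundary
    sphere.\<close>
  have uw: "u x = w x" if x: "x \<in> cball 0 1" for x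
  proof -
    obtain r \<theta> where r: "0 \<le> r" "r \<le> 1" "\<theta> \<in> sphere 0 1" "x = r *\<^sub>R \<theta>"
    proof (cases "x = 0")
      case True
      obtain e :: 'a where "e \<in> Basis" using nonempty_Basis by blast
      then show thesis using that[of 0 e] True by simp
    next
      case False
      then show thesis using that[of "norm x" "sgn x"] x by (simp add: norm_sgn sgn_div_norm)
    qed
    have "(\<lambda>r. u (r *\<^sub>R \<theta>) - w (r *\<^sub>R \<theta>)) r = 0"
    proof (rule continuous_constant_on_closure[where S = "{0<..<1}" and f = "\<lambda>r. u (r *\<^sub>R \<theta>) - w (r *\<^sub>R \<theta>)" and x = r])
      have c: "continuous_on (closure {0<..<1}) (\<lambda>r. f (r *\<^sub>R \<theta>))" if "continuous_on (cball 0 1) f" for f :: "'a \<Rightarrow> real"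
      proof (rule continuous_on_compose2[OF that])
        show "continuous_on (closure {0<..<1}) (\<lambda>r. r *\<^sub>R \<theta>)" by (intro continuous_intros)
      qed (use r in auto)
      show "continuous_on (closure {0<..<1}) (\<lambda>r. u (r *\<^sub>R \<theta>) - w (r *\<^sub>R \<theta>))"
        by (intro continuous_on_diff c cu cw)
    qed (use zero r in auto)
    then show ?thesis using r by simp
  qed
  show ?thesis
  proof (rule span_on_sum[OF finK])
    show "u x = (\<Sum>k\<in>K. \<Sum>b\<in>B k. a k b * (b x * \<phi> k (x \<bullet> x)))" if "x \<in> cball 0 1" for x
      using uw[OF that] by (simp add: w_def)
    fix k assume k: "k \<in> K"
    show "(\<lambda>x. \<Sum>b\<in>B k. a k b * (b x * \<phi> k (x \<bullet> x))) \<in> span_on (cball 0 1) ?S"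
    proof (rule span_on_sum[OF B(1)[of k]])
      fix b assume b: "b \<in> B k"
      show "(\<lambda>x. a k b * (b x * \<phi> k (x \<bullet> x))) \<in> span_on (cball 0 1) ?S"
      proof (cases "\<exists>x. b x \<noteq> 0")
        case True
        have "(\<lambda>x. b x * \<phi> k (x \<bullet> x)) \<in> ?S"
          using True harm[OF b] k unfolding \<phi>_def s_def \<nu>_def K_def by blast
        then show ?thesis by (rule span_on_base[where a = "a k b"]) simp
      next
        case False
        then show ?thesis by (intro span_on_zero) simp
      qed
    qed simp
  qed
qed

section \<open>The radial eigenfunctions\<close>

lemma nu_Suc: "nu N (Suc k) = nu N k + 1"
  by (simp add: nu_def)

text \<open>The coefficients absorb the powers from \<open>bessel_J_eq\<close> and
  \<open>bessel_I_eq\<close>. The quotient of \<kappa>^2/16 by \<alpha>^2/4 is left unsimplified to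
  match c/t in \<open>char_fun\<close>.\<close>

definition radial_profile :: "nat \<Rightarrow> real \<Rightarrow> nat \<Rightarrow> real \<Rightarrow> real \<Rightarrow> real \<Rightarrow> real \<Rightarrow> real" where
  "radial_profile N \<kappa> k \<alpha> c d = profile (nu N k) (\<alpha>\<^sup>2 / 4) (\<kappa>\<^sup>2 / 16 / (\<alpha>\<^sup>2 / 4))
     (c * (\<alpha> / 2) powr nu N k) (d * (\<kappa> / \<alpha> / 2) powr nu N k)"

definition radial_profile' :: "nat \<Rightarrow> real \<Rightarrow> nat \<Rightarrow> real \<Rightarrow> real \<Rightarrow> real \<Rightarrow> real \<Rightarrow> real" where
  "radial_profile' N \<kappa> k \<alpha> c d = profile' (nu N k) (\<alpha>\<^sup>2 / 4) (\<kappa>\<^sup>2 / 16 / (\<alpha>\<^sup>2 / 4))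
     (c * (\<alpha> / 2) powr nu N k) (d * (\<kappa> / \<alpha> / 2) powr nu N k)"

context
  fixes N :: nat and \<kappa> \<alpha> :: real and k :: nat
  assumes N: "N \<ge> 2" and \<kappa>: "\<kappa> > 0" and \<alpha>: "\<alpha> > 0"
begin

text \<open>The exponents - (N - 2)/2 and \<nu> of r add up to the integer k.\<close>

lemma radial_formula_eq:
  assumes r: "r > 0"
  shows "radial_formula N \<kappa> k \<alpha> c d r = r ^ k * radial_profile N \<kappa> k \<alpha> c d (r\<^sup>2)"
proof -
  define \<nu> where "\<nu> = nu N k"
  have \<nu>: "\<nu> \<ge> 0" unfolding \<nu>_def by (rule nu_nonneg[OF N])
  have p: "r powr (- (real N - 2) / 2) * r powr \<nu> = r ^ k"
  proof -
    have "r powr (- (real N - 2) / 2) * r powr \<nu> = r powr real k"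
      by (simp add: powr_add[symmetric] \<nu>_def nu_def diff_divide_distrib)
    then show ?thesis using r by (simp add: powr_realpow)
  qed
  have J: "bessel_J \<nu> (\<alpha> * r) = (\<alpha> / 2) powr \<nu> * r powr \<nu> * bess \<nu> (\<alpha>\<^sup>2 / 4 * r\<^sup>2)"
  proof -
    have "(\<alpha> * r / 2) powr \<nu> = (\<alpha> / 2) powr \<nu> * r powr \<nu>"
      using \<alpha> r by (subst powr_mult[symmetric]) (auto simp: mult.commute)
    moreover have "(\<alpha> * r)\<^sup>2 / 4 = \<alpha>\<^sup>2 / 4 * r\<^sup>2" by (simp add: power_mult_distrib)
    ultimately show ?thesis using bessel_J_eq[OF \<nu>, of "\<alpha> * r"] \<alpha> r by simp
  qed
  have I: "bessel_I \<nu> (\<kappa> / \<alpha> * r) = (\<kappa> / \<alpha> / 2) powr \<nu> * r powr \<nu> * bess \<nu> (- (\<kappa>\<^sup>2 / 16 / (\<alpha>\<^sup>2 / 4)) * r\<^sup>2)"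
  proof -
    have "(\<kappa> / \<alpha> * r / 2) powr \<nu> = (\<kappa> / \<alpha> / 2) powr \<nu> * r powr \<nu>"
      using \<kappa> \<alpha> r by (subst powr_mult[symmetric]) (auto simp: mult.commute)
    moreover have "- ((\<kappa> / \<alpha> * r)\<^sup>2 / 4) = - (\<kappa>\<^sup>2 / 16 / (\<alpha>\<^sup>2 / 4)) * r\<^sup>2" using \<alpha> by (simp add: power_mult_distrib power_divide)
    moreover have "\<kappa> / \<alpha> * r > 0" using \<kappa> \<alpha> r by simp
    ultimately show ?thesis using bessel_I_eq[OF \<nu>, of "\<kappa> / \<alpha> * r"] by presburger
  qed
  have "radial_formula N \<kappa> k \<alpha> c d r = r powr (- (real N - 2) / 2) * r powr \<nu> *
     (c * (\<alpha> / 2) powr \<nu> * bess \<nu> (\<alpha>\<^sup>2 / 4 * r\<^sup>2) + d * (\<kappa> / \<alpha> / 2) powr \<nu> * bess \<nu> (- (\<kappa>\<^sup>2 / 16 / (\<alpha>\<^sup>2 / 4)) * r\<^sup>2))"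
    unfolding radial_formula_def \<nu>_def[symmetric] J I by (simp only: distrib_left mult_ac)
  also have "\<dots> = r ^ k * radial_profile N \<kappa> k \<alpha> c d (r\<^sup>2)"
    unfolding p radial_profile_def profile_def \<nu>_def[symmetric] ..
  finally show ?thesis .
qed

lemma DERIV_radial_profile:
  "(radial_profile N \<kappa> k \<alpha> c d has_real_derivative radial_profile' N \<kappa> k \<alpha> c d z) (at z)"
  unfolding radial_profile_def radial_profile'_def by (rule DERIV_profile[OF nu_nonneg[OF N]])

lemma continuous_on_radial_profile:
  "continuous_on S f \<Longrightarrow> continuous_on S (\<lambda>x. radial_profile N \<kappa> k \<alpha> c d (f x))"
  unfolding radial_profile_def profile_def using nu_nonneg[OF N] by (intro continuous_intros)

lemma radial_eq:
  assumes "r \<ge> 0" shows "radial N \<kappa> k \<alpha> c d r = r ^ k * radial_profile N \<kappa> k \<alpha> c d (r\<^sup>2)"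
proof (cases "r = 0")
  case True
  have "continuous_on UNIV (\<lambda>r. r ^ k * radial_profile N \<kappa> k \<alpha> c d (r\<^sup>2))"
    by (intro continuous_intros continuous_on_radial_profile)
  then have "((\<lambda>r. r ^ k * radial_profile N \<kappa> k \<alpha> c d (r\<^sup>2)) \<longlongrightarrow> 0 ^ k * radial_profile N \<kappa> k \<alpha> c d (0\<^sup>2)) (at_right 0)"
    unfolding continuous_on_def by (meson UNIV_I tendsto_within_subset subset_UNIV)
  moreover have ev: "eventually (\<lambda>r. radial_formula N \<kappa> k \<alpha> c d r = r ^ k * radial_profile N \<kappa> k \<alpha> c d (r\<^sup>2)) (at_right 0)"
    unfolding eventually_at_right_field using radial_formula_eq by (intro exI[of _ 1]) auto
  ultimately have "(radial_formula N \<kappa> k \<alpha> c d \<longlongrightarrow> 0 ^ k * radial_profile N \<kappa> k \<alpha> c d (0\<^sup>2)) (at_right 0)"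
    by (simp only: tendsto_cong[OF ev])
  then show ?thesis using True by (simp add: radial_def tendsto_Lim[OF trivial_limit_at_right_real])
next
  case False
  then show ?thesis using assms radial_formula_eq[of r] by (simp add: radial_def)
qed

lemma DERIV_radial:
  assumes r: "r > 0"
  shows "(radial N \<kappa> k \<alpha> c d has_real_derivative
     real k * r ^ (k - Suc 0) * radial_profile N \<kappa> k \<alpha> c d (r\<^sup>2) + radial_profile' N \<kappa> k \<alpha> c d (r\<^sup>2) * (2 * r) * r ^ k) (at r)"
proof -
  have "((\<lambda>r. r\<^sup>2) has_real_derivative 2 * r) (at r)" by (auto intro!: derivative_eq_intros)
  from DERIV_mult[OF DERIV_pow[of k r] DERIV_chain2[OF DERIV_radial_profile[of c d "r\<^sup>2"] this]]
  show ?thesis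
    by (rule has_field_derivative_transform_within_open[of _ _ _ "{0<..}"]) (use r radial_eq in auto)
qed

text \<open>At r = 1 the derivative of r^k p(r^2) is k p(1) + 2 p'(1); once p(1) = 0, its vanishing
  means p'(1) = 0.\<close>

lemma admissible_iff:
  "admissible N \<kappa> k \<alpha> c d \<longleftrightarrow> (c, d) \<noteq> (0, 0) \<and> radial_profile N \<kappa> k \<alpha> c d 1 = 0 \<and> radial_profile' N \<kappa> k \<alpha> c d 1 = 0"
proof -
  have 1: "radial N \<kappa> k \<alpha> c d 1 = radial_profile N \<kappa> k \<alpha> c d 1"
    using radial_eq[OF zero_le_one, of c d] unfolding power_one mult_1 .
  have d: "(radial N \<kappa> k \<alpha> c d has_real_derivative
     real k * radial_profile N \<kappa> k \<alpha> c d 1 + 2 * radial_profile' N \<kappa> k \<alpha> c d 1) (at 1)"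
    by (rule DERIV_cong[OF DERIV_radial[OF zero_less_one]]) simp
  have "(radial N \<kappa> k \<alpha> c d has_real_derivative 0) (at 1) \<longleftrightarrow> radial_profile' N \<kappa> k \<alpha> c d 1 = 0"
    if p: "radial_profile N \<kappa> k \<alpha> c d 1 = 0"
  proof
    assume "(radial N \<kappa> k \<alpha> c d has_real_derivative 0) (at 1)"
    from DERIV_unique[OF d this] have "2 * radial_profile' N \<kappa> k \<alpha> c d 1 = 0" unfolding p by (simp only: mult_zero_right add_0_left)
    then show "radial_profile' N \<kappa> k \<alpha> c d 1 = 0" by simp
  next
    assume "radial_profile' N \<kappa> k \<alpha> c d 1 = 0"
    with d show "(radial N \<kappa> k \<alpha> c d has_real_derivative 0) (at 1)" unfolding p by (simp only: mult_zero_right add_0_left)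
  qed
  then show ?thesis unfolding admissible_def 1 by blast
qed

lemma coeffs_nonzero:
  "(c * (\<alpha> / 2) powr nu N k, d * (\<kappa> / \<alpha> / 2) powr nu N k) \<noteq> (0, 0) \<longleftrightarrow> (c, d) \<noteq> (0, 0)"
  using \<kappa> \<alpha> by auto

text \<open>Homogeneity absorbs the factor r^k, since P x = |x|^k P (x/|x|). The right-hand side is
  continuous at 0 and so supplies the limit used as the value there.\<close>

lemma separated_radial:
  fixes P Y :: "'a::euclidean_space \<Rightarrow> real"
  assumes P: "harmonic_homogeneous_poly k P" and Y: "\<And>\<theta>. \<theta> \<in> sphere 0 1 \<Longrightarrow> Y \<theta> = P \<theta>"
  shows "separated (radial N \<kappa> k \<alpha> c d) Y = (\<lambda>x. P x * radial_profile N \<kappa> k \<alpha> c d (x \<bullet> x))"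
proof
  fix x :: 'a
  let ?u = "\<lambda>x. P x * radial_profile N \<kappa> k \<alpha> c d (x \<bullet> x)"
  note D = harmonic_homogeneous_polyD[OF P]
  have eq: "radial N \<kappa> k \<alpha> c d (norm y) * Y (sgn y) = ?u y" if "y \<noteq> 0" for y
  proof -
    have "P y = norm y ^ k * P (sgn y)" using D(2)[of "norm y" "sgn y"] that by (simp add: sgn_div_norm)
    then show ?thesis
      using radial_eq[of "norm y" c d] Y[OF sgn_sphere[OF that]] by (simp add: dot_square_norm mult_ac)
  qed
  show "separated (radial N \<kappa> k \<alpha> c d) Y x = ?u x"
  proof (cases "x = 0")
    case True
    have "continuous_on UNIV ?u"
      by (intro continuous_intros continuous_on_radial_profile Ck_on_imp_continuous_on[OF D(1)])
    then have "(?u \<longlongrightarrow> ?u 0) (at 0)" unfolding continuous_on_def by (rule bspec) simp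
    moreover have ev: "eventually (\<lambda>y. radial N \<kappa> k \<alpha> c d (norm y) * Y (sgn y) = ?u y) (at 0)"
      unfolding eventually_at using eq by (intro exI[of _ 1]) auto
    ultimately have "((\<lambda>y. radial N \<kappa> k \<alpha> c d (norm y) * Y (sgn y)) \<longlongrightarrow> ?u 0) (at 0)"
      by (simp only: tendsto_cong[OF ev])
    from tendsto_Lim[OF _ this] show ?thesis using True by (simp add: separated_def)
  next
    case False
    then show ?thesis using eq by (simp add: separated_def)
  qed
qed

end

lemma spherical_harmonicE:
  assumes "spherical_harmonic k Y"
  obtains P where "harmonic_homogeneous_poly k P" "\<exists>\<theta>\<in>sphere 0 1. P \<theta> \<noteq> 0" "\<And>\<theta>. \<theta> \<in> sphere 0 1 \<Longrightarrow> Y \<theta> = P \<theta>"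
proof -
  obtain P where P: "harmonic_homogeneous_poly k P" "\<exists>x. P x \<noteq> 0" "\<forall>\<theta>\<in>sphere 0 1. Y \<theta> = P \<theta>"
    using assms unfolding spherical_harmonic_def by blast
  obtain x where x: "P x \<noteq> 0" using P(2) by blast
  note D = harmonic_homogeneous_polyD(2)[OF P(1)]
  have "\<exists>\<theta>\<in>sphere 0 1. P \<theta> \<noteq> 0"
  proof (cases "x = 0")
    case False
    then have "P (sgn x) \<noteq> 0" using D[of "norm x" "sgn x"] x by (auto simp: sgn_div_norm)
    then show ?thesis using sgn_sphere[OF False] by blast
  next
    case True
    obtain e :: 'a where e: "e \<in> Basis" using nonempty_Basis by blast
    \<comment> \<open>A nonzero value at the origin occurs only for k = 0, where 0^0 = 1; a unit
      vector then has the same value.\<close>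
    have "P 0 = 0 ^ k * P e" using D[of 0 e] by simp
    then have "P e \<noteq> 0" using x True by auto
    then show ?thesis using e by (intro bexI[of _ e]) auto
  qed
  then show thesis using that[OF P(1)] P(3) by blast
qed

lemma spherical_harmonicI:
  "harmonic_homogeneous_poly k P \<Longrightarrow> \<exists>x. P x \<noteq> 0 \<Longrightarrow> spherical_harmonic k P"
  unfolding spherical_harmonic_def by blast

lemma lam_mono:
  fixes c :: real
  assumes "c > 0" "0 < t" "t < t'"
  shows "4 * t - 4 * (c / t) < 4 * t' - 4 * (c / t')"
proof -
  have "c / t' < c / t" using assms by (simp add: divide_strict_left_mono)
  then show ?thesis using assms by linarith
qed

text \<open>The witness is the positive root of 4 t^2 - \<mu> t - 4 c. Every real \<mu> is reached,
  so no eigenvalue of either sign escapes the parametrization.\<close>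

lemma ex_lam_preimage:
  fixes c \<mu> :: real
  assumes "c > 0" shows "\<exists>t>0. \<mu> = 4 * t - 4 * (c / t)"
proof -
  let ?q = "sqrt (\<mu>\<^sup>2 + 64 * c)"
  let ?t = "(\<mu> + ?q) / 8"
  have "\<bar>\<mu>\<bar> < ?q" using assms by (intro real_less_rsqrt) simp
  then have t: "?t > 0" by (simp add: abs_less_iff)
  have q2: "?q\<^sup>2 = \<mu>\<^sup>2 + 64 * c" using assms by simp
  have "4 * ?t\<^sup>2 - 4 * c = \<mu> * ?t"
    using q2 by (simp add: power2_eq_square field_simps)
  then have "\<mu> = 4 * ?t - 4 * (c / ?t)"
    using t by (simp add: field_simps power2_eq_square)
  then show ?thesis using t by blast
qed

text \<open>The root \<open>\<alpha>\<^sub>k\<^sub>,\<^sub>l\<close>; \<open>char_root\<close> is indexed from \<open>0\<close>.\<close>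

definition alpha :: "nat \<Rightarrow> real \<Rightarrow> nat \<Rightarrow> nat \<Rightarrow> real" where
  "alpha N \<kappa> k l = 2 * sqrt (char_root (nu N k) (\<kappa>\<^sup>2 / 16) (l - 1))"

context
  fixes N :: nat and \<kappa> :: real
  assumes N: "N \<ge> 2" and \<kappa>: "\<kappa> > 0"
begin

lemma c0_pos: "\<kappa>\<^sup>2 / 16 > 0" using \<kappa> by simp

lemma nu_N_nonneg: "nu N k \<ge> 0" by (rule nu_nonneg[OF N])

lemma char_root_N_pos: "char_root (nu N k) (\<kappa>\<^sup>2 / 16) n > 0"
  by (rule char_root_pos[OF nu_N_nonneg c0_pos])

lemma alpha_pos: "alpha N \<kappa> k l > 0"
  using char_root_N_pos by (simp add: alpha_def)

lemma alpha_sq: "(alpha N \<kappa> k l)\<^sup>2 / 4 = char_root (nu N k) (\<kappa>\<^sup>2 / 16) (l - 1)"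
  using char_root_N_pos[of k "l - 1"] by (simp add: alpha_def power_mult_distrib)

lemma lam_eq: "(alpha N \<kappa> k l)\<^sup>2 - \<kappa>\<^sup>2 / (alpha N \<kappa> k l)\<^sup>2 =
   4 * char_root (nu N k) (\<kappa>\<^sup>2 / 16) (l - 1) - 4 * (\<kappa>\<^sup>2 / 16 / char_root (nu N k) (\<kappa>\<^sup>2 / 16) (l - 1))"
  unfolding alpha_sq[symmetric] by simp

lemma F_eq_0_iff:
  assumes "a > 0" shows "F N \<kappa> k a = 0 \<longleftrightarrow> char_fun (nu N k) (\<kappa>\<^sup>2 / 16) (a\<^sup>2 / 4) = 0"
  using F_eq_char_fun[OF N \<kappa> assms, of k] \<kappa> by simp

lemma alpha_enumerates:
  "strict_mono_on {1..} (alpha N \<kappa> k)" "alpha N \<kappa> k ` {1..} = {a. a > 0 \<and> F N \<kappa> k a = 0}"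
proof -
  note sm = strict_mono_char_root[OF nu_N_nonneg c0_pos, of k]
  show "strict_mono_on {1..} (alpha N \<kappa> k)"
  proof (rule strict_mono_onI)
    fix l m :: nat assume "l \<in> {1..}" "m \<in> {1..}" "l < m"
    then have "l - 1 < m - 1" by auto
    then show "alpha N \<kappa> k l < alpha N \<kappa> k m" using strict_monoD[OF sm] by (simp add: alpha_def)
  qed
  show "alpha N \<kappa> k ` {1..} = {a. a > 0 \<and> F N \<kappa> k a = 0}"
  proof (intro subset_antisym subsetI)
    fix a assume "a \<in> alpha N \<kappa> k ` {1..}"
    then obtain l where l: "a = alpha N \<kappa> k l" by blast
    have "char_fun (nu N k) (\<kappa>\<^sup>2 / 16) (a\<^sup>2 / 4) = 0"
      unfolding l alpha_sq by (rule char_root(3)[OF nu_N_nonneg c0_pos])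
    then show "a \<in> {a. a > 0 \<and> F N \<kappa> k a = 0}" using alpha_pos[of k l] F_eq_0_iff[of a k] l by simp
  next
    fix a assume "a \<in> {a. a > 0 \<and> F N \<kappa> k a = 0}"
    then have a: "a > 0" "char_fun (nu N k) (\<kappa>\<^sup>2 / 16) (a\<^sup>2 / 4) = 0" using F_eq_0_iff by auto
    then have "a\<^sup>2 / 4 \<in> range (char_root (nu N k) (\<kappa>\<^sup>2 / 16))"
      unfolding range_char_root[OF nu_N_nonneg c0_pos] by simp
    then obtain n where n: "a\<^sup>2 / 4 = char_root (nu N k) (\<kappa>\<^sup>2 / 16) n" by blast
    have "a = alpha N \<kappa> k (Suc n)"
      using a(1) by (simp add: alpha_def n[symmetric] real_sqrt_divide)
    then show "a \<in> alpha N \<kappa> k ` {1..}" by (intro image_eqI[of _ _ "Suc n"]) auto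
  qed
qed

lemma simple_root_alpha: "simple_root (F N \<kappa> k) (alpha N \<kappa> k l)"
proof -
  let ?a = "alpha N \<kappa> k l" and ?c = "2 * (\<kappa> / 4) powr nu N k" and ?\<nu> = "nu N k"
  have a: "?a > 0" by (rule alpha_pos)
  then have t: "?a\<^sup>2 / 4 > 0" by simp
  have W0: "char_fun ?\<nu> (\<kappa>\<^sup>2 / 16) (?a\<^sup>2 / 4) = 0"
    unfolding alpha_sq by (rule char_root(3)[OF nu_N_nonneg c0_pos])
  obtain D where D: "(char_fun ?\<nu> (\<kappa>\<^sup>2 / 16) has_real_derivative D) (at (?a\<^sup>2 / 4))"
    "char_fun ?\<nu> (\<kappa>\<^sup>2 / 16) (?a\<^sup>2 / 4) = 0 \<Longrightarrow> bess ?\<nu> (?a\<^sup>2 / 4) * D > 0"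
    using DERIV_char_fun[OF nu_N_nonneg c0_pos t] by blast
  have "((\<lambda>a. a\<^sup>2 / 4) has_real_derivative ?a / 2) (at ?a)" by (auto intro!: derivative_eq_intros)
  from DERIV_cmult[OF DERIV_chain2[OF D(1) this], of ?c]
  have "(F N \<kappa> k has_real_derivative ?c * (D * (?a / 2))) (at ?a)"
    by (rule has_field_derivative_transform_within_open[of _ _ _ "{0<..}"]) (use a F_eq_char_fun[OF N \<kappa>] in auto)
  moreover have "?c * (D * (?a / 2)) \<noteq> 0" using D(2)[OF W0] a \<kappa> by auto
  moreover have "F N \<kappa> k ?a = 0" using F_eq_0_iff[OF a] W0 by simp
  ultimately show ?thesis unfolding simple_root_def by blast
qed

lemma ex_admissible: "\<exists>c d. admissible N \<kappa> k (alpha N \<kappa> k l) c d"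
proof -
  let ?a = "alpha N \<kappa> k l" and ?\<nu> = "nu N k"
  have a: "?a > 0" by (rule alpha_pos)
  have "char_fun ?\<nu> (\<kappa>\<^sup>2 / 16) (?a\<^sup>2 / 4) = 0"
    unfolding alpha_sq by (rule char_root(3)[OF nu_N_nonneg c0_pos])
  from ex_profile[OF nu_N_nonneg _ c0_pos this] a obtain c d where cd: "(c, d) \<noteq> (0, 0)"
    "profile ?\<nu> (?a\<^sup>2 / 4) (\<kappa>\<^sup>2 / 16 / (?a\<^sup>2 / 4)) c d 1 = 0" "profile' ?\<nu> (?a\<^sup>2 / 4) (\<kappa>\<^sup>2 / 16 / (?a\<^sup>2 / 4)) c d 1 = 0"
    by auto
  \<comment> \<open>Dividing by the powers undoes the normalization built into
    \<open>radial_profile\<close>.\<close>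
  let ?c = "c / (?a / 2) powr ?\<nu>" and ?d = "d / (\<kappa> / ?a / 2) powr ?\<nu>"
  have "?c * (?a / 2) powr ?\<nu> = c" "?d * (\<kappa> / ?a / 2) powr ?\<nu> = d" using a \<kappa> by auto
  then have "admissible N \<kappa> k ?a ?c ?d"
    unfolding admissible_iff[OF N \<kappa> a] radial_profile_def radial_profile'_def using cd by auto
  then show ?thesis by blast
qed

lemma char_root_first_le: "char_root (nu N 0) (\<kappa>\<^sup>2 / 16) 0 \<le> char_root (nu N k) (\<kappa>\<^sup>2 / 16) 0"
  and char_root_first_less: "k > 0 \<Longrightarrow> char_root (nu N 0) (\<kappa>\<^sup>2 / 16) 0 < char_root (nu N k) (\<kappa>\<^sup>2 / 16) 0"
proof -
  have step: "char_root (nu N k) (\<kappa>\<^sup>2 / 16) 0 < char_root (nu N (Suc k)) (\<kappa>\<^sup>2 / 16) 0" for k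
    unfolding nu_Suc by (rule char_root_0_mono[OF nu_N_nonneg c0_pos])
  then have sm: "strict_mono (\<lambda>k. char_root (nu N k) (\<kappa>\<^sup>2 / 16) 0)" by (simp add: strict_mono_Suc_iff)
  show "char_root (nu N 0) (\<kappa>\<^sup>2 / 16) 0 \<le> char_root (nu N k) (\<kappa>\<^sup>2 / 16) 0"
    using strict_mono_less_eq[OF sm] by simp
  show "char_root (nu N 0) (\<kappa>\<^sup>2 / 16) 0 < char_root (nu N k) (\<kappa>\<^sup>2 / 16) 0" if "k > 0"
    using strict_monoD[OF sm that] .
qed

text \<open>The least root over all degrees belongs to one pair only; this yields the smallest
  eigenvalue and the dimension of its eigenspace.\<close>

lemma char_root_first_min:
  "char_root (nu N 0) (\<kappa>\<^sup>2 / 16) 0 \<le> char_root (nu N k) (\<kappa>\<^sup>2 / 16) n"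
  "char_root (nu N k) (\<kappa>\<^sup>2 / 16) n = char_root (nu N 0) (\<kappa>\<^sup>2 / 16) 0 \<Longrightarrow> k = 0 \<and> n = 0"
proof -
  note sm = strict_mono_char_root[OF nu_N_nonneg c0_pos, of k]
  have 1: "char_root (nu N k) (\<kappa>\<^sup>2 / 16) 0 \<le> char_root (nu N k) (\<kappa>\<^sup>2 / 16) n"
    using strict_mono_less_eq[OF sm] by simp
  show "char_root (nu N 0) (\<kappa>\<^sup>2 / 16) 0 \<le> char_root (nu N k) (\<kappa>\<^sup>2 / 16) n"
    using char_root_first_le[of k] 1 by linarith
  assume e: "char_root (nu N k) (\<kappa>\<^sup>2 / 16) n = char_root (nu N 0) (\<kappa>\<^sup>2 / 16) 0"
  have "k = 0" using char_root_first_less[of k] e 1 by (cases "k = 0") auto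
  moreover have "n = 0"
  proof (rule ccontr)
    assume "n \<noteq> 0"
    then show False using strict_monoD[OF sm, of 0 n] e char_root_first_le[of k] by simp
  qed
  ultimately show "k = 0 \<and> n = 0" by simp
qed

end

section \<open>Spectrum and eigenspaces\<close>

context
  fixes \<kappa> :: real and c d :: "nat \<Rightarrow> nat \<Rightarrow> real" and N :: nat
  assumes N2: "N \<ge> 2" and \<kappa>: "\<kappa> > 0"
    and adm: "\<forall>k. \<forall>l\<ge>1. admissible N \<kappa> k (alpha N \<kappa> k l) (c k l) (d k l)"
begin

abbreviation rad :: "nat \<Rightarrow> nat \<Rightarrow> real \<Rightarrow> real" where
  "rad k l \<equiv> radial N \<kappa> k (alpha N \<kappa> k l) (c k l) (d k l)"

abbreviation root :: "nat \<Rightarrow> nat \<Rightarrow> real" where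
  "root k l \<equiv> char_root (nu N k) (\<kappa>\<^sup>2 / 16) (l - 1)"

abbreviation prof :: "nat \<Rightarrow> nat \<Rightarrow> real \<Rightarrow> real" where
  "prof k l \<equiv> radial_profile N \<kappa> k (alpha N \<kappa> k l) (c k l) (d k l)"

definition cc :: "nat \<Rightarrow> nat \<Rightarrow> real" where
  "cc k l = c k l * (alpha N \<kappa> k l / 2) powr nu N k"

definition dd :: "nat \<Rightarrow> nat \<Rightarrow> real" where
  "dd k l = d k l * (\<kappa> / alpha N \<kappa> k l / 2) powr nu N k"

lemma prof_eq: "prof k l = profile (nu N k) (root k l) (\<kappa>\<^sup>2 / 16 / root k l) (cc k l) (dd k l)"
  unfolding radial_profile_def alpha_sq[OF N2 \<kappa>] cc_def dd_def ..

lemma prof_boundary: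
  assumes "l \<ge> 1"
  shows "(cc k l, dd k l) \<noteq> (0, 0)"
    "profile (nu N k) (root k l) (\<kappa>\<^sup>2 / 16 / root k l) (cc k l) (dd k l) 1 = 0"
    "profile' (nu N k) (root k l) (\<kappa>\<^sup>2 / 16 / root k l) (cc k l) (dd k l) 1 = 0"
proof -
  note a = alpha_pos[OF N2 \<kappa>]
  have "admissible N \<kappa> k (alpha N \<kappa> k l) (c k l) (d k l)" using adm assms by blast
  note A = this[unfolded admissible_iff[OF N2 \<kappa> a] radial_profile_def radial_profile'_def alpha_sq[OF N2 \<kappa>],
      folded cc_def dd_def]
  show "(cc k l, dd k l) \<noteq> (0, 0)"
    using A coeffs_nonzero[OF N2 \<kappa> a] unfolding cc_def dd_def by blast
  show "profile (nu N k) (root k l) (\<kappa>\<^sup>2 / 16 / root k l) (cc k l) (dd k l) 1 = 0"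
    "profile' (nu N k) (root k l) (\<kappa>\<^sup>2 / 16 / root k l) (cc k l) (dd k l) 1 = 0"
    using A by blast+
qed

lemma root_pos: "root k l > 0"
  by (rule char_root_N_pos[OF N2 \<kappa>])

lemma rad_eq: "r \<ge> 0 \<Longrightarrow> rad k l r = r ^ k * prof k l (r\<^sup>2)"
  by (rule radial_eq[OF N2 \<kappa> alpha_pos[OF N2 \<kappa>]])

lemma separated_eq:
  assumes "harmonic_homogeneous_poly k P" "\<And>\<theta>. \<theta> \<in> sphere 0 1 \<Longrightarrow> Y \<theta> = P \<theta>"
  shows "separated (rad k l) Y = (\<lambda>x. P x * prof k l (x \<bullet> x))"
  by (rule separated_radial[OF N2 \<kappa> alpha_pos[OF N2 \<kappa>] assms])

lemma eigenfunction_separated: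
  fixes Y :: "'a::euclidean_space \<Rightarrow> real"
  assumes N: "N = DIM('a)" and l: "l \<ge> 1" and Y: "spherical_harmonic k Y"
  shows "eigenfunction \<kappa> (4 * root k l - 4 * (\<kappa>\<^sup>2 / 16 / root k l)) (separated (rad k l) Y)"
proof -
  obtain P where P: "harmonic_homogeneous_poly k P" "\<exists>\<theta>\<in>sphere 0 1. P \<theta> \<noteq> 0" "\<And>\<theta>. \<theta> \<in> sphere 0 1 \<Longrightarrow> Y \<theta> = P \<theta>"
    using spherical_harmonicE[OF Y] by blast
  have eq: "separated (rad k l) Y = (\<lambda>x. P x * prof k l (x \<bullet> x))" by (rule separated_eq[OF P(1,3)])
  have "bvp_solution \<kappa> (4 * root k l - 4 * (\<kappa>\<^sup>2 / 16 / root k l)) (separated (rad k l) Y)"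
    unfolding eq prof_eq unfolding N
    by (rule bvp_solution_profile[OF P(1)])
       (use N2 root_pos[of k l] prof_boundary[OF l, of k] in \<open>simp_all add: N\<close>)
  moreover have "\<exists>x\<in>cball 0 1. separated (rad k l) Y x \<noteq> 0"
  proof -
    obtain r where r: "0 < r" "r < 1" "prof k l (r\<^sup>2) \<noteq> 0"
      unfolding prof_eq
      using ex_profile_nonzero[OF nu_nonneg[OF N2] c0_pos[OF N2 \<kappa>] root_pos char_root(3)[OF nu_nonneg[OF N2] c0_pos[OF N2 \<kappa>]]
        prof_boundary(1,2)[OF l]] by blast
    obtain \<theta> where \<theta>: "\<theta> \<in> sphere 0 1" "P \<theta> \<noteq> 0" using P(2) by blast
    have "(r *\<^sub>R \<theta>) \<bullet> (r *\<^sub>R \<theta>) = r\<^sup>2" using \<theta>(1) by (simp add: dot_square_norm power2_eq_square)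
    then have "separated (rad k l) Y (r *\<^sub>R \<theta>) \<noteq> 0"
      unfolding eq using r \<theta>(2) harmonic_homogeneous_polyD(2)[OF P(1), of r \<theta>] by simp
    moreover have "r *\<^sub>R \<theta> \<in> cball 0 1" using r \<theta>(1) by simp
    ultimately show ?thesis by blast
  qed
  ultimately show ?thesis unfolding eigenfunction_def by blast
qed

lemma solution_in_span:
  fixes u :: "'a::euclidean_space \<Rightarrow> real"
  assumes N: "N = DIM('a)" and t: "t > 0" and u: "bvp_solution \<kappa> (4 * t - 4 * (\<kappa>\<^sup>2 / 16 / t)) u"
  shows "u \<in> span_on (cball 0 1) {separated (rad k l) Y | k l Y. l \<ge> 1 \<and> root k l = t \<and> spherical_harmonic k Y}"
    (is "_ \<in> span_on _ ?S")
proof -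
  let ?c0 = "\<kappa>\<^sup>2 / 16"
  \<comment> \<open>For a degree that has t as a root, the index of this root, counted from
    1.\<close>
  define L where "L = (\<lambda>k. SOME l. l \<ge> 1 \<and> root k l = t)"
  have L: "L k \<ge> 1 \<and> root k (L k) = t" if "char_fun (nu N k) ?c0 t = 0" for k
  proof -
    have "t \<in> range (char_root (nu N k) ?c0)"
      unfolding range_char_root[OF nu_nonneg[OF N2] c0_pos[OF N2 \<kappa>]] using that t by simp
    then obtain n where "t = char_root (nu N k) ?c0 n" by blast
    then have "Suc n \<ge> 1 \<and> root k (Suc n) = t" by simp
    then show ?thesis unfolding L_def by (rule someI)
  qed
  have b: "(cc k (L k), dd k (L k)) \<noteq> (0, 0)" "profile (nu N k) t (?c0 / t) (cc k (L k)) (dd k (L k)) 1 = 0"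
    if "char_fun (nu N k) ?c0 t = 0" for k
    using prof_boundary(1,2)[of "L k" k] L[OF that] by simp_all
  have "u \<in> span_on (cball 0 1) {\<lambda>x. P x * profile (nu N k) t (?c0 / t) (cc k (L k)) (dd k (L k)) (x \<bullet> x) | k P.
     char_fun (nu N k) ?c0 t = 0 \<and> harmonic_homogeneous_poly k P \<and> (\<exists>x. P x \<noteq> 0)}" (is "_ \<in> span_on _ ?T")
    unfolding N
    by (rule bvp_solution_in_span[OF _ t c0_pos[OF N2 \<kappa>] refl u]) (use N2 b in \<open>simp_all add: N\<close>)
  moreover have "?T \<subseteq> ?S"
  proof
    fix v assume "v \<in> ?T"
    then obtain k P where v: "v = (\<lambda>x. P x * profile (nu N k) t (?c0 / t) (cc k (L k)) (dd k (L k)) (x \<bullet> x))"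
      and k: "char_fun (nu N k) ?c0 t = 0" and P: "harmonic_homogeneous_poly k P" "\<exists>x. P x \<noteq> 0" by blast
    have "v = separated (rad k (L k)) P"
      unfolding v separated_eq[OF P(1) refl] prof_eq using L[OF k] by simp
    then show "v \<in> ?S" using L[OF k] spherical_harmonicI[OF P] by blast
  qed
  ultimately show ?thesis by (rule span_on_subset)
qed

text \<open>A homogeneous polynomial of degree 0 is constant, so degree 0 contributes radial
  functions only.\<close>

lemma root_of_separated_zero:
  fixes Y :: "'a::euclidean_space \<Rightarrow> real"
  assumes Y: "spherical_harmonic 0 Y"
  shows "\<exists>a. \<forall>x. separated (rad 0 l) Y x = a * rad 0 l (norm x)"
proof -
  obtain P where P: "harmonic_homogeneous_poly 0 P" "\<And>\<theta>. \<theta> \<in> sphere 0 1 \<Longrightarrow> Y \<theta> = P \<theta>"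
    using spherical_harmonicE[OF Y] by blast
  have eq: "separated (rad 0 l) Y = (\<lambda>x. P x * prof 0 l (x \<bullet> x))" by (rule separated_eq[OF P])
  define a where "a = P 0"
  have "P x = a" for x using harmonic_homogeneous_polyD(2)[OF P(1), of 0 x] by (simp add: a_def)
  then have "separated (rad 0 l) Y x = a * rad 0 l (norm x)" for x
    unfolding eq using rad_eq[OF norm_ge_zero, of 0 l x] by (simp add: dot_square_norm)
  then show ?thesis by blast
qed

lemma separated_const:
  "separated (rad 0 l) (\<lambda>_. 1) = (\<lambda>x :: 'a::euclidean_space. rad 0 l (norm x))"
  and spherical_harmonic_const: "spherical_harmonic 0 (\<lambda>_ :: 'a::euclidean_space. 1)"
proof -
  have P: "harmonic_homogeneous_poly 0 (\<lambda>_ :: 'a. 1)"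
    unfolding harmonic_homogeneous_poly_def by (auto simp: laplacian_def)
  show "spherical_harmonic 0 (\<lambda>_ :: 'a. 1)" by (rule spherical_harmonicI[OF P]) simp
  show "separated (rad 0 l) (\<lambda>_. 1) = (\<lambda>x :: 'a. rad 0 l (norm x))"
    unfolding separated_eq[OF P refl] by (rule ext) (simp add: rad_eq dot_square_norm)
qed

lemma rad_roots:
  assumes l: "l \<ge> 1"
  shows "finite {r \<in> {0<..<1}. rad k l r = 0}" "card {r \<in> {0<..<1}. rad k l r = 0} = l - 1"
    "r \<in> {0<..<1} \<Longrightarrow> rad k l r = 0 \<Longrightarrow> simple_root (rad k l) r"
proof -
  let ?Z = "{z. 0 < z \<and> z < 1 \<and> prof k l z = 0}"
  let ?R = "{r \<in> {0<..<1}. rad k l r = 0}"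
  note Z = profile_roots[OF nu_nonneg[OF N2] c0_pos[OF N2 \<kappa>] refl prof_boundary(1,2)[OF l], folded prof_eq]
  have zero_iff: "rad k l r = 0 \<longleftrightarrow> prof k l (r\<^sup>2) = 0" if "r > 0" for r
    using rad_eq[of r k l] that by simp
  \<comment> \<open>Squaring passes from radii to the variable z of the profile and maps ]0,1[ onto
    itself.\<close>
  have bij: "bij_betw (\<lambda>r. r\<^sup>2) ?R ?Z"
  proof (rule bij_betwI[where g = sqrt])
    show "(\<lambda>r. r\<^sup>2) \<in> ?R \<rightarrow> ?Z" using zero_iff by (auto simp: power_less_one_iff)
    show "sqrt \<in> ?Z \<rightarrow> ?R" using zero_iff by auto
  qed auto
  show "finite ?R" by (simp only: bij_betw_finite[OF bij] Z(1))
  show "card ?R = l - 1" by (simp only: bij_betw_same_card[OF bij] Z(2))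
  assume r: "r \<in> {0<..<1}" "rad k l r = 0"
  then have "prof k l (r\<^sup>2) = 0" using zero_iff by simp
  moreover have "r\<^sup>2 \<in> ?Z" using r zero_iff by (simp add: power_less_one_iff)
  ultimately have p: "prof k l (r\<^sup>2) = 0" "radial_profile' N \<kappa> k (alpha N \<kappa> k l) (c k l) (d k l) (r\<^sup>2) \<noteq> 0"
    using Z(3)[of "r\<^sup>2" k] unfolding radial_profile'_def alpha_sq[OF N2 \<kappa>] cc_def dd_def by simp_all
  have r0: "r > 0" using r by simp
  show "simple_root (rad k l) r"
    unfolding simple_root_def
  proof (intro conjI exI)
    show "rad k l r = 0" by (rule r(2))
    show "(rad k l has_real_derivative radial_profile' N \<kappa> k (alpha N \<kappa> k l) (c k l) (d k l) (r\<^sup>2) * (2 * r) * r ^ k) (at r)"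
      by (rule DERIV_cong[OF DERIV_radial[OF N2 \<kappa> alpha_pos[OF N2 \<kappa>] r0]]) (simp only: p(1) mult_zero_right add_0_left)
    show "radial_profile' N \<kappa> k (alpha N \<kappa> k l) (c k l) (d k l) (r\<^sup>2) * (2 * r) * r ^ k \<noteq> 0"
      using p(2) r0 by simp
  qed
qed

lemma rad_first_decreasing:
  assumes "0 \<le> x" "x < y" "y \<le> 1"
  shows "\<bar>rad 0 1 y\<bar> < \<bar>rad 0 1 x\<bar>"
proof -
  have r1: "root 0 1 = char_root (nu N 0) (\<kappa>\<^sup>2 / 16) 0" by simp
  have "x\<^sup>2 < y\<^sup>2" using assms by (intro power_strict_mono) auto
  moreover have "y\<^sup>2 \<le> 1" using assms by (simp add: power_le_one)
  ultimately have "\<bar>prof 0 1 (y\<^sup>2)\<bar> < \<bar>prof 0 1 (x\<^sup>2)\<bar>"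
    unfolding prof_eq
    by (intro profile_0_decreasing[OF nu_nonneg[OF N2] c0_pos[OF N2 \<kappa>] r1 prof_boundary[of 1]]) auto
  then show ?thesis using rad_eq[of x 0 1] rad_eq[of y 0 1] assms by simp
qed

lemma rad_first_pos:
  assumes "0 \<le> x" "x < 1" shows "\<bar>rad 0 1 x\<bar> > 0"
  using rad_first_decreasing[of x 1] assms by linarith

end

theorem eigenvalue_problem:
  fixes \<kappa> :: real
  assumes N2: "DIM('a::euclidean_space) \<ge> 2" and \<kappa>: "\<kappa> > 0"
  shows "\<exists>\<alpha> :: nat \<Rightarrow> nat \<Rightarrow> real.
    (\<forall>k. strict_mono_on {1..} (\<alpha> k) \<and>
         \<alpha> k ` {1..} = {a. a > 0 \<and> F DIM('a) \<kappa> k a = 0} \<and>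
         (\<forall>l\<ge>1. simple_root (F DIM('a) \<kappa> k) (\<alpha> k l))) \<and>
    (\<forall>k. \<forall>l\<ge>1. \<exists>c d. admissible DIM('a) \<kappa> k (\<alpha> k l) c d) \<and>
    (let lam = (\<lambda>k l. (\<alpha> k l)\<^sup>2 - \<kappa>\<^sup>2 / (\<alpha> k l)\<^sup>2) in
      {\<mu>. \<exists>u :: 'a \<Rightarrow> real. eigenfunction \<kappa> \<mu> u} = {lam k l | k l. l \<ge> 1} \<and>
      (\<forall>c d :: nat \<Rightarrow> nat \<Rightarrow> real.
        (\<forall>k. \<forall>l\<ge>1. admissible DIM('a) \<kappa> k (\<alpha> k l) (c k l) (d k l)) \<longrightarrow>
        (let R = (\<lambda>k l. radial DIM('a) \<kappa> k (\<alpha> k l) (c k l) (d k l)) in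
          (\<forall>k. \<forall>l\<ge>1. \<forall>Y :: 'a \<Rightarrow> real. spherical_harmonic k Y \<longrightarrow>
             eigenfunction \<kappa> (lam k l) (separated (R k l) Y)) \<and>
          (\<forall>k. \<forall>l\<ge>1.
             {u :: 'a \<Rightarrow> real. bvp_solution \<kappa> (lam k l) u} =
             span_on (cball 0 1)
               {separated (R k' l') Y | k' l' Y.
                  l' \<ge> 1 \<and> lam k' l' = lam k l \<and> spherical_harmonic k' Y}) \<and>
          (\<forall>\<mu>. (\<exists>u :: 'a \<Rightarrow> real. eigenfunction \<kappa> \<mu> u) \<longrightarrow> lam 0 1 \<le> \<mu>) \<and>
          {u :: 'a \<Rightarrow> real. bvp_solution \<kappa> (lam 0 1) u} =
            span_on (cball 0 1) {\<lambda>x. R 0 1 (norm x)} \<and>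
          (\<forall>r\<in>{0..<1}. \<bar>R 0 1 r\<bar> > 0) \<and>
          strict_antimono_on {0..<1} (\<lambda>r. \<bar>R 0 1 r\<bar>) \<and>
          (\<forall>k. \<forall>l\<ge>1.
             finite {r \<in> {0<..<1}. R k l r = 0} \<and>
             card {r \<in> {0<..<1}. R k l r = 0} = l - 1 \<and>
             (\<forall>r\<in>{0<..<1}. R k l r = 0 \<longrightarrow> simple_root (R k l) r)))))"
proof (rule exI[of _ "alpha DIM('a) \<kappa>"], intro conjI)
  let ?N = "DIM('a)" and ?c0 = "\<kappa>\<^sup>2 / 16"
  let ?\<alpha> = "alpha ?N \<kappa>"
  let ?root = "\<lambda>k l. char_root (nu ?N k) ?c0 (l - 1)"
  let ?lam = "\<lambda>k l. (?\<alpha> k l)\<^sup>2 - \<kappa>\<^sup>2 / (?\<alpha> k l)\<^sup>2"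
  show "\<forall>k. strict_mono_on {1..} (?\<alpha> k) \<and> ?\<alpha> k ` {1..} = {a. a > 0 \<and> F ?N \<kappa> k a = 0} \<and>
      (\<forall>l\<ge>1. simple_root (F ?N \<kappa> k) (?\<alpha> k l))"
    using alpha_enumerates[OF N2 \<kappa>] simple_root_alpha[OF N2 \<kappa>] by blast
  show exadm: "\<forall>k. \<forall>l\<ge>1. \<exists>c d. admissible ?N \<kappa> k (?\<alpha> k l) c d"
    using ex_admissible[OF N2 \<kappa>] by blast
  \<comment> \<open>The spectrum is stated before coefficients are introduced, so some choice of
    them is needed. The index l = 0 does no harm: truncated subtraction makes it repeat l =
    1.\<close>
  have adm_choice: "\<exists>c d. \<forall>k. \<forall>l\<ge>1. admissible ?N \<kappa> k (?\<alpha> k l) (c k l) (d k l)"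
  proof -
    have "\<forall>p. \<exists>q. admissible ?N \<kappa> (fst p) (?\<alpha> (fst p) (snd p)) (fst q) (snd q)"
    proof
      fix p
      obtain c d where "admissible ?N \<kappa> (fst p) (?\<alpha> (fst p) (snd p)) c d" using ex_admissible[OF N2 \<kappa>] by blast
      then show "\<exists>q. admissible ?N \<kappa> (fst p) (?\<alpha> (fst p) (snd p)) (fst q) (snd q)"
        by (intro exI[of _ "(c, d)"]) simp
    qed
    from choice[OF this] obtain f where
      f: "\<forall>p. admissible ?N \<kappa> (fst p) (?\<alpha> (fst p) (snd p)) (fst (f p)) (snd (f p))" ..
    show ?thesis
    proof (intro exI allI impI)
      show "admissible ?N \<kappa> k (?\<alpha> k l) ((\<lambda>k l. fst (f (k, l))) k l) ((\<lambda>k l. snd (f (k, l))) k l)" for k l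
        using spec[OF f, of "(k, l)"] by simp
    qed
  qed
  note lam = lam_eq[OF N2 \<kappa>]
  have rpos: "?root k l > 0" for k l by (rule char_root_N_pos[OF N2 \<kappa>])
  have c0: "?c0 > 0" using \<kappa> by simp
  have lam_less: "?lam k l < ?lam k' l'" if "?root k l < ?root k' l'" for k l k' l'
    unfolding lam by (rule lam_mono[OF c0 rpos that])
  \<comment> \<open>The eigenvalue is a strictly increasing function of the root, so equal
    eigenvalues mean equal roots.\<close>
  have lam_inj: "?root k l = ?root k' l'" if "?lam k l = ?lam k' l'" for k l k' l'
    using lam_less[of k l k' l'] lam_less[of k' l' k l] that by linarith
  have lam_cong: "?lam k l = ?lam k' l'" if "?root k l = ?root k' l'" for k l k' l'
    unfolding lam that ..
  have lam_first: "?lam 0 1 \<le> ?lam k l" for k l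
  proof (cases "?root 0 1 = ?root k l")
    case True
    show ?thesis by (rule eq_refl[OF lam_cong[OF True]])
  next
    case False
    moreover have "?root 0 1 \<le> ?root k l" using char_root_first_min(1)[OF N2 \<kappa>, of k "l - 1"] by simp
    ultimately have "?root 0 1 < ?root k l" by (rule le_neq_trans[rotated])
    then show ?thesis by (rule less_imp_le[OF lam_less])
  qed
  have spectrum_sub: "\<mu> \<in> {?lam k l | k l. l \<ge> 1}" if u: "eigenfunction \<kappa> \<mu> (u :: 'a \<Rightarrow> real)" for \<mu> u
  proof -
    obtain c d where adm: "\<forall>k. \<forall>l\<ge>1. admissible ?N \<kappa> k (?\<alpha> k l) (c k l) (d k l)"
      using adm_choice by blast
    obtain t where t: "t > 0" "\<mu> = 4 * t - 4 * (?c0 / t)" using ex_lam_preimage[OF c0] by blast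
    have "bvp_solution \<kappa> (4 * t - 4 * (?c0 / t)) u" and nz: "\<exists>x\<in>cball 0 1. u x \<noteq> 0"
      using u unfolding eigenfunction_def t(2) by blast+
    from solution_in_span[OF N2 \<kappa> adm refl t(1) this(1)] obtain T a where
      T: "T \<subseteq> {separated (rad \<kappa> c d ?N k l) Y | k l Y. l \<ge> 1 \<and> ?root k l = t \<and> spherical_harmonic k Y}"
        "\<forall>x\<in>cball 0 1. u x = (\<Sum>v\<in>T. a v * v x)"
      unfolding span_on_def by blast
    \<comment> \<open>An empty sum would make u vanish on the ball; any member of T exhibits a
      degree and an index whose root is t.\<close>
    have "T \<noteq> {}" using nz T(2) by auto
    then obtain k l where kl: "l \<ge> 1" "?root k l = t" using T(1) by blast
    have "\<mu> = ?lam k l" unfolding t(2) lam kl(2) ..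
    then show ?thesis using kl(1) by blast
  qed
  show "let lam = ?lam in
      {\<mu>. \<exists>u :: 'a \<Rightarrow> real. eigenfunction \<kappa> \<mu> u} = {lam k l | k l. l \<ge> 1} \<and>
      (\<forall>c d :: nat \<Rightarrow> nat \<Rightarrow> real.
        (\<forall>k. \<forall>l\<ge>1. admissible ?N \<kappa> k (?\<alpha> k l) (c k l) (d k l)) \<longrightarrow>
        (let R = (\<lambda>k l. radial ?N \<kappa> k (?\<alpha> k l) (c k l) (d k l)) in
          (\<forall>k. \<forall>l\<ge>1. \<forall>Y :: 'a \<Rightarrow> real. spherical_harmonic k Y \<longrightarrow>
             eigenfunction \<kappa> (lam k l) (separated (R k l) Y)) \<and>
          (\<forall>k. \<forall>l\<ge>1.
             {u :: 'a \<Rightarrow> real. bvp_solution \<kappa> (lam k l) u} =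
             span_on (cball 0 1)
               {separated (R k' l') Y | k' l' Y.
                  l' \<ge> 1 \<and> lam k' l' = lam k l \<and> spherical_harmonic k' Y}) \<and>
          (\<forall>\<mu>. (\<exists>u :: 'a \<Rightarrow> real. eigenfunction \<kappa> \<mu> u) \<longrightarrow> lam 0 1 \<le> \<mu>) \<and>
          {u :: 'a \<Rightarrow> real. bvp_solution \<kappa> (lam 0 1) u} =
            span_on (cball 0 1) {\<lambda>x. R 0 1 (norm x)} \<and>
          (\<forall>r\<in>{0..<1}. \<bar>R 0 1 r\<bar> > 0) \<and>
          strict_antimono_on {0..<1} (\<lambda>r. \<bar>R 0 1 r\<bar>) \<and>
          (\<forall>k. \<forall>l\<ge>1.
             finite {r \<in> {0<..<1}. R k l r = 0} \<and>
             card {r \<in> {0<..<1}. R k l r = 0} = l - 1 \<and>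
             (\<forall>r\<in>{0<..<1}. R k l r = 0 \<longrightarrow> simple_root (R k l) r))))"
    unfolding Let_def
  proof (intro conjI allI impI)
    show "{\<mu>. \<exists>u :: 'a \<Rightarrow> real. eigenfunction \<kappa> \<mu> u} = {?lam k l | k l. l \<ge> 1}"
    proof (intro subset_antisym subsetI)
      fix \<mu> assume "\<mu> \<in> {\<mu>. \<exists>u :: 'a \<Rightarrow> real. eigenfunction \<kappa> \<mu> u}"
      then obtain u :: "'a \<Rightarrow> real" where "eigenfunction \<kappa> \<mu> u" by blast
      then show "\<mu> \<in> {?lam k l | k l. l \<ge> 1}" by (rule spectrum_sub)
    next
      fix \<mu> assume "\<mu> \<in> {?lam k l | k l. l \<ge> 1}"
      then obtain k l where kl: "l \<ge> 1" "\<mu> = ?lam k l" by blast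
      obtain c d where adm: "\<forall>k. \<forall>l\<ge>1. admissible ?N \<kappa> k (?\<alpha> k l) (c k l) (d k l)"
        using adm_choice by blast
      \<comment> \<open>A nonzero harmonic polynomial of degree k is needed for the listed number to
        be an eigenvalue at all.\<close>
      obtain h :: "'a \<Rightarrow> real" where h: "hharm k h" "\<exists>x. h x \<noteq> 0" using ex_hharm[OF N2] by blast
      from eigenfunction_separated[OF N2 \<kappa> adm refl kl(1) spherical_harmonicI[OF hharm_harmonic[OF h(1)] h(2)]]
      show "\<mu> \<in> {\<mu>. \<exists>u :: 'a \<Rightarrow> real. eigenfunction \<kappa> \<mu> u}" unfolding kl(2) lam by blast
    qed
  next
    fix c d :: "nat \<Rightarrow> nat \<Rightarrow> real"
    assume adm: "\<forall>k. \<forall>l\<ge>1. admissible ?N \<kappa> k (?\<alpha> k l) (c k l) (d k l)"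
    let ?R = "rad \<kappa> c d ?N"
    note facts = N2 \<kappa> adm
    show eig: "eigenfunction \<kappa> (?lam k l) (separated (?R k l) Y)" if "l \<ge> 1" "spherical_harmonic k Y" for k l and Y :: "'a \<Rightarrow> real"
      unfolding lam by (rule eigenfunction_separated[OF facts refl that])
    show space: "{u :: 'a \<Rightarrow> real. bvp_solution \<kappa> (?lam k l) u} =
       span_on (cball 0 1) {separated (?R k' l') Y | k' l' Y. l' \<ge> 1 \<and> ?lam k' l' = ?lam k l \<and> spherical_harmonic k' Y}"
      (is "_ = span_on _ ?S") for k l
    proof (intro subset_antisym subsetI)
      fix u :: "'a \<Rightarrow> real" assume "u \<in> {u. bvp_solution \<kappa> (?lam k l) u}"
      then have "bvp_solution \<kappa> (4 * ?root k l - 4 * (?c0 / ?root k l)) u" unfolding lam by simp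
      from solution_in_span[OF facts refl rpos this] show "u \<in> span_on (cball 0 1) ?S"
      proof (rule span_on_subset)
        show "{separated (?R k' l') Y | k' l' Y. l' \<ge> 1 \<and> ?root k' l' = ?root k l \<and> spherical_harmonic k' Y} \<subseteq> ?S"
          using lam_cong by blast
      qed
    next
      fix u assume u: "u \<in> span_on (cball 0 1) ?S"
      have sol: "bvp_solution \<kappa> (?lam k l) v" if v: "v \<in> ?S" for v
      proof -
        obtain k' l' and Y :: "'a \<Rightarrow> real" where k': "v = separated (?R k' l') Y" "l' \<ge> 1" "?lam k' l' = ?lam k l" "spherical_harmonic k' Y"
          using v by blast
        show ?thesis using eig[OF k'(2,4)] unfolding k'(1,3) eigenfunction_def by (rule conjunct1)
      qed
      have "bvp_solution \<kappa> (?lam k l) u"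
        by (rule span_on_bvp_solution[OF _ u], rule sol)
      then show "u \<in> {u. bvp_solution \<kappa> (?lam k l) u}" by (simp only: mem_Collect_eq)
    qed
    show "?lam 0 1 \<le> \<mu>" if ex: "\<exists>u :: 'a \<Rightarrow> real. eigenfunction \<kappa> \<mu> u" for \<mu>
    proof -
      obtain u :: "'a \<Rightarrow> real" where "eigenfunction \<kappa> \<mu> u" using ex ..
      from spectrum_sub[OF this] obtain k l where kl: "\<mu> = ?lam k l" by blast
      show ?thesis unfolding kl by (rule lam_first)
    qed
    show "{u :: 'a \<Rightarrow> real. bvp_solution \<kappa> (?lam 0 1) u} = span_on (cball 0 1) {\<lambda>x. ?R 0 1 (norm x)}"
      unfolding space
    proof (rule subset_antisym; rule span_on_mono; rule subsetI)
      fix v :: "'a \<Rightarrow> real"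
      assume "v \<in> {separated (?R k' l') Y | k' l' Y. l' \<ge> 1 \<and> ?lam k' l' = ?lam 0 1 \<and> spherical_harmonic k' Y}"
      then obtain k' l' and Y :: "'a \<Rightarrow> real" where k': "v = separated (?R k' l') Y" "l' \<ge> 1" "?lam k' l' = ?lam 0 1" "spherical_harmonic k' Y"
        by blast
      \<comment> \<open>The least root is attained by k' = 0 and l' - 1 = 0 only; together with l'
        >= 1 this means l' = 1.\<close>
      have "?root k' l' = ?root 0 1" by (rule lam_inj[OF k'(3)])
      then have "k' = 0 \<and> l' - 1 = 0" using char_root_first_min(2)[OF N2 \<kappa>, of k' "l' - 1"] by simp
      then have kl: "k' = 0" "l' = 1" using k'(2) by auto
      obtain a where a: "\<And>x. separated (?R 0 1) Y x = a * ?R 0 1 (norm x)"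
        using root_of_separated_zero[OF facts k'(4)[unfolded kl(1)]] by blast
      show "v \<in> span_on (cball 0 1) {\<lambda>x. ?R 0 1 (norm x)}"
        by (rule span_on_base[OF singletonI]) (simp only: k'(1) kl a)
    next
      fix v :: "'a \<Rightarrow> real"
      assume "v \<in> {\<lambda>x. ?R 0 1 (norm x)}"
      then have "v = (\<lambda>x. ?R 0 1 (norm x))" by (rule singletonD)
      then have "v = separated (?R 0 1) (\<lambda>_. 1)" by (rule trans[OF _ separated_const[OF facts, symmetric]])
      then have "v \<in> {separated (?R k' l') Y | k' l' Y. l' \<ge> 1 \<and> ?lam k' l' = ?lam 0 1 \<and> spherical_harmonic k' Y}"
        using spherical_harmonic_const[OF facts] by blast
      then show "v \<in> span_on (cball 0 1) {separated (?R k' l') Y | k' l' Y. l' \<ge> 1 \<and> ?lam k' l' = ?lam 0 1 \<and> spherical_harmonic k' Y}"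
        by (rule span_on_base[where a = 1]) (simp only: mult_1)
    qed
    show "\<forall>r\<in>{0..<1}. \<bar>?R 0 1 r\<bar> > 0"
    proof
      fix r :: real assume "r \<in> {0..<1}"
      then show "\<bar>?R 0 1 r\<bar> > 0" using rad_first_pos[OF facts, of r] by simp
    qed
    show "strict_antimono_on {0..<1} (\<lambda>r. \<bar>?R 0 1 r\<bar>)"
    proof (rule monotone_onI)
      fix x y :: real assume "x \<in> {0..<1}" "y \<in> {0..<1}" "x < y"
      then show "\<bar>?R 0 1 x\<bar> > \<bar>?R 0 1 y\<bar>" using rad_first_decreasing[OF facts, of x y] by simp
    qed
    fix k l :: nat assume l: "l \<ge> 1"
    show "finite {r \<in> {0<..<1}. ?R k l r = 0}" "card {r \<in> {0<..<1}. ?R k l r = 0} = l - 1"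
      by (rule rad_roots(1)[OF facts l], rule rad_roots(2)[OF facts l])
    show "\<forall>r\<in>{0<..<1}. ?R k l r = 0 \<longrightarrow> simple_root (?R k l) r"
      using rad_roots(3)[OF facts l] by blast
  qed
qed

theorem theorem19:
  fixes \<kappa> :: real
  assumes "CARD('n::finite) \<ge> 2" and "\<kappa> > 0"
  shows "\<exists>\<alpha> :: nat \<Rightarrow> nat \<Rightarrow> real.
    (\<forall>k. strict_mono_on {1..} (\<alpha> k) \<and>
         \<alpha> k ` {1..} = {a. a > 0 \<and> F CARD('n) \<kappa> k a = 0} \<and>
         (\<forall>l\<ge>1. simple_root (F CARD('n) \<kappa> k) (\<alpha> k l))) \<and>
    (\<forall>k. \<forall>l\<ge>1. \<exists>c d. admissible CARD('n) \<kappa> k (\<alpha> k l) c d) \<and>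
    (let lam = (\<lambda>k l. (\<alpha> k l)\<^sup>2 - \<kappa>\<^sup>2 / (\<alpha> k l)\<^sup>2) in
      {\<mu>. \<exists>u :: real ^ 'n \<Rightarrow> real. eigenfunction \<kappa> \<mu> u} = {lam k l | k l. l \<ge> 1} \<and>
      (\<forall>c d :: nat \<Rightarrow> nat \<Rightarrow> real.
        (\<forall>k. \<forall>l\<ge>1. admissible CARD('n) \<kappa> k (\<alpha> k l) (c k l) (d k l)) \<longrightarrow>
        (let R = (\<lambda>k l. radial CARD('n) \<kappa> k (\<alpha> k l) (c k l) (d k l)) in
          (\<forall>k. \<forall>l\<ge>1. \<forall>Y :: real ^ 'n \<Rightarrow> real. spherical_harmonic k Y \<longrightarrow>
             eigenfunction \<kappa> (lam k l) (separated (R k l) Y)) \<and>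
          (\<forall>k. \<forall>l\<ge>1.
             {u :: real ^ 'n \<Rightarrow> real. bvp_solution \<kappa> (lam k l) u} =
             span_on (cball 0 1)
               {separated (R k' l') Y | k' l' Y.
                  l' \<ge> 1 \<and> lam k' l' = lam k l \<and> spherical_harmonic k' Y}) \<and>
          (\<forall>\<mu>. (\<exists>u :: real ^ 'n \<Rightarrow> real. eigenfunction \<kappa> \<mu> u) \<longrightarrow> lam 0 1 \<le> \<mu>) \<and>
          {u :: real ^ 'n \<Rightarrow> real. bvp_solution \<kappa> (lam 0 1) u} =
            span_on (cball 0 1) {\<lambda>x. R 0 1 (norm x)} \<and>
          (\<forall>r\<in>{0..<1}. \<bar>R 0 1 r\<bar> > 0) \<and>
          strict_antimono_on {0..<1} (\<lambda>r. \<bar>R 0 1 r\<bar>) \<and>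
          (\<forall>k. \<forall>l\<ge>1.
             finite {r \<in> {0<..<1}. R k l r = 0} \<and>
             card {r \<in> {0<..<1}. R k l r = 0} = l - 1 \<and>
             (\<forall>r\<in>{0<..<1}. R k l r = 0 \<longrightarrow> simple_root (R k l) r)))))"
proof -
  have D: "DIM(real ^ 'n) = CARD('n)" by simp
  show ?thesis
    by (rule eigenvalue_problem[where 'a = "real ^ 'n", unfolded D, OF assms])
qed

end
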